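(* The following decision problem (the almost multilinear matroid representation problem) is algorithmically undecidable. Instance: a matroid $M$ on a finite ground set $E$ with rank function $r$, and a field $\mathbb F$. Question: does there exist, for every $\varepsilon>0$, a vector space $V$ over $\mathbb F$, a collection of subspaces $\{W_e\}_{e\in E}$ of $V$ and an integer $c\in\mathbb N$ such that \[\max_{S\subseteq E}\left|r(S)-\frac1c\dim\Big(\sum_{e\in S}W_e\Big)\right|<\varepsilon\,?\]
   Context: A matroid $M=(E,r)$ is a finite set $E$ with a function $r:\mathcal P(E)\to\mathbb N$ satisfying $r(A)\le|A|$, monotonicity and submodularity. *)

theory Defs
  imports
    Complex_Main
    "HOL-Library.Nat_Bijection"
    "Jordan_Normal_Form.Missing_VectorSpace"
begin

section \<open>Matroids\<close>

locale matroid =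
  fixes E :: "'e set" and r :: "'e set \<Rightarrow> nat"
  assumes finite_ground: "finite E"
    and rank_le_card: "A \<subseteq> E \<Longrightarrow> r A \<le> card A"
    and rank_mono: "A \<subseteq> B \<Longrightarrow> B \<subseteq> E \<Longrightarrow> r A \<le> r B"
    and rank_submodular:
      "A \<subseteq> E \<Longrightarrow> B \<subseteq> E \<Longrightarrow> r (A \<union> B) + r (A \<inter> B) \<le> r A + r B"

section \<open>Almost multilinear representability\<close>

definition subspaces_sum ::
  "('k, 'v, 'm) module_scheme \<Rightarrow> ('e \<Rightarrow> 'v set) \<Rightarrow> 'e set \<Rightarrow> 'v set" where
  "subspaces_sum V W S = {(\<Oplus>\<^bsub>V\<^esub> e\<in>S. w e) | w. w \<in> (\<Pi> e\<in>S. W e)}"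

text \<open>The type of vectors is fixed to \<^typ>\<open>nat \<Rightarrow> 'k\<close>, because HOL cannot quantify over types
  inside a formula. This loses no generality: only the span of the finitely many finite-dimensional
  subspaces matters, and it is isomorphic to some \<open>K\<^sup>n\<close>, whose carrier can be taken inside
  \<^typ>\<open>nat \<Rightarrow> 'k\<close>. Finite dimension of each \<open>W e\<close> is implicit in the approximation of \<open>r\<close> by
  \<open>dim / c\<close>; it has to be required because \<^const>\<open>vectorspace.dim\<close> is an unspecified number
  otherwise. Likewise \<open>c > 0\<close> because \<open>1 / 0 = 0\<close> in HOL.\<close>

definition almost_multilinear ::
  "('k, 'm) ring_scheme \<Rightarrow> 'e set \<Rightarrow> ('e set \<Rightarrow> nat) \<Rightarrow> bool" where
  "almost_multilinear K E r \<longleftrightarrow>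
     (\<forall>\<epsilon>::real. \<epsilon> > 0 \<longrightarrow>
       (\<exists>(V :: ('k, nat \<Rightarrow> 'k) module) (W :: 'e \<Rightarrow> (nat \<Rightarrow> 'k) set) (c :: nat).
          vectorspace K V \<and>
          (\<forall>e\<in>E. subspace K (W e) V \<and> vectorspace.fin_dim K (V\<lparr>carrier := W e\<rparr>)) \<and>
          c > 0 \<and>
          (MAX S\<in>Pow E. \<bar>real (r S)
             - 1 / real c * real (vectorspace.dim K (V\<lparr>carrier := subspaces_sum V W S\<rparr>))\<bar>)
            < \<epsilon>))"

section \<open>Algorithms\<close>

text \<open>Algorithms are the partial recursive (that is, Turing computable) functions on the natural
  numbers. \<open>computes f xs y\<close> says that \<open>f\<close> halts on input \<open>xs\<close> with output \<open>y\<close>.\<close>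

datatype recf =
    Zero
  | Succ
  | Proj nat
  | Comp recf "recf list"
  | PrimRec recf recf
  | Minim recf

inductive computes :: "recf \<Rightarrow> nat list \<Rightarrow> nat \<Rightarrow> bool" where
  zero: "computes Zero xs 0"
| succ: "computes Succ [x] (Suc x)"
| proj: "i < length xs \<Longrightarrow> computes (Proj i) xs (xs ! i)"
| comp: "list_all2 (\<lambda>g y. computes g xs y) gs ys \<Longrightarrow> computes f ys z
    \<Longrightarrow> computes (Comp f gs) xs z"
| prim_0: "computes f xs z \<Longrightarrow> computes (PrimRec f g) (0 # xs) z"
| prim_Suc: "computes (PrimRec f g) (n # xs) y \<Longrightarrow> computes g (n # y # xs) z
    \<Longrightarrow> computes (PrimRec f g) (Suc n # xs) z"
| minim: "computes f (n # xs) 0 \<Longrightarrow> (\<forall>m<n. \<exists>y. computes f (m # xs) (Suc y))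
    \<Longrightarrow> computes (Minim f) xs n"

lemma computes_deterministic:
  assumes "computes f xs y" "computes f xs z"
  shows "y = z"
  using assms
proof (induction arbitrary: z rule: computes.induct)
  case (zero xs)
  then show ?case by (auto elim: computes.cases)
next
  case (succ x)
  then show ?case by (auto elim: computes.cases)
next
  case (proj i xs)
  then show ?case by (auto elim: computes.cases)
next
  case (comp xs gs ys f y)
  from comp.prems obtain ys' where ys': "list_all2 (\<lambda>g y. computes g xs y) gs ys'"
      "computes f ys' z"
    by (auto elim: computes.cases)
  have "ys = ys'"
    using comp.IH(1) ys'(1) by (auto simp: list_all2_conv_all_nth intro!: nth_equalityI)
  then show ?case using comp.IH ys' by auto
next
  case (prim_0 f xs y g)
  from prim_0.prems show ?case
    by (cases rule: computes.cases) (auto intro: prim_0.IH)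
next
  case (prim_Suc f g n xs y y')
  from prim_Suc.prems show ?case
    by (cases rule: computes.cases) (auto dest!: prim_Suc.IH(1) intro: prim_Suc.IH(2))
next
  case (minim f n xs)
  from minim.prems have *: "computes f (z # xs) 0" "\<forall>m<z. \<exists>y. computes f (m # xs) (Suc y)"
    by (auto elim: computes.cases)
  have "\<not> n < z"
    using *(2) minim.IH(1) by fastforce
  moreover have "\<not> z < n"
    using *(1) minim.IH(2) by fastforce
  ultimately show ?case by simp
qed

text \<open>A decision problem consists of its set \<open>I\<close> of instances, an encoding of instances as natural
  numbers, and a question \<open>Q\<close>. A decision procedure has to halt with the correct answer on every
  (encoded) instance; nothing is required of it on numbers which encode no instance.\<close>

definition decidable_problem :: "'i set \<Rightarrow> ('i \<Rightarrow> nat) \<Rightarrow> ('i \<Rightarrow> bool) \<Rightarrow> bool" where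
  "decidable_problem I code Q \<longleftrightarrow>
     (\<exists>f. \<forall>x\<in>I. computes f [code x] (if Q x then 1 else 0))"

text \<open>A matroid on a finite set of natural numbers is encoded by the graph of its rank function on
  the subsets of the ground set, using the standard encodings of pairs and of finite sets.\<close>

definition matroid_code :: "nat set \<Rightarrow> (nat set \<Rightarrow> nat) \<Rightarrow> nat" where
  "matroid_code E r = set_encode ((\<lambda>S. prod_encode (set_encode S, r S)) ` Pow E)"

lemma matroid_code_inject:
  assumes "finite E" "finite E'" "matroid_code E r = matroid_code E' r'"
  shows "E = E'" "\<And>S. S \<subseteq> E \<Longrightarrow> r S = r' S"
proof -
  let ?G = "\<lambda>E r. (\<lambda>S. prod_encode (set_encode S, r S)) ` Pow E"
  have G: "?G E r = ?G E' r'"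
    using assms inj_on_set_encode by (auto simp: matroid_code_def inj_on_def)
  have *: "S \<subseteq> E2 \<and> r1 S = r2 S"
    if G: "?G E1 r1 = ?G E2 r2" and fin: "finite E1" "finite E2" and S: "S \<subseteq> E1"
    for E1 E2 S and r1 r2 :: "nat set \<Rightarrow> nat"
  proof -
    have "prod_encode (set_encode S, r1 S) \<in> ?G E2 r2"
      using S G by blast
    then obtain T where "T \<subseteq> E2" "set_encode S = set_encode T" "r1 S = r2 T"
      by auto
    moreover from this have "S = T"
      using fin S by (metis finite_subset set_encode_inverse)
    ultimately show ?thesis by simp
  qed
  show "E = E'"
    using *[OF G assms(1,2)] *[OF G[symmetric] assms(2,1)] by blast
  show "r S = r' S" if "S \<subseteq> E" for S
    using *[OF G assms(1,2) that] by simp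
qed

text \<open>Unlike matroids, fields have no canonical finite description. The statement is therefore made
  relative to a nonempty class \<open>\<F>\<close> of admissible input fields and an injective encoding
  \<open>\<phi>\<close> of its members; both are arbitrary. Isomorphic copies of the same field may occur
  several times in \<open>\<F>\<close>, so several descriptions of one field are allowed.\<close>

definition almost_multilinear_instances ::
  "'k ring set \<Rightarrow> (nat set \<times> (nat set \<Rightarrow> nat) \<times> 'k ring) set" where
  "almost_multilinear_instances \<F> = {(E, r, K). matroid E r \<and> K \<in> \<F>}"

definition almost_multilinear_code ::
  "('k ring \<Rightarrow> nat) \<Rightarrow> nat set \<times> (nat set \<Rightarrow> nat) \<times> 'k ring \<Rightarrow> nat" where
  "almost_multilinear_code \<phi> = (\<lambda>(E, r, K). prod_encode (matroid_code E r, \<phi> K))"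

end

theory Submission
  imports Defs "HOL-Library.Infinite_Set" "HOL-Computational_Algebra.Polynomial" "HOL-Computational_Algebra.Primes"
begin

text \<open>
  The proof reduces the halting problem to almost multilinear representability over one fixed field.
  Read backwards and forwards, the moves of a two-counter machine generate an equivalence relation on
  configurations; whether \<open>(0, 0, 0)\<close> and \<open>(1, 0, 0)\<close> are equivalent is undecidable. In a group the
  counter values \<open>a\<close> and \<open>b\<close> are stored as iterated conjugates of two elements \<open>p\<close> and \<open>q\<close>, and a
  configuration with state \<open>i\<close> as a commutation relation between the two conjugates, one of them
  conjugated by an element \<open>u\<^sub>i\<close>. All relations have the form \<open>a\<^sup>-\<^sup>1 b = c\<^sup>-\<^sup>1 d\<close> with short words, and
  equivalence of the two configurations forces \<open>D = q u\<^sub>0\<close> for a further generator \<open>D\<close>.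

  Each such relation becomes four collinear triples of a matroid of rank 3 which contains a point for
  every word. Given an almost multilinear representation, the subspaces can be shrunk by a vanishing
  proportion until the triples define partial linear injections, whose germs (agreement on large
  subspaces) form a group in which the relations hold and different words have different values. Hence
  there is no such representation if the configurations are equivalent.

  Otherwise the relations are realised by bijections of a concrete space of stacks on which different
  words differ at every point. The action is amenable, so Foelner sets yield permutations of finite sets
  which satisfy almost all relations, and their graphs span subspaces of almost the correct dimensions.

  The matroid is computable from the machine. A decider, run by a machine on the matroid of that very
  machine, would have to answer the opposite of the truth.
\<close>

section \<open>Counter moves as an equivalence relation, and the words and relators that encode
  it\<close>

section \<open>Relation systems\<close>

text \<open>One matroid has to serve both cases, and a representation keeps all its points apart. So
  without collapse, distinct words must have no finite set invariant under their quotient, which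
  faithfulness alone would not give. An integer grading does nearly all of this: weight
  \<open>2 ^ x\<close> for the letter \<open>x\<close>, and for letter 10 the sum of the weights of
  9 and 11, respects every relation, and no two words consist of the same letters. This explains the
  four shifts per counter. Only \<open>[10]\<close> and \<open>[9, 11]\<close> share a weight, the
  very pair that a collapse identifies. The model separates them by a central integer: the
  commutator attached to a configuration translates it by 1, up to sign, on the class of the start
  configuration and by 0 elsewhere. Zero tests need no machinery, since a relation about the
  unshifted \<open>p\<close> or \<open>q\<close> constrains only the counter value 0. Equivalence is
  tractable because machines are deterministic: equivalent configurations run into a common one.
  Self-reference uses no fixed-point theorem: the program does not mention its code
  \<open>d\<close>, and the relations add a chain of increments that hands \<open>d\<close> to
  it.\<close>

type_synonym config = "nat \<times> nat \<times> nat"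
type_synonym rels = "nat \<Rightarrow> nat \<Rightarrow> nat \<Rightarrow> bool"

text \<open>Only the generated equivalence matters, so a decrement needs no rule of its own: it is a
  shift read backwards.\<close>

inductive rstep :: "rels \<Rightarrow> config \<Rightarrow> config \<Rightarrow> bool" for R where
  shift_a: "R 0 i j \<Longrightarrow> rstep R (i, a, b) (j, Suc a, b)"
| shift_b: "R 1 i j \<Longrightarrow> rstep R (i, a, b) (j, a, Suc b)"
| zero_a: "R 2 i j \<Longrightarrow> rstep R (i, 0, b) (j, 0, b)"
| zero_b: "R 3 i j \<Longrightarrow> rstep R (i, a, 0) (j, a, 0)"

definition collapses :: "rels \<Rightarrow> bool" where
  "collapses R \<longleftrightarrow> equivclp (rstep R) (0, 0, 0) (1, 0, 0)"

section \<open>The group presentation of a relation system\<close>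

type_synonym word = "nat list"
type_synonym quad = "word \<times> word \<times> word \<times> word"
type_synonym family = "nat \<times> quad"

text \<open>The letters 0 to 3 are shifts on the first counter and 4 is \<open>p\<close>; 5 to 8 are shifts on the second
  counter and 9 is \<open>q\<close>; 10 is \<open>D\<close>, and \<open>11 + i\<close> is \<open>u\<^sub>i\<close>. In a template 13 and 14 stand for \<open>u\<^sub>i\<close> and
  \<open>u\<^sub>j\<close> with parameters \<open>i\<close> and \<open>j\<close>. The quadruple \<open>(a, b, c, d)\<close> means \<open>a\<^sup>-\<^sup>1 b = c\<^sup>-\<^sup>1 d\<close>. The tag of a
  family is \<open>0\<close> or \<open>1\<close> if it is always present, and \<open>k + 2\<close> if it is present when \<open>R k i j\<close> holds.\<close>

definition templates :: "nat list list" where "templates = [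
  [], [0], [1], [2], [3], [4], [5], [6],
  [7], [8], [9], [10], [0,2], [1,2], [0,4], [1,4],
  [7,5], [7,6], [9,5], [9,6], [1,3], [2,3], [2,4], [8,6],
  [8,7], [9,7], [1,0], [3,0], [3,4], [5,6], [5,8], [9,8],
  [0,9], [0,5], [5,4], [13], [13,4], [9,13], [13,1], [0,13],
  [6,13], [13,5], [7,13], [9,13,4], [13,1,4], [0,13,4], [13,1,2], [0,13,2],
  [9,6,13], [9,13,5], [7,6,13], [7,13,5]]"

text \<open>Words are mere points of the matroid, so nothing yet ties a word to its letters. With
  \<open>[]\<close> as neutral element these quadruples make each longer word its
  \<open>butlast\<close> times its last letter. For this purpose \<open>templates\<close> is closed
  under \<open>butlast\<close>.\<close>

definition word_families :: "family list" where "word_families = [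
  (0, [], [2], [0], [0,2]), (0, [], [2], [1], [1,2]), (0, [], [4], [0], [0,4]),
  (0, [], [4], [1], [1,4]), (0, [], [5], [7], [7,5]), (0, [], [6], [7], [7,6]),
  (0, [], [5], [9], [9,5]), (0, [], [6], [9], [9,6]), (0, [], [3], [1], [1,3]),
  (0, [], [3], [2], [2,3]), (0, [], [4], [2], [2,4]), (0, [], [6], [8], [8,6]),
  (0, [], [7], [8], [8,7]), (0, [], [7], [9], [9,7]), (0, [], [0], [1], [1,0]),
  (0, [], [0], [3], [3,0]), (0, [], [4], [3], [3,4]), (0, [], [6], [5], [5,6]),
  (0, [], [8], [5], [5,8]), (0, [], [8], [9], [9,8]), (0, [], [9], [0], [0,9]),
  (0, [], [5], [0], [0,5]), (0, [], [4], [5], [5,4]), (1, [], [4], [13], [13,4]),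
  (1, [], [13], [9], [9,13]), (1, [], [4], [9,13], [9,13,4]), (1, [], [1], [13], [13,1]),
  (1, [], [4], [13,1], [13,1,4]), (1, [], [13], [0], [0,13]), (1, [], [4], [0,13], [0,13,4]),
  (1, [], [2], [13,1], [13,1,2]), (1, [], [2], [0,13], [0,13,2]), (1, [], [13], [6], [6,13]),
  (1, [], [13], [9,6], [9,6,13]), (1, [], [5], [13], [13,5]), (1, [], [5], [9,13], [9,13,5]),
  (1, [], [13], [7,6], [7,6,13]), (1, [], [13], [7], [7,13]), (1, [], [5], [7,13], [7,13,5])]"

text \<open>The shape \<open>(a x, b x, a, b)\<close> says that \<open>a^-1 b\<close> commutes with
  \<open>x\<close>, and \<open>(a, x a, b, x b)\<close> says that \<open>a\<close> and
  \<open>b\<close> conjugate \<open>x\<close> alike; all relators but the one with letter 10 have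
  one of these shapes. The first twelve make the four shifts of each counter interchangeable, and
  the next three make the two counters independent. The relators with letters 12 and 11 concern the
  halting and the start state, and the tagged ones transport a commutation along an edge.\<close>

definition relator_families :: "family list" where "relator_families = [
  (0, [0,2], [1,2], [0], [1]),
  (0, [0,4], [1,4], [0], [1]),
  (0, [5], [7,5], [6], [7,6]),
  (0, [5], [9,5], [6], [9,6]),
  (0, [1,3], [2,3], [1], [2]),
  (0, [1,4], [2,4], [1], [2]),
  (0, [6], [8,6], [7], [8,7]),
  (0, [6], [9,6], [7], [9,7]),
  (0, [1,0], [3,0], [1], [3]),
  (0, [1,4], [3,4], [1], [3]),
  (0, [6], [5,6], [8], [5,8]),
  (0, [6], [9,6], [8], [9,8]),
  (0, [9], [0,9], [], [0]),
  (0, [5], [0,5], [], [0]),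
  (0, [4], [5,4], [], [5]),
  (0, [12,4], [9,12,4], [12], [9,12]),
  (0, [11,4], [9,11,4], [11], [10]),
  (2, [14,1,4], [0,13,4], [14,1], [0,13]),
  (2, [14,1,2], [0,13,2], [14,1], [0,13]),
  (3, [6,14], [9,6,14], [13,5], [9,13,5]),
  (3, [6,14], [7,6,14], [13,5], [7,13,5]),
  (4, [14,4], [13,4], [14], [13]),
  (5, [13], [9,13], [14], [9,14])]"

definition families :: "family list" where
  "families = word_families @ relator_families"

definition subst_letter :: "nat \<Rightarrow> nat \<Rightarrow> nat \<Rightarrow> nat" where
  "subst_letter i j x = (if x = 13 then 11 + i else if x = 14 then 11 + j else x)"

abbreviation subst_word :: "nat \<Rightarrow> nat \<Rightarrow> word \<Rightarrow> word" where
  "subst_word i j \<equiv> map (subst_letter i j)"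

fun subst_quad :: "nat \<Rightarrow> nat \<Rightarrow> quad \<Rightarrow> quad" where
  "subst_quad i j (a, b, c, d) = (subst_word i j a, subst_word i j b, subst_word i j c, subst_word i j d)"

definition admits :: "rels \<Rightarrow> nat \<Rightarrow> nat \<Rightarrow> nat \<Rightarrow> bool" where
  "admits R k i j \<longleftrightarrow> k \<le> 1 \<or> R (k - 2) i j"

definition words :: "nat \<Rightarrow> word set" where
  "words N = {subst_word i 0 w | w i. w \<in> set templates \<and> i < N}"

definition quads :: "rels \<Rightarrow> nat \<Rightarrow> quad set" where
  "quads R N = {subst_quad i j Q | k Q i j. (k, Q) \<in> set families \<and> i < N \<and> j < N \<and> admits R k i j}"

lemma quadsI:
  "(k, Q) \<in> set families \<Longrightarrow> i < N \<Longrightarrow> j < N \<Longrightarrow> admits R k i j \<Longrightarrow> subst_quad i j Q \<in> quads R N"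
  unfolding quads_def by blast

text \<open>A zero test from a state to itself would yield a quadruple with two equal entries and
  violate \<open>good_quad\<close>, hence the clause for \<open>2 \<le> t\<close>.\<close>

definition supported :: "rels \<Rightarrow> nat \<Rightarrow> bool" where
  "supported R N \<longleftrightarrow> 2 \<le> N \<and> (\<forall>t i j. R t i j \<longrightarrow> i < N \<and> j < N \<and> (2 \<le> t \<longrightarrow> i \<noteq> j))"

section \<open>Reachability as commutation in an arbitrary group\<close>

section \<open>Collapse forces a relation in every group\<close>

abbreviation commute :: "'g::group_add \<Rightarrow> 'g \<Rightarrow> bool" where
  "commute x y \<equiv> x + y = y + x"

definition conj :: "'g::group_add \<Rightarrow> 'g \<Rightarrow> 'g" where
  "conj g x = g + x + - g"

lemma conj_plus: "conj (g + h) x = conj g (conj h x)"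
  by (simp add: conj_def add.assoc minus_add del: add_uminus_conv_diff)

lemma conj_add: "conj g (x + y) = conj g x + conj g y"
  by (simp add: conj_def add.assoc del: add_uminus_conv_diff)

lemma conj_uminus [simp]: "conj g (conj (- g) x) = x" "conj (- g) (conj g x) = x"
  by (simp_all add: conj_def add.assoc del: add_uminus_conv_diff)

lemma conj_inject [simp]: "conj g x = conj g y \<longleftrightarrow> x = y"
  by (metis conj_uminus(2))

lemma commute_iff_conj: "commute g x \<longleftrightarrow> conj g x = x"
  by (metis conj_def add.assoc add.right_neutral add_uminus_conv_diff diff_add_cancel right_minus)

lemma commute_conj_iff: "commute (conj g x) (conj g y) \<longleftrightarrow> commute x y"
  by (simp add: conj_add [symmetric])

text \<open>This decodes the first shape of relators; \<open>quad_left_iff\<close> decodes the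
  second.\<close>

lemma quad_right_iff:
  "- (a + x) + (b + x) = - a + b \<longleftrightarrow> commute (- a + b) (x :: 'g::group_add)"
proof -
  have "- (a + x) + (b + x) = - x + ((- a + b) + x)"
    by (simp add: add.assoc minus_add del: add_uminus_conv_diff)
  moreover have "- x + ((- a + b) + x) = - a + b \<longleftrightarrow> x + (- x + ((- a + b) + x)) = x + (- a + b)"
    by (simp del: minus_add_cancel add_minus_cancel)
  ultimately show ?thesis by (metis add_minus_cancel)
qed

lemma quad_left_iff:
  "- a + (x + a) = - b + (x + b) \<longleftrightarrow> conj (- a) x = conj (- b) (x :: 'g::group_add)"
  by (simp add: conj_def add.assoc del: add_uminus_conv_diff)

lemma conj_eq_iff: "conj a x = conj b x \<longleftrightarrow> conj (- a + b) x = x"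
  by (metis conj_plus conj_uminus)

lemma conj_minus: "conj g (- x) = - conj g x"
  by (metis conj_add add.right_inverse add_eq_0_iff conj_def add.right_neutral)

lemma conj_conj: "conj g (conj h x) = conj (conj g h) (conj g x)"
proof -
  have "conj g h + g = g + h"
    by (simp add: conj_def add.assoc)
  then show ?thesis by (metis conj_plus)
qed

lemma conj_commuting:
  assumes "conj g h = h" "conj g x = x"
  shows "conj g (conj h x) = conj h x"
  by (metis assms commute_iff_conj conj_plus)

text \<open>Triples for which the quotient of shifts \<open>i\<close> and \<open>j\<close> is to
  commute with a third shift \<open>k\<close>. The pairs \<open>(i, j)\<close> connect all four
  indices, and the six sets \<open>{i, k}\<close>, \<open>{j, k}\<close> are distinct, so no two of
  the resulting words are permutations of each other. Three shifts would need four words but offer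
  only three such sets.\<close>

definition shift_edges :: "(nat \<times> nat \<times> nat) set" where
  "shift_edges = {(0, 1, 2), (1, 2, 3), (1, 3, 0)}"

text \<open>Each quotient \<open>- s i + s j\<close> fixes the whole tower, by induction: the next
  element may be formed with the shift \<open>s k\<close>, with which the quotient commutes. Hence
  all shifts climb the tower alike.\<close>

lemma shift_tower:
  fixes s :: "nat \<Rightarrow> 'g::group_add"
  assumes "\<And>i j k. (i, j, k) \<in> shift_edges \<Longrightarrow> conj (- s i + s j) (s k) = s k"
    and "\<And>i j k. (i, j, k) \<in> shift_edges \<Longrightarrow> conj (- s i + s j) x = x"
    and "i \<le> 3"
  shows "conj (s i) ((conj (s 0) ^^ n) x) = (conj (s 0) ^^ Suc n) x"
proof -
  define P where "P n = (conj (s 0) ^^ n) x" for n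
  have step: "conj (s i) (P n) = P (Suc n)"
    if e: "\<And>i j k. (i, j, k) \<in> shift_edges \<Longrightarrow> conj (- s i + s j) (P n) = P n" and "i \<le> 3" for i n
  proof -
    have 1: "conj (s 0) (P n) = conj (s 1) (P n)" "conj (s 1) (P n) = conj (s 2) (P n)"
      "conj (s 1) (P n) = conj (s 3) (P n)"
      using e[of 0 1 2] e[of 1 2 3] e[of 1 3 0] by (simp_all add: shift_edges_def conj_eq_iff)
    moreover have "i = 0 \<or> i = 1 \<or> i = 2 \<or> i = 3" using \<open>i \<le> 3\<close> by linarith
    moreover have "P (Suc n) = conj (s 0) (P n)" by (simp add: P_def)
    ultimately show ?thesis by metis
  qed
  have fixed: "\<forall>i j k. (i, j, k) \<in> shift_edges \<longrightarrow> conj (- s i + s j) (P n) = P n" for n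
  proof (induction n)
    case 0
    then show ?case using assms(2) by (simp add: P_def)
  next
    case (Suc n)
    show ?case
    proof (intro allI impI)
      fix i j k assume ijk: "(i, j, k) \<in> shift_edges"
      then have "k \<le> 3" by (auto simp: shift_edges_def)
      then have "P (Suc n) = conj (s k) (P n)" using step Suc.IH by metis
      moreover have "conj (- s i + s j) (conj (s k) (P n)) = conj (s k) (P n)"
        using conj_commuting assms(1)[OF ijk] Suc.IH ijk by blast
      ultimately show "conj (- s i + s j) (P (Suc n)) = P (Suc n)" by simp
    qed
  qed
  show ?thesis using step[of n i] fixed assms(3) unfolding P_def by blast
qed

lemma conj_tower_fixed:
  assumes "conj g x = x" "conj g h = h"
  shows "conj g ((conj h ^^ n) x) = (conj h ^^ n) x"
  by (induction n) (auto simp: assms conj_commuting)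

text \<open>The class \<open>group_add\<close> is written additively but does not assume
  commutativity.\<close>

locale relation_group =
  fixes R :: rels and N :: nat and v :: "nat \<Rightarrow> 'g::group_add"
  assumes supp: "supported R N"
    and quads: "\<And>a b c d. (a, b, c, d) \<in> quads R N \<Longrightarrow>
      - sum_list (map v a) + sum_list (map v b) = - sum_list (map v c) + sum_list (map v d)"
begin

lemma relator:
  assumes "(k, (a, b, c, d)) \<in> set relator_families" "admits R k i j" "k \<le> 1 \<longrightarrow> i = 0 \<and> j = 0"
  shows "- sum_list (map v (subst_word i j a)) + sum_list (map v (subst_word i j b)) =
    - sum_list (map v (subst_word i j c)) + sum_list (map v (subst_word i j d))"
proof -
  have "i < N" "j < N"
    using assms supp by (auto simp: admits_def supported_def)
  then show ?thesis
    using quadsI[of k "(a, b, c, d)" i N j R] assms(1,2) by (intro quads) (simp add: families_def)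
qed

lemmas const_relator = relator[where i = 0 and j = 0, of 0]

abbreviation "P n \<equiv> (conj (v 0) ^^ n) (v 4)"
abbreviation "Q n \<equiv> (conj (- v 5) ^^ n) (v 9)"

lemma P_shift: "i \<le> 3 \<Longrightarrow> conj (v i) (P n) = P (Suc n)"
proof (rule shift_tower)
  fix i j k assume "(i, j, k) \<in> shift_edges"
  then have "([i, k], [j, k], [i], [j]) \<in> snd ` set relator_families \<and> (0, [i, k], [j, k], [i], [j]) \<in> set relator_families \<and>
     (0, [i, 4], [j, 4], [i], [j]) \<in> set relator_families \<and> i < 13 \<and> j < 13 \<and> k < 13"
    by (auto simp: shift_edges_def relator_families_def)
  then show "conj (- v i + v j) (v k) = v k" "conj (- v i + v j) (v 4) = v 4"
    using const_relator[of "[i, k]" "[j, k]" "[i]" "[j]"] const_relator[of "[i, 4]" "[j, 4]" "[i]" "[j]"]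
    by (simp_all add: admits_def subst_letter_def quad_right_iff commute_iff_conj)
qed

text \<open>The shifts of the second counter enter inverted, which turns the second shape of
  relators into the hypotheses of \<open>shift_tower\<close>.\<close>

lemma Q_shift: "i \<le> 3 \<Longrightarrow> conj (- v (5 + i)) (Q n) = Q (Suc n)"
proof -
  have "conj ((\<lambda>i. - v (5 + i)) i) ((conj ((\<lambda>i. - v (5 + i)) 0) ^^ n) (v 9)) =
     (conj ((\<lambda>i. - v (5 + i)) 0) ^^ Suc n) (v 9)" if "i \<le> 3"
  proof (rule shift_tower)
    fix i j k assume "(i, j, k) \<in> shift_edges"
    then have "(0, [5 + i], [5 + k, 5 + i], [5 + j], [5 + k, 5 + j]) \<in> set relator_families \<and>
      (0, [5 + i], [9, 5 + i], [5 + j], [9, 5 + j]) \<in> set relator_families \<and> i < 8 \<and> j < 8 \<and> k < 8"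
      by (auto simp: shift_edges_def relator_families_def)
    then have "conj (- v (5 + i)) (v (5 + k)) = conj (- v (5 + j)) (v (5 + k))"
      "conj (- v (5 + i)) (v 9) = conj (- v (5 + j)) (v 9)"
      using const_relator[of "[5 + i]" "[5 + k, 5 + i]" "[5 + j]" "[5 + k, 5 + j]"]
        const_relator[of "[5 + i]" "[9, 5 + i]" "[5 + j]" "[9, 5 + j]"]
      by (simp_all add: admits_def subst_letter_def quad_left_iff)
    then show "conj (- (- v (5 + i)) + - v (5 + j)) (- v (5 + k)) = - v (5 + k)"
      "conj (- (- v (5 + i)) + - v (5 + j)) (v 9) = v 9"
      by (simp_all only: conj_eq_iff conj_minus)
  qed (fact that)
  then show "i \<le> 3 \<Longrightarrow> conj (- v (5 + i)) (Q n) = Q (Suc n)" by simp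
qed

text \<open>One shift of each counter is related to the other counter. This suffices because all
  shifts of a counter act alike on its tower.\<close>

lemma cross: "conj (v 0) (v 9) = v 9" "conj (v 0) (v 5) = v 5" "conj (v 5) (v 4) = v 4"
proof -
  have "- v 9 + (v 0 + v 9) = v 0" "- v 5 + (v 0 + v 5) = v 0" "- v 4 + (v 5 + v 4) = v 5"
    using const_relator[of "[9]" "[0,9]" "[]" "[0]"] const_relator[of "[5]" "[0,5]" "[]" "[0]"]
      const_relator[of "[4]" "[5,4]" "[]" "[5]"]
    by (simp_all add: relator_families_def admits_def subst_letter_def)
  then show "conj (v 0) (v 9) = v 9" "conj (v 0) (v 5) = v 5" "conj (v 5) (v 4) = v 4"
    by (metis add_minus_cancel commute_iff_conj)+
qed

lemma cross_P: "conj (v 5) (P n) = P n"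
  using cross by (intro conj_tower_fixed) (metis commute_iff_conj)+

lemma cross_Q: "conj (v 0) (Q n) = Q n"
  using cross by (intro conj_tower_fixed) (simp_all add: conj_minus)

text \<open>The invariant of the equivalence: \<open>P a\<close> and \<open>Q b\<close> carry the
  counters, and the conjugating letter carries the state. In the stack model the commutator in
  question is translation by 0 or 1 up to sign, and the invariant says that it is 0.\<close>

definition zero_at :: "config \<Rightarrow> bool" where
  "zero_at = (\<lambda>(i, a, b). commute (conj (v (11 + i)) (P a)) (Q b))"

lemma zero_at_iff: "zero_at (i, a, b) \<longleftrightarrow> commute (P a) (conj (- v (11 + i)) (Q b))"
  using commute_conj_iff[of "v (11 + i)" "P a" "conj (- v (11 + i)) (Q b)"] by (simp add: zero_at_def)

lemma subst_simps: "subst_letter i j 13 = 11 + i" "subst_letter i j 14 = 11 + j"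
  "x < 13 \<Longrightarrow> subst_letter i j x = x"
  by (auto simp: subst_letter_def)

text \<open>A shift edge supplies two conjugators that agree on the base of a tower and on the shift
  \<open>v 2\<close> or \<open>v 7\<close>, hence on the whole tower. The other counter is carried
  along because \<open>v 0\<close> fixes every \<open>Q n\<close> and \<open>v 5\<close> fixes every
  \<open>P n\<close>. A zero edge gives agreement on the base only, which is the counter value
  0.\<close>

lemma zero_at_step:
  assumes "rstep R x y"
  shows "zero_at x \<longleftrightarrow> zero_at y"
  using assms
proof cases
  case (shift_a i j a b)
  define V where "V = - (v (11 + j) + v 1) + (v 0 + v (11 + i))"
  have "- (v (11 + j) + v 1 + v 4) + (v 0 + v (11 + i) + v 4) = V"
    "- (v (11 + j) + v 1 + v 2) + (v 0 + v (11 + i) + v 2) = V"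
    using relator[of 2 "[14,1,4]" "[0,13,4]" "[14,1]" "[0,13]" i j]
      relator[of 2 "[14,1,2]" "[0,13,2]" "[14,1]" "[0,13]" i j] shift_a
    by (simp_all add: V_def relator_families_def admits_def subst_simps add.assoc)
  then have V: "conj V (v 4) = v 4" "conj V (v 2) = v 2"
    unfolding V_def by (simp_all add: quad_right_iff commute_iff_conj)
  have "conj V (P a) = P a" for a
  proof (induction a)
    case (Suc a)
    then show ?case using P_shift[of 2 a] conj_commuting[OF V(2)] by fastforce
  qed (simp add: V)
  moreover have "v 0 + v (11 + i) = v (11 + j) + v 1 + V"
    unfolding V_def by (simp add: add.assoc minus_add del: add_uminus_conv_diff)
  ultimately have "conj (v 0) (conj (v (11 + i)) (P a)) = conj (v (11 + j)) (P (Suc a))"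
    using P_shift[of 1 a] by (metis conj_plus numeral_One one_le_numeral)
  then show ?thesis
    using shift_a cross_Q commute_conj_iff[of "v 0" "conj (v (11 + i)) (P a)" "Q b"] by (simp add: zero_at_def)
next
  case (shift_b i j a b)
  define X where "X = v 6 + v (11 + j)"
  define Y where "Y = v (11 + i) + v 5"
  have "- X + (v 9 + X) = - Y + (v 9 + Y)" "- X + (v 7 + X) = - Y + (v 7 + Y)"
    using relator[of 3 "[6,14]" "[9,6,14]" "[13,5]" "[9,13,5]" i j]
      relator[of 3 "[6,14]" "[7,6,14]" "[13,5]" "[7,13,5]" i j] shift_b
    by (simp_all add: X_def Y_def relator_families_def admits_def subst_simps add.assoc)
  then have XY: "conj (- X) (v 9) = conj (- Y) (v 9)" "conj (- X) (- v 7) = conj (- Y) (- v 7)"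
    by (simp_all add: quad_left_iff conj_minus)
  have "conj (- X) (Q b) = conj (- Y) (Q b)" for b
  proof (induction b)
    case (Suc b)
    have "Q (Suc b) = conj (- v 7) (Q b)" using Q_shift[of 2 b] by simp
    then show ?case
      using Suc XY(2) conj_conj[of "- X" "- v 7" "Q b"] conj_conj[of "- Y" "- v 7" "Q b"] by simp
  qed (simp add: XY)
  then have "conj (- v (11 + j)) (conj (- v 6) (Q b)) = conj (- v 5) (conj (- v (11 + i)) (Q b))"
    by (simp add: X_def Y_def minus_add conj_plus del: add_uminus_conv_diff)
  then have "conj (v 5) (conj (- v (11 + j)) (Q (Suc b))) = conj (- v (11 + i)) (Q b)"
    using Q_shift[of 1 b] by simp
  then show ?thesis
    using shift_b cross_P commute_conj_iff[of "v 5" "P a" "conj (- v (11 + j)) (Q (Suc b))"]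
    by (simp add: zero_at_iff)
next
  case (zero_a i j b)
  have "conj (- v (11 + j) + v (11 + i)) (v 4) = v 4"
    using relator[of 4 "[14,4]" "[13,4]" "[14]" "[13]" i j] zero_a
    by (simp add: relator_families_def admits_def subst_simps quad_right_iff commute_iff_conj)
  then show ?thesis using zero_a by (simp add: zero_at_def conj_eq_iff [symmetric])
next
  case (zero_b i j a)
  have "conj (- v (11 + i)) (v 9) = conj (- v (11 + j)) (v 9)"
    using relator[of 5 "[13]" "[9,13]" "[14]" "[9,14]" i j] zero_b
    by (simp add: relator_families_def admits_def subst_simps quad_left_iff)
  then show ?thesis using zero_b by (simp add: zero_at_iff)
qed

text \<open>The relator with letter 12 is the invariant at \<open>(1, 0, 0)\<close>. The one with
  letter 10 says that \<open>u_0^-1 D\<close> is the conjugate by \<open>p^-1\<close> of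
  \<open>u_0^-1 q u_0\<close>; the invariant at \<open>(0, 0, 0)\<close> removes this conjugation
  and leaves \<open>D = q u_0\<close>.\<close>

theorem collapse:
  assumes "collapses R"
  shows "v 10 = v 9 + v 11"
proof -
  have "zero_at x \<longleftrightarrow> zero_at y" if "equivclp (rstep R) x y" for x y
    using that
  proof (induction rule: equivclp_induct)
    case (step y z)
    then show ?case using zero_at_step by blast
  qed simp
  moreover have "zero_at (1, 0, 0)"
  proof -
    have "conj (- (v 12 + v 4)) (v 9) = conj (- v 12) (v 9)"
      using const_relator[of "[12,4]" "[9,12,4]" "[12]" "[9,12]"]
      by (simp add: relator_families_def admits_def subst_simps quad_left_iff [symmetric] add.assoc)
    then have "conj (- v 4) (conj (- v 12) (v 9)) = conj (- v 12) (v 9)"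
      by (simp add: minus_add conj_plus del: add_uminus_conv_diff)
    then have "conj (v 4) (conj (- v 12) (v 9)) = conj (- v 12) (v 9)"
      by (metis conj_uminus(1))
    then show ?thesis by (simp add: zero_at_iff commute_iff_conj)
  qed
  ultimately have "zero_at (0, 0, 0)"
    using assms unfolding collapses_def by blast
  then have "conj (v 4) (conj (- v 11) (v 9)) = conj (- v 11) (v 9)"
    by (simp add: zero_at_iff commute_iff_conj)
  then have *: "conj (- v 4) (conj (- v 11) (v 9)) = conj (- v 11) (v 9)"
    by (metis conj_uminus(2))
  have "- (v 11 + v 4) + (v 9 + v 11 + v 4) = - v 11 + v 10"
    using const_relator[of "[11,4]" "[9,11,4]" "[11]" "[10]"]
    by (simp add: relator_families_def admits_def subst_simps add.assoc)
  moreover have "- (v 11 + v 4) + (v 9 + v 11 + v 4) = conj (- v 4) (conj (- v 11) (v 9))"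
    by (simp add: conj_def minus_add add.assoc del: add_uminus_conv_diff)
  moreover have "conj (- v 11) (v 9) = - v 11 + (v 9 + v 11)"
    by (simp add: conj_def add.assoc)
  ultimately show ?thesis using * by simp
qed

end

section \<open>Rank-three geometry and the points that encode quadruples\<close>

section \<open>Rank-three matroids\<close>

text \<open>Lines may contain points outside \<open>P\<close>, so that they can be given uniformly
  by predicates. A pair on no listed line tacitly spans a line of two points.\<close>

locale linear_space =
  fixes P :: "'p set" and Lines :: "'p set set"
  assumes finite_P: "finite P"
    and two_points: "l \<in> Lines \<Longrightarrow> m \<in> Lines \<Longrightarrow> x \<noteq> y \<Longrightarrow> {x, y} \<subseteq> l \<Longrightarrow> {x, y} \<subseteq> m \<Longrightarrow> {x, y} \<subseteq> P \<Longrightarrow> l = m"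
begin

definition col :: "'p \<Rightarrow> 'p \<Rightarrow> 'p \<Rightarrow> bool" where
  "col x y z \<longleftrightarrow> x = y \<or> y = z \<or> x = z \<or> (\<exists>l\<in>Lines. {x, y, z} \<subseteq> l)"

text \<open>A sum of three truth values, so that \<open>code_rank\<close> can later compute it by
  bounded search.\<close>

definition rk :: "'p set \<Rightarrow> nat" where
  "rk S = of_bool (\<exists>x. x \<in> S) + of_bool (\<exists>x\<in>S. \<exists>y\<in>S. x \<noteq> y) + of_bool (\<exists>x\<in>S. \<exists>y\<in>S. \<exists>z\<in>S. \<not> col x y z)"

lemma ncol_distinct: "\<not> col x y z \<Longrightarrow> x \<noteq> y \<and> y \<noteq> z \<and> x \<noteq> z"
  by (simp add: col_def)

lemma col_swap: "col x y z \<longleftrightarrow> col y x z" "col x y z \<longleftrightarrow> col x z y"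
proof -
  have "{x, y, z} = {y, x, z}" "{x, y, z} = {x, z, y}" by auto
  then show "col x y z \<longleftrightarrow> col y x z" "col x y z \<longleftrightarrow> col x z y"
    unfolding col_def by metis+
qed

text \<open>By \<open>two_points\<close>, everything collinear with two distinct points lies on the
  one line through them.\<close>

lemma col_exchange:
  assumes "x \<noteq> y" "col x y u" "col x y v" "col x y w" "{x, y} \<subseteq> P"
  shows "col u v w"
proof (cases "u = v \<or> v = w \<or> u = w")
  case True
  then show ?thesis by (auto simp: col_def)
next
  case False
  have *: "\<exists>l\<in>Lines. {x, y, t} \<subseteq> l" if "t \<notin> {x, y}" "col x y t" for t
    using that assms(1) by (auto simp: col_def)
  have "\<not> {u, v, w} \<subseteq> {x, y}"
    using False by auto
  then obtain s where s: "s \<notin> {x, y}" "s \<in> {u, v, w}" by blast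
  then have "col x y s" using assms by blast
  then obtain l where l: "l \<in> Lines" "{x, y} \<subseteq> l"
    using *[OF s(1)] by blast
  have "t \<in> l" if tc: "col x y t" for t
  proof (cases "t \<in> {x, y}")
    case False
    obtain m where m: "m \<in> Lines" "{x, y, t} \<subseteq> m" using *[OF False tc] by blast
    then have "l = m" using two_points[OF l(1) m(1) assms(1) l(2) _ assms(5)] by blast
    then show ?thesis using m by blast
  next
    case True
    then show ?thesis using l by blast
  qed
  then have "{u, v, w} \<subseteq> l" using assms by blast
  then show ?thesis using l unfolding col_def by blast
qed

lemma rk_mono: "A \<subseteq> B \<Longrightarrow> rk A \<le> rk B"
proof -
  have "of_bool a \<le> (of_bool b :: nat)" if "a \<longrightarrow> b" for a b
    using that by (cases a; cases b) auto
  moreover assume "A \<subseteq> B"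
  then have "(\<exists>x. x \<in> A) \<longrightarrow> (\<exists>x. x \<in> B)"
    "(\<exists>x\<in>A. \<exists>y\<in>A. x \<noteq> y) \<longrightarrow> (\<exists>x\<in>B. \<exists>y\<in>B. x \<noteq> y)"
    "(\<exists>x\<in>A. \<exists>y\<in>A. \<exists>z\<in>A. \<not> col x y z) \<longrightarrow> (\<exists>x\<in>B. \<exists>y\<in>B. \<exists>z\<in>B. \<not> col x y z)"
    by blast+
  ultimately show "rk A \<le> rk B"
    unfolding rk_def by (intro add_mono) simp_all
qed

lemma rk_eq_0: "rk A = 0 \<longleftrightarrow> A = {}"
  by (auto simp: rk_def)

lemma rk_empty [simp]: "rk {} = 0"
  by (simp add: rk_eq_0)

lemma rk_le_3: "rk A \<le> 3"
  by (simp add: rk_def of_bool_def)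

lemma rk_eq_3_iff: "rk A = 3 \<longleftrightarrow> (\<exists>x\<in>A. \<exists>y\<in>A. \<exists>z\<in>A. \<not> col x y z)"
proof
  assume "\<exists>x\<in>A. \<exists>y\<in>A. \<exists>z\<in>A. \<not> col x y z"
  then obtain x y z where *: "x \<in> A" "y \<in> A" "z \<in> A" "\<not> col x y z" by blast
  then have "x \<noteq> y" using ncol_distinct by blast
  then have "\<exists>x. x \<in> A" "\<exists>x\<in>A. \<exists>y\<in>A. x \<noteq> y" "\<exists>x\<in>A. \<exists>y\<in>A. \<exists>z\<in>A. \<not> col x y z" using * by blast+
  then show "rk A = 3" by (simp only: rk_def of_bool_eq)
qed (simp add: rk_def of_bool_def split: if_splits)

lemma two_le_rk_iff: "2 \<le> rk A \<longleftrightarrow> (\<exists>x\<in>A. \<exists>y\<in>A. x \<noteq> y)"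
proof
  assume *: "\<exists>x\<in>A. \<exists>y\<in>A. x \<noteq> y"
  then have "\<exists>x. x \<in> A" by blast
  then show "2 \<le> rk A" using * by (simp only: rk_def of_bool_eq)
next
  show "\<exists>x\<in>A. \<exists>y\<in>A. x \<noteq> y" if "2 \<le> rk A"
  proof (rule ccontr)
    assume no: "\<not> (\<exists>x\<in>A. \<exists>y\<in>A. x \<noteq> y)"
    then have "\<not> (\<exists>x\<in>A. \<exists>y\<in>A. \<exists>z\<in>A. \<not> col x y z)" using ncol_distinct by blast
    then show False using that no by (simp only: rk_def of_bool_eq) (simp add: of_bool_def split: if_splits)
  qed
qed

lemma rk_singleton [simp]: "rk {x} = 1"
  using two_le_rk_iff[of "{x}"] rk_eq_0[of "{x}"] by (auto simp: not_le)

lemma rk_le_1_cases: "rk A \<le> 1 \<Longrightarrow> A = {} \<or> (\<exists>x. A = {x})"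
  using two_le_rk_iff[of A] by (metis Suc_1 is_singletonI' is_singleton_def not_less_eq_eq)

lemma rk_insert_le: "A \<subseteq> P \<Longrightarrow> x \<in> P \<Longrightarrow> rk (insert x A) \<le> rk A + 1"
proof (cases "rk A" rule: nat.exhaust)
  assume "rk A = 0"
  then have "A = {}" by (simp add: rk_eq_0)
  then show ?thesis by simp
next
  fix n
  assume A: "A \<subseteq> P" "x \<in> P" and n: "rk A = Suc n"
  show ?thesis
  proof (cases "n = 0")
    case True
    then obtain y where "A = {y}" using n rk_le_1_cases[of A] rk_eq_0[of A] by auto
    then have "rk (insert x A) \<noteq> 3"
      unfolding rk_eq_3_iff using ncol_distinct by blast
    then show ?thesis using rk_le_3[of "insert x A"] n by linarith
  next
    case False
    then show ?thesis using rk_le_3[of "insert x A"] n by linarith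
  qed
qed

text \<open>Monotonicity and the bound 3 settle all cases but that of two sets of rank 2 with two
  common points. Both then lie on the line through these points, and so does their union.\<close>

lemma rk_submodular:
  assumes "A \<subseteq> P" "B \<subseteq> P"
  shows "rk (A \<union> B) + rk (A \<inter> B) \<le> rk A + rk B"
proof -
  have one: "rk (A \<union> B) + rk (A \<inter> B) \<le> rk A + rk B" if le: "rk A \<le> 1" "A \<subseteq> P" "B \<subseteq> P" for A B
  proof -
    consider "A = {}" | x where "A = {x}" using rk_le_1_cases le(1) by blast
    then show ?thesis
    proof cases
      case 2
      then show ?thesis
      proof (cases "x \<in> B")
        case True
        then have "A \<union> B = B" "A \<inter> B = A" using 2 by auto
        then show ?thesis by simp
      next
        case False
        then have "A \<inter> B = {}" "A \<union> B = insert x B" using 2 by auto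
        then show ?thesis using rk_insert_le[of B x] le 2 by simp
      qed
    qed simp
  qed
  have mono: "rk (A \<inter> B) \<le> rk A" "rk (A \<inter> B) \<le> rk B" by (simp_all add: rk_mono)
  consider "rk A \<le> 1" | "rk B \<le> 1" | "rk A = 3" | "rk B = 3" | "rk A = 2" "rk B = 2"
    using rk_le_3[of A] rk_le_3[of B] by linarith
  then show ?thesis
  proof cases
    case 1 then show ?thesis using one assms by blast
  next
    case 2 then show ?thesis using one[of B A] assms by (simp add: Un_commute Int_commute)
  next
    case 3 then show ?thesis using mono rk_le_3[of "A \<union> B"] by linarith
  next
    case 4 then show ?thesis using mono rk_le_3[of "A \<union> B"] by linarith
  next
    case 5
    show ?thesis
    proof (cases "2 \<le> rk (A \<inter> B)")
      case False
      then show ?thesis using 5 rk_le_3[of "A \<union> B"] by linarith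
    next
      case True
      then obtain x y where xy: "x \<in> A \<inter> B" "y \<in> A \<inter> B" "x \<noteq> y" unfolding two_le_rk_iff by blast
      have "rk A \<noteq> 3" "rk B \<noteq> 3" using 5 by simp_all
      then have xyt: "col x y t" if "t \<in> A \<union> B" for t
        unfolding rk_eq_3_iff using that xy by blast
      have "{x, y} \<subseteq> P" using assms(1) xy by blast
      then have "col u v w" if "u \<in> A \<union> B" "v \<in> A \<union> B" "w \<in> A \<union> B" for u v w
        using col_exchange[OF xy(3) xyt[OF that(1)] xyt[OF that(2)] xyt[OF that(3)]] by blast
      then have "rk (A \<union> B) \<noteq> 3"
        unfolding rk_eq_3_iff by blast
      then show ?thesis using rk_le_3[of "A \<union> B"] 5 mono by linarith
    qed
  qed
qed

lemma rk_le_card: "A \<subseteq> P \<Longrightarrow> rk A \<le> card A"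
proof -
  assume "A \<subseteq> P"
  then have "finite A" using finite_P finite_subset by blast
  then show ?thesis using \<open>A \<subseteq> P\<close>
  proof (induction A)
    case (insert x A)
    then show ?case using rk_insert_le[of A x] by simp
  qed simp
qed

lemma rk_matroid:
  fixes c :: "'p \<Rightarrow> 'b"
  assumes "inj_on c P"
  shows "matroid (c ` P) (\<lambda>S. rk {x \<in> P. c x \<in> S})"
proof
  show "finite (c ` P)" using finite_P by simp
next
  fix A assume "A \<subseteq> c ` P"
  then have "c ` {x \<in> P. c x \<in> A} = A" by auto
  then have "card {x \<in> P. c x \<in> A} = card A"
    using card_image[OF inj_on_subset[OF assms]] by (metis (no_types, lifting) mem_Collect_eq subsetI)
  then show "rk {x \<in> P. c x \<in> A} \<le> card A"
    using rk_le_card[of "{x \<in> P. c x \<in> A}"] by auto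
next
  fix A B :: "'b set" assume "A \<subseteq> B"
  then show "rk {x \<in> P. c x \<in> A} \<le> rk {x \<in> P. c x \<in> B}" by (intro rk_mono) auto
next
  fix A B :: "'b set"
  have "{x \<in> P. c x \<in> A \<union> B} = {x \<in> P. c x \<in> A} \<union> {x \<in> P. c x \<in> B}"
    "{x \<in> P. c x \<in> A \<inter> B} = {x \<in> P. c x \<in> A} \<inter> {x \<in> P. c x \<in> B}" by auto
  then show "rk {x \<in> P. c x \<in> A \<union> B} + rk {x \<in> P. c x \<in> A \<inter> B} \<le>
      rk {x \<in> P. c x \<in> A} + rk {x \<in> P. c x \<in> B}"
    using rk_submodular[of "{x \<in> P. c x \<in> A}" "{x \<in> P. c x \<in> B}"] by auto
qed

end

section \<open>The matroid of a set of quadruples\<close>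

text \<open>The joints are the vertices of a triangle, and a point on a side stands for a map
  between the two vertices: \<open>Lpt\<close> on the side of joints 0 and 1, \<open>Rpt\<close> on
  that of 1 and 2, \<open>Spt\<close> on that of 0 and 2. A transversal collinear triple says that
  one map is the composite of the others.\<close>

datatype pt = Joint nat | Lpt word | Rpt bool quad | Spt bool quad

fun slot :: "quad \<Rightarrow> bool \<Rightarrow> bool \<Rightarrow> word" where
  "slot (a, b, c, d) \<beta> \<gamma> = (if \<beta> then if \<gamma> then d else b else if \<gamma> then c else a)"

fun good_quad :: "quad \<Rightarrow> bool" where
  "good_quad (a, b, c, d) \<longleftrightarrow> a \<noteq> b \<and> c \<noteq> d \<and> a \<noteq> c \<and> b \<noteq> d"

lemma good_quad_slot:
  assumes "good_quad e"
  shows "slot e \<beta> \<gamma> = slot e \<beta>' \<gamma> \<longleftrightarrow> \<beta> = \<beta>'" "slot e \<beta> \<gamma> = slot e \<beta> \<gamma>' \<longleftrightarrow> \<gamma> = \<gamma>'"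
  using assms by (cases e; auto)+

definition points :: "word set \<Rightarrow> quad set \<Rightarrow> pt set" where
  "points W Q = Joint ` {0, 1, 2} \<union> Lpt ` W \<union> (\<lambda>(\<beta>, e). Rpt \<beta> e) ` (UNIV \<times> Q) \<union> (\<lambda>(\<gamma>, e). Spt \<gamma> e) ` (UNIV \<times> Q)"

fun on_line :: "nat \<Rightarrow> pt \<Rightarrow> bool" where
  "on_line l (Joint i) \<longleftrightarrow> l = 0 \<and> (i = 0 \<or> i = 1) \<or> l = 1 \<and> (i = 1 \<or> i = 2) \<or> l = 2 \<and> (i = 0 \<or> i = 2)"
| "on_line l (Lpt w) \<longleftrightarrow> l = 0"
| "on_line l (Rpt \<beta> e) \<longleftrightarrow> l = 1"
| "on_line l (Spt \<gamma> e) \<longleftrightarrow> l = 2"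

text \<open>With points read as maps, the four triangles of \<open>(a, b, c, d)\<close> say
  \<open>a R_0 = S_0 = b R_1\<close> and \<open>c R_0 = S_1 = d R_1\<close>. Eliminating the
  auxiliary points leaves \<open>a^-1 b = c^-1 d\<close>.\<close>

definition triangle :: "bool \<Rightarrow> bool \<Rightarrow> quad \<Rightarrow> pt set" where
  "triangle \<beta> \<gamma> e = {Lpt (slot e \<beta> \<gamma>), Rpt \<beta> e, Spt \<gamma> e}"

definition quad_lines :: "quad set \<Rightarrow> pt set set" where
  "quad_lines Q = {Collect (on_line l) | l. l < 3} \<union> {triangle \<beta> \<gamma> e | \<beta> \<gamma> e. e \<in> Q}"

lemma on_line_two:
  "on_line i x \<Longrightarrow> on_line j x \<Longrightarrow> i \<noteq> j \<Longrightarrow> x = Joint (if i + j = 1 then 1 else if i + j = 2 then 0 else 2)"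
  by (cases x) auto

text \<open>Two points of a triangle always include an auxiliary one, which names the quadruple. So
  triangles with two common points belong to the same quadruple, and \<open>good_quad\<close> makes
  their third points agree.\<close>

lemma linear_space_quads:
  assumes "finite W" "finite Q" "\<And>e. e \<in> Q \<Longrightarrow> good_quad e"
  shows "linear_space (points W Q) (quad_lines Q)"
proof
  show "finite (points W Q)" using assms by (simp add: points_def)
  fix l m and x y :: pt
  assume lm: "l \<in> quad_lines Q" "m \<in> quad_lines Q" and xy: "x \<noteq> y" "{x, y} \<subseteq> l" "{x, y} \<subseteq> m"
  have long: "i = j" if "x \<in> Collect (on_line i)" "y \<in> Collect (on_line i)" "x \<in> Collect (on_line j)" "y \<in> Collect (on_line j)" for i j
    using that xy(1) on_line_two by (metis mem_Collect_eq)
  have mixed: False if "x \<in> Collect (on_line i)" "y \<in> Collect (on_line i)" "x \<in> triangle \<beta> \<gamma> e" "y \<in> triangle \<beta> \<gamma> e" for i \<beta> \<gamma> e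
    using that xy(1) by (auto simp: triangle_def)
  have short: "triangle \<beta> \<gamma> e = triangle \<beta>' \<gamma>' e'" if "x \<in> triangle \<beta> \<gamma> e" "y \<in> triangle \<beta> \<gamma> e"
    "x \<in> triangle \<beta>' \<gamma>' e'" "y \<in> triangle \<beta>' \<gamma>' e'" "e \<in> Q" for \<beta> \<gamma> e \<beta>' \<gamma>' e'
    using that xy(1) good_quad_slot[OF assms(3)[OF that(5)]] unfolding triangle_def by auto
  have x: "x \<in> l" "y \<in> l" "x \<in> m" "y \<in> m" using xy by auto
  have cases: "(\<exists>i. l = Collect (on_line i)) \<or> (\<exists>\<beta> \<gamma> e. l = triangle \<beta> \<gamma> e \<and> e \<in> Q)" if "l \<in> quad_lines Q" for l
    using that by (auto simp: quad_lines_def)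
  show "l = m"
    using cases[OF lm(1)]
  proof (elim disjE exE conjE)
    fix i assume l: "l = Collect (on_line i)"
    show ?thesis
      using cases[OF lm(2)]
    proof (elim disjE exE conjE)
      fix j assume "m = Collect (on_line j)"
      then show ?thesis using l x long[of i j] by simp
    next
      fix \<beta> \<gamma> e assume "m = triangle \<beta> \<gamma> e"
      then show ?thesis using l x mixed[of i \<beta> \<gamma> e] by simp
    qed
  next
    fix \<beta> \<gamma> e assume l: "l = triangle \<beta> \<gamma> e" and e: "e \<in> Q"
    show ?thesis
      using cases[OF lm(2)]
    proof (elim disjE exE conjE)
      fix j assume "m = Collect (on_line j)"
      then show ?thesis using l x mixed[of j \<beta> \<gamma> e] by simp
    next
      fix \<beta>' \<gamma>' e' assume "m = triangle \<beta>' \<gamma>' e'"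
      then show ?thesis using l x short[of \<beta> \<gamma> e \<beta>' \<gamma>' e'] e by simp
    qed
  qed
qed

definition quad_code :: "quad \<Rightarrow> nat" where
  "quad_code = (\<lambda>(a, b, c, d). prod_encode (list_encode a, prod_encode (list_encode b, prod_encode (list_encode c, list_encode d))))"

text \<open>The kind of a point is the last octal digit and its index the rest, so
  \<open>div\<close> and \<open>mod\<close> recover both.\<close>

fun pt_code :: "pt \<Rightarrow> nat" where
  "pt_code (Joint i) = 8 * i"
| "pt_code (Lpt w) = 8 * list_encode w + 1"
| "pt_code (Rpt \<beta> e) = 8 * quad_code e + (if \<beta> then 3 else 2)"
| "pt_code (Spt \<gamma> e) = 8 * quad_code e + (if \<gamma> then 5 else 4)"

lemma quad_code_eq_iff [simp]: "quad_code e = quad_code e' \<longleftrightarrow> e = e'"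
  by (cases e; cases e') (simp add: quad_code_def inj_eq[OF inj_list_encode])

fun pt_kind :: "pt \<Rightarrow> nat" where
  "pt_kind (Joint i) = 0"
| "pt_kind (Lpt w) = 1"
| "pt_kind (Rpt \<beta> e) = (if \<beta> then 3 else 2)"
| "pt_kind (Spt \<gamma> e) = (if \<gamma> then 5 else 4)"

fun pt_index :: "pt \<Rightarrow> nat" where
  "pt_index (Joint i) = i"
| "pt_index (Lpt w) = list_encode w"
| "pt_index (Rpt \<beta> e) = quad_code e"
| "pt_index (Spt \<gamma> e) = quad_code e"

lemma pt_code_eq: "pt_code x = 8 * pt_index x + pt_kind x"
  by (cases x) simp_all

lemma pt_kind_less: "pt_kind x < 8"
  by (cases x) simp_all

lemma pt_kind_index: "pt_kind x = pt_kind y \<Longrightarrow> pt_index x = pt_index y \<Longrightarrow> x = y"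
  by (cases x; cases y; simp split: if_splits add: inj_eq[OF inj_list_encode])

lemma pt_code_div_mod: "pt_code x div 8 = pt_index x" "pt_code x mod 8 = pt_kind x"
  using pt_kind_less[of x] by (simp_all add: pt_code_eq)

lemma inj_pt_code: "inj pt_code"
  by (rule injI) (metis pt_code_div_mod pt_kind_index)

section \<open>Dimension theory of subspaces of an ambient space\<close>

section \<open>Dimensions of subspaces\<close>

context vectorspace
begin

text \<open>Finite dimension is asked of the subspace only; the ambient space may be
  infinite-dimensional, as function spaces are.\<close>

definition fsub :: "'c set \<Rightarrow> bool" where
  "fsub U \<longleftrightarrow> subspace K U V \<and> vectorspace.fin_dim K (vs U)"

definition sdim :: "'c set \<Rightarrow> nat" where
  "sdim U = vectorspace.dim K (vs U)"

lemma subspaceD: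
  assumes "subspace K U V"
  shows "U \<subseteq> carrier V" "\<zero>\<^bsub>V\<^esub> \<in> U" "x \<in> U \<Longrightarrow> y \<in> U \<Longrightarrow> x \<oplus>\<^bsub>V\<^esub> y \<in> U"
    "a \<in> carrier K \<Longrightarrow> x \<in> U \<Longrightarrow> a \<odot>\<^bsub>V\<^esub> x \<in> U" "x \<in> U \<Longrightarrow> \<ominus>\<^bsub>V\<^esub> x \<in> U" "x \<in> U \<Longrightarrow> y \<in> U \<Longrightarrow> x \<ominus>\<^bsub>V\<^esub> y \<in> U"
proof -
  interpret submodule K U V using assms by simp
  show 1: "U \<subseteq> carrier V" "\<zero>\<^bsub>V\<^esub> \<in> U" "\<And>x y. x \<in> U \<Longrightarrow> y \<in> U \<Longrightarrow> x \<oplus>\<^bsub>V\<^esub> y \<in> U"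
    "\<And>a x. a \<in> carrier K \<Longrightarrow> x \<in> U \<Longrightarrow> a \<odot>\<^bsub>V\<^esub> x \<in> U"
    using subset by auto
  have 2: "\<ominus>\<^bsub>V\<^esub> x \<in> U" if "x \<in> U" for x
  proof -
    have "\<ominus>\<^bsub>V\<^esub> x = (\<ominus>\<^bsub>K\<^esub> \<one>\<^bsub>K\<^esub>) \<odot>\<^bsub>V\<^esub> x" using that 1(1) smult_minus_1 by auto
    then show ?thesis using that 1(4) by auto
  qed
  then show "x \<in> U \<Longrightarrow> \<ominus>\<^bsub>V\<^esub> x \<in> U" .
  show "x \<in> U \<Longrightarrow> y \<in> U \<Longrightarrow> x \<ominus>\<^bsub>V\<^esub> y \<in> U"
    using 1(3) 2 by (simp add: a_minus_def)
qed

lemma subspaceI: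
  assumes "U \<subseteq> carrier V" "\<zero>\<^bsub>V\<^esub> \<in> U" "\<And>x y. x \<in> U \<Longrightarrow> y \<in> U \<Longrightarrow> x \<oplus>\<^bsub>V\<^esub> y \<in> U"
    "\<And>a x. a \<in> carrier K \<Longrightarrow> x \<in> U \<Longrightarrow> a \<odot>\<^bsub>V\<^esub> x \<in> U"
  shows "subspace K U V"
proof -
  have "module K V" "vectorspace K V" by unfold_locales
  then show ?thesis using assms by (simp add: subspace_def submodule_def)
qed

lemma subspace_inter: "subspace K A V \<Longrightarrow> subspace K B V \<Longrightarrow> subspace K (A \<inter> B) V"
  using subspaceD by (intro subspaceI) auto

lemma in_sum_iff: "x \<in> subspace_sum A B \<longleftrightarrow> (\<exists>a\<in>A. \<exists>b\<in>B. x = a \<oplus>\<^bsub>V\<^esub> b)"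
  unfolding submodule_sum_def by auto

lemma subspace_sum: "subspace K A V \<Longrightarrow> subspace K B V \<Longrightarrow> subspace K (subspace_sum A B) V"
  by (rule sum_is_subspace)

lemma fsub_basis:
  assumes "fsub U"
  obtains B where "finite B" "B \<subseteq> U" "lin_indpt B" "span B = U" "card B = sdim U"
proof -
  have U: "subspace K U V" and fd: "vectorspace.fin_dim K (vs U)" using assms by (auto simp: fsub_def)
  interpret U: vectorspace K "vs U" using subspace_is_vs[OF U] .
  obtain B where B: "finite B" "U.basis B" using U.finite_basis_exists[OF fd] by blast
  then have BU: "B \<subseteq> U" by (simp add: U.basis_def)
  have "U.span B = U" "U.lin_indpt B" using B by (simp_all add: U.basis_def)
  then have "span B = U" "lin_indpt B"
    using span_li_not_depend[OF BU] U by simp_all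
  moreover have "card B = sdim U" using U.dim_basis[OF B] by (simp add: sdim_def)
  ultimately show ?thesis using that B BU by blast
qed

lemma span_fsub:
  assumes "finite B" "B \<subseteq> carrier V"
  shows "fsub (span B)" "sdim (span B) \<le> card B" "lin_indpt B \<Longrightarrow> sdim (span B) = card B"
proof -
  have s: "subspace K (span B) V" using span_is_subspace assms by simp
  interpret U: vectorspace K "vs (span B)" using subspace_is_vs[OF s] .
  have B: "B \<subseteq> span B" using in_own_span assms by simp
  have gen: "U.span B = span B"
    using span_li_not_depend[OF B] s by simp
  have "U.fin_dim" unfolding U.fin_dim_def using gen assms B by auto
  then show "fsub (span B)" using s by (simp add: fsub_def)
  show "sdim (span B) \<le> card B"
    using U.gen_ge_dim[of B] assms B gen by (simp add: sdim_def)
  assume "lin_indpt B"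
  then have "U.lin_indpt B" using span_li_not_depend[OF B] s by simp
  then have "U.basis B" using gen B by (simp add: U.basis_def)
  then show "sdim (span B) = card B" using U.dim_basis[of B] assms by (simp add: sdim_def)
qed

lemma indep_card_le:
  assumes "fsub U" "B \<subseteq> U" "lin_indpt B"
  shows "finite B" "card B \<le> sdim U"
proof -
  have U: "subspace K U V" and fd: "vectorspace.fin_dim K (vs U)" using assms by (auto simp: fsub_def)
  interpret U: vectorspace K "vs U" using subspace_is_vs[OF U] .
  have "U.lin_indpt B" using span_li_not_depend[OF assms(2)] U assms(3) by simp
  then show "finite B" "card B \<le> sdim U"
    using U.li_le_dim[OF fd, of B] assms by (simp_all add: sdim_def)
qed

text \<open>Independent subsets of \<open>A\<close> have at most \<open>sdim U\<close> elements, so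
  a maximal one containing \<open>B\<close> exists, and maximality makes it span.\<close>

lemma basis_extension:
  assumes "fsub U" "subspace K A V" "A \<subseteq> U" "B \<subseteq> A" "lin_indpt B"
  obtains M where "finite M" "B \<subseteq> M" "M \<subseteq> A" "lin_indpt M" "span M = A"
proof -
  let ?P = "\<lambda>S. B \<subseteq> S \<and> S \<subseteq> A \<and> lin_indpt S"
  have "\<exists>M. finite M \<and> maximal M ?P"
    using assms indep_card_le[OF assms(1)] by (intro maximal_exists[of ?P "sdim U" B]) auto
  then obtain M where M0: "finite M" "maximal M ?P" by blast
  note M1 = M0(2)[unfolded maximal_def]
  have M: "finite M" "?P M" using M0(1) M1[THEN conjunct1] .
  have max: "M \<subseteq> S \<Longrightarrow> ?P S \<Longrightarrow> S = M" for S using M1[THEN conjunct2] by simp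
  have AV: "A \<subseteq> carrier V" using subspaceD(1)[OF assms(2)] .
  have "v \<in> span M" if "v \<in> A" for v
  proof (rule ccontr)
    assume v: "v \<notin> span M"
    have "M \<subseteq> span M" using in_own_span M AV by auto
    then have "v \<notin> M" using v by blast
    have "lin_indpt (M \<union> {v})"
      using lin_dep_iff_in_span[of M v] M v that AV \<open>v \<notin> M\<close> by auto
    then have "M \<union> {v} = M" using max[of "M \<union> {v}"] M that by auto
    then show False using \<open>v \<notin> M\<close> by blast
  qed
  moreover have "span M \<subseteq> A" using span_is_subset[of M A] M assms(2) by simp
  ultimately show ?thesis using that[of M] M by blast
qed

lemma fsub_subset:
  assumes "fsub U" "subspace K A V" "A \<subseteq> U"
  shows "fsub A" "sdim A \<le> sdim U"
proof -
  have "lin_indpt {}" by (simp add: lin_dep_def)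
  then obtain M where M: "finite M" "M \<subseteq> A" "lin_indpt M" "span M = A"
    by (rule basis_extension[OF assms empty_subsetI])
  then have "M \<subseteq> carrier V" using subspaceD(1)[OF assms(2)] by blast
  then show "fsub A" "sdim A \<le> sdim U"
    using span_fsub[OF M(1)] M indep_card_le(2)[OF assms(1), of M] assms(3) by auto
qed

lemma span_disjoint:
  assumes "finite S" "finite T" "S \<subseteq> carrier V" "T \<subseteq> carrier V" "S \<inter> T = {}" "lin_indpt (S \<union> T)"
  shows "span S \<inter> span T = {\<zero>\<^bsub>V\<^esub>}"
proof -
  have "v = \<zero>\<^bsub>V\<^esub>" if v: "v \<in> span S" "v \<in> span T" for v
  proof -
    obtain a where a: "v = lincomb a S" "a \<in> S \<rightarrow> carrier K" using v finite_span assms by auto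
    have "\<ominus>\<^bsub>V\<^esub> v \<in> span T" using span_neg v assms by blast
    then obtain b where b: "\<ominus>\<^bsub>V\<^esub> v = lincomb b T" "b \<in> T \<rightarrow> carrier K" using finite_span assms by auto
    define c where "c x = (if x \<in> S then a x else b x)" for x
    have c: "c \<in> S \<union> T \<rightarrow> carrier K" using a b by (auto simp: c_def)
    have "lincomb c S = lincomb a S"
      using assms a by (intro lincomb_cong) (auto simp: c_def)
    moreover have "lincomb c T = lincomb b T"
      using assms b by (intro lincomb_cong) (auto simp: c_def)
    moreover have "v \<in> carrier V" using v span_closed assms by blast
    ultimately have "lincomb c (S \<union> T) = \<zero>\<^bsub>V\<^esub>"
      using lincomb_union[OF assms(3,4,5,1,2) c] a b by (metis M.r_neg)
    then have "c \<in> S \<union> T \<rightarrow> {\<zero>\<^bsub>K\<^esub>}"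
      using not_lindepD[OF assms(6) _ subset_refl c] assms by simp
    then have "a \<in> S \<rightarrow> {\<zero>\<^bsub>K\<^esub>}" by (auto simp: c_def Pi_def split: if_splits)
    then show ?thesis using lincomb_zero a assms by simp
  qed
  then show ?thesis using span_zero by blast
qed

lemma indep_union:
  assumes "finite S" "finite T" "S \<subseteq> carrier V" "T \<subseteq> carrier V" "lin_indpt S" "lin_indpt T"
    "span S \<inter> span T = {\<zero>\<^bsub>V\<^esub>}"
  shows "S \<inter> T = {}" "lin_indpt (S \<union> T)"
proof -
  have "S \<inter> T \<subseteq> span S \<inter> span T" using in_own_span assms(3,4) by blast
  then have "S \<inter> T \<subseteq> {\<zero>\<^bsub>V\<^esub>}" using assms by simp
  moreover have "\<zero>\<^bsub>V\<^esub> \<notin> S" using vs_zero_lin_dep assms by blast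
  ultimately show disj: "S \<inter> T = {}" by blast
  show "lin_indpt (S \<union> T)"
  proof (rule finite_lin_indpt2)
    fix a assume a: "a \<in> S \<union> T \<rightarrow> carrier K" "lincomb a (S \<union> T) = \<zero>\<^bsub>V\<^esub>"
    have a': "a \<in> S \<rightarrow> carrier K" "a \<in> T \<rightarrow> carrier K" using a by auto
    have *: "lincomb a S \<oplus>\<^bsub>V\<^esub> lincomb a T = \<zero>\<^bsub>V\<^esub>"
      using lincomb_union[OF assms(3,4) disj assms(1,2) a(1)] a by simp
    have sp: "lincomb a S \<in> span S" "lincomb a T \<in> span T"
      using finite_span[OF assms(1,3)] finite_span[OF assms(2,4)] a' by auto
    have cl: "lincomb a S \<in> carrier V" "lincomb a T \<in> carrier V" using a' assms by auto
    then have "lincomb a S = \<ominus>\<^bsub>V\<^esub> lincomb a T" using * by (metis M.minus_equality)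
    then have "lincomb a S \<in> span T" using span_neg[OF assms(4)] sp by simp
    then have 0: "lincomb a S = \<zero>\<^bsub>V\<^esub>" using sp assms(7) by blast
    then have "lincomb a T = \<zero>\<^bsub>V\<^esub>" using * cl by simp
    then have "a \<in> T \<rightarrow> {\<zero>\<^bsub>K\<^esub>}" "a \<in> S \<rightarrow> {\<zero>\<^bsub>K\<^esub>}"
      using not_lindepD[OF assms(6,2) subset_refl a'(2)] not_lindepD[OF assms(5,1) subset_refl a'(1) 0] by simp_all
    then show "\<forall>v\<in>S \<union> T. a v = \<zero>\<^bsub>K\<^esub>" by auto
  qed (use assms in auto)
qed

lemma sdim_direct:
  assumes "fsub A" "fsub B" "A \<inter> B = {\<zero>\<^bsub>V\<^esub>}"
  shows "fsub (subspace_sum A B)" "sdim (subspace_sum A B) = sdim A + sdim B"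
proof -
  obtain S where S: "finite S" "S \<subseteq> A" "lin_indpt S" "span S = A" "card S = sdim A" using fsub_basis[OF assms(1)] .
  obtain T where T: "finite T" "T \<subseteq> B" "lin_indpt T" "span T = B" "card T = sdim B" using fsub_basis[OF assms(2)] .
  have c: "S \<subseteq> carrier V" "T \<subseteq> carrier V"
    using S T assms subspaceD(1) unfolding fsub_def by blast+
  have ST: "S \<inter> T = {}" "lin_indpt (S \<union> T)" using indep_union[OF S(1) T(1) c S(3) T(3)] S T assms by auto
  have sp: "span (S \<union> T) = subspace_sum A B" using span_union_is_sum[OF c] S T by simp
  show "fsub (subspace_sum A B)" "sdim (subspace_sum A B) = sdim A + sdim B"
    using span_fsub[of "S \<union> T"] S T c ST sp card_Un_disjoint[of S T] by auto
qed

lemma fsub_complement: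
  assumes "fsub A" "subspace K C V" "C \<subseteq> A"
  obtains D where "fsub D" "D \<subseteq> A" "D \<inter> C = {\<zero>\<^bsub>V\<^esub>}" "subspace_sum D C = A" "sdim D + sdim C = sdim A"
proof -
  have fC: "fsub C" using fsub_subset[OF assms] by simp
  obtain B where B: "finite B" "B \<subseteq> C" "lin_indpt B" "span B = C" using fsub_basis[OF fC] by metis
  have sA: "subspace K A V" using assms by (simp add: fsub_def)
  obtain M where M: "finite M" "B \<subseteq> M" "M \<subseteq> A" "lin_indpt M" "span M = A"
    using basis_extension[OF assms(1) sA subset_refl _ B(3)] B(2) assms(3) by blast
  have AV: "A \<subseteq> carrier V" using subspaceD(1)[OF sA] .
  have c: "M - B \<subseteq> carrier V" "B \<subseteq> carrier V" using M B AV by auto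
  have eq: "(M - B) \<union> B = M" using M by auto
  have disj: "span (M - B) \<inter> C = {\<zero>\<^bsub>V\<^esub>}"
    using span_disjoint[of "M - B" B] M B c eq by auto
  have sum: "subspace_sum (span (M - B)) C = A"
    using span_union_is_sum[OF c] eq M B by simp
  have f: "fsub (span (M - B))" using span_fsub[of "M - B"] M c by auto
  have "span (M - B) \<subseteq> A" using span_is_subset[of "M - B" A] M sA by auto
  then show ?thesis using that[of "span (M - B)"] f disj sum sdim_direct[OF f fC disj] by simp
qed

lemma sum_mono: "A \<subseteq> A' \<Longrightarrow> B \<subseteq> B' \<Longrightarrow> subspace_sum A B \<subseteq> subspace_sum A' B'"
  unfolding submodule_sum_def by auto

lemma sum_upper:
  assumes "subspace K A V" "subspace K B V"
  shows "A \<subseteq> subspace_sum A B" "B \<subseteq> subspace_sum A B"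
  using in_sum[of A B] in_sum[of B A] msum_comm[of A B] assms by simp_all

lemma sum_least: "subspace K C V \<Longrightarrow> A \<subseteq> C \<Longrightarrow> B \<subseteq> C \<Longrightarrow> subspace_sum A B \<subseteq> C"
  using subspaceD(3)[of C] unfolding submodule_sum_def by auto

text \<open>Splitting off a complement \<open>D\<close> of \<open>A \<inter> B\<close> in
  \<open>A\<close> reduces the claim to the direct sum of \<open>D\<close> and
  \<open>B\<close>.\<close>

lemma sdim_modular:
  assumes "fsub A" "fsub B"
  shows "fsub (subspace_sum A B)" "sdim (subspace_sum A B) + sdim (A \<inter> B) = sdim A + sdim B"
proof -
  have sAB: "subspace K A V" "subspace K B V" using assms by (auto simp: fsub_def)
  then have sI: "subspace K (A \<inter> B) V" by (rule subspace_inter)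
  obtain D where D: "fsub D" "D \<subseteq> A" "D \<inter> (A \<inter> B) = {\<zero>\<^bsub>V\<^esub>}" "subspace_sum D (A \<inter> B) = A"
    "sdim D + sdim (A \<inter> B) = sdim A"
    using fsub_complement[OF assms(1) sI] by blast
  have sD: "subspace K D V" using D by (simp add: fsub_def)
  have DB: "D \<inter> B = {\<zero>\<^bsub>V\<^esub>}" using D by auto
  have sDB: "subspace K (subspace_sum D B) V" using sD sAB subspace_sum by blast
  have "A \<subseteq> subspace_sum D B"
    using D(4) sum_mono[of D D "A \<inter> B" B] by auto
  then have "subspace_sum A B \<subseteq> subspace_sum D B"
    using sum_least[OF sDB] sum_upper(2)[OF sD sAB(2)] by blast
  moreover have "subspace_sum D B \<subseteq> subspace_sum A B" using sum_mono D(2) by blast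
  ultimately have eq: "subspace_sum A B = subspace_sum D B" by blast
  show "fsub (subspace_sum A B)" "sdim (subspace_sum A B) + sdim (A \<inter> B) = sdim A + sdim B"
    using sdim_direct[OF D(1) assms(2) DB] D(5) eq by simp_all
qed

lemma sdim_zero: "sdim {\<zero>\<^bsub>V\<^esub>} = 0" "fsub {\<zero>\<^bsub>V\<^esub>}"
  using span_fsub[of "{}"] by (simp_all add: span_empty)

lemma sdim_image:
  assumes "fsub U" "\<And>x. x \<in> U \<Longrightarrow> T x \<in> carrier V"
    "\<And>x y. x \<in> U \<Longrightarrow> y \<in> U \<Longrightarrow> T (x \<oplus>\<^bsub>V\<^esub> y) = T x \<oplus>\<^bsub>V\<^esub> T y"
    "\<And>a x. a \<in> carrier K \<Longrightarrow> x \<in> U \<Longrightarrow> T (a \<odot>\<^bsub>V\<^esub> x) = a \<odot>\<^bsub>V\<^esub> T x"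
  shows "fsub (T ` U)" "inj_on T U \<Longrightarrow> sdim (T ` U) = sdim U"
proof -
  have sU: "subspace K U V" and fd: "vectorspace.fin_dim K (vs U)" using assms by (auto simp: fsub_def)
  interpret U: vectorspace K "vs U" using subspace_is_vs[OF sU] .
  have "mod_hom K (vs U) V T"
    unfolding mod_hom_def mod_hom_axioms_def module_hom_def
    using assms U.module_axioms module_axioms by auto
  then interpret T: linear_map K "vs U" V T
    unfolding linear_map_def using U.vectorspace_axioms vectorspace_axioms by blast
  have im: "T.imT = T ` U" by (simp add: T.im_def)
  have sT: "subspace K (T ` U) V" using T.imT_is_subspace im by simp
  interpret W: vectorspace K "vs (T ` U)" using subspace_is_vs[OF sT] .
  have "mod_hom K (vs U) (vs (T ` U)) T"
    unfolding mod_hom_def mod_hom_axioms_def module_hom_def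
    using assms U.module_axioms W.module_axioms by auto
  then interpret W: linear_map K "vs U" "vs (T ` U)" T
    unfolding linear_map_def using U.vectorspace_axioms W.vectorspace_axioms by blast
  have "W.fin_dim" using W.surj_fin_dim[OF fd] by simp
  then show "fsub (T ` U)" using sT by (simp add: fsub_def)
  assume "inj_on T U"
  then show "sdim (T ` U) = sdim U"
    using W.dim_eq[OF fd] by (simp add: sdim_def)
qed

end

section \<open>Partial linear injections and their loss of dimension\<close>

section \<open>Partial linear injections\<close>

context vectorspace
begin

text \<open>A partial map is its graph, so restriction, agreement, inverse and composition become
  subset, intersection, converse and \<open>O\<close>. Note that \<open>F O G\<close> applies
  \<open>F\<close> first.\<close>

definition pmap :: "'c set \<Rightarrow> 'c set \<Rightarrow> ('c \<times> 'c) set \<Rightarrow> bool" where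
  "pmap A B F \<longleftrightarrow> F \<subseteq> A \<times> B \<and> (\<zero>\<^bsub>V\<^esub>, \<zero>\<^bsub>V\<^esub>) \<in> F \<and>
    (\<forall>x y x' y'. (x, y) \<in> F \<longrightarrow> (x', y') \<in> F \<longrightarrow> (x \<oplus>\<^bsub>V\<^esub> x', y \<oplus>\<^bsub>V\<^esub> y') \<in> F) \<and>
    (\<forall>a x y. a \<in> carrier K \<longrightarrow> (x, y) \<in> F \<longrightarrow> (a \<odot>\<^bsub>V\<^esub> x, a \<odot>\<^bsub>V\<^esub> y) \<in> F) \<and>
    single_valued F \<and> single_valued (F\<inverse>)"

definition sz :: "('c \<times> 'c) set \<Rightarrow> nat" where
  "sz F = sdim (Domain F)"

lemma pmapD:
  assumes "pmap A B F"
  shows "F \<subseteq> A \<times> B" "(\<zero>\<^bsub>V\<^esub>, \<zero>\<^bsub>V\<^esub>) \<in> F"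
    "(x, y) \<in> F \<Longrightarrow> (x', y') \<in> F \<Longrightarrow> (x \<oplus>\<^bsub>V\<^esub> x', y \<oplus>\<^bsub>V\<^esub> y') \<in> F"
    "a \<in> carrier K \<Longrightarrow> (x, y) \<in> F \<Longrightarrow> (a \<odot>\<^bsub>V\<^esub> x, a \<odot>\<^bsub>V\<^esub> y) \<in> F"
    "(x, y) \<in> F \<Longrightarrow> (x, z) \<in> F \<Longrightarrow> y = z" "(x, y) \<in> F \<Longrightarrow> (z, y) \<in> F \<Longrightarrow> x = z"
proof -
  note F = assms[unfolded pmap_def]
  note a = F[THEN conjunct1] F[THEN conjunct2, THEN conjunct1]
  note b = F[THEN conjunct2, THEN conjunct2, THEN conjunct1]
  note c = F[THEN conjunct2, THEN conjunct2, THEN conjunct2, THEN conjunct1]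
  note d = F[THEN conjunct2, THEN conjunct2, THEN conjunct2, THEN conjunct2, THEN conjunct1]
    F[THEN conjunct2, THEN conjunct2, THEN conjunct2, THEN conjunct2, THEN conjunct2]
  show "F \<subseteq> A \<times> B" "(\<zero>\<^bsub>V\<^esub>, \<zero>\<^bsub>V\<^esub>) \<in> F" using a .
  show "(x, y) \<in> F \<Longrightarrow> (x', y') \<in> F \<Longrightarrow> (x \<oplus>\<^bsub>V\<^esub> x', y \<oplus>\<^bsub>V\<^esub> y') \<in> F" using b by simp
  show "a \<in> carrier K \<Longrightarrow> (x, y) \<in> F \<Longrightarrow> (a \<odot>\<^bsub>V\<^esub> x, a \<odot>\<^bsub>V\<^esub> y) \<in> F" using c by simp
  show "(x, y) \<in> F \<Longrightarrow> (x, z) \<in> F \<Longrightarrow> y = z" using d(1) by (rule single_valuedD)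
  show "(x, y) \<in> F \<Longrightarrow> (z, y) \<in> F \<Longrightarrow> x = z" using single_valuedD[OF d(2), of y x z] by simp
qed

lemma pmapI:
  assumes "F \<subseteq> A \<times> B" "(\<zero>\<^bsub>V\<^esub>, \<zero>\<^bsub>V\<^esub>) \<in> F"
    "\<And>x y x' y'. (x, y) \<in> F \<Longrightarrow> (x', y') \<in> F \<Longrightarrow> (x \<oplus>\<^bsub>V\<^esub> x', y \<oplus>\<^bsub>V\<^esub> y') \<in> F"
    "\<And>a x y. a \<in> carrier K \<Longrightarrow> (x, y) \<in> F \<Longrightarrow> (a \<odot>\<^bsub>V\<^esub> x, a \<odot>\<^bsub>V\<^esub> y) \<in> F"
    "\<And>x y z. (x, y) \<in> F \<Longrightarrow> (x, z) \<in> F \<Longrightarrow> y = z" "\<And>x y z. (x, y) \<in> F \<Longrightarrow> (z, y) \<in> F \<Longrightarrow> x = z"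
  shows "pmap A B F"
proof -
  have "single_valued F" by (rule single_valuedI) (rule assms(5))
  moreover have "single_valued (F\<inverse>)" by (rule single_valuedI) (simp add: assms(6))
  ultimately show ?thesis unfolding pmap_def using assms(1-4) by simp
qed

lemma pmap_converse: "pmap A B F \<Longrightarrow> pmap B A (F\<inverse>)"
  unfolding pmap_def by auto

lemma pmap_inter: "pmap A B F \<Longrightarrow> pmap A B G \<Longrightarrow> pmap A B (F \<inter> G)"
proof (rule pmapI)
  assume F: "pmap A B F" and G: "pmap A B G"
  show "F \<inter> G \<subseteq> A \<times> B" using pmapD(1)[OF F] by blast
  show "(\<zero>\<^bsub>V\<^esub>, \<zero>\<^bsub>V\<^esub>) \<in> F \<inter> G" using pmapD(2)[OF F] pmapD(2)[OF G] by simp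
  show "(x \<oplus>\<^bsub>V\<^esub> x', y \<oplus>\<^bsub>V\<^esub> y') \<in> F \<inter> G" if "(x, y) \<in> F \<inter> G" "(x', y') \<in> F \<inter> G" for x y x' y'
    using that pmapD(3)[OF F] pmapD(3)[OF G] by simp
  show "(a \<odot>\<^bsub>V\<^esub> x, a \<odot>\<^bsub>V\<^esub> y) \<in> F \<inter> G" if "a \<in> carrier K" "(x, y) \<in> F \<inter> G" for a x y
    using that pmapD(4)[OF F] pmapD(4)[OF G] by simp
  show "y = z" if "(x, y) \<in> F \<inter> G" "(x, z) \<in> F \<inter> G" for x y z
    using that pmapD(5)[OF F, of x y z] by simp
  show "x = z" if "(x, y) \<in> F \<inter> G" "(z, y) \<in> F \<inter> G" for x y z
    using that pmapD(6)[OF F, of x y z] by simp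
qed

lemma pmap_relcomp: "pmap A B F \<Longrightarrow> pmap B C G \<Longrightarrow> pmap A C (F O G)"
proof (rule pmapI)
  assume F: "pmap A B F" and G: "pmap B C G"
  show "F O G \<subseteq> A \<times> C" using pmapD(1)[OF F] pmapD(1)[OF G] by blast
  show "(\<zero>\<^bsub>V\<^esub>, \<zero>\<^bsub>V\<^esub>) \<in> F O G" using pmapD(2)[OF F] pmapD(2)[OF G] by blast
  show "(x \<oplus>\<^bsub>V\<^esub> x', y \<oplus>\<^bsub>V\<^esub> y') \<in> F O G" if "(x, y) \<in> F O G" "(x', y') \<in> F O G" for x y x' y'
    using that pmapD(3)[OF F] pmapD(3)[OF G] by (meson relcompE relcompEpair relcompI)
  show "(a \<odot>\<^bsub>V\<^esub> x, a \<odot>\<^bsub>V\<^esub> y) \<in> F O G" if "a \<in> carrier K" "(x, y) \<in> F O G" for a x y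
    using that pmapD(4)[OF F] pmapD(4)[OF G] by (meson relcompE relcompEpair relcompI)
  show "y = z" if "(x, y) \<in> F O G" "(x, z) \<in> F O G" for x y z
    using that pmapD(5)[OF F] pmapD(5)[OF G] by (metis relcompEpair)
  show "x = z" if "(x, y) \<in> F O G" "(z, y) \<in> F O G" for x y z
    using that pmapD(6)[OF F] pmapD(6)[OF G] by (metis relcompEpair)
qed

lemma pmap_Id_on:
  assumes "subspace K D V" "D \<subseteq> A" shows "pmap A A (Id_on D)"
  using subspaceD[OF assms(1)] assms(2) by (intro pmapI) auto

lemma Domain_subspace:
  assumes "subspace K A V" "pmap A B F"
  shows "subspace K (Domain F) V" "Domain F \<subseteq> A"
proof -
  show D: "Domain F \<subseteq> A" using pmapD(1)[OF assms(2)] by blast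
  show "subspace K (Domain F) V"
  proof (rule subspaceI)
    show "Domain F \<subseteq> carrier V" using D subspaceD(1)[OF assms(1)] by blast
    show "\<zero>\<^bsub>V\<^esub> \<in> Domain F" using pmapD(2)[OF assms(2)] by blast
    show "x \<oplus>\<^bsub>V\<^esub> y \<in> Domain F" if "x \<in> Domain F" "y \<in> Domain F" for x y
      using that pmapD(3)[OF assms(2)] by (meson DomainE DomainI)
    show "a \<odot>\<^bsub>V\<^esub> x \<in> Domain F" if "a \<in> carrier K" "x \<in> Domain F" for a x
      using that pmapD(4)[OF assms(2)] by (meson DomainE DomainI)
  qed
qed

lemma fsub_subspace: "fsub A \<Longrightarrow> subspace K A V"
  by (simp add: fsub_def)

text \<open>The map \<open>x \<mapsto> T (x, F x)\<close> is a linear injection on the domain. It is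
  used for the range of a graph and for its difference graph.\<close>

lemma pmap_graph_dim:
  assumes A: "fsub A" and B: "subspace K B V" and F: "pmap A B F"
    and T: "\<And>x y. T (x, y) \<in> carrier V"
      "\<And>x y x' y'. (x, y) \<in> F \<Longrightarrow> (x', y') \<in> F \<Longrightarrow> T (x \<oplus>\<^bsub>V\<^esub> x', y \<oplus>\<^bsub>V\<^esub> y') = T (x, y) \<oplus>\<^bsub>V\<^esub> T (x', y')"
      "\<And>a x y. a \<in> carrier K \<Longrightarrow> (x, y) \<in> F \<Longrightarrow> T (a \<odot>\<^bsub>V\<^esub> x, a \<odot>\<^bsub>V\<^esub> y) = a \<odot>\<^bsub>V\<^esub> T (x, y)"
      "inj_on T F"
  shows "fsub (T ` F)" "sdim (T ` F) = sz F"
proof -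
  define f where "f x = (THE y. (x, y) \<in> F)" for x
  have f: "f x = y" if "(x, y) \<in> F" for x y
    unfolding f_def using that pmapD(5)[OF F] by blast
  have fD: "fsub (Domain F)"
    using fsub_subset[OF A] Domain_subspace[OF fsub_subspace[OF A] F] by blast
  have fd: "(x, f x) \<in> F" if "x \<in> Domain F" for x
    using that f by blast
  define S where "S x = T (x, f x)" for x
  have im: "S ` Domain F = T ` F"
    using f unfolding S_def by force
  have hom: "S (x \<oplus>\<^bsub>V\<^esub> y) = S x \<oplus>\<^bsub>V\<^esub> S y" if "x \<in> Domain F" "y \<in> Domain F" for x y
    using T(2)[OF fd[OF that(1)] fd[OF that(2)]] f[OF pmapD(3)[OF F fd[OF that(1)] fd[OF that(2)]]]
    by (simp add: S_def)
  have smult: "S (a \<odot>\<^bsub>V\<^esub> x) = a \<odot>\<^bsub>V\<^esub> S x" if "a \<in> carrier K" "x \<in> Domain F" for a x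
    using T(3)[OF that(1) fd[OF that(2)]] f[OF pmapD(4)[OF F that(1) fd[OF that(2)]]]
    by (simp add: S_def)
  have inj: "inj_on S (Domain F)"
    using T(4) fd unfolding S_def inj_on_def by (metis Pair_inject)
  show "fsub (T ` F)" "sdim (T ` F) = sz F"
    using sdim_image[OF fD, of S] hom smult inj T(1) im by (simp_all add: sz_def S_def)
qed

lemma sz_converse:
  assumes "fsub A" "fsub B" "pmap A B F"
  shows "sz (F\<inverse>) = sz F"
proof -
  \<comment> \<open>The default value outside \<open>F\<close> ensures that \<open>T\<close> always
    lands in the carrier.\<close>
  define T where "T p = (if p \<in> F then snd p else \<zero>\<^bsub>V\<^esub>)" for p :: "'c \<times> 'c"
  have B: "B \<subseteq> carrier V" using subspaceD(1) fsub_subspace[OF assms(2)] by blast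
  have im: "T ` F = Range F" by (force simp: T_def)
  have "sdim (T ` F) = sz F"
  proof (rule pmap_graph_dim(2)[OF assms(1) fsub_subspace[OF assms(2)] assms(3)])
    show "T (x, y) \<in> carrier V" for x y
      using pmapD(1)[OF assms(3)] B by (auto simp: T_def)
    show "T (x \<oplus>\<^bsub>V\<^esub> x', y \<oplus>\<^bsub>V\<^esub> y') = T (x, y) \<oplus>\<^bsub>V\<^esub> T (x', y')" if "(x, y) \<in> F" "(x', y') \<in> F" for x y x' y'
      using that pmapD(3)[OF assms(3)] by (simp add: T_def)
    show "T (a \<odot>\<^bsub>V\<^esub> x, a \<odot>\<^bsub>V\<^esub> y) = a \<odot>\<^bsub>V\<^esub> T (x, y)" if "a \<in> carrier K" "(x, y) \<in> F" for a x y
      using that pmapD(4)[OF assms(3)] by (simp add: T_def)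
    show "inj_on T F"
      using pmapD(6)[OF assms(3)] by (auto simp: inj_on_def T_def)
  qed
  then show ?thesis by (simp add: sz_def im)
qed

lemma sz_le:
  assumes "fsub A" "pmap A B F"
  shows "sz F \<le> sdim A"
  using fsub_subset[OF assms(1)] Domain_subspace[OF fsub_subspace[OF assms(1)] assms(2)] by (simp add: sz_def)

lemma sz_mono:
  assumes "fsub A" "pmap A B F" "pmap A B G" "F \<subseteq> G"
  shows "sz F \<le> sz G"
  unfolding sz_def
proof (rule fsub_subset(2))
  show "fsub (Domain G)"
    using fsub_subset[OF assms(1)] Domain_subspace[OF fsub_subspace[OF assms(1)] assms(3)] by blast
  show "subspace K (Domain F) V" using Domain_subspace[OF fsub_subspace[OF assms(1)] assms(2)] by blast
  show "Domain F \<subseteq> Domain G" using assms(4) by blast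
qed

lemma sdim_inter_ge:
  assumes "fsub A" "subspace K U V" "subspace K W V" "U \<subseteq> A" "W \<subseteq> A"
  shows "sdim U + sdim W \<le> sdim (U \<inter> W) + sdim A"
proof -
  have f: "fsub U" "fsub W" using fsub_subset[OF assms(1)] assms by blast+
  have "subspace_sum U W \<subseteq> A" using sum_least fsub_subspace[OF assms(1)] assms by blast
  then have "sdim (subspace_sum U W) \<le> sdim A"
    using fsub_subset(2)[OF assms(1)] subspace_sum assms by blast
  then show ?thesis using sdim_modular(2)[OF f] by linarith
qed

text \<open>Codimensions in \<open>A\<close> add up at worst when subspaces are intersected. This
  makes agreement up to small codimension transitive.\<close>

lemma sz_inter_trans:
  assumes "fsub A" "pmap A B F" "pmap A B G" "pmap A B H"
  shows "sz (F \<inter> G) + sz (G \<inter> H) \<le> sz (F \<inter> H) + sdim A"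
proof -
  have s: "subspace K A V" using fsub_subspace assms by blast
  have p: "pmap A B (F \<inter> G)" "pmap A B (G \<inter> H)" "pmap A B (F \<inter> H)" using pmap_inter assms by blast+
  have sub: "Domain (F \<inter> G) \<inter> Domain (G \<inter> H) \<subseteq> Domain (F \<inter> H)"
    using pmapD(5)[OF assms(3)] by blast
  have "sdim (Domain (F \<inter> G) \<inter> Domain (G \<inter> H)) \<le> sdim (Domain (F \<inter> H))"
    using fsub_subset[OF assms(1)] Domain_subspace[OF s p(3)]
      subspace_inter[OF Domain_subspace(1)[OF s p(1)] Domain_subspace(1)[OF s p(2)]]
      fsub_subset(2)[of "Domain (F \<inter> H)" "Domain (F \<inter> G) \<inter> Domain (G \<inter> H)"] sub by blast
  then show ?thesis
    using sdim_inter_ge[OF assms(1) Domain_subspace(1)[OF s p(1)] Domain_subspace(1)[OF s p(2)]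
      Domain_subspace(2)[OF s p(1)] Domain_subspace(2)[OF s p(2)]] by (simp add: sz_def)
qed

text \<open>The domain of the composite is the preimage of range of \<open>F\<close> meet domain of
  \<open>G\<close>, and injectivity preserves its dimension.\<close>

lemma sz_relcomp:
  assumes "fsub A" "fsub B" "fsub C" "pmap A B F" "pmap B C G"
  shows "sz F + sz G \<le> sz (F O G) + sdim B"
proof -
  have s: "subspace K A V" "subspace K B V" using fsub_subspace assms by blast+
  have F': "pmap B A (F\<inverse>)" using pmap_converse assms by blast
  define D where "D = Domain (F\<inverse>) \<inter> Domain G"
  have dF: "subspace K (Domain (F\<inverse>)) V" "Domain (F\<inverse>) \<subseteq> B" using Domain_subspace[OF s(2) F'] by blast+
  have dG: "subspace K (Domain G) V" "Domain G \<subseteq> B" using Domain_subspace[OF s(2) assms(5)] by blast+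
  have D: "subspace K D V" "D \<subseteq> B" unfolding D_def using subspace_inter dF dG by blast+
  have p: "pmap B A (Id_on D O F\<inverse>)" using pmap_relcomp[OF pmap_Id_on[OF D] F'] .
  have "Domain (Id_on D O F\<inverse>) = D" by (auto simp: D_def)
  then have 1: "sz (Id_on D O F\<inverse>) = sdim D" by (simp add: sz_def)
  have p': "pmap A B ((Id_on D O F\<inverse>)\<inverse>)" using pmap_converse[OF p] .
  have dom: "Domain ((Id_on D O F\<inverse>)\<inverse>) = Domain (F O G)" by (auto simp: D_def)
  have "sz (F O G) = sdim D"
    using sz_converse[OF assms(2,1) p] 1 dom by (simp add: sz_def)
  moreover have "sdim (Domain (F\<inverse>)) + sdim (Domain G) \<le> sdim D + sdim B"
    unfolding D_def using sdim_inter_ge[OF assms(2) dF(1) dG(1) dF(2) dG(2)] .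
  moreover have "sdim (Domain (F\<inverse>)) = sz F" using sz_converse[OF assms(1,2,4)] by (simp add: sz_def)
  ultimately show ?thesis by (simp add: sz_def)
qed

lemma sz_relcomp_cong:
  assumes "fsub A" "fsub B" "fsub C" "pmap A B F" "pmap A B F'" "pmap B C G" "pmap B C G'"
  shows "sz (F \<inter> F') + sz (G \<inter> G') \<le> sz ((F O G) \<inter> (F' O G')) + sdim B"
proof -
  have p: "pmap A B (F \<inter> F')" "pmap B C (G \<inter> G')" using pmap_inter assms by blast+
  have "sz ((F \<inter> F') O (G \<inter> G')) \<le> sz ((F O G) \<inter> (F' O G'))"
    using pmap_relcomp pmap_inter assms p by (intro sz_mono[OF assms(1)]) blast+
  then show ?thesis using sz_relcomp[OF assms(1-3) p] by linarith
qed

text \<open>The graph as a subspace of the ambient space: if \<open>A\<close> and \<open>B\<close>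
  meet trivially, a difference \<open>z - x\<close> determines both terms. Differences make
  composition additive, as \<open>(z - x) + (x - y) = z - y\<close>.\<close>

definition diff_graph :: "('c \<times> 'c) set \<Rightarrow> 'c set" where
  "diff_graph F = {z \<ominus>\<^bsub>V\<^esub> x | x z. (x, z) \<in> F}"

lemma minus_chain:
  assumes "a \<in> carrier V" "b \<in> carrier V" "c \<in> carrier V"
  shows "(a \<ominus>\<^bsub>V\<^esub> b) \<oplus>\<^bsub>V\<^esub> (b \<ominus>\<^bsub>V\<^esub> c) = a \<ominus>\<^bsub>V\<^esub> c"
  using assms by (simp add: a_minus_def M.a_assoc M.r_neg1)

lemma diff_eq:
  assumes "x \<in> carrier V" "z \<in> carrier V" "x' \<in> carrier V" "z' \<in> carrier V" "z \<ominus>\<^bsub>V\<^esub> x = z' \<ominus>\<^bsub>V\<^esub> x'"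
  shows "z \<ominus>\<^bsub>V\<^esub> z' = x \<ominus>\<^bsub>V\<^esub> x'"
proof -
  have "z \<ominus>\<^bsub>V\<^esub> z' = (z' \<ominus>\<^bsub>V\<^esub> x') \<oplus>\<^bsub>V\<^esub> (x \<ominus>\<^bsub>V\<^esub> z')"
    using minus_chain[of z x z'] assms by simp
  also have "\<dots> = (x \<ominus>\<^bsub>V\<^esub> z') \<oplus>\<^bsub>V\<^esub> (z' \<ominus>\<^bsub>V\<^esub> x')"
    using assms by (intro M.a_comm) auto
  finally show ?thesis using minus_chain[of x z' x'] assms by simp
qed

lemma disjoint_diff:
  assumes "subspace K A V" "subspace K B V" "A \<inter> B = {\<zero>\<^bsub>V\<^esub>}"
    "x \<in> A" "z \<in> B" "x' \<in> A" "z' \<in> B" "z \<ominus>\<^bsub>V\<^esub> x = z' \<ominus>\<^bsub>V\<^esub> x'"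
  shows "x = x'" "z = z'"
proof -
  have c: "x \<in> carrier V" "z \<in> carrier V" "x' \<in> carrier V" "z' \<in> carrier V"
    using assms subspaceD(1) by blast+
  have "z \<ominus>\<^bsub>V\<^esub> z' = x \<ominus>\<^bsub>V\<^esub> x'" using diff_eq[OF c assms(8)] .
  then have "z \<ominus>\<^bsub>V\<^esub> z' = \<zero>\<^bsub>V\<^esub>" "x \<ominus>\<^bsub>V\<^esub> x' = \<zero>\<^bsub>V\<^esub>"
    using subspaceD(6)[OF assms(1,4,6)] subspaceD(6)[OF assms(2,5,7)] assms(3) by auto
  then show "x = x'" "z = z'" using c by simp_all
qed

lemma diff_graph_dim:
  assumes "fsub A" "fsub B" "A \<inter> B = {\<zero>\<^bsub>V\<^esub>}" "pmap A B F"
  shows "fsub (diff_graph F)" "sdim (diff_graph F) = sz F"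
proof -
  have s: "subspace K A V" "subspace K B V" using fsub_subspace assms by blast+
  have c: "A \<subseteq> carrier V" "B \<subseteq> carrier V" using subspaceD(1) s by blast+
  define T where "T p = (if p \<in> F then snd p \<ominus>\<^bsub>V\<^esub> fst p else \<zero>\<^bsub>V\<^esub>)" for p :: "'c \<times> 'c"
  have F: "x \<in> A" "y \<in> B" "x \<in> carrier V" "y \<in> carrier V" if "(x, y) \<in> F" for x y
    using that pmapD(1)[OF assms(4)] c by blast+
  have im: "T ` F = diff_graph F" by (force simp: T_def diff_graph_def)
  have 1: "T (x, y) \<in> carrier V" for x y using F by (simp add: T_def)
  have 2: "T (x \<oplus>\<^bsub>V\<^esub> x', y \<oplus>\<^bsub>V\<^esub> y') = T (x, y) \<oplus>\<^bsub>V\<^esub> T (x', y')" if "(x, y) \<in> F" "(x', y') \<in> F" for x y x' y'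
    using that pmapD(3)[OF assms(4)] F[OF that(1)] F[OF that(2)] by (simp add: T_def a_minus_def M.minus_add M.a_ac)
  have 3: "T (a \<odot>\<^bsub>V\<^esub> x, a \<odot>\<^bsub>V\<^esub> y) = a \<odot>\<^bsub>V\<^esub> T (x, y)" if "a \<in> carrier K" "(x, y) \<in> F" for a x y
    using that pmapD(4)[OF assms(4)] F[OF that(2)] by (simp add: T_def a_minus_def smult_r_distr smult_r_minus)
  have 4: "inj_on T F"
  proof (rule inj_onI)
    fix p q assume pq: "p \<in> F" "q \<in> F" "T p = T q"
    obtain x y x' y' where eq: "p = (x, y)" "q = (x', y')" by fastforce
    then have "x = x'" "y = y'"
      using disjoint_diff[OF s assms(3), of x y x' y'] pq F by (simp_all add: T_def)
    then show "p = q" using eq by simp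
  qed
  show "fsub (diff_graph F)" "sdim (diff_graph F) = sz F"
    using pmap_graph_dim[OF assms(1) s(2) assms(4) 1 2 3 4] im by simp_all
qed

text \<open>Inside the sum of \<open>A\<close> and \<open>B\<close>, a subspace that meets neither
  of them nontrivially is the difference graph of a partial injection. Such a subspace is obtained
  by passing to complements, first of the part in \<open>A\<close>, then of the part in
  \<open>B\<close>; the dimensions of these parts are the loss in the bound.\<close>

lemma extract_pmap:
  assumes "fsub A" "fsub B" "A \<inter> B = {\<zero>\<^bsub>V\<^esub>}" "fsub G"
  obtains F where "pmap A B F" "diff_graph F \<subseteq> G"
    "sdim (G \<inter> subspace_sum A B) \<le> sz F + sdim (G \<inter> A) + sdim (G \<inter> B)"
proof -
  have s: "subspace K A V" "subspace K B V" "subspace K G V" using fsub_subspace assms by blast+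
  have c: "A \<subseteq> carrier V" "B \<subseteq> carrier V" "G \<subseteq> carrier V" using subspaceD(1) s by blast+
  define G0 where "G0 = G \<inter> subspace_sum A B"
  have G0: "subspace K G0 V" unfolding G0_def using subspace_inter subspace_sum s by blast
  have fG0: "fsub G0" using fsub_subset(1)[OF assms(4) G0] by (simp add: G0_def)
  obtain G1 where G1: "fsub G1" "G1 \<subseteq> G0" "G1 \<inter> (G0 \<inter> A) = {\<zero>\<^bsub>V\<^esub>}"
      "subspace_sum G1 (G0 \<inter> A) = G0" "sdim G1 + sdim (G0 \<inter> A) = sdim G0"
    by (rule fsub_complement[OF fG0 subspace_inter[OF G0 s(1)] Int_lower1])
  have sG1: "subspace K G1 V" using fsub_subspace G1 by blast
  obtain G2 where G2: "fsub G2" "G2 \<subseteq> G1" "G2 \<inter> (G1 \<inter> B) = {\<zero>\<^bsub>V\<^esub>}"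
      "subspace_sum G2 (G1 \<inter> B) = G1" "sdim G2 + sdim (G1 \<inter> B) = sdim G1"
    by (rule fsub_complement[OF G1(1) subspace_inter[OF sG1 s(2)] Int_lower1])
  have sG2: "subspace K G2 V" using fsub_subspace G2 by blast
  have GA: "G2 \<inter> A = {\<zero>\<^bsub>V\<^esub>}" and GB: "G2 \<inter> B = {\<zero>\<^bsub>V\<^esub>}" using G1 G2 by blast+
  define F where "F = {(x, z). x \<in> A \<and> z \<in> B \<and> z \<ominus>\<^bsub>V\<^esub> x \<in> G2}"
  have F: "pmap A B F"
  proof (rule pmapI)
    show "F \<subseteq> A \<times> B" by (auto simp: F_def)
    have "\<zero>\<^bsub>V\<^esub> \<ominus>\<^bsub>V\<^esub> \<zero>\<^bsub>V\<^esub> = \<zero>\<^bsub>V\<^esub>" by (simp add: a_minus_def)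
    then show "(\<zero>\<^bsub>V\<^esub>, \<zero>\<^bsub>V\<^esub>) \<in> F"
      using subspaceD(2)[OF sG2] subspaceD(2)[OF s(1)] subspaceD(2)[OF s(2)] unfolding F_def by (auto simp only: split_conv mem_Collect_eq)
    show "(x \<oplus>\<^bsub>V\<^esub> x', y \<oplus>\<^bsub>V\<^esub> y') \<in> F" if "(x, y) \<in> F" "(x', y') \<in> F" for x y x' y'
    proof -
      have xy: "x \<in> A" "y \<in> B" "x' \<in> A" "y' \<in> B" "y \<ominus>\<^bsub>V\<^esub> x \<in> G2" "y' \<ominus>\<^bsub>V\<^esub> x' \<in> G2" using that by (auto simp: F_def)
      have "(y \<oplus>\<^bsub>V\<^esub> y') \<ominus>\<^bsub>V\<^esub> (x \<oplus>\<^bsub>V\<^esub> x') = (y \<ominus>\<^bsub>V\<^esub> x) \<oplus>\<^bsub>V\<^esub> (y' \<ominus>\<^bsub>V\<^esub> x')"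
        using xy c by (simp add: a_minus_def M.minus_add M.a_ac subset_iff)
      then show ?thesis
        using xy subspaceD(3)[OF s(1)] subspaceD(3)[OF s(2)] subspaceD(3)[OF sG2] by (simp add: F_def)
    qed
    show "(a \<odot>\<^bsub>V\<^esub> x, a \<odot>\<^bsub>V\<^esub> y) \<in> F" if "a \<in> carrier K" "(x, y) \<in> F" for a x y
    proof -
      have xy: "x \<in> A" "y \<in> B" "y \<ominus>\<^bsub>V\<^esub> x \<in> G2" using that by (auto simp: F_def)
      have "(a \<odot>\<^bsub>V\<^esub> y) \<ominus>\<^bsub>V\<^esub> (a \<odot>\<^bsub>V\<^esub> x) = a \<odot>\<^bsub>V\<^esub> (y \<ominus>\<^bsub>V\<^esub> x)"
        using xy c that by (simp add: a_minus_def smult_r_distr smult_r_minus subset_iff)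
      then show ?thesis
        using that(1) xy subspaceD(4)[OF s(1)] subspaceD(4)[OF s(2)] subspaceD(4)[OF sG2] by (simp add: F_def)
    qed
    show "y = z" if "(x, y) \<in> F" "(x, z) \<in> F" for x y z
    proof -
      have xy: "x \<in> A" "y \<in> B" "z \<in> B" "y \<ominus>\<^bsub>V\<^esub> x \<in> G2" "z \<ominus>\<^bsub>V\<^esub> x \<in> G2" using that by (auto simp: F_def)
      then have cc: "x \<in> carrier V" "y \<in> carrier V" "z \<in> carrier V" using c by auto
      have "(y \<ominus>\<^bsub>V\<^esub> x) \<ominus>\<^bsub>V\<^esub> (z \<ominus>\<^bsub>V\<^esub> x) = y \<ominus>\<^bsub>V\<^esub> z"
        using cc by (simp add: a_minus_def M.minus_add M.a_ac M.r_neg1 M.r_neg2)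
      then have "y \<ominus>\<^bsub>V\<^esub> z \<in> G2 \<inter> B" using subspaceD(6)[OF sG2 xy(4,5)] subspaceD(6)[OF s(2) xy(2,3)] by simp
      then show ?thesis using GB cc by simp
    qed
    show "x = z" if "(x, y) \<in> F" "(z, y) \<in> F" for x y z
    proof -
      have xy: "x \<in> A" "z \<in> A" "y \<in> B" "y \<ominus>\<^bsub>V\<^esub> x \<in> G2" "y \<ominus>\<^bsub>V\<^esub> z \<in> G2" using that by (auto simp: F_def)
      then have cc: "x \<in> carrier V" "y \<in> carrier V" "z \<in> carrier V" using c by auto
      have "(y \<ominus>\<^bsub>V\<^esub> z) \<ominus>\<^bsub>V\<^esub> (y \<ominus>\<^bsub>V\<^esub> x) = x \<ominus>\<^bsub>V\<^esub> z"
        using cc by (simp add: a_minus_def M.minus_add M.a_ac M.r_neg1 M.r_neg2)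
      then have "x \<ominus>\<^bsub>V\<^esub> z \<in> G2 \<inter> A" using subspaceD(6)[OF sG2 xy(5,4)] subspaceD(6)[OF s(1) xy(1,2)] by simp
      then show ?thesis using GA cc by simp
    qed
  qed
  have dg: "diff_graph F = G2"
  proof
    show "diff_graph F \<subseteq> G2" by (auto simp: diff_graph_def F_def)
    show "G2 \<subseteq> diff_graph F"
    proof
      fix v assume v: "v \<in> G2"
      then have "v \<in> subspace_sum A B" using G2 G1 by (auto simp: G0_def)
      then obtain a b where ab: "a \<in> A" "b \<in> B" "v = a \<oplus>\<^bsub>V\<^esub> b" by (auto simp: in_sum_iff)
      have "v = b \<ominus>\<^bsub>V\<^esub> (\<ominus>\<^bsub>V\<^esub> a)" using ab c by (simp add: a_minus_def M.a_comm subset_iff)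
      moreover have "\<ominus>\<^bsub>V\<^esub> a \<in> A" using subspaceD(5)[OF s(1) ab(1)] .
      ultimately have "(\<ominus>\<^bsub>V\<^esub> a, b) \<in> F" using v ab by (simp add: F_def)
      then show "v \<in> diff_graph F"
        using \<open>v = b \<ominus>\<^bsub>V\<^esub> (\<ominus>\<^bsub>V\<^esub> a)\<close> unfolding diff_graph_def by blast
    qed
  qed
  have "sz F = sdim G2" using diff_graph_dim(2)[OF assms(1-3) F] dg by simp
  moreover have "sdim (G1 \<inter> B) \<le> sdim (G \<inter> B)"
    using fsub_subset(1)[OF assms(4) subspace_inter[OF s(3,2)]] subspace_inter[OF sG1 s(2)] G1 G0_def
    by (intro fsub_subset(2)) auto
  moreover have "sdim (G0 \<inter> A) \<le> sdim (G \<inter> A)"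
    using fsub_subset(1)[OF assms(4) subspace_inter[OF s(3,1)]] subspace_inter[OF G0 s(1)] G0_def
    by (intro fsub_subset(2)) auto
  ultimately have "sdim G0 \<le> sz F + sdim (G \<inter> A) + sdim (G \<inter> B)"
    using G1(5) G2(5) by linarith
  then show ?thesis using that[OF F] dg G1 G2 by (auto simp: G0_def)
qed

end

section \<open>The group of germs of partial linear injections\<close>

text \<open>An instance of \<open>group_add\<close> needs a type, whereas germs depend on parameters
  of a locale. They are therefore represented, as in the theorem of Cayley, in the symmetric group
  of a fixed type.\<close>

typedef 'a symm = "{f :: 'a \<Rightarrow> 'a. bij f}"
  using bij_id by blast

setup_lifting type_definition_symm

instantiation symm :: (type) group_add
begin
lift_definition zero_symm :: "'a symm" is id by simp
lift_definition plus_symm :: "'a symm \<Rightarrow> 'a symm \<Rightarrow> 'a symm" is "(\<circ>)" by (rule bij_comp)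
lift_definition uminus_symm :: "'a symm \<Rightarrow> 'a symm" is "inv_into UNIV" by (rule bij_imp_bij_inv)
definition minus_symm :: "'a symm \<Rightarrow> 'a symm \<Rightarrow> 'a symm" where "minus_symm x y = x + - y"
instance
proof
  fix a b c :: "'a symm"
  show "a + b + c = a + (b + c)" by transfer (rule comp_assoc)
  show "0 + a = a" by transfer simp
  show "a + 0 = a" by transfer simp
  show "- a + a = 0" by transfer (simp add: bij_is_inj)
  show "a + - b = a - b" by (simp add: minus_symm_def)
qed
end

text \<open>Stage \<open>k\<close> stands for one approximation, in which dimensions are measured in
  units of \<open>c k\<close>.\<close>

locale germs =
  fixes K :: "('k, 'm) ring_scheme" and V :: "nat \<Rightarrow> ('k, 'v, 'n) module_scheme" and c :: "nat \<Rightarrow> nat"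
  assumes vs: "\<And>k. vectorspace K (V k)" and c_pos: "\<And>k. c k > 0"
begin

abbreviation "fsub k \<equiv> vectorspace.fsub K (V k)"
abbreviation "sdim k \<equiv> vectorspace.sdim K (V k)"
abbreviation "pmap k \<equiv> vectorspace.pmap K (V k)"
abbreviation "sz k \<equiv> vectorspace.sz K (V k)"

definition full :: "(nat \<Rightarrow> 'v set) \<Rightarrow> bool" where
  "full A \<longleftrightarrow> (\<forall>k. fsub k (A k)) \<and> (\<lambda>k. real (sdim k (A k)) / real (c k)) \<longlonglongrightarrow> 1"

definition germ :: "(nat \<Rightarrow> 'v set) \<Rightarrow> (nat \<Rightarrow> 'v set) \<Rightarrow> (nat \<Rightarrow> ('v \<times> 'v) set) \<Rightarrow> bool" where
  "germ A B F \<longleftrightarrow> (\<forall>k. pmap k (A k) (B k) (F k)) \<and> (\<lambda>k. real (sz k (F k)) / real (c k)) \<longlonglongrightarrow> 1"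

text \<open>The dimension of \<open>A k\<close> bounds \<open>sz\<close> from above, so only lower
  bounds ever have to be supplied.\<close>

lemma germI_bound:
  assumes A: "full A" and F: "\<And>k. pmap k (A k) (B k) (F k)"
    and lim: "(\<lambda>k. l k / real (c k)) \<longlonglongrightarrow> 1" and le: "\<And>k. l k \<le> real (sz k (F k))"
  shows "germ A B F"
proof -
  have "(\<lambda>k. real (sz k (F k)) / real (c k)) \<longlonglongrightarrow> 1"
  proof (rule tendsto_sandwich[OF _ _ lim])
    show "\<forall>\<^sub>F k in sequentially. l k / real (c k) \<le> real (sz k (F k)) / real (c k)"
      using le by (intro always_eventually allI divide_right_mono) auto
    show "\<forall>\<^sub>F k in sequentially. real (sz k (F k)) / real (c k) \<le> real (sdim k (A k)) / real (c k)"
      using vectorspace.sz_le[OF vs _ F] A by (intro always_eventually allI divide_right_mono) (auto simp: full_def)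
    show "(\<lambda>k. real (sdim k (A k)) / real (c k)) \<longlonglongrightarrow> 1" using A by (simp add: full_def)
  qed
  then show ?thesis using F by (simp add: germ_def)
qed

lemma lim_plus_minus:
  assumes "(\<lambda>k. real (f k) / real (c k)) \<longlonglongrightarrow> 1" "(\<lambda>k. real (g k) / real (c k)) \<longlonglongrightarrow> 1" "(\<lambda>k. real (h k) / real (c k)) \<longlonglongrightarrow> 1"
  shows "(\<lambda>k. (real (f k) + real (g k) - real (h k)) / real (c k)) \<longlonglongrightarrow> 1"
  using tendsto_diff[OF tendsto_add[OF assms(1,2)] assms(3)] by (simp add: add_divide_distrib diff_divide_distrib)

lemma germ_converse: "full A \<Longrightarrow> full B \<Longrightarrow> germ A B F \<Longrightarrow> germ B A (\<lambda>k. (F k)\<inverse>)"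
proof -
  assume "full A" "full B" and F: "germ A B F"
  then have "sz k ((F k)\<inverse>) = sz k (F k)" for k
    using vectorspace.sz_converse[OF vs, of k "A k" "B k" "F k"] by (simp add: full_def germ_def)
  then show ?thesis using F by (simp add: germ_def vectorspace.pmap_converse[OF vs])
qed

lemma germ_relcomp:
  assumes "full A" "full B" "full C" "germ A B F" "germ B C G"
  shows "germ A C (\<lambda>k. F k O G k)"
proof (rule germI_bound[OF assms(1)])
  have *: "fsub k (A k)" "fsub k (B k)" "fsub k (C k)" "pmap k (A k) (B k) (F k)" "pmap k (B k) (C k) (G k)" for k
    using assms by (auto simp: full_def germ_def)
  show "pmap k (A k) (C k) (F k O G k)" for k
    using vectorspace.pmap_relcomp[OF vs *(4,5)] .
  show "(\<lambda>k. (real (sz k (F k)) + real (sz k (G k)) - real (sdim k (B k))) / real (c k)) \<longlonglongrightarrow> 1"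
    using assms by (intro lim_plus_minus) (auto simp: full_def germ_def)
  show "real (sz k (F k)) + real (sz k (G k)) - real (sdim k (B k)) \<le> real (sz k (F k O G k))" for k
    using vectorspace.sz_relcomp[OF vs *, of k] by linarith
qed

definition agree :: "(nat \<Rightarrow> 'v set) \<Rightarrow> (nat \<Rightarrow> 'v set) \<Rightarrow> (nat \<Rightarrow> ('v \<times> 'v) set) \<Rightarrow> (nat \<Rightarrow> ('v \<times> 'v) set) \<Rightarrow> bool" where
  "agree A B F G \<longleftrightarrow> germ A B F \<and> germ A B G \<and> germ A B (\<lambda>k. F k \<inter> G k)"

lemma agree_refl: "germ A B F \<Longrightarrow> agree A B F F"
  by (simp add: agree_def)

lemma agree_sym: "agree A B F G \<Longrightarrow> agree A B G F"
  by (simp add: agree_def Int_commute)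

lemma agree_superset:
  assumes "full A" "germ A B F" "\<And>k. pmap k (A k) (B k) (G k)" "\<And>k. F k \<subseteq> G k"
  shows "germ A B G" "agree A B F G"
proof -
  have "F k \<inter> G k = F k" for k using assms(4) by blast
  moreover show "germ A B G"
  proof (rule germI_bound[OF assms(1,3)])
    show "(\<lambda>k. real (sz k (F k)) / real (c k)) \<longlonglongrightarrow> 1" using assms(2) by (simp add: germ_def)
    show "real (sz k (F k)) \<le> real (sz k (G k))" for k
      using vectorspace.sz_mono[OF vs _ _ assms(3,4)] assms(1,2) by (auto simp: full_def germ_def)
  qed
  ultimately show "agree A B F G" using assms(2) by (simp add: agree_def)
qed

lemma agree_trans:
  assumes "full A" "agree A B F G" "agree A B G H"
  shows "agree A B F H"
proof -
  have *: "fsub k (A k)" "pmap k (A k) (B k) (F k)" "pmap k (A k) (B k) (G k)" "pmap k (A k) (B k) (H k)" for k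
    using assms by (auto simp: agree_def full_def germ_def)
  have "germ A B (\<lambda>k. F k \<inter> H k)"
  proof (rule germI_bound[OF assms(1)])
    show "pmap k (A k) (B k) (F k \<inter> H k)" for k
      using vectorspace.pmap_inter[OF vs *(2,4)] .
    show "(\<lambda>k. (real (sz k (F k \<inter> G k)) + real (sz k (G k \<inter> H k)) - real (sdim k (A k))) / real (c k)) \<longlonglongrightarrow> 1"
      using assms by (intro lim_plus_minus) (auto simp: full_def germ_def agree_def)
    show "real (sz k (F k \<inter> G k)) + real (sz k (G k \<inter> H k)) - real (sdim k (A k)) \<le> real (sz k (F k \<inter> H k))" for k
      using vectorspace.sz_inter_trans[OF vs *, of k] by linarith
  qed
  then show ?thesis using assms by (simp add: agree_def)
qed

lemma agree_relcomp:
  assumes "full A" "full B" "full C" "agree A B F F'" "agree B C G G'"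
  shows "agree A C (\<lambda>k. F k O G k) (\<lambda>k. F' k O G' k)"
proof -
  have g: "germ A C (\<lambda>k. F k O G k)" "germ A C (\<lambda>k. F' k O G' k)"
    using assms germ_relcomp unfolding agree_def by blast+
  have *: "fsub k (A k)" "fsub k (B k)" "fsub k (C k)" "pmap k (A k) (B k) (F k)" "pmap k (A k) (B k) (F' k)"
    "pmap k (B k) (C k) (G k)" "pmap k (B k) (C k) (G' k)" for k
    using assms by (auto simp: full_def germ_def agree_def)
  have "germ A C (\<lambda>k. (F k O G k) \<inter> (F' k O G' k))"
  proof (rule germI_bound[OF assms(1)])
    show "pmap k (A k) (C k) ((F k O G k) \<inter> (F' k O G' k))" for k
      using g vectorspace.pmap_inter[OF vs] by (simp add: germ_def)
    show "(\<lambda>k. (real (sz k (F k \<inter> F' k)) + real (sz k (G k \<inter> G' k)) - real (sdim k (B k))) / real (c k)) \<longlonglongrightarrow> 1"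
      using assms by (intro lim_plus_minus) (auto simp: full_def germ_def agree_def)
    show "real (sz k (F k \<inter> F' k)) + real (sz k (G k \<inter> G' k)) - real (sdim k (B k)) \<le> real (sz k ((F k O G k) \<inter> (F' k O G' k)))" for k
      using vectorspace.sz_relcomp_cong[OF vs *, of k] by linarith
  qed
  then show ?thesis using g by (simp add: agree_def)
qed

lemma germ_Id: "full A \<Longrightarrow> germ A A (\<lambda>k. Id_on (A k))"
  unfolding germ_def full_def
  by (simp add: vectorspace.pmap_Id_on[OF vs] vectorspace.fsub_subspace[OF vs] vectorspace.sz_def[OF vs])

lemma agree_converse:
  assumes "full A" "full B" "germ A B F"
  shows "agree A A (\<lambda>k. F k O (F k)\<inverse>) (\<lambda>k. Id_on (A k))"
proof (rule agree_superset(2)[OF assms(1)])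
  show "germ A A (\<lambda>k. F k O (F k)\<inverse>)"
    using germ_relcomp[OF assms(1,2,1,3) germ_converse[OF assms]] .
  show "pmap k (A k) (A k) (Id_on (A k))" for k using germ_Id[OF assms(1)] by (simp add: germ_def)
  show "F k O (F k)\<inverse> \<subseteq> Id_on (A k)" for k
  proof -
    have p: "pmap k (A k) (B k) (F k)" using assms(3) by (simp add: germ_def)
    show ?thesis
      using vectorspace.pmapD(1)[OF vs p] vectorspace.pmapD(6)[OF vs p] by blast
  qed
qed

text \<open>Multiplication on classes of germs. Sets that are not classes stay fixed, so that the
  result is a permutation of a whole type.\<close>

definition act :: "(nat \<Rightarrow> 'v set) \<Rightarrow> (nat \<Rightarrow> ('v \<times> 'v) set) \<Rightarrow> (nat \<Rightarrow> ('v \<times> 'v) set) set \<Rightarrow> (nat \<Rightarrow> ('v \<times> 'v) set) set" where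
  "act A F C = (if \<exists>X. germ A A X \<and> C = {Y. agree A A X Y} then {Y. \<exists>X\<in>C. agree A A (\<lambda>k. X k O F k) Y} else C)"

lemma act_outside: "\<not> (\<exists>X. germ A A X \<and> C = {Y. agree A A X Y}) \<Longrightarrow> act A F C = C"
  unfolding act_def by (rule if_not_P)

lemma class_eq:
  assumes "full A" "agree A A X X'"
  shows "{Y. agree A A X Y} = {Y. agree A A X' Y}"
  using agree_trans[OF assms(1)] agree_sym assms(2) by blast

lemma act_class:
  assumes "full A" "germ A A X" "germ A A F"
  shows "act A F {Y. agree A A X Y} = {Y. agree A A (\<lambda>k. X k O F k) Y}"
proof -
  have "(\<exists>X'\<in>{Y. agree A A X Y}. agree A A (\<lambda>k. X' k O F k) Y) \<longleftrightarrow> agree A A (\<lambda>k. X k O F k) Y" for Y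
  proof
    assume "\<exists>X'\<in>{Y. agree A A X Y}. agree A A (\<lambda>k. X' k O F k) Y"
    then obtain X' where X': "agree A A X X'" "agree A A (\<lambda>k. X' k O F k) Y" by blast
    show "agree A A (\<lambda>k. X k O F k) Y"
      using agree_trans[OF assms(1) agree_relcomp[OF assms(1,1,1) X'(1) agree_refl[OF assms(3)]] X'(2)] .
  next
    assume "agree A A (\<lambda>k. X k O F k) Y"
    then show "\<exists>X'\<in>{Y. agree A A X Y}. agree A A (\<lambda>k. X' k O F k) Y" using agree_refl[OF assms(2)] by blast
  qed
  moreover have "\<exists>X'. germ A A X' \<and> {Y. agree A A X Y} = {Y. agree A A X' Y}" using assms(2) by blast
  ultimately show ?thesis by (simp add: act_def)
qed

text \<open>Both sides apply \<open>G\<close> first: the action composes on the right of a germ, and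
  \<open>O\<close> is read from left to right.\<close>

lemma act_comp:
  assumes "full A" "germ A A F" "germ A A G"
  shows "act A F \<circ> act A G = act A (\<lambda>k. G k O F k)"
proof
  fix C
  have gf: "germ A A (\<lambda>k. G k O F k)" using germ_relcomp assms by blast
  show "(act A F \<circ> act A G) C = act A (\<lambda>k. G k O F k) C"
  proof (cases "\<exists>X. germ A A X \<and> C = {Y. agree A A X Y}")
    case True
    then obtain X where X: "germ A A X" "C = {Y. agree A A X Y}" by blast
    have XG: "germ A A (\<lambda>k. X k O G k)" using germ_relcomp assms X by blast
    have "(act A F \<circ> act A G) C = {Y. agree A A (\<lambda>k. (X k O G k) O F k) Y}"
      using act_class[OF assms(1) X(1) assms(3)] act_class[OF assms(1) XG assms(2)] X(2) by simp
    then show ?thesis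
      using act_class[OF assms(1) X(1) gf] X(2) by (simp add: O_assoc)
  next
    case False
    show ?thesis by (simp only: act_outside[OF False] o_apply id_apply)
  qed
qed

lemma act_cong:
  assumes "full A" "agree A A F G"
  shows "act A F = act A G"
proof
  fix C
  have g: "germ A A F" "germ A A G" using assms by (auto simp: agree_def)
  show "act A F C = act A G C"
  proof (cases "\<exists>X. germ A A X \<and> C = {Y. agree A A X Y}")
    case True
    then obtain X where X: "germ A A X" "C = {Y. agree A A X Y}" by blast
    have "agree A A (\<lambda>k. X k O F k) (\<lambda>k. X k O G k)"
      using agree_relcomp[OF assms(1,1,1) agree_refl[OF X(1)] assms(2)] .
    then show ?thesis
      using act_class[OF assms(1) X(1) g(1)] act_class[OF assms(1) X(1) g(2)] X(2) class_eq[OF assms(1)] by simp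
  next
    case False
    show ?thesis by (simp only: act_outside[OF False] o_apply id_apply)
  qed
qed

lemma Id_on_comp:
  assumes "germ A B F"
  shows "Id_on (A k) O F k = F k" "F k O Id_on (B k) = F k"
proof -
  have p: "pmap k (A k) (B k) (F k)" using assms by (simp add: germ_def)
  show "Id_on (A k) O F k = F k" "F k O Id_on (B k) = F k"
    using vectorspace.pmapD(1)[OF vs p] by auto
qed

lemma act_Id:
  assumes "full A"
  shows "act A (\<lambda>k. Id_on (A k)) = id"
proof
  fix C
  show "act A (\<lambda>k. Id_on (A k)) C = id C"
  proof (cases "\<exists>X. germ A A X \<and> C = {Y. agree A A X Y}")
    case True
    then obtain X where X: "germ A A X" "C = {Y. agree A A X Y}" by blast
    then show ?thesis using act_class[OF assms X(1) germ_Id[OF assms]] Id_on_comp(2)[OF X(1)] by simp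
  next
    case False
    show ?thesis by (simp only: act_outside[OF False] o_apply id_apply)
  qed
qed

lemma act_bij:
  assumes "full A" "germ A A F"
  shows "bij (act A F)"
proof (rule o_bij)
  have c: "germ A A (\<lambda>k. (F k)\<inverse>)" using germ_converse assms by blast
  show "act A (\<lambda>k. (F k)\<inverse>) \<circ> act A F = id"
    using act_comp[OF assms(1) c assms(2)] act_cong[OF assms(1) agree_converse[OF assms(1,1,2)]] act_Id[OF assms(1)] by simp
  show "act A F \<circ> act A (\<lambda>k. (F k)\<inverse>) = id"
    using act_comp[OF assms(1) assms(2) c] act_cong[OF assms(1) agree_converse[OF assms(1,1) c]] act_Id[OF assms(1)] by simp
qed

text \<open>A germ is recovered from its action on the class of the identity.\<close>

lemma act_inject:
  assumes "full A" "germ A A F" "germ A A G" "act A F = act A G"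
  shows "agree A A F G"
proof -
  have "{Y. agree A A F Y} = {Y. agree A A G Y}"
    using act_class[OF assms(1) germ_Id[OF assms(1)] assms(2)] act_class[OF assms(1) germ_Id[OF assms(1)] assms(3)]
      Id_on_comp(1)[OF assms(2)] Id_on_comp(1)[OF assms(3)] assms(4) by simp
  then show ?thesis using agree_refl[OF assms(3)] by blast
qed

definition elt :: "(nat \<Rightarrow> 'v set) \<Rightarrow> (nat \<Rightarrow> ('v \<times> 'v) set) \<Rightarrow> (nat \<Rightarrow> ('v \<times> 'v) set) set symm" where
  "elt A F = Abs_symm (act A F)"

lemma elt_plus:
  assumes "full A" "germ A A F" "germ A A G"
  shows "elt A F + elt A G = elt A (\<lambda>k. G k O F k)"
proof -
  have "Rep_symm (elt A F + elt A G) = Rep_symm (elt A (\<lambda>k. G k O F k))"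
    using act_bij[OF assms(1)] assms germ_relcomp[OF assms(1,1,1,3,2)] act_comp[OF assms]
    by (simp add: elt_def plus_symm.rep_eq Abs_symm_inverse)
  then show ?thesis by (simp add: Rep_symm_inject)
qed

lemma elt_eq_iff:
  assumes "full A" "germ A A F" "germ A A G"
  shows "elt A F = elt A G \<longleftrightarrow> agree A A F G"
proof -
  have "elt A F = elt A G \<longleftrightarrow> act A F = act A G"
    unfolding elt_def using act_bij[OF assms(1)] assms by (intro Abs_symm_inject) auto
  then show ?thesis using act_cong[OF assms(1)] act_inject[OF assms] by blast
qed

text \<open>Two triangles with a common point: \<open>a \<rho> = \<sigma> = b \<rho>'\<close> gives
  \<open>a^-1 b = \<rho> \<rho>'^-1\<close>, here written in the order of \<open>O\<close>.\<close>

lemma agree_quotient: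
  assumes "full A" "full B" "full D" "germ D B \<rho>" "germ D B \<rho>'" "germ B A a" "germ B A b"
    and "agree D A (\<lambda>k. \<rho> k O a k) \<sigma>" "agree D A (\<lambda>k. \<rho>' k O b k) \<sigma>"
  shows "agree B B (\<lambda>k. b k O (a k)\<inverse>) (\<lambda>k. (\<rho>' k)\<inverse> O \<rho> k)"
proof -
  have \<rho>c: "germ B D (\<lambda>k. (\<rho>' k)\<inverse>)" and ac: "germ A B (\<lambda>k. (a k)\<inverse>)"
    using germ_converse assms by blast+
  have 1: "agree D A (\<lambda>k. \<rho>' k O b k) (\<lambda>k. \<rho> k O a k)"
    using agree_trans[OF assms(3) assms(9) agree_sym[OF assms(8)]] .
  have 2: "agree B A (\<lambda>k. (\<rho>' k)\<inverse> O (\<rho>' k O b k)) (\<lambda>k. (\<rho>' k)\<inverse> O (\<rho> k O a k))"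
    using agree_relcomp[OF assms(2,3,1) agree_refl[OF \<rho>c] 1] .
  have 3: "agree B B (\<lambda>k. (\<rho>' k)\<inverse> O \<rho>' k) (\<lambda>k. Id_on (B k))"
    using agree_converse[OF assms(2,3) \<rho>c] by simp
  have 4: "agree B A (\<lambda>k. ((\<rho>' k)\<inverse> O \<rho>' k) O b k) b"
    using agree_relcomp[OF assms(2,2,1) 3 agree_refl[OF assms(7)]] Id_on_comp(1)[OF assms(7)] by simp
  have 5: "agree B A b (\<lambda>k. ((\<rho>' k)\<inverse> O \<rho> k) O a k)"
    using agree_trans[OF assms(2) agree_sym[OF 4]] 2 by (simp add: O_assoc)
  have 6: "agree B B (\<lambda>k. b k O (a k)\<inverse>) (\<lambda>k. (((\<rho>' k)\<inverse> O \<rho> k) O a k) O (a k)\<inverse>)"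
    using agree_relcomp[OF assms(2,1,2) 5 agree_refl[OF ac]] .
  have g: "germ B B (\<lambda>k. (\<rho>' k)\<inverse> O \<rho> k)" using germ_relcomp[OF assms(2,3,2) \<rho>c assms(4)] .
  have 7: "agree B B (\<lambda>k. ((\<rho>' k)\<inverse> O \<rho> k) O (a k O (a k)\<inverse>)) (\<lambda>k. (\<rho>' k)\<inverse> O \<rho> k)"
    using agree_relcomp[OF assms(2,2,2) agree_refl[OF g] agree_converse[OF assms(2,1,6)]] Id_on_comp(2)[OF g] by simp
  show ?thesis using agree_trans[OF assms(2) 6] 7 by (simp add: O_assoc)
qed

text \<open>Points of the first side give maps between two different spaces. Dividing by a base map
  \<open>e\<close> puts them into one group, and \<open>e\<close> cancels from quotients.\<close>

lemma elt_quotient: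
  assumes "full A" "full B" "germ B A e" "germ B A a" "germ B A b"
  shows "- elt B (\<lambda>k. a k O (e k)\<inverse>) + elt B (\<lambda>k. b k O (e k)\<inverse>) = elt B (\<lambda>k. b k O (a k)\<inverse>)"
proof -
  have c: "germ A B (\<lambda>k. (a k)\<inverse>)" "germ A B (\<lambda>k. (e k)\<inverse>)"
    using germ_converse[OF assms(2,1)] assms by blast+
  have g: "germ B B (\<lambda>k. a k O (e k)\<inverse>)" "germ B B (\<lambda>k. b k O (e k)\<inverse>)" "germ B B (\<lambda>k. b k O (a k)\<inverse>)"
    using germ_relcomp[OF assms(2,1,2)] assms c by blast+
  have "agree A A (\<lambda>k. (a k)\<inverse> O a k) (\<lambda>k. Id_on (A k))"
    using agree_converse[OF assms(1,2) c(1)] by simp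
  then have "agree A B (\<lambda>k. ((a k)\<inverse> O a k) O (e k)\<inverse>) (\<lambda>k. (e k)\<inverse>)"
    using agree_relcomp[OF assms(1,1,2) _ agree_refl[OF c(2)]] Id_on_comp(1)[OF c(2)] by fastforce
  then have "agree B B (\<lambda>k. b k O (((a k)\<inverse> O a k) O (e k)\<inverse>)) (\<lambda>k. b k O (e k)\<inverse>)"
    using agree_relcomp[OF assms(2,1,2) agree_refl[OF assms(5)]] by blast
  then have eq: "elt B (\<lambda>k. a k O (e k)\<inverse>) + elt B (\<lambda>k. b k O (a k)\<inverse>) = elt B (\<lambda>k. b k O (e k)\<inverse>)"
    using elt_plus[OF assms(2) g(1,3)] elt_eq_iff[OF assms(2) germ_relcomp[OF assms(2,2,2) g(3,1)] g(2)]
    by (simp add: O_assoc)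
  show ?thesis unfolding eq [symmetric] by (rule minus_add_cancel)
qed

end

section \<open>A group extracted from an almost multilinear representation\<close>

section \<open>From almost multilinear representations to groups\<close>

context vectorspace
begin

lemma subspaces_sum_singleton:
  assumes "subspace K (W x) V"
  shows "subspaces_sum V W {x} = W x"
proof -
  have *: "(\<Oplus>\<^bsub>V\<^esub>e\<in>{x}. w e) = w x" if "w x \<in> W x" for w :: "_ \<Rightarrow> 'c"
    using that subspaceD(1)[OF assms] by (subst finsum_insert) auto
  have "v \<in> subspaces_sum V W {x}" if "v \<in> W x" for v
    unfolding subspaces_sum_def using *[of "\<lambda>_. v"] that by (intro CollectI exI[of _ "\<lambda>_. v"]) auto
  moreover have "v \<in> W x" if "v \<in> subspaces_sum V W {x}" for v
    using that * unfolding subspaces_sum_def by auto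
  ultimately show ?thesis by blast
qed

lemma subspaces_sum_insert:
  assumes "finite S" "x \<notin> S" "\<And>y. y \<in> insert x S \<Longrightarrow> subspace K (W y) V"
  shows "subspaces_sum V W (insert x S) = subspace_sum (W x) (subspaces_sum V W S)"
proof -
  have c: "w y \<in> carrier V" if "w \<in> Pi (insert x S) W" "y \<in> insert x S" for w y
    using that subspaceD(1)[OF assms(3)] by blast
  have fi: "(\<Oplus>\<^bsub>V\<^esub>e\<in>insert x S. w e) = w x \<oplus>\<^bsub>V\<^esub> (\<Oplus>\<^bsub>V\<^esub>e\<in>S. w e)" if "w \<in> Pi (insert x S) W" for w
    using c[OF that] assms(1,2) by (intro finsum_insert) auto
  show ?thesis
  proof
    show "subspaces_sum V W (insert x S) \<subseteq> subspace_sum (W x) (subspaces_sum V W S)"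
    proof
      fix v assume "v \<in> subspaces_sum V W (insert x S)"
      then obtain w where w: "w \<in> Pi (insert x S) W" "v = (\<Oplus>\<^bsub>V\<^esub>e\<in>insert x S. w e)"
        unfolding subspaces_sum_def by blast
      have "w x \<in> W x" "(\<Oplus>\<^bsub>V\<^esub>e\<in>S. w e) \<in> subspaces_sum V W S"
        using w(1) unfolding subspaces_sum_def by auto
      then show "v \<in> subspace_sum (W x) (subspaces_sum V W S)"
        unfolding in_sum_iff w(2) fi[OF w(1)] by blast
    qed
    show "subspace_sum (W x) (subspaces_sum V W S) \<subseteq> subspaces_sum V W (insert x S)"
    proof
      fix v assume "v \<in> subspace_sum (W x) (subspaces_sum V W S)"
      then obtain a w where w: "a \<in> W x" "w \<in> Pi S W" "v = a \<oplus>\<^bsub>V\<^esub> (\<Oplus>\<^bsub>V\<^esub>e\<in>S. w e)"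
        unfolding in_sum_iff subspaces_sum_def by blast
      define w' where "w' = w(x := a)"
      have w': "w' \<in> Pi (insert x S) W" using w assms(2) by (auto simp: w'_def)
      have "(\<Oplus>\<^bsub>V\<^esub>e\<in>S. w' e) = (\<Oplus>\<^bsub>V\<^esub>e\<in>S. w e)"
      proof (rule finsum_cong')
        show "w \<in> S \<rightarrow> carrier V" using w(2) subspaceD(1)[OF assms(3)] by blast
        show "w' i = w i" if "i \<in> S" for i using that assms(2) by (auto simp: w'_def)
      qed simp
      then have "v = (\<Oplus>\<^bsub>V\<^esub>e\<in>insert x S. w' e)" using fi[OF w'] w(3) by (simp add: w'_def)
      then show "v \<in> subspaces_sum V W (insert x S)" using w' unfolding subspaces_sum_def by blast
    qed
  qed
qed

lemma fsub_subspaces_sum: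
  assumes "finite S" "S \<noteq> {}" "\<And>y. y \<in> S \<Longrightarrow> fsub (W y)"
  shows "fsub (subspaces_sum V W S)"
  using assms
proof (induction S rule: finite_ne_induct)
  case (singleton x)
  then show ?case using subspaces_sum_singleton[of W x] fsub_subspace by simp
next
  case (insert x S)
  have "subspaces_sum V W (insert x S) = subspace_sum (W x) (subspaces_sum V W S)"
    using insert fsub_subspace by (intro subspaces_sum_insert) auto
  then show ?case using sdim_modular(1)[of "W x"] insert by simp
qed

text \<open>The modular law rewrites the loss in \<open>extract_pmap\<close> through dimensions of
  sums, the quantities that a representation controls. \<open>A\<close> and \<open>B\<close> are the
  cut-down versions of the joint spaces \<open>A0\<close> and \<open>B0\<close>.\<close>

lemma extract_bound:
  assumes A: "fsub A" "fsub A0" "A \<subseteq> A0" and B: "fsub B" "fsub B0" "B \<subseteq> B0" and AB: "A \<inter> B = {\<zero>\<^bsub>V\<^esub>}" and G: "fsub G"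
  shows "\<exists>F. pmap A B F \<and> diff_graph F \<subseteq> G \<and>
    sdim A + sdim B + sdim (subspace_sum G A0) + sdim (subspace_sum G B0) \<le>
    sz F + sdim (subspace_sum G (subspace_sum A0 B0)) + sdim G + sdim A0 + sdim B0"
proof -
  obtain F where F: "pmap A B F" "diff_graph F \<subseteq> G"
    "sdim (G \<inter> subspace_sum A B) \<le> sz F + sdim (G \<inter> A) + sdim (G \<inter> B)"
    using extract_pmap[OF A(1) B(1) AB G] by blast
  have sG: "subspace K G V" using fsub_subspace G .
  have s: "subspace K A V" "subspace K B V" "subspace K A0 V" "subspace K B0 V" using fsub_subspace A B by blast+
  have le: "sdim (G \<inter> A) \<le> sdim (G \<inter> A0)" "sdim (G \<inter> B) \<le> sdim (G \<inter> B0)"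
    using subspace_inter[OF sG] s A(3) B(3) fsub_subset(1)[OF G subspace_inter[OF sG s(3)]]
      fsub_subset(1)[OF G subspace_inter[OF sG s(4)]]
    by (auto intro!: fsub_subset(2))
  have fAB: "fsub (subspace_sum A B)" "fsub (subspace_sum A0 B0)" using sdim_modular(1) A B by blast+
  have "subspace_sum G (subspace_sum A B) \<subseteq> subspace_sum G (subspace_sum A0 B0)"
    by (intro sum_mono A(3) B(3)) simp
  then have "sdim (subspace_sum G (subspace_sum A B)) \<le> sdim (subspace_sum G (subspace_sum A0 B0))"
    using fsub_subset(2)[OF sdim_modular(1)[OF G fAB(2)] fsub_subspace[OF sdim_modular(1)[OF G fAB(1)]]] by blast
  then show ?thesis
    using F le sdim_modular(2)[OF G fAB(1)] sdim_direct(2)[OF A(1) B(1) AB]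
      sdim_modular(2)[OF G A(2)] sdim_modular(2)[OF G B(2)]
    by (intro exI[of _ F]) simp
qed

lemma frame_algebra:
  assumes "x \<in> carrier V" "x' \<in> carrier V" "y \<in> carrier V" "y' \<in> carrier V" "z \<in> carrier V" "z' \<in> carrier V"
    and "z \<ominus>\<^bsub>V\<^esub> y = (z' \<ominus>\<^bsub>V\<^esub> x) \<oplus>\<^bsub>V\<^esub> (x' \<ominus>\<^bsub>V\<^esub> y')"
  shows "y' \<ominus>\<^bsub>V\<^esub> y = (z' \<ominus>\<^bsub>V\<^esub> z) \<oplus>\<^bsub>V\<^esub> (x' \<ominus>\<^bsub>V\<^esub> x)"
proof -
  have "(z' \<ominus>\<^bsub>V\<^esub> z) \<oplus>\<^bsub>V\<^esub> (x' \<ominus>\<^bsub>V\<^esub> x) = (z' \<ominus>\<^bsub>V\<^esub> x) \<oplus>\<^bsub>V\<^esub> (x' \<ominus>\<^bsub>V\<^esub> z)"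
    using assms(1-6) by (simp add: a_minus_def M.a_ac)
  also have "\<dots> = (z' \<ominus>\<^bsub>V\<^esub> x) \<oplus>\<^bsub>V\<^esub> ((x' \<ominus>\<^bsub>V\<^esub> y') \<oplus>\<^bsub>V\<^esub> (y' \<ominus>\<^bsub>V\<^esub> z))"
    using minus_chain[of x' y' z] assms(1-6) by simp
  also have "\<dots> = (z \<ominus>\<^bsub>V\<^esub> y) \<oplus>\<^bsub>V\<^esub> (y' \<ominus>\<^bsub>V\<^esub> z)"
    using assms by (simp add: M.a_assoc)
  also have "\<dots> = (y' \<ominus>\<^bsub>V\<^esub> z) \<oplus>\<^bsub>V\<^esub> (z \<ominus>\<^bsub>V\<^esub> y)"
    using assms(1-6) by (intro M.a_comm) auto
  also have "\<dots> = y' \<ominus>\<^bsub>V\<^esub> y" using minus_chain[of y' z y] assms(1-6) by simp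
  finally show ?thesis ..
qed

text \<open>The graphs of \<open>L\<close> and \<open>R\<close> meet trivially, so their sum fills
  \<open>sz L + sz R\<close> dimensions of \<open>T\<close>, and the graph of \<open>S\<close> must
  meet this sum in large dimension. Since the three spaces are independent, the coordinates of a
  common vector can be compared, and it comes from an argument where \<open>R O L\<close> and
  \<open>S\<close> agree.\<close>

lemma triangle_bound:
  assumes E: "fsub E1" "fsub E2" "fsub E3" "E1 \<inter> E2 = {\<zero>\<^bsub>V\<^esub>}" "E3 \<inter> subspace_sum E1 E2 = {\<zero>\<^bsub>V\<^esub>}"
    and L: "pmap E2 E1 L" and R: "pmap E3 E2 R" and S: "pmap E3 E1 S"
    and T: "fsub T" "diff_graph L \<subseteq> T" "diff_graph R \<subseteq> T" "diff_graph S \<subseteq> T"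
  shows "sz L + sz R + sz S \<le> sz ((R O L) \<inter> S) + sdim T"
proof -
  have s: "subspace K E1 V" "subspace K E2 V" "subspace K E3 V" "subspace K T V" using fsub_subspace E T by blast+
  have c: "E1 \<subseteq> carrier V" "E2 \<subseteq> carrier V" "E3 \<subseteq> carrier V" using subspaceD(1) s by blast+
  have up: "E1 \<subseteq> subspace_sum E1 E2" "E2 \<subseteq> subspace_sum E1 E2" using sum_upper[OF s(1,2)] .
  have ne: "\<zero>\<^bsub>V\<^esub> \<in> E1" "\<zero>\<^bsub>V\<^esub> \<in> E2" "\<zero>\<^bsub>V\<^esub> \<in> E3" using subspaceD(2) s by blast+
  have d: "E2 \<inter> E1 = {\<zero>\<^bsub>V\<^esub>}" "E3 \<inter> E2 = {\<zero>\<^bsub>V\<^esub>}" "E3 \<inter> E1 = {\<zero>\<^bsub>V\<^esub>}"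
    using E(4,5) up ne by blast+
  have frame: "y = y'" "x = x'" "z = z'"
    if "x \<in> E2" "x' \<in> E2" "y \<in> E3" "y' \<in> E3" "z \<in> E1" "z' \<in> E1"
      "z \<ominus>\<^bsub>V\<^esub> y = (z' \<ominus>\<^bsub>V\<^esub> x) \<oplus>\<^bsub>V\<^esub> (x' \<ominus>\<^bsub>V\<^esub> y')" for x x' y y' z z'
  proof -
    have cc: "x \<in> carrier V" "x' \<in> carrier V" "y \<in> carrier V" "y' \<in> carrier V" "z \<in> carrier V" "z' \<in> carrier V"
      using that c by auto
    have *: "y' \<ominus>\<^bsub>V\<^esub> y = (z' \<ominus>\<^bsub>V\<^esub> z) \<oplus>\<^bsub>V\<^esub> (x' \<ominus>\<^bsub>V\<^esub> x)" using frame_algebra[OF cc that(7)] .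
    have m: "y' \<ominus>\<^bsub>V\<^esub> y \<in> E3" "z' \<ominus>\<^bsub>V\<^esub> z \<in> E1" "x' \<ominus>\<^bsub>V\<^esub> x \<in> E2"
      using subspaceD(6) s that by blast+
    then have "y' \<ominus>\<^bsub>V\<^esub> y \<in> subspace_sum E1 E2" unfolding * in_sum_iff by blast
    then have y: "y' \<ominus>\<^bsub>V\<^esub> y = \<zero>\<^bsub>V\<^esub>" using m E(5) by blast
    then show "y = y'" using cc by simp
    have "(z' \<ominus>\<^bsub>V\<^esub> z) \<oplus>\<^bsub>V\<^esub> (x' \<ominus>\<^bsub>V\<^esub> x) = \<zero>\<^bsub>V\<^esub>" using * y by simp
    then have "z' \<ominus>\<^bsub>V\<^esub> z = \<ominus>\<^bsub>V\<^esub> (x' \<ominus>\<^bsub>V\<^esub> x)" using cc by (metis M.minus_closed M.minus_equality)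
    then have "z' \<ominus>\<^bsub>V\<^esub> z \<in> E2" using subspaceD(5)[OF s(2)] m by simp
    then have z: "z' \<ominus>\<^bsub>V\<^esub> z = \<zero>\<^bsub>V\<^esub>" using m E(4) by blast
    then show "z = z'" using cc by simp
    then have "x' \<ominus>\<^bsub>V\<^esub> x = \<zero>\<^bsub>V\<^esub>" using * y z cc by (metis M.l_zero M.minus_closed)
    then show "x = x'" using cc by simp
  qed
  let ?l = "diff_graph L" and ?r = "diff_graph R" and ?s = "diff_graph S"
  have dl: "fsub ?l" "sdim ?l = sz L" using diff_graph_dim[OF E(2,1) d(1) L] .
  have dr: "fsub ?r" "sdim ?r = sz R" using diff_graph_dim[OF E(3,2) d(2) R] .
  have ds: "fsub ?s" "sdim ?s = sz S" using diff_graph_dim[OF E(3,1) d(3) S] .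
  have mem: "\<exists>x z. (x, z) \<in> L \<and> x \<in> E2 \<and> z \<in> E1 \<and> v = z \<ominus>\<^bsub>V\<^esub> x" if "v \<in> ?l" for v
    using that pmapD(1)[OF L] unfolding diff_graph_def by blast
  have memr: "\<exists>y x. (y, x) \<in> R \<and> y \<in> E3 \<and> x \<in> E2 \<and> v = x \<ominus>\<^bsub>V\<^esub> y" if "v \<in> ?r" for v
    using that pmapD(1)[OF R] unfolding diff_graph_def by blast
  have mems: "\<exists>y z. (y, z) \<in> S \<and> y \<in> E3 \<and> z \<in> E1 \<and> v = z \<ominus>\<^bsub>V\<^esub> y" if "v \<in> ?s" for v
    using that pmapD(1)[OF S] unfolding diff_graph_def by blast
  have "?l \<inter> ?r \<subseteq> {\<zero>\<^bsub>V\<^esub>}"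
  proof
    fix v assume v: "v \<in> ?l \<inter> ?r"
    obtain x z where xz: "(x, z) \<in> L" "x \<in> E2" "z \<in> E1" "v = z \<ominus>\<^bsub>V\<^esub> x" using mem v by blast
    obtain y x' where yx: "(y, x') \<in> R" "y \<in> E3" "x' \<in> E2" "v = x' \<ominus>\<^bsub>V\<^esub> y" using memr v by blast
    have cc: "x \<in> carrier V" "x' \<in> carrier V" "y \<in> carrier V" "z \<in> carrier V" using xz yx c by auto
    \<comment> \<open>A common vector \<open>z - x = x' - y\<close> is rearranged into the form of
      \<open>frame\<close>, with zeros for the missing coordinates.\<close>
    have "\<zero>\<^bsub>V\<^esub> \<ominus>\<^bsub>V\<^esub> y = (z \<ominus>\<^bsub>V\<^esub> x) \<oplus>\<^bsub>V\<^esub> ((\<ominus>\<^bsub>V\<^esub> x') \<ominus>\<^bsub>V\<^esub> \<zero>\<^bsub>V\<^esub>)"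
    proof -
      have "(z \<ominus>\<^bsub>V\<^esub> x) \<oplus>\<^bsub>V\<^esub> ((\<ominus>\<^bsub>V\<^esub> x') \<ominus>\<^bsub>V\<^esub> \<zero>\<^bsub>V\<^esub>) = (x' \<ominus>\<^bsub>V\<^esub> y) \<oplus>\<^bsub>V\<^esub> (\<ominus>\<^bsub>V\<^esub> x')"
        using xz(4) yx(4) cc by (simp add: a_minus_def)
      also have "\<dots> = \<ominus>\<^bsub>V\<^esub> y" using cc by (simp add: a_minus_def M.a_ac M.r_neg1 M.r_neg2 M.r_neg M.l_neg)
      finally show ?thesis using cc by (simp add: a_minus_def)
    qed
    then have "y = \<zero>\<^bsub>V\<^esub>" using frame(1)[of x "\<ominus>\<^bsub>V\<^esub> x'" y "\<zero>\<^bsub>V\<^esub>" "\<zero>\<^bsub>V\<^esub>" z] xz yx ne subspaceD(5)[OF s(2)] by simp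
    moreover have "x' = \<zero>\<^bsub>V\<^esub>" using pmapD(5)[OF R yx(1)] pmapD(2)[OF R] \<open>y = \<zero>\<^bsub>V\<^esub>\<close> by simp
    ultimately show "v \<in> {\<zero>\<^bsub>V\<^esub>}" using yx(4) by (simp add: a_minus_def)
  qed
  then have lr0: "?l \<inter> ?r = {\<zero>\<^bsub>V\<^esub>}"
    using subspaceD(2)[OF fsub_subspace[OF dl(1)]] subspaceD(2)[OF fsub_subspace[OF dr(1)]] by blast
  have lr: "fsub (subspace_sum ?l ?r)" "sdim (subspace_sum ?l ?r) = sz L + sz R"
    using sdim_direct[OF dl(1) dr(1) lr0] dl dr by simp_all
  have "subspace_sum ?l ?r \<subseteq> T" using sum_least[OF s(4) T(2,3)] .
  then have "sz L + sz R + sz S \<le> sdim (subspace_sum ?l ?r \<inter> ?s) + sdim T"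
    using sdim_inter_ge[OF T(1) fsub_subspace[OF lr(1)] fsub_subspace[OF ds(1)] _ T(4)] lr ds by simp
  moreover have "subspace_sum ?l ?r \<inter> ?s \<subseteq> diff_graph ((R O L) \<inter> S)"
  proof
    fix v assume v: "v \<in> subspace_sum ?l ?r \<inter> ?s"
    then obtain a b where ab: "a \<in> ?l" "b \<in> ?r" "v = a \<oplus>\<^bsub>V\<^esub> b" by (auto simp: in_sum_iff)
    obtain x z' where xz: "(x, z') \<in> L" "x \<in> E2" "z' \<in> E1" "a = z' \<ominus>\<^bsub>V\<^esub> x" using mem ab by blast
    obtain y' x' where yx: "(y', x') \<in> R" "y' \<in> E3" "x' \<in> E2" "b = x' \<ominus>\<^bsub>V\<^esub> y'" using memr ab by blast
    obtain y z where yz: "(y, z) \<in> S" "y \<in> E3" "z \<in> E1" "v = z \<ominus>\<^bsub>V\<^esub> y" using mems v by blast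
    have "z \<ominus>\<^bsub>V\<^esub> y = (z' \<ominus>\<^bsub>V\<^esub> x) \<oplus>\<^bsub>V\<^esub> (x' \<ominus>\<^bsub>V\<^esub> y')" using ab xz yx yz by simp
    then have "y = y'" "x = x'" "z = z'"
      using frame[OF xz(2) yx(3) yz(2) yx(2) yz(3) xz(3)] by simp_all
    then have "(y, z) \<in> (R O L) \<inter> S" using xz yx yz by blast
    then show "v \<in> diff_graph ((R O L) \<inter> S)" using yz(4) unfolding diff_graph_def by blast
  qed
  moreover have p: "pmap E3 E1 ((R O L) \<inter> S)" using pmap_inter[OF pmap_relcomp[OF R L] S] .
  ultimately show ?thesis
    using diff_graph_dim[OF E(3,1) d(3) p]
      fsub_subset(2)[OF _ subspace_inter[OF fsub_subspace[OF lr(1)] fsub_subspace[OF ds(1)]]] by fastforce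
qed

text \<open>The joint spaces of a representation are independent only up to small error. Cutting
  down the second and the third makes independence exact, and the dimension equations show that
  nothing is lost in the limit.\<close>

lemma frame_exists:
  assumes "fsub E1" "fsub E2" "fsub E3"
  shows "\<exists>D2 D3. fsub D2 \<and> fsub D3 \<and> D2 \<subseteq> E2 \<and> D3 \<subseteq> E3 \<and> E1 \<inter> D2 = {\<zero>\<^bsub>V\<^esub>} \<and> D3 \<inter> subspace_sum E1 D2 = {\<zero>\<^bsub>V\<^esub>} \<and>
    sdim D2 + sdim E1 = sdim (subspace_sum E1 E2) \<and>
    sdim D3 + sdim (subspace_sum E1 E2) = sdim (subspace_sum E3 (subspace_sum E1 E2))"
proof -
  have s: "subspace K E1 V" "subspace K E2 V" "subspace K E3 V" using fsub_subspace assms by blast+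
  have f12: "fsub (subspace_sum E1 E2)" using sdim_modular(1) assms by blast
  obtain D2 where D2: "fsub D2" "D2 \<subseteq> E2" "D2 \<inter> (E1 \<inter> E2) = {\<zero>\<^bsub>V\<^esub>}" "subspace_sum D2 (E1 \<inter> E2) = E2"
    "sdim D2 + sdim (E1 \<inter> E2) = sdim E2"
    by (rule fsub_complement[OF assms(2) subspace_inter[OF s(1,2)] Int_lower2])
  obtain D3 where D3: "fsub D3" "D3 \<subseteq> E3" "D3 \<inter> (E3 \<inter> subspace_sum E1 E2) = {\<zero>\<^bsub>V\<^esub>}"
    "subspace_sum D3 (E3 \<inter> subspace_sum E1 E2) = E3" "sdim D3 + sdim (E3 \<inter> subspace_sum E1 E2) = sdim E3"
    by (rule fsub_complement[OF assms(3) subspace_inter[OF s(3) fsub_subspace[OF f12]] Int_lower1])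
  have "E1 \<inter> D2 = {\<zero>\<^bsub>V\<^esub>}" using D2(2,3) by blast
  moreover have "\<zero>\<^bsub>V\<^esub> \<in> D3" "\<zero>\<^bsub>V\<^esub> \<in> subspace_sum E1 D2"
    using subspaceD(2) fsub_subspace D3 sdim_modular(1)[OF assms(1) D2(1)] by blast+
  moreover have "subspace_sum E1 D2 \<subseteq> subspace_sum E1 E2" using sum_mono D2 by blast
  ultimately have "D3 \<inter> subspace_sum E1 D2 = {\<zero>\<^bsub>V\<^esub>}" using D3(2,3) by blast
  then show ?thesis
    using D2 D3 \<open>E1 \<inter> D2 = {\<zero>\<^bsub>V\<^esub>}\<close> sdim_modular(2)[OF assms(1,2)] sdim_modular(2)[OF assms(3) f12]
    by (intro exI[of _ D2] exI[of _ D3]) auto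
qed

end

lemma tendsto_of_bound:
  assumes "\<And>k. \<bar>x - f k\<bar> < inverse (real (Suc k))"
  shows "f \<longlonglongrightarrow> x"
proof -
  have "(\<lambda>k. f k - x) \<longlonglongrightarrow> 0"
  proof (rule tendsto_rabs_zero_cancel, rule tendsto_sandwich[OF _ _ tendsto_const LIMSEQ_inverse_real_of_nat])
    show "\<forall>\<^sub>F k in sequentially. 0 \<le> \<bar>f k - x\<bar>" by simp
    show "\<forall>\<^sub>F k in sequentially. \<bar>f k - x\<bar> \<le> inverse (real (Suc k))"
      using assms by (intro always_eventually allI) (simp add: abs_minus_commute less_imp_le)
  qed
  then show ?thesis by (simp add: LIM_zero_iff)
qed

text \<open>The errors \<open>1 / (k + 1)\<close> turn approximations into limits, so that later
  arguments need no bookkeeping of errors.\<close>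

lemma almost_multilinear_sequence:
  assumes "almost_multilinear K E r" "finite E"
  shows "\<exists>(V :: nat \<Rightarrow> ('k, nat \<Rightarrow> 'k) module) U c. (\<forall>k. vectorspace K (V k) \<and> c k > 0) \<and>
    (\<forall>k. \<forall>e\<in>E. vectorspace.fsub K (V k) (U k e)) \<and>
    (\<forall>S. S \<subseteq> E \<longrightarrow> (\<lambda>k. real (vectorspace.sdim K (V k) (subspaces_sum (V k) (U k) S)) / real (c k)) \<longlonglongrightarrow> real (r S))"
proof -
  have "\<forall>k. \<exists>(V :: ('k, nat \<Rightarrow> 'k) module) U c. vectorspace K V \<and>
          (\<forall>e\<in>E. subspace K (U e) V \<and> vectorspace.fin_dim K (V\<lparr>carrier := U e\<rparr>)) \<and> c > 0 \<and>
          (MAX S\<in>Pow E. \<bar>real (r S) - 1 / real c * real (vectorspace.dim K (V\<lparr>carrier := subspaces_sum V U S\<rparr>))\<bar>) < inverse (real (Suc k))"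
    using assms(1) unfolding almost_multilinear_def by simp
  then obtain V U c where "\<forall>k. vectorspace K (V k :: ('k, nat \<Rightarrow> 'k) module) \<and>
          (\<forall>e\<in>E. subspace K (U k e) (V k) \<and> vectorspace.fin_dim K (V k\<lparr>carrier := U k e\<rparr>)) \<and> c k > (0 :: nat) \<and>
          (MAX S\<in>Pow E. \<bar>real (r S) - 1 / real (c k) * real (vectorspace.dim K (V k\<lparr>carrier := subspaces_sum (V k) (U k) S\<rparr>))\<bar>) < inverse (real (Suc k))"
    unfolding choice_iff by (elim exE)
  then have *: "\<And>k. vectorspace K (V k)"
    "\<And>k. (\<forall>e\<in>E. subspace K (U k e) (V k) \<and> vectorspace.fin_dim K (V k\<lparr>carrier := U k e\<rparr>))"
    "\<And>k. c k > 0"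
    "\<And>k. (MAX S\<in>Pow E. \<bar>real (r S) - 1 / real (c k) * real (vectorspace.dim K (V k\<lparr>carrier := subspaces_sum (V k) (U k) S\<rparr>))\<bar>) < inverse (real (Suc k))"
    by blast+
  show ?thesis
  proof (intro exI conjI allI ballI impI)
    show "vectorspace K (V k)" "c k > 0" for k using *(1,3) by auto
    show "vectorspace.fsub K (V k) (U k e)" if "e \<in> E" for k e
      using *(2) that by (simp add: vectorspace.fsub_def[OF *(1)])
    show "(\<lambda>k. real (vectorspace.sdim K (V k) (subspaces_sum (V k) (U k) S)) / real (c k)) \<longlonglongrightarrow> real (r S)" if "S \<subseteq> E" for S
    proof (rule tendsto_of_bound)
      fix k
      let ?f = "\<lambda>S. \<bar>real (r S) - 1 / real (c k) * real (vectorspace.dim K (V k\<lparr>carrier := subspaces_sum (V k) (U k) S\<rparr>))\<bar>"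
      have "?f S \<le> Max (?f ` Pow E)" using assms(2) that by (intro Max_ge) auto
      then show "\<bar>real (r S) - real (vectorspace.sdim K (V k) (subspaces_sum (V k) (U k) S)) / real (c k)\<bar> < inverse (real (Suc k))"
        using *(4)[of k] by (simp add: vectorspace.sdim_def[OF *(1)])
    qed
  qed
qed

locale quad_matroid =
  fixes W :: "word set" and Q :: "quad set"
  assumes finite_W: "finite W" and finite_Q: "finite Q" and good: "\<And>e. e \<in> Q \<Longrightarrow> good_quad e"
    and slots: "\<And>e \<beta> \<gamma>. e \<in> Q \<Longrightarrow> slot e \<beta> \<gamma> \<in> W" and Nil_W: "[] \<in> W"
begin

sublocale linear_space "points W Q" "quad_lines Q"
  by (rule linear_space_quads) (use finite_W finite_Q good in auto)

definition ground :: "nat set" where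
  "ground = pt_code ` points W Q"

definition rank :: "nat set \<Rightarrow> nat" where
  "rank S = rk {x \<in> points W Q. pt_code x \<in> S}"

lemma matroid_rank: "matroid ground rank"
  unfolding ground_def rank_def by (rule rk_matroid) (rule inj_on_subset[OF inj_pt_code subset_UNIV])

lemma rank_image:
  assumes "S \<subseteq> points W Q"
  shows "rank (pt_code ` S) = rk S"
proof -
  have "{x \<in> points W Q. pt_code x \<in> pt_code ` S} = S"
    using assms inj_pt_code by (auto simp: inj_image_mem_iff)
  then show ?thesis by (simp add: rank_def)
qed

lemma points_simps [simp]:
  "Joint 0 \<in> points W Q" "Joint 1 \<in> points W Q" "Joint (Suc 0) \<in> points W Q" "Joint 2 \<in> points W Q" "Lpt w \<in> points W Q \<longleftrightarrow> w \<in> W"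
  "Rpt \<beta> e \<in> points W Q \<longleftrightarrow> e \<in> Q" "Spt \<beta> e \<in> points W Q \<longleftrightarrow> e \<in> Q"
  by (auto simp: points_def)

lemma rk_pair: "x \<noteq> y \<Longrightarrow> rk {x, y} = 2"
proof -
  assume "x \<noteq> y"
  moreover have "rk {x, y} \<noteq> 3" unfolding rk_eq_3_iff using ncol_distinct by blast
  ultimately show ?thesis using two_le_rk_iff[of "{x, y}"] rk_le_3[of "{x, y}"] by force
qed

lemma rk_triple:
  assumes "x \<noteq> y"
  shows "rk {x, y, z} = (if col x y z then 2 else 3)"
proof (cases "col x y z")
  case True
  have perm: "col a b c" if "{a, b, c} \<subseteq> {x, y, z}" for a b c
  proof (cases "a = b \<or> b = c \<or> a = c")
    case False
    then have "{a, b, c} = {x, y, z}" using that by auto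
    moreover have "x \<noteq> z" "y \<noteq> z" using False that by auto
    ultimately show ?thesis using True assms unfolding col_def by metis
  qed (auto simp: col_def)
  then have "rk {x, y, z} \<noteq> 3" unfolding rk_eq_3_iff by blast
  moreover have "2 \<le> rk {x, y, z}" unfolding two_le_rk_iff using assms by blast
  ultimately show ?thesis using rk_le_3[of "{x, y, z}"] True by simp
next
  case False
  then show ?thesis using rk_eq_3_iff[of "{x, y, z}"] by auto
qed

lemma on_line_col: "l < 3 \<Longrightarrow> on_line l x \<Longrightarrow> on_line l y \<Longrightarrow> on_line l z \<Longrightarrow> col x y z"
proof -
  assume "l < 3" "on_line l x" "on_line l y" "on_line l z"
  then have "Collect (on_line l) \<in> quad_lines Q" "{x, y, z} \<subseteq> Collect (on_line l)"
    unfolding quad_lines_def by blast+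
  then show ?thesis unfolding col_def by blast
qed

lemma triangle_col: "e \<in> Q \<Longrightarrow> col (Lpt (slot e \<beta> \<gamma>)) (Rpt \<beta> e) (Spt \<gamma> e)"
proof -
  assume "e \<in> Q"
  then have "triangle \<beta> \<gamma> e \<in> quad_lines Q" unfolding quad_lines_def by blast
  moreover have "{Lpt (slot e \<beta> \<gamma>), Rpt \<beta> e, Spt \<gamma> e} \<subseteq> triangle \<beta> \<gamma> e" by (simp add: triangle_def)
  ultimately show ?thesis unfolding col_def by blast
qed

lemma col_joints: "\<not> col (Joint 0) (Joint 1) (Joint 2)"
proof
  assume "col (Joint 0) (Joint 1) (Joint 2)"
  then obtain l where "l \<in> quad_lines Q" "{Joint 0, Joint 1, Joint 2} \<subseteq> l" unfolding col_def by auto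
  then show False unfolding quad_lines_def triangle_def by auto
qed

end

text \<open>The element of a word is its germ relative to the germ of \<open>[]\<close>. Relations
  come from the four triangles of a quadruple, and injectivity from the fact that two distinct
  points have rank 2.\<close>

lemma (in quad_matroid) almost_multilinear_group:
  fixes K :: "'k ring"
  assumes "almost_multilinear K ground rank"
  obtains g :: "word \<Rightarrow> (nat \<Rightarrow> ((nat \<Rightarrow> 'k) \<times> (nat \<Rightarrow> 'k)) set) set symm" where
    "\<And>a b c d. (a, b, c, d) \<in> Q \<Longrightarrow> - g a + g b = - g c + g d"
    "\<And>w w'. w \<in> W \<Longrightarrow> w' \<in> W \<Longrightarrow> g w = g w' \<Longrightarrow> w = w'"
proof -
  have "finite ground" using finite_P by (simp add: ground_def)
  obtain V :: "nat \<Rightarrow> ('k, nat \<Rightarrow> 'k) module" and U c where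
    "(\<forall>k. vectorspace K (V k) \<and> c k > 0) \<and> (\<forall>k. \<forall>e\<in>ground. vectorspace.fsub K (V k) (U k e)) \<and>
    (\<forall>S. S \<subseteq> ground \<longrightarrow> (\<lambda>k. real (vectorspace.sdim K (V k) (subspaces_sum (V k) (U k) S)) / real (c k)) \<longlonglongrightarrow> real (rank S))"
    using almost_multilinear_sequence[OF assms \<open>finite ground\<close>] by (elim exE)
  then have VU: "\<And>k. vectorspace K (V k)" "\<And>k. c k > 0"
    "\<And>k e. e \<in> ground \<Longrightarrow> vectorspace.fsub K (V k) (U k e)"
    "\<And>S. S \<subseteq> ground \<Longrightarrow> (\<lambda>k. real (vectorspace.sdim K (V k) (subspaces_sum (V k) (U k) S)) / real (c k)) \<longlonglongrightarrow> real (rank S)"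
    by simp_all
  interpret germs K V c by (rule germs.intro) (use VU in auto)
  note vs = VU(1)
  define X where "X k p = U k (pt_code p)" for k p
  define sm where "sm k = module.submodule_sum (V k)" for k
  have X: "fsub k (X k p)" if "p \<in> points W Q" for k p
    using VU(3) that by (simp add: X_def ground_def)
  then have sX: "subspace K (X k p) (V k)" if "p \<in> points W Q" for k p
    using that vectorspace.fsub_subspace[OF vs] by blast
  have code: "pt_code p \<noteq> pt_code q" if "p \<noteq> q" for p q
    using inj_pt_code that by (simp add: inj_eq)
  have lim: "(\<lambda>k. real (sdim k (subspaces_sum (V k) (U k) (pt_code ` S))) / real (c k)) \<longlonglongrightarrow> real (rk S)"
    if "S \<subseteq> points W Q" for S
    using VU(4)[of "pt_code ` S"] rank_image[OF that] that by (auto simp: ground_def)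
  have s1: "subspaces_sum (V k) (U k) {pt_code p} = X k p" if "p \<in> points W Q" for k p
    using vectorspace.subspaces_sum_singleton[OF vs, of "U k" "pt_code p" k] sX[OF that] by (simp add: X_def)
  have s2: "subspaces_sum (V k) (U k) {pt_code p, pt_code q} = sm k (X k p) (X k q)"
    if "p \<in> points W Q" "q \<in> points W Q" "p \<noteq> q" for k p q
    using vectorspace.subspaces_sum_insert[OF vs, of "{pt_code q}" "pt_code p" "U k" k] sX that code[OF that(3)] s1[of q k]
    by (auto simp: X_def sm_def)
  have s3: "subspaces_sum (V k) (U k) {pt_code p, pt_code q, pt_code r} = sm k (X k p) (sm k (X k q) (X k r))"
    if "p \<in> points W Q" "q \<in> points W Q" "r \<in> points W Q" "p \<noteq> q" "p \<noteq> r" "q \<noteq> r" for k p q r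
    using vectorspace.subspaces_sum_insert[OF vs, of "{pt_code q, pt_code r}" "pt_code p" "U k" k] sX that
      code[OF that(4)] code[OF that(5)] s2[OF that(2,3,6), of k]
    by (auto simp: X_def sm_def)
  have lim1: "(\<lambda>k. real (sdim k (X k p)) / real (c k)) \<longlonglongrightarrow> 1" if "p \<in> points W Q" for p
    using lim[of "{p}"] s1[OF that] that by simp
  have lim2: "(\<lambda>k. real (sdim k (sm k (X k p) (X k q))) / real (c k)) \<longlonglongrightarrow> 2"
    if "p \<in> points W Q" "q \<in> points W Q" "p \<noteq> q" for p q
    using lim[of "{p, q}"] s2[OF that] that rk_pair[OF that(3)] by simp
  have lim3: "(\<lambda>k. real (sdim k (sm k (X k p) (sm k (X k q) (X k r)))) / real (c k)) \<longlonglongrightarrow> (if col p q r then 2 else 3)"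
    if "p \<in> points W Q" "q \<in> points W Q" "r \<in> points W Q" "p \<noteq> q" "p \<noteq> r" "q \<noteq> r" for p q r
    using lim[of "{p, q, r}"] s3[OF that] that rk_triple[OF that(4), of r] by (simp split: if_splits)
  let ?J = "\<lambda>i k. X k (Joint i)"
  have J: "Joint 0 \<in> points W Q" "Joint 1 \<in> points W Q" "Joint 2 \<in> points W Q" by simp_all
  have "\<forall>k. \<exists>D2 D3. fsub k D2 \<and> fsub k D3 \<and> D2 \<subseteq> ?J 1 k \<and> D3 \<subseteq> ?J 2 k \<and> ?J 0 k \<inter> D2 = {\<zero>\<^bsub>V k\<^esub>} \<and>
    D3 \<inter> sm k (?J 0 k) D2 = {\<zero>\<^bsub>V k\<^esub>} \<and>
    sdim k D2 + sdim k (?J 0 k) = sdim k (sm k (?J 0 k) (?J 1 k)) \<and>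
    sdim k D3 + sdim k (sm k (?J 0 k) (?J 1 k)) = sdim k (sm k (?J 2 k) (sm k (?J 0 k) (?J 1 k)))"
    unfolding sm_def using vectorspace.frame_exists[OF vs X[OF J(1)] X[OF J(2)] X[OF J(3)]] by blast
  then obtain D2 D3 where D: "\<And>k. fsub k (D2 k)" "\<And>k. fsub k (D3 k)" "\<And>k. D2 k \<subseteq> ?J 1 k" "\<And>k. D3 k \<subseteq> ?J 2 k"
    "\<And>k. ?J 0 k \<inter> D2 k = {\<zero>\<^bsub>V k\<^esub>}" "\<And>k. D3 k \<inter> sm k (?J 0 k) (D2 k) = {\<zero>\<^bsub>V k\<^esub>}"
    "\<And>k. sdim k (D2 k) + sdim k (?J 0 k) = sdim k (sm k (?J 0 k) (?J 1 k))"
    "\<And>k. sdim k (D3 k) + sdim k (sm k (?J 0 k) (?J 1 k)) = sdim k (sm k (?J 2 k) (sm k (?J 0 k) (?J 1 k)))"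
    by metis
  have full0: "full (?J 0)" unfolding full_def using X[OF J(1)] lim1[OF J(1)] by blast
  have full2: "full D2"
  proof -
    have "real (sdim k (D2 k)) / real (c k) = real (sdim k (sm k (?J 0 k) (?J 1 k))) / real (c k) - real (sdim k (?J 0 k)) / real (c k)" for k
      using D(7)[of k] by (simp add: diff_divide_distrib [symmetric])
    then show ?thesis
      unfolding full_def using D(1) tendsto_diff[OF lim2[OF J(1,2)] lim1[OF J(1)]] by simp
  qed
  have full3: "full D3"
  proof -
    have "real (sdim k (D3 k)) / real (c k) = real (sdim k (sm k (?J 2 k) (sm k (?J 0 k) (?J 1 k)))) / real (c k) - real (sdim k (sm k (?J 0 k) (?J 1 k))) / real (c k)" for k
      using D(8)[of k] by (simp add: diff_divide_distrib [symmetric])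
    moreover have "\<not> col (Joint 2) (Joint 0) (Joint 1)" using col_joints col_swap by metis
    then have "(\<lambda>k. real (sdim k (sm k (?J 2 k) (sm k (?J 0 k) (?J 1 k)))) / real (c k)) \<longlonglongrightarrow> 3"
      using lim3[OF J(3,1,2)] by simp
    ultimately show ?thesis
      unfolding full_def using D(2) tendsto_diff[OF _ lim2[OF J(1,2)]] by fastforce
  qed
  have up: "?J 0 k \<subseteq> sm k (?J 0 k) (D2 k)" "D2 k \<subseteq> sm k (?J 0 k) (D2 k)" for k
    unfolding sm_def using vectorspace.sum_upper[OF vs sX[OF J(1)] vectorspace.fsub_subspace[OF vs D(1)]] .
  have zero: "\<zero>\<^bsub>V k\<^esub> \<in> ?J 0 k" "\<zero>\<^bsub>V k\<^esub> \<in> D2 k" "\<zero>\<^bsub>V k\<^esub> \<in> D3 k" for k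
    using vectorspace.subspaceD(2)[OF vs] sX[OF J(1)] vectorspace.fsub_subspace[OF vs] D(1,2) by blast+
  have disj: "D2 k \<inter> ?J 0 k = {\<zero>\<^bsub>V k\<^esub>}" "D3 k \<inter> D2 k = {\<zero>\<^bsub>V k\<^esub>}" "D3 k \<inter> ?J 0 k = {\<zero>\<^bsub>V k\<^esub>}" for k
    using D(5,6)[of k] up[of k] zero[of k] by blast+
  \<comment> \<open>A point on a long line becomes a germ between the two frame spaces of that
    line.\<close>
  have extraction: "\<exists>F. germ A B F \<and> (\<forall>k. vectorspace.diff_graph (V k) (F k) \<subseteq> X k p)"
    if "full A" "full B" "\<And>k. A k \<subseteq> X k (Joint i)" "\<And>k. B k \<subseteq> X k (Joint j)" "\<And>k. A k \<inter> B k = {\<zero>\<^bsub>V k\<^esub>}"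
      "p \<in> points W Q" "i \<noteq> j" "Joint i \<in> points W Q" "Joint j \<in> points W Q" "p \<noteq> Joint i" "p \<noteq> Joint j" "col p (Joint i) (Joint j)"
    for A B i j p
  proof -
    have fA: "fsub k (A k)" "fsub k (B k)" for k using that(1,2) by (auto simp: full_def)
    have "\<forall>k. \<exists>F. pmap k (A k) (B k) F \<and> vectorspace.diff_graph (V k) F \<subseteq> X k p \<and>
      sdim k (A k) + sdim k (B k) + sdim k (sm k (X k p) (?J i k)) + sdim k (sm k (X k p) (?J j k)) \<le>
      sz k F + sdim k (sm k (X k p) (sm k (?J i k) (?J j k))) + sdim k (X k p) + sdim k (?J i k) + sdim k (?J j k)"
      unfolding sm_def
      using vectorspace.extract_bound[OF vs fA(1) X[OF that(8)] that(3) fA(2) X[OF that(9)] that(4,5) X[OF that(6)]] by blast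
    then obtain F where F: "\<And>k. pmap k (A k) (B k) (F k)" "\<And>k. vectorspace.diff_graph (V k) (F k) \<subseteq> X k p"
      "\<And>k. sdim k (A k) + sdim k (B k) + sdim k (sm k (X k p) (?J i k)) + sdim k (sm k (X k p) (?J j k)) \<le>
      sz k (F k) + sdim k (sm k (X k p) (sm k (?J i k) (?J j k))) + sdim k (X k p) + sdim k (?J i k) + sdim k (?J j k)"
      by metis
    have ne: "Joint i \<noteq> Joint j" using that(7) by simp
    have "germ A B F"
    proof (rule germI_bound[OF that(1) F(1)])
      show "(\<lambda>k. (real (sdim k (A k)) + real (sdim k (B k)) + real (sdim k (sm k (X k p) (?J i k))) + real (sdim k (sm k (X k p) (?J j k)))
        - real (sdim k (sm k (X k p) (sm k (?J i k) (?J j k)))) - real (sdim k (X k p)) - real (sdim k (?J i k)) - real (sdim k (?J j k))) / real (c k)) \<longlonglongrightarrow> 1"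
      proof -
        \<comment> \<open>The limits are ranks: two frame spaces, two pairs, then with minus sign
          the collinear triple and three single points.\<close>
        have "(\<lambda>k. real (sdim k (A k)) / real (c k) + real (sdim k (B k)) / real (c k) + real (sdim k (sm k (X k p) (?J i k))) / real (c k)
          + real (sdim k (sm k (X k p) (?J j k))) / real (c k) - real (sdim k (sm k (X k p) (sm k (?J i k) (?J j k)))) / real (c k)
          - real (sdim k (X k p)) / real (c k) - real (sdim k (?J i k)) / real (c k) - real (sdim k (?J j k)) / real (c k)) \<longlonglongrightarrow>
          1 + 1 + 2 + 2 - 2 - 1 - 1 - 1"
          using that(1,2) lim2[OF that(6,8,10)] lim2[OF that(6,9,11)] lim3[OF that(6,8,9,10,11) ne] that(12) lim1[OF that(6)] lim1[OF that(8)] lim1[OF that(9)]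
          by (intro tendsto_diff tendsto_add) (simp_all add: full_def)
        then show ?thesis by (simp add: add_divide_distrib diff_divide_distrib)
      qed
      show "real (sdim k (A k)) + real (sdim k (B k)) + real (sdim k (sm k (X k p) (?J i k))) + real (sdim k (sm k (X k p) (?J j k)))
        - real (sdim k (sm k (X k p) (sm k (?J i k) (?J j k)))) - real (sdim k (X k p)) - real (sdim k (?J i k)) - real (sdim k (?J j k))
        \<le> real (sz k (F k))" for k
        using F(3)[of k] by linarith
    qed
    then show ?thesis using F(2) by blast
  qed
  have "\<forall>w\<in>W. \<exists>F. germ D2 (?J 0) F \<and> (\<forall>k. vectorspace.diff_graph (V k) (F k) \<subseteq> X k (Lpt w))"
    using extraction[OF full2 full0 D(3) subset_refl disj(1)] on_line_col[of 0] by simp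
  then obtain L where L: "\<And>w. w \<in> W \<Longrightarrow> germ D2 (?J 0) (L w)"
    "\<And>w k. w \<in> W \<Longrightarrow> vectorspace.diff_graph (V k) (L w k) \<subseteq> X k (Lpt w)" by metis
  have "\<forall>e\<in>Q. \<forall>\<beta>. \<exists>F. germ D3 D2 F \<and> (\<forall>k. vectorspace.diff_graph (V k) (F k) \<subseteq> X k (Rpt \<beta> e))"
    using extraction[OF full3 full2 D(4) D(3) disj(2)] on_line_col[of 1] by simp
  then obtain R where R: "\<And>e \<beta>. e \<in> Q \<Longrightarrow> germ D3 D2 (R e \<beta>)"
    "\<And>e \<beta> k. e \<in> Q \<Longrightarrow> vectorspace.diff_graph (V k) (R e \<beta> k) \<subseteq> X k (Rpt \<beta> e)" by metis
  have "\<forall>e\<in>Q. \<forall>\<beta>. \<exists>F. germ D3 (?J 0) F \<and> (\<forall>k. vectorspace.diff_graph (V k) (F k) \<subseteq> X k (Spt \<beta> e))"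
    using extraction[OF full3 full0 D(4) subset_refl disj(3)] on_line_col[of 2] by simp
  then obtain S where S: "\<And>e \<beta>. e \<in> Q \<Longrightarrow> germ D3 (?J 0) (S e \<beta>)"
    "\<And>e \<beta> k. e \<in> Q \<Longrightarrow> vectorspace.diff_graph (V k) (S e \<beta> k) \<subseteq> X k (Spt \<beta> e)" by metis
  have triangle: "agree D3 (?J 0) (\<lambda>k. R e \<beta> k O L (slot e \<beta> \<gamma>) k) (S e \<gamma>)" if e: "e \<in> Q" for e \<beta> \<gamma>
  proof -
    have w: "slot e \<beta> \<gamma> \<in> W" using slots e by simp
    let ?w = "slot e \<beta> \<gamma>"
    define T where "T k = sm k (X k (Lpt ?w)) (sm k (X k (Rpt \<beta> e)) (X k (Spt \<gamma> e)))" for k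
    have pts: "Lpt ?w \<in> points W Q" "Rpt \<beta> e \<in> points W Q" "Spt \<gamma> e \<in> points W Q" using e w by simp_all
    have limT: "(\<lambda>k. real (sdim k (T k)) / real (c k)) \<longlonglongrightarrow> 2"
      unfolding T_def using lim3[OF pts] triangle_col[OF e, of \<beta> \<gamma>] by simp
    have f: "fsub k (sm k (X k (Rpt \<beta> e)) (X k (Spt \<gamma> e)))" for k
      unfolding sm_def using vectorspace.sdim_modular(1)[OF vs X[OF pts(2)] X[OF pts(3)]] .
    then have fT: "fsub k (T k)" for k
      unfolding T_def sm_def using vectorspace.sdim_modular(1)[OF vs X[OF pts(1)]] by (simp add: sm_def)
    have sub: "X k (Lpt ?w) \<subseteq> T k" "X k (Rpt \<beta> e) \<subseteq> T k" "X k (Spt \<gamma> e) \<subseteq> T k" for k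
      using vectorspace.sum_upper[OF vs sX[OF pts(1)] vectorspace.fsub_subspace[OF vs f], of k]
        vectorspace.sum_upper[OF vs sX[OF pts(2)] sX[OF pts(3)], of k]
      unfolding T_def sm_def by blast+
    have p: "pmap k (D2 k) (?J 0 k) (L ?w k)" "pmap k (D3 k) (D2 k) (R e \<beta> k)" "pmap k (D3 k) (?J 0 k) (S e \<gamma> k)" for k
      using L(1)[OF w] R(1)[OF e] S(1)[OF e] by (simp_all add: germ_def)
    have gRL: "germ D3 (?J 0) (\<lambda>k. R e \<beta> k O L ?w k)"
      using germ_relcomp[OF full3 full2 full0 R(1)[OF e] L(1)[OF w]] .
    have "germ D3 (?J 0) (\<lambda>k. (R e \<beta> k O L ?w k) \<inter> S e \<gamma> k)"
    proof (rule germI_bound[OF full3])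
      show "pmap k (D3 k) (?J 0 k) ((R e \<beta> k O L ?w k) \<inter> S e \<gamma> k)" for k
        using vectorspace.pmap_inter[OF vs] gRL p(3) by (simp add: germ_def)
      show "(\<lambda>k. (real (sz k (L ?w k)) + real (sz k (R e \<beta> k)) + real (sz k (S e \<gamma> k)) - real (sdim k (T k))) / real (c k)) \<longlonglongrightarrow> 1"
      proof -
        have "(\<lambda>k. real (sz k (L ?w k)) / real (c k) + real (sz k (R e \<beta> k)) / real (c k) + real (sz k (S e \<gamma> k)) / real (c k)
          - real (sdim k (T k)) / real (c k)) \<longlonglongrightarrow> 1 + 1 + 1 - 2"
          using limT L(1)[OF w] R(1)[OF e] S(1)[OF e] by (intro tendsto_diff tendsto_add) (simp_all add: germ_def)
        then show ?thesis by (simp add: add_divide_distrib diff_divide_distrib)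
      qed
      show "real (sz k (L ?w k)) + real (sz k (R e \<beta> k)) + real (sz k (S e \<gamma> k)) - real (sdim k (T k))
        \<le> real (sz k ((R e \<beta> k O L ?w k) \<inter> S e \<gamma> k))" for k
      proof -
        have "sz k (L ?w k) + sz k (R e \<beta> k) + sz k (S e \<gamma> k) \<le> sz k ((R e \<beta> k O L ?w k) \<inter> S e \<gamma> k) + sdim k (T k)"
          using L(2)[OF w, of k] R(2)[OF e, of k \<beta>] S(2)[OF e, of k \<gamma>] sub[of k] D(6)[of k]
          by (intro vectorspace.triangle_bound[OF vs X[OF J(1)] D(1,2) D(5) _ p fT]) (auto simp: sm_def)
        then show ?thesis by linarith
      qed
    qed
    then show ?thesis using gRL S(1)[OF e] by (simp add: agree_def)
  qed
  define g where "g w = elt D2 (\<lambda>k. L w k O (L [] k)\<inverse>)" for w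
  have quot: "- g a + g b = elt D2 (\<lambda>k. L b k O (L a k)\<inverse>)" if "a \<in> W" "b \<in> W" for a b
    unfolding g_def using elt_quotient[OF full0 full2 L(1)[OF Nil_W] L(1)[OF that(1)] L(1)[OF that(2)]] .
  show ?thesis
  proof (rule that)
    fix a b c' d assume e: "(a, b, c', d) \<in> Q"
    let ?e = "(a, b, c', d)"
    have w: "a \<in> W" "b \<in> W" "c' \<in> W" "d \<in> W"
      using slots[OF e, of False False] slots[OF e, of True False] slots[OF e, of False True] slots[OF e, of True True] by simp_all
    have 1: "agree D2 D2 (\<lambda>k. L b k O (L a k)\<inverse>) (\<lambda>k. (R ?e True k)\<inverse> O R ?e False k)"
      using agree_quotient[OF full0 full2 full3 R(1)[OF e] R(1)[OF e] L(1)[OF w(1)] L(1)[OF w(2)]]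
        triangle[OF e, of False False] triangle[OF e, of True False] by simp
    have 2: "agree D2 D2 (\<lambda>k. L d k O (L c' k)\<inverse>) (\<lambda>k. (R ?e True k)\<inverse> O R ?e False k)"
      using agree_quotient[OF full0 full2 full3 R(1)[OF e] R(1)[OF e] L(1)[OF w(3)] L(1)[OF w(4)]]
        triangle[OF e, of False True] triangle[OF e, of True True] by simp
    have 3: "agree D2 D2 (\<lambda>k. L b k O (L a k)\<inverse>) (\<lambda>k. L d k O (L c' k)\<inverse>)"
      using agree_trans[OF full2 1 agree_sym[OF 2]] .
    then have "elt D2 (\<lambda>k. L b k O (L a k)\<inverse>) = elt D2 (\<lambda>k. L d k O (L c' k)\<inverse>)"
      using elt_eq_iff[OF full2] by (simp add: agree_def)
    then show "- g a + g b = - g c' + g d" using quot w by simp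
  next
    fix w w' assume w: "w \<in> W" "w' \<in> W" and eq: "g w = g w'"
    show "w = w'"
    proof (rule ccontr)
      assume "w \<noteq> w'"
      have inv: "germ (?J 0) D2 (\<lambda>k. (L [] k)\<inverse>)" using germ_converse[OF full2 full0 L(1)[OF Nil_W]] .
      have gw: "germ D2 D2 (\<lambda>k. L v k O (L [] k)\<inverse>)" if "v \<in> W" for v
        using germ_relcomp[OF full2 full0 full2 L(1)[OF that] inv] .
      have id: "agree (?J 0) (?J 0) (\<lambda>k. (L [] k)\<inverse> O L [] k) (\<lambda>k. Id_on (?J 0 k))"
        using agree_converse[OF full0 full2 inv] by simp
      have cancel: "agree D2 (?J 0) (\<lambda>k. (L v k O (L [] k)\<inverse>) O L [] k) (L v)" if "v \<in> W" for v
        using agree_relcomp[OF full2 full0 full0 agree_refl[OF L(1)[OF that]] id] Id_on_comp(2)[OF L(1)[OF that]]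
        by (simp add: O_assoc)
      have "agree D2 D2 (\<lambda>k. L w k O (L [] k)\<inverse>) (\<lambda>k. L w' k O (L [] k)\<inverse>)"
        using elt_eq_iff[OF full2 gw[OF w(1)] gw[OF w(2)]] eq by (simp add: g_def)
      then have "agree D2 (?J 0) (\<lambda>k. (L w k O (L [] k)\<inverse>) O L [] k) (\<lambda>k. (L w' k O (L [] k)\<inverse>) O L [] k)"
        using agree_relcomp[OF full2 full2 full0 _ agree_refl[OF L(1)[OF Nil_W]]] by blast
      then have "agree D2 (?J 0) (L w) (L w')"
        using agree_trans[OF full2] agree_sym[OF cancel[OF w(1)]] cancel[OF w(2)] by blast
      then have g: "germ D2 (?J 0) (\<lambda>k. L w k \<inter> L w' k)" by (simp add: agree_def)
      have pts: "Lpt w \<in> points W Q" "Lpt w' \<in> points W Q" "Lpt w \<noteq> Lpt w'" using w \<open>w \<noteq> w'\<close> by simp_all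
      \<comment> \<open>If the germs agreed, the two point spaces would intersect in dimension close
        to \<open>c k\<close>, whereas rank 2 of the pair makes the intersection negligible.\<close>
      have bound: "sz k (L w k \<inter> L w' k) + sdim k (sm k (X k (Lpt w)) (X k (Lpt w'))) \<le> sdim k (X k (Lpt w)) + sdim k (X k (Lpt w'))" for k
      proof -
        have p: "pmap k (D2 k) (?J 0 k) (L w k \<inter> L w' k)" using g by (simp add: germ_def)
        note dg = vectorspace.diff_graph_dim[OF vs D(1) X[OF J(1)] disj(1) p]
        have "vectorspace.diff_graph (V k) (L w k \<inter> L w' k) \<subseteq> X k (Lpt w) \<inter> X k (Lpt w')"
          using L(2)[OF w(1), of k] L(2)[OF w(2), of k] unfolding vectorspace.diff_graph_def[OF vs] by blast
        then have "sz k (L w k \<inter> L w' k) \<le> sdim k (X k (Lpt w) \<inter> X k (Lpt w'))"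
          using vectorspace.fsub_subset(2)[OF vs vectorspace.fsub_subset(1)[OF vs X[OF pts(1)] vectorspace.subspace_inter[OF vs sX[OF pts(1)] sX[OF pts(2)]] Int_lower1]
            vectorspace.fsub_subspace[OF vs dg(1)]] dg(2) by simp
        then show ?thesis
          using vectorspace.sdim_modular(2)[OF vs X[OF pts(1)] X[OF pts(2)], of k] by (simp add: sm_def)
      qed
      have "(\<lambda>k. real (sz k (L w k \<inter> L w' k)) / real (c k)) \<longlonglongrightarrow> 1" using g by (simp add: germ_def)
      then have "(\<lambda>k. real (sz k (L w k \<inter> L w' k)) / real (c k) + real (sdim k (sm k (X k (Lpt w)) (X k (Lpt w')))) / real (c k)) \<longlonglongrightarrow> 1 + 2"
        using lim2[OF pts] by (rule tendsto_add)
      moreover have "(\<lambda>k. real (sdim k (X k (Lpt w))) / real (c k) + real (sdim k (X k (Lpt w'))) / real (c k)) \<longlonglongrightarrow> 1 + 1"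
        by (intro tendsto_add lim1 pts(1,2))
      moreover have "real (sz k (L w k \<inter> L w' k)) / real (c k) + real (sdim k (sm k (X k (Lpt w)) (X k (Lpt w')))) / real (c k)
        \<le> real (sdim k (X k (Lpt w))) / real (c k) + real (sdim k (X k (Lpt w'))) / real (c k)" for k
        unfolding add_divide_distrib [symmetric] using bound[of k] by (intro divide_right_mono) linarith+
      ultimately have "(1 + 2 :: real) \<le> 1 + 1" using LIMSEQ_le by blast
      then show False by simp
    qed
  qed
qed

section \<open>Representations built from permutations\<close>

section \<open>From permutations to subspaces\<close>

text \<open>The space of all functions, as the type of vectors is prescribed; finite dimension is
  enforced later by finite supports.\<close>

definition fun_module :: "('k, 'm) ring_scheme \<Rightarrow> ('k, nat \<Rightarrow> 'k) module" where
  "fun_module K = \<lparr>carrier = {v. \<forall>n. v n \<in> carrier K}, monoid.mult = \<lambda>_ v. v, one = \<lambda>_. \<one>\<^bsub>K\<^esub>, zero = \<lambda>_. \<zero>\<^bsub>K\<^esub>,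
     add = \<lambda>v w n. v n \<oplus>\<^bsub>K\<^esub> w n, module.smult = \<lambda>a v n. a \<otimes>\<^bsub>K\<^esub> v n\<rparr>"

context field
begin

lemma fun_module_simps [simp]:
  "v \<in> carrier (fun_module R) \<longleftrightarrow> (\<forall>n. v n \<in> carrier R)" "\<zero>\<^bsub>fun_module R\<^esub> = (\<lambda>_. \<zero>)"
  "(v \<oplus>\<^bsub>fun_module R\<^esub> w) = (\<lambda>n. v n \<oplus> w n)" "(a \<odot>\<^bsub>fun_module R\<^esub> v) = (\<lambda>n. a \<otimes> v n)"
  by (simp_all add: fun_module_def)

lemma vectorspace_fun_module: "vectorspace R (fun_module R)"
proof -
  have "abelian_group (fun_module R)"
  proof (rule abelian_groupI)
    fix v assume v: "v \<in> carrier (fun_module R)"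
    then show "\<exists>w\<in>carrier (fun_module R). w \<oplus>\<^bsub>fun_module R\<^esub> v = \<zero>\<^bsub>fun_module R\<^esub>"
      by (intro bexI[of _ "\<lambda>n. \<ominus> v n"]) (auto simp: l_neg)
  qed (auto simp: a_ac intro!: ext)
  then have "module R (fun_module R)"
    by (intro module.intro module_axioms.intro is_cring) (auto simp: l_distr r_distr m_assoc intro!: ext)
  then show ?thesis by (intro vectorspace.intro field_axioms)
qed

end

sublocale field \<subseteq> FM: vectorspace R "fun_module R"
  by (rule vectorspace_fun_module)

context field
begin

lemma minus_eq_zero_iff: "a \<in> carrier R \<Longrightarrow> b \<in> carrier R \<Longrightarrow> a \<ominus> b = \<zero> \<longleftrightarrow> a = b"
  by (metis add.inv_closed add.m_closed minus_eq minus_equality minus_minus r_neg)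

definition supp :: "nat set \<Rightarrow> (nat \<Rightarrow> 'a) set" where
  "supp A = {v. (\<forall>n. v n \<in> carrier R) \<and> (\<forall>n. n \<notin> A \<longrightarrow> v n = \<zero>)}"

lemma supp_subspace: "subspace R (supp A) (fun_module R)"
  by (rule FM.subspaceI) (auto simp: supp_def)

lemma supp_mono: "A \<subseteq> B \<Longrightarrow> supp A \<subseteq> supp B"
  by (auto simp: supp_def)

lemma sdim_supp_singleton: "FM.fsub (supp {a})" "FM.sdim (supp {a}) = 1"
proof -
  define d where "d = (\<lambda>n. if n = a then \<one> else \<zero>)"
  have d: "{d} \<subseteq> supp {a}" by (auto simp: d_def supp_def)
  have dc: "{d} \<subseteq> carrier (fun_module R)" by (auto simp: d_def)
  have "FM.span {d} \<subseteq> supp {a}" using FM.span_is_subset[OF d] supp_subspace by (simp add: subspace_def)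
  moreover have "v \<in> FM.span {d}" if "v \<in> supp {a}" for v
  proof -
    have "v = v a \<odot>\<^bsub>fun_module R\<^esub> d" using that by (auto simp: d_def supp_def intro!: ext)
    moreover have "d \<in> FM.span {d}" using FM.in_own_span[OF dc] by simp
    ultimately show ?thesis
      using FM.subspaceD(4)[OF FM.span_is_subspace[OF dc], of "v a" d] that by (simp add: supp_def)
  qed
  ultimately have eq: "FM.span {d} = supp {a}" by blast
  show f: "FM.fsub (supp {a})" using FM.span_fsub(1)[OF _ dc] eq by simp
  have "FM.sdim (supp {a}) \<noteq> 0"
  proof
    assume "FM.sdim (supp {a}) = 0"
    then obtain B where "finite B" "card B = 0" "FM.span B = supp {a}" using FM.fsub_basis[OF f] by metis
    then have "FM.span {} = supp {a}" by simp
    then have "d = (\<lambda>_. \<zero>)" using d FM.span_empty by auto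
    then have "d a = \<zero>" by simp
    then show False by (simp add: d_def)
  qed
  moreover have "FM.sdim (supp {a}) \<le> 1" using FM.span_fsub(2)[OF _ dc] eq by simp
  ultimately show "FM.sdim (supp {a}) = 1" by simp
qed

lemma sdim_supp:
  assumes "finite A"
  shows "FM.fsub (supp A)" "FM.sdim (supp A) = card A"
proof -
  have "FM.fsub (supp A) \<and> FM.sdim (supp A) = card A"
    using assms
  proof induction
    case empty
    have "supp {} = {\<zero>\<^bsub>fun_module R\<^esub>}" by (auto simp: supp_def)
    then show ?case using FM.sdim_zero by simp
  next
    case (insert a A)
    have "supp {a} \<inter> supp A = {\<zero>\<^bsub>fun_module R\<^esub>}"
      using insert(2) by (auto simp: supp_def intro!: ext)
    moreover have "FM.subspace_sum (supp {a}) (supp A) = supp (insert a A)"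
    proof
      show "FM.subspace_sum (supp {a}) (supp A) \<subseteq> supp (insert a A)"
        by (intro FM.sum_least supp_subspace supp_mono) auto
      show "supp (insert a A) \<subseteq> FM.subspace_sum (supp {a}) (supp A)"
      proof
        fix v assume v: "v \<in> supp (insert a A)"
        have "(\<lambda>n. if n = a then v n else \<zero>) \<in> supp {a}" "(\<lambda>n. if n = a then \<zero> else v n) \<in> supp A"
          using v by (auto simp: supp_def)
        moreover have "v = (\<lambda>n. if n = a then v n else \<zero>) \<oplus>\<^bsub>fun_module R\<^esub> (\<lambda>n. if n = a then \<zero> else v n)"
          using v by (auto simp: supp_def intro!: ext)
        ultimately show "v \<in> FM.subspace_sum (supp {a}) (supp A)" unfolding FM.in_sum_iff by blast
      qed
    qed
    ultimately show ?case
      using FM.sdim_direct[OF sdim_supp_singleton(1)[of a], of "supp A"] sdim_supp_singleton(2)[of a] insert by simp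
  qed
  then show "FM.fsub (supp A)" "FM.sdim (supp A) = card A" by simp_all
qed

text \<open>Restriction to the coordinates in \<open>B\<close> is injective on \<open>U\<close>.
  Dimensions are bounded below by naming coordinates that determine a vector.\<close>

lemma sdim_le_card:
  assumes "finite A" "subspace R U (fun_module R)" "U \<subseteq> supp A" "finite B"
    and det: "\<And>v. v \<in> U \<Longrightarrow> (\<And>n. n \<in> B \<Longrightarrow> v n = \<zero>) \<Longrightarrow> v = (\<lambda>_. \<zero>)"
  shows "FM.fsub U" "FM.sdim U \<le> card B"
proof -
  show U: "FM.fsub U" using FM.fsub_subset(1)[OF sdim_supp(1)[OF assms(1)] assms(2,3)] .
  have cU: "v n \<in> carrier R" if "v \<in> U" for v n using that assms(3) by (auto simp: supp_def)
  define T where "T v = (\<lambda>n. if n \<in> B then v n else \<zero>)" for v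
  have T: "FM.fsub (T ` U)" "inj_on T U \<Longrightarrow> FM.sdim (T ` U) = FM.sdim U"
    by (rule FM.sdim_image[OF U]; auto simp: T_def cU intro!: ext)+
  have "inj_on T U"
  proof (rule inj_onI)
    fix v w assume vw: "v \<in> U" "w \<in> U" "T v = T w"
    let ?x = "v \<oplus>\<^bsub>fun_module R\<^esub> ((\<ominus> \<one>) \<odot>\<^bsub>fun_module R\<^esub> w)"
    have x: "?x n = v n \<ominus> w n" for n
      using cU[OF vw(1), of n] cU[OF vw(2), of n] unfolding a_minus_def by (simp add: l_minus)
    have "?x \<in> U" by (rule FM.subspaceD(3)[OF assms(2) vw(1) FM.subspaceD(4)[OF assms(2) _ vw(2)]]) simp
    moreover have "?x n = \<zero>" if "n \<in> B" for n
    proof -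
      have "v n = w n" using fun_cong[OF vw(3), of n] that by (simp add: T_def)
      then show ?thesis unfolding x using cU[OF vw(2), of n] minus_eq_zero_iff by metis
    qed
    ultimately have "?x = (\<lambda>_. \<zero>)" by (rule det)
    then have "v n \<ominus> w n = \<zero>" for n using x[of n] by metis
    then have "v n = w n" for n using minus_eq_zero_iff[OF cU[OF vw(1)] cU[OF vw(2)]] by metis
    then show "v = w" by (rule ext)
  qed
  moreover have "FM.sdim (T ` U) \<le> FM.sdim (supp B)"
    using cU by (intro FM.fsub_subset(2)[OF sdim_supp(1)[OF assms(4)] FM.fsub_subspace[OF T(1)]]) (auto simp: T_def supp_def)
  ultimately show "FM.sdim U \<le> card B" using T(2) sdim_supp(2)[OF assms(4)] by simp
qed

end

text \<open>Three interleaved copies of \<open>{..<c}\<close>, one for each joint, told apart by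
  residues modulo 3.\<close>

definition block :: "nat \<Rightarrow> nat \<Rightarrow> nat set" where
  "block c i = (\<lambda>x. 3 * x + i) ` {..<c}"

lemma block: "finite (block c i)" "card (block c i) = c" "i < 3 \<Longrightarrow> j < 3 \<Longrightarrow> i \<noteq> j \<Longrightarrow> block c i \<inter> block c j = {}"
proof -
  show "finite (block c i)" by (simp add: block_def)
  show "card (block c i) = c" unfolding block_def by (subst card_image) (auto simp: inj_on_def)
  have *: "n mod 3 = i" if "n \<in> block c i" "i < 3" for n i using that by (auto simp: block_def)
  show "block c i \<inter> block c j = {}" if "i < 3" "j < 3" "i \<noteq> j"
    using *[of _ i] *[of _ j] that by blast
qed

text \<open>\<open>hits c f g B\<close> says that \<open>B\<close> meets every orbit of \<open>g \<circ> f\<^sup>-\<^sup>1\<close> on \<open>{..<c}\<close>.\<close>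

definition hits :: "nat \<Rightarrow> (nat \<Rightarrow> nat) \<Rightarrow> (nat \<Rightarrow> nat) \<Rightarrow> nat set \<Rightarrow> bool" where
  "hits c f g B \<longleftrightarrow> B \<subseteq> {..<c} \<and> (\<forall>Z\<subseteq>{..<c}. (\<forall>x<c. f x \<in> Z \<longleftrightarrow> g x \<in> Z) \<and> Z \<inter> B = {} \<longrightarrow> Z = {})"

text \<open>For a point that stands for a map, \<open>hi_block\<close> is the source and
  \<open>lo_block\<close> the target: \<open>Lpt\<close> maps 1 to 0, \<open>Rpt\<close> maps 2 to 1
  and \<open>Spt\<close> maps 2 to 0, so that \<open>L\<close> after \<open>R\<close> can be
  compared with \<open>S\<close>.\<close>

fun lo_block :: "pt \<Rightarrow> nat" where
  "lo_block (Rpt \<beta> e) = 1" | "lo_block _ = 0"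

fun hi_block :: "pt \<Rightarrow> nat" where
  "hi_block (Lpt w) = 1" | "hi_block _ = 2"

context field
begin

text \<open>For a permutation \<open>f\<close> of \<open>{..<c}\<close> this is the span of the
  differences of unit vectors at \<open>x\<close> in block \<open>j\<close> and at
  \<open>f x\<close> in block \<open>i\<close>.\<close>

definition graph_sp :: "nat \<Rightarrow> nat \<Rightarrow> nat \<Rightarrow> (nat \<Rightarrow> nat) \<Rightarrow> (nat \<Rightarrow> 'a) set" where
  "graph_sp c i j f = {v \<in> supp (block c i \<union> block c j). \<forall>x<c. v (3 * f x + i) = \<ominus> v (3 * x + j)}"

definition pt_sp :: "nat \<Rightarrow> (pt \<Rightarrow> nat \<Rightarrow> nat) \<Rightarrow> pt \<Rightarrow> (nat \<Rightarrow> 'a) set" where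
  "pt_sp c \<pi> p = (case p of Joint i \<Rightarrow> supp (block c i) | _ \<Rightarrow> graph_sp c (lo_block p) (hi_block p) (\<pi> p))"

lemma supp_zeroI: "v \<in> supp A \<Longrightarrow> (\<And>n. n \<in> A \<Longrightarrow> v n = \<zero>) \<Longrightarrow> v = (\<lambda>_. \<zero>)"
  unfolding supp_def by (auto intro!: ext)

lemma supp_outside: "v \<in> supp A \<Longrightarrow> n \<notin> A \<Longrightarrow> v n = \<zero>"
  by (simp add: supp_def)

lemma supp_carrier: "v \<in> supp A \<Longrightarrow> v n \<in> carrier R"
  by (simp add: supp_def)

lemma graph_sp_subspace: "subspace R (graph_sp c i j f) (fun_module R)"
  using FM.subspaceD[OF supp_subspace]
  by (intro FM.subspaceI) (auto simp: graph_sp_def supp_carrier minus_add a_comm r_minus)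

lemma graph_sp_zero:
  assumes "bij_betw f {..<c} {..<c}" "v \<in> graph_sp c i j f" "k = i \<or> k = j" "\<And>n. n \<in> block c k \<Longrightarrow> v n = \<zero>"
  shows "v = (\<lambda>_. \<zero>)"
proof (rule supp_zeroI)
  show "v \<in> supp (block c i \<union> block c j)" using assms(2) by (simp add: graph_sp_def)
  have eq: "v (3 * f x + i) = \<ominus> v (3 * x + j)" if "x < c" for x using assms(2) that by (simp add: graph_sp_def)
  have c: "v n \<in> carrier R" for n using assms(2) by (auto simp: graph_sp_def supp_def)
  have surj: "\<exists>z<c. y = f z" if "y < c" for y
    using bij_betw_imp_surj_on[OF assms(1)] that by (metis imageE lessThan_iff)
  have inc: "f x < c" if "x < c" for x using assms(1) that by (auto simp: bij_betw_def)
  have "v (3 * x + i) = \<zero> \<and> v (3 * x + j) = \<zero>" if xc: "x < c" for x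
    using assms(3)
  proof
    assume k: "k = i"
    have "v (3 * f x + i) = \<zero>" using assms(4)[of "3 * f x + i"] inc[OF xc] k by (auto simp: block_def)
    then have "v (3 * x + j) = \<zero>" using eq[OF xc] c by (metis minus_minus minus_zero)
    then show ?thesis using assms(4)[of "3 * x + i"] xc k by (auto simp: block_def)
  next
    assume k: "k = j"
    obtain y where y: "y < c" "x = f y" using surj[OF xc] by blast
    have "v (3 * y + j) = \<zero>" "v (3 * x + j) = \<zero>" using assms(4) y xc k by (auto simp: block_def)
    then show ?thesis using eq[OF y(1)] y(2) by simp
  qed
  then show "v n = \<zero>" if "n \<in> block c i \<union> block c j" for n using that by (auto simp: block_def)
qed

text \<open>Together with block \<open>i\<close> the graph spans both blocks; this yields the lower
  bound in \<open>sdim_graph_sp\<close>.\<close>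

lemma graph_sp_sum:
  assumes "bij_betw f {..<c} {..<c}" "i < 3" "j < 3" "i \<noteq> j"
  shows "supp (block c i \<union> block c j) \<subseteq> FM.subspace_sum (graph_sp c i j f) (supp (block c i))"
proof
  fix v assume v: "v \<in> supp (block c i \<union> block c j)"
  define g where "g = inv_into {..<c} f"
  have g: "g (f x) = x" if "x < c" for x using assms(1) that by (simp add: g_def bij_betw_def)
  define w where "w n = (if n \<in> block c j then v n else if n \<in> block c i then \<ominus> v (3 * g (n div 3) + j) else \<zero>)" for n
  have cv: "v n \<in> carrier R" for n using v by (rule supp_carrier)
  have dj: "n \<notin> block c j" if "n \<in> block c i" for n using block(3)[OF assms(2-4)] that by blast
  have "w (3 * f x + i) = \<ominus> w (3 * x + j)" if "x < c" for x
  proof -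
    have "f x < c" using assms(1) that by (auto simp: bij_betw_def)
    then have "3 * f x + i \<in> block c i" "3 * x + j \<in> block c j" using that by (auto simp: block_def)
    then show ?thesis using dj assms(2) g[OF that] by (simp add: w_def)
  qed
  then have w: "w \<in> graph_sp c i j f" using cv by (auto simp: graph_sp_def supp_def w_def)
  have "(\<lambda>n. v n \<ominus> w n) \<in> supp (block c i)"
    using v cv w by (auto simp: supp_def w_def graph_sp_def minus_eq_zero_iff)
  moreover have "v = w \<oplus>\<^bsub>fun_module R\<^esub> (\<lambda>n. v n \<ominus> w n)"
  proof
    fix n have "w n \<in> carrier R" using w by (auto simp: graph_sp_def supp_def)
    then show "v n = (w \<oplus>\<^bsub>fun_module R\<^esub> (\<lambda>n. v n \<ominus> w n)) n" using cv[of n]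
      by (simp add: minus_eq) (metis a_lcomm a_closed a_inv_closed r_neg r_zero)
  qed
  ultimately show "v \<in> FM.subspace_sum (graph_sp c i j f) (supp (block c i))"
    unfolding FM.in_sum_iff using w by blast
qed

lemma sdim_graph_sp:
  assumes "bij_betw f {..<c} {..<c}" "i < 3" "j < 3" "i \<noteq> j"
  shows "FM.fsub (graph_sp c i j f)" "FM.sdim (graph_sp c i j f) = c"
proof -
  let ?A = "block c i \<union> block c j"
  have sub: "graph_sp c i j f \<subseteq> supp ?A" by (auto simp: graph_sp_def)
  show f: "FM.fsub (graph_sp c i j f)" and "FM.sdim (graph_sp c i j f) = c"
  proof -
    have z: "v = (\<lambda>_. \<zero>)" if "v \<in> graph_sp c i j f" "\<And>n. n \<in> block c i \<Longrightarrow> v n = \<zero>" for v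
      using graph_sp_zero[OF assms(1) that(1) _ that(2)] by blast
    have *: "FM.fsub (graph_sp c i j f)"
      by (rule sdim_le_card(1)[OF finite_UnI[OF block(1) block(1)] graph_sp_subspace sub block(1)[of c i]]) (use z in blast)
    have *: "FM.fsub (graph_sp c i j f)" "FM.sdim (graph_sp c i j f) \<le> card (block c i)"
      by (rule *, rule sdim_le_card(2)[OF finite_UnI[OF block(1) block(1)] graph_sp_subspace sub block(1)[of c i]]) (use z in blast)
    show "FM.fsub (graph_sp c i j f)" by (rule *)
    note m = FM.sdim_modular[OF *(1) sdim_supp(1)[OF block(1)], of c i]
    have "FM.sdim (supp ?A) \<le> FM.sdim (FM.subspace_sum (graph_sp c i j f) (supp (block c i)))"
      by (rule FM.fsub_subset(2)[OF m(1) supp_subspace graph_sp_sum[OF assms]])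
    moreover have "FM.sdim (supp ?A) = 2 * c"
      using sdim_supp(2)[of ?A] block(3)[OF assms(2-4)] by (simp add: block card_Un_disjoint)
    moreover have "FM.sdim (supp (block c i)) = c" using sdim_supp(2)[of "block c i"] by (simp add: block)
    ultimately show "FM.sdim (graph_sp c i j f) = c" using m(2) *(2) by (simp add: block)
  qed
qed

end

lemma (in quad_matroid) same_lines_cases:
  assumes "p \<in> points W Q" "q \<in> points W Q" "p \<noteq> q" "\<And>l. on_line l p \<longleftrightarrow> on_line l q"
  obtains w w' where "p = Lpt w" "q = Lpt w'" | \<beta> e \<beta>' e' where "p = Rpt \<beta> e" "q = Rpt \<beta>' e'"
    | \<gamma> e \<gamma>' e' where "p = Spt \<gamma> e" "q = Spt \<gamma>' e'"
proof (cases p)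
  case (Joint i)
  then have "i = 0 \<or> i = 1 \<or> i = 2" using assms(1) by (auto simp: points_def)
  moreover have "i' = 0 \<or> i' = 1 \<or> i' = 2" if "q = Joint i'" for i' using assms(2) that by (auto simp: points_def)
  ultimately have False using assms(4)[of 0] assms(4)[of 1] assms(4)[of 2] assms(3) Joint by (cases q) auto
  then show ?thesis by blast
next
  case (Lpt w)
  then have "\<exists>w'. q = Lpt w'" using assms(4)[of 0] assms(4)[of 1] assms(4)[of 2] by (cases q) auto
  then show ?thesis using that(1) Lpt by blast
next
  case (Rpt \<beta> e)
  then have "\<exists>\<beta>' e'. q = Rpt \<beta>' e'" using assms(4)[of 0] assms(4)[of 1] assms(4)[of 2] by (cases q) auto
  then show ?thesis using that(2) Rpt by blast
next
  case (Spt \<gamma> e)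
  then have "\<exists>\<gamma>' e'. q = Spt \<gamma>' e'" using assms(4)[of 0] assms(4)[of 1] assms(4)[of 2] by (cases q) auto
  then show ?thesis using that(3) Spt by blast
qed

text \<open>Here \<open>c\<close> is the scale and \<open>b\<close> the admissible error. Triangles
  may fail at \<open>b\<close> arguments. Where independence is expected, \<open>hits\<close> bounds
  the number of orbits of coincidence, and thereby the dimension of an intersection.\<close>

locale perm_model = quad_matroid +
  fixes c b :: nat and \<pi> :: "pt \<Rightarrow> nat \<Rightarrow> nat"
  assumes perm: "p \<in> points W Q \<Longrightarrow> bij_betw (\<pi> p) {..<c} {..<c}"
    and triangles: "e \<in> Q \<Longrightarrow> card {x\<in>{..<c}. \<pi> (Lpt (slot e \<beta> \<gamma>)) (\<pi> (Rpt \<beta> e) x) \<noteq> \<pi> (Spt \<gamma> e) x} \<le> b"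
    and pairs: "p \<in> points W Q \<Longrightarrow> q \<in> points W Q \<Longrightarrow> p \<noteq> q \<Longrightarrow> (\<And>l. on_line l p \<longleftrightarrow> on_line l q) \<Longrightarrow>
      \<exists>B. hits c (\<pi> p) (\<pi> q) B \<and> card B \<le> b"
    and triples: "w \<in> W \<Longrightarrow> e \<in> Q \<Longrightarrow> e' \<in> Q \<Longrightarrow> \<not> col (Lpt w) (Rpt \<beta> e) (Spt \<gamma> e') \<Longrightarrow>
      \<exists>B. hits c (\<lambda>x. \<pi> (Lpt w) (\<pi> (Rpt \<beta> e) x)) (\<pi> (Spt \<gamma> e')) B \<and> card B \<le> b"

context vectorspace
begin

lemma subspaces_sum_empty: "subspaces_sum V W {} = {\<zero>\<^bsub>V\<^esub>}"
  by (auto simp: subspaces_sum_def)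

lemma subspaces_sum_upper:
  assumes "finite S" "\<And>y. y \<in> S \<Longrightarrow> fsub (W y)" "x \<in> S"
  shows "W x \<subseteq> subspaces_sum V W S"
proof (cases "S = {x}")
  case True
  then show ?thesis using subspaces_sum_singleton[of W x] fsub_subspace[OF assms(2)[OF assms(3)]] by simp
next
  case False
  let ?T = "S - {x}"
  have S: "S = insert x ?T" using assms(3) by blast
  have s: "subspace K (W y) V" if "y \<in> S" for y using fsub_subspace[OF assms(2)[OF that]] .
  have T: "finite ?T" "?T \<noteq> {}" "x \<notin> ?T" using assms(1,3) False by auto
  have "subspaces_sum V W (insert x ?T) = subspace_sum (W x) (subspaces_sum V W ?T)"
    by (rule subspaces_sum_insert[OF T(1,3)]) (use s S in blast)
  moreover have "fsub (subspaces_sum V W ?T)" by (rule fsub_subspaces_sum[OF T(1,2)]) (use assms(2) in blast)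
  ultimately show ?thesis using sum_upper(1)[OF s[OF assms(3)] fsub_subspace] S by metis
qed

lemma subspaces_sum_least:
  assumes "finite S" "\<And>y. y \<in> S \<Longrightarrow> subspace K (W y) V" "subspace K U V" "\<And>y. y \<in> S \<Longrightarrow> W y \<subseteq> U"
  shows "subspaces_sum V W S \<subseteq> U"
  using assms(1,2,4)
proof (induction S)
  case empty
  then show ?case using subspaceD(2)[OF assms(3)] by (simp add: subspaces_sum_empty)
next
  case (insert x S)
  have "subspaces_sum V W (insert x S) = subspace_sum (W x) (subspaces_sum V W S)"
    by (rule subspaces_sum_insert[OF insert(1,2)]) (use insert(4) in blast)
  also have "\<dots> \<subseteq> U" by (rule sum_least[OF assms(3)]) (use insert in blast)+
  finally show ?case .
qed

end

context linear_space
begin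

lemma rk_le_2_flat:
  assumes "S \<subseteq> P" "rk S = 2"
  shows "(\<exists>x y. S = {x, y}) \<or> (\<exists>l\<in>Lines. S \<subseteq> l)"
proof -
  have "2 \<le> rk S" using assms(2) by simp
  then obtain x y where xy: "x \<in> S" "y \<in> S" "x \<noteq> y" unfolding two_le_rk_iff by blast
  have col: "col x y z" if "z \<in> S" for z using assms(2) rk_eq_3_iff[of S] xy that by force
  show ?thesis
  proof (cases "S = {x, y}")
    case False
    then obtain z where z: "z \<in> S" "z \<noteq> x" "z \<noteq> y" using xy by blast
    have line: "\<exists>l\<in>Lines. {x, y, t} \<subseteq> l" if "t \<in> S" "t \<noteq> x" "t \<noteq> y" for t
      using col[OF that(1)] that xy(3) unfolding col_def by blast
    obtain l where l: "l \<in> Lines" "{x, y, z} \<subseteq> l" using line[OF z] by blast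
    have "t \<in> l" if t: "t \<in> S" for t
    proof (cases "t = x \<or> t = y")
      case False
      then obtain m where m: "m \<in> Lines" "{x, y, t} \<subseteq> m" using line[OF t] by blast
      then have "l = m" using two_points[OF l(1) m(1) xy(3)] l(2) xy(1,2) assms(1) by blast
      then show ?thesis using m by blast
    qed (use l in auto)
    then show ?thesis using l(1) by blast
  qed blast
qed

end

locale perm_space = perm_model W Q c b \<pi> + field K
  for W Q c b \<pi> and K :: "'k ring" (structure)
begin

abbreviation sp :: "pt \<Rightarrow> (nat \<Rightarrow> 'k) set" where
  "sp \<equiv> pt_sp c \<pi>"

definition lblocks :: "nat \<Rightarrow> nat set" where
  "lblocks l = (\<Union>i\<in>{i. i < 3 \<and> on_line l (Joint i)}. block c i)"

lemma lblocks_off: "k < 3 \<Longrightarrow> \<not> on_line l (Joint k) \<Longrightarrow> n \<in> block c k \<Longrightarrow> n \<notin> lblocks l"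
  using block(3)[of k] unfolding lblocks_def by blast

lemma block_lblocks: "i < 3 \<Longrightarrow> on_line l (Joint i) \<Longrightarrow> block c i \<subseteq> lblocks l"
  unfolding lblocks_def by blast

lemma finite_lblocks: "finite (lblocks l)"
  unfolding lblocks_def by (intro finite_UN_I) (auto simp: block)

lemma card_lblocks: "l < 3 \<Longrightarrow> card (lblocks l) = 2 * c"
proof -
  assume l: "l < 3"
  then consider "l = 0" | "l = 1" | "l = 2" by linarith
  then have "\<exists>i j. i < 3 \<and> j < 3 \<and> i \<noteq> j \<and> {i. i < 3 \<and> on_line l (Joint i)} = {i, j}"
  proof cases
    case 1 then show ?thesis by (intro exI[of _ 0] exI[of _ 1]) auto
  next
    case 2 then show ?thesis by (intro exI[of _ 1] exI[of _ 2]) auto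
  next
    case 3 then show ?thesis by (intro exI[of _ 0] exI[of _ 2]) auto
  qed
  then obtain i j where ij: "i < 3" "j < 3" "i \<noteq> j" "{i. i < 3 \<and> on_line l (Joint i)} = {i, j}" by blast
  have "lblocks l = block c i \<union> block c j" unfolding lblocks_def ij(4) by simp
  then show ?thesis using block(3)[OF ij(1-3)] by (simp add: card_Un_disjoint block)
qed

lemma joint_less: "Joint i \<in> points W Q \<Longrightarrow> i < 3"
  by (auto simp: points_def)

lemma on_some_line: "p \<in> points W Q \<Longrightarrow> on_line 0 p \<or> on_line 1 p \<or> on_line 2 p"
  using joint_less by (cases p) fastforce+

lemma sp_simps:
  "sp (Joint i) = supp (block c i)" "sp (Lpt w) = graph_sp c 0 1 (\<pi> (Lpt w))"
  "sp (Rpt \<beta> e) = graph_sp c 1 2 (\<pi> (Rpt \<beta> e))" "sp (Spt \<gamma> e) = graph_sp c 0 2 (\<pi> (Spt \<gamma> e))"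
  by (simp_all add: pt_sp_def)

lemma sp_dim:
  assumes "p \<in> points W Q"
  shows "FM.fsub (sp p)" "FM.sdim (sp p) = c"
  using sdim_graph_sp[OF perm[OF assms], of 0 1] sdim_graph_sp[OF perm[OF assms], of 1 2]
    sdim_graph_sp[OF perm[OF assms], of 0 2] sdim_supp[OF block(1)[of c]]
  by (cases p; simp add: sp_simps block)+

lemma sp_sub: "p \<in> points W Q \<Longrightarrow> subspace K (sp p) (fun_module K)"
  using FM.fsub_subspace[OF sp_dim(1)] .

lemma graph_sp_supp: "graph_sp c i j f \<subseteq> supp (block c i \<union> block c j)"
  by (auto simp: graph_sp_def)

lemma sp_on:
  assumes "p \<in> points W Q" "on_line l p" "l < 3"
  shows "sp p \<subseteq> supp (lblocks l)"
proof -
  have *: "graph_sp c i j f \<subseteq> supp (lblocks l)" if "i < 3" "j < 3" "on_line l (Joint i)" "on_line l (Joint j)" for i j f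
    using graph_sp_supp[of i j f] supp_mono[of "block c i \<union> block c j" "lblocks l"] block_lblocks that by blast
  show ?thesis
  proof (cases p)
    case (Joint i)
    then show ?thesis using supp_mono[OF block_lblocks] joint_less assms by (simp add: sp_simps)
  next
    case (Lpt w) then show ?thesis using *[of 0 1] assms by (simp add: sp_simps)
  next
    case (Rpt \<beta> e) then show ?thesis using *[of 1 2] assms by (simp add: sp_simps)
  next
    case (Spt \<beta> e) then show ?thesis using *[of 0 2] assms by (simp add: sp_simps)
  qed
qed

lemma sp_off:
  assumes "p \<in> points W Q" "\<not> on_line l p" "l < 3" "v \<in> sp p" "v \<in> supp (lblocks l)"
  shows "v = (\<lambda>_. \<zero>)"
proof -
  have z: "v n = \<zero>" if "k < 3" "\<not> on_line l (Joint k)" "n \<in> block c k" for k n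
    using supp_outside[OF assms(5) lblocks_off[OF that]] .
  have g: "v = (\<lambda>_. \<zero>)" if gg: "v \<in> graph_sp c i j (\<pi> p)" "i < 3" "j < 3" "\<not> on_line l (Joint i) \<or> \<not> on_line l (Joint j)" for i j
  proof -
    obtain k where k: "k = i \<or> k = j" "k < 3" "\<not> on_line l (Joint k)" using gg(2-4) by blast
    show ?thesis by (rule graph_sp_zero[OF perm[OF assms(1)] gg(1) k(1) z[OF k(2,3)]])
  qed
  show ?thesis
  proof (cases p)
    case (Joint i)
    then have "v \<in> supp (block c i)" "i < 3" "\<not> on_line l (Joint i)" using assms joint_less by (simp_all add: sp_simps)
    then show ?thesis using supp_zeroI z by metis
  next
    case (Lpt w) then show ?thesis using g[of 0 1] assms by (simp add: sp_simps)
  next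
    case (Rpt \<beta> e) then show ?thesis using g[of 1 2] assms by (cases "l = 0") (simp_all add: sp_simps)
  next
    case (Spt \<beta> e) then show ?thesis using g[of 0 2] assms by (cases "l = 0") (simp_all add: sp_simps)
  qed
qed

lemma sdim_trivial:
  assumes "\<And>v. v \<in> A \<Longrightarrow> v \<in> B \<Longrightarrow> v = (\<lambda>_. \<zero>)" "subspace K A (fun_module K)" "subspace K B (fun_module K)"
  shows "FM.sdim (A \<inter> B) = 0"
proof -
  have "(\<lambda>_. \<zero>) \<in> A" "(\<lambda>_. \<zero>) \<in> B"
    using FM.subspaceD(2)[OF assms(2)] FM.subspaceD(2)[OF assms(3)] by simp_all
  then have "A \<inter> B = {\<lambda>_. \<zero>}" using assms(1) by blast
  then show ?thesis using FM.sdim_zero(1) by simp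
qed

text \<open>\<open>hits\<close> is applied to the set of arguments at which \<open>v\<close> does
  not vanish.\<close>

lemma hits_zero:
  assumes "hits c f g B" "\<And>x. x < c \<Longrightarrow> v (3 * f x + i) = v (3 * g x + i)" "\<And>x. x \<in> B \<Longrightarrow> v (3 * x + i) = \<zero>"
    "n \<in> block c i" "\<And>x. x < c \<Longrightarrow> f x < c" "\<And>x. x < c \<Longrightarrow> g x < c"
  shows "v n = \<zero>"
proof -
  let ?Z = "{x. x < c \<and> v (3 * x + i) \<noteq> \<zero>}"
  have H: "\<forall>Z\<subseteq>{..<c}. (\<forall>x<c. f x \<in> Z \<longleftrightarrow> g x \<in> Z) \<and> Z \<inter> B = {} \<longrightarrow> Z = {}"
    using assms(1) unfolding hits_def by (rule conjunct2)
  have 1: "\<forall>x<c. f x \<in> ?Z \<longleftrightarrow> g x \<in> ?Z" using assms(2,5,6) by simp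
  have 2: "?Z \<inter> B = {}" using assms(3) by blast
  have 3: "?Z \<subseteq> {..<c}" by blast
  have "?Z = {}" by (rule mp[OF mp[OF spec[OF H] 3] conjI[OF 1 2]])
  then show ?thesis using assms(4) by (auto simp: block_def)
qed

lemma perm_less: "p \<in> points W Q \<Longrightarrow> x < c \<Longrightarrow> \<pi> p x < c"
  using perm by (auto simp: bij_betw_def)

text \<open>Points on different long lines have trivially intersecting spaces, because of their
  supports. On the same lines, a common vector is constant along the orbits of
  \<open>\<pi> q\<close> after the inverse of \<open>\<pi> p\<close>, so its values on a set that
  meets all orbits determine it.\<close>

lemma pair_bound:
  assumes "p \<in> points W Q" "q \<in> points W Q" "p \<noteq> q"
  shows "FM.sdim (sp p \<inter> sp q) \<le> b"
proof (cases "\<exists>l<3. on_line l p \<noteq> on_line l q")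
  case True
  then obtain l where l: "l < 3" "on_line l p \<noteq> on_line l q" by blast
  then have "FM.sdim (sp p \<inter> sp q) = 0"
    using sp_on[OF assms(1) _ l(1)] sp_off[OF assms(1) _ l(1)] sp_on[OF assms(2) _ l(1)] sp_off[OF assms(2) _ l(1)]
    by (intro sdim_trivial sp_sub assms) blast
  then show ?thesis by simp
next
  case False
  have "\<not> on_line l p \<and> \<not> on_line l q" if "\<not> l < 3" for l using that by (cases p; cases q) auto
  then have same: "on_line l p \<longleftrightarrow> on_line l q" for l using False by blast
  obtain B where B: "hits c (\<pi> p) (\<pi> q) B" "card B \<le> b" using pairs[OF assms same] by blast
  then have fB: "finite B" unfolding hits_def using finite_subset by blast
  have kinds: "\<exists>i j. i \<noteq> j \<and> sp p = graph_sp c i j (\<pi> p) \<and> sp q = graph_sp c i j (\<pi> q)"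
  proof (rule same_lines_cases[OF assms same])
    show ?thesis if "p = Lpt w" "q = Lpt w'" for w w' using that by (intro exI[of _ 0] exI[of _ 1]) (simp add: sp_simps)
    show ?thesis if "p = Rpt \<beta> e" "q = Rpt \<beta>' e'" for \<beta> e \<beta>' e' using that by (intro exI[of _ 1] exI[of _ 2]) (simp add: sp_simps)
    show ?thesis if "p = Spt \<beta> e" "q = Spt \<beta>' e'" for \<beta> e \<beta>' e' using that by (intro exI[of _ 0] exI[of _ 2]) (simp add: sp_simps)
  qed
  then obtain i j where ij: "sp p = graph_sp c i j (\<pi> p)" "sp q = graph_sp c i j (\<pi> q)" by blast
  have "FM.sdim (sp p \<inter> sp q) \<le> card ((\<lambda>x. 3 * x + i) ` B)"
  proof (rule sdim_le_card(2)[of "block c i \<union> block c j"])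
    show "finite (block c i \<union> block c j)" by (simp add: block)
    show "subspace K (sp p \<inter> sp q) (fun_module K)" by (intro FM.subspace_inter sp_sub assms)
    show "sp p \<inter> sp q \<subseteq> supp (block c i \<union> block c j)" using graph_sp_supp ij(1) by blast
    show "finite ((\<lambda>x. 3 * x + i) ` B)" using fB by simp
    fix v assume v: "v \<in> sp p \<inter> sp q" and zero: "\<And>n. n \<in> (\<lambda>x. 3 * x + i) ` B \<Longrightarrow> v n = \<zero>"
    have "v n = \<zero>" if n: "n \<in> block c i" for n
    proof (rule hits_zero[OF B(1) _ _ n])
      show "v (3 * \<pi> p x + i) = v (3 * \<pi> q x + i)" if "x < c" for x
        using v that unfolding ij by (simp add: graph_sp_def)
      show "v (3 * x + i) = \<zero>" if "x \<in> B" for x using zero that by blast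
    qed (use perm_less assms in auto)
    then show "v = (\<lambda>_. \<zero>)" using v graph_sp_zero[OF perm[OF assms(1)], of v i j i] ij(1) by blast
  qed
  also have "\<dots> \<le> b" using card_image_le[OF fB, of "\<lambda>x. 3 * x + i"] B(2) by linarith
  finally show ?thesis .
qed

lemma pair_lower:
  assumes "p \<in> points W Q" "q \<in> points W Q" "p \<noteq> q" "FM.fsub U" "sp p \<subseteq> U" "sp q \<subseteq> U"
  shows "2 * c \<le> FM.sdim U + b"
proof -
  note m = FM.sdim_modular[OF sp_dim(1)[OF assms(1)] sp_dim(1)[OF assms(2)]]
  have "FM.subspace_sum (sp p) (sp q) \<subseteq> U" using FM.sum_least[OF FM.fsub_subspace[OF assms(4)]] assms by blast
  then have "FM.sdim (FM.subspace_sum (sp p) (sp q)) \<le> FM.sdim U"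
    using FM.fsub_subset(2)[OF assms(4) FM.fsub_subspace[OF m(1)]] by blast
  then show ?thesis using m(2) sp_dim(2) assms pair_bound[OF assms(1-3)] by simp
qed

lemma triple_lower_line:
  assumes "p \<in> points W Q" "q \<in> points W Q" "r \<in> points W Q" "p \<noteq> q" "FM.fsub U" "sp p \<subseteq> U" "sp q \<subseteq> U" "sp r \<subseteq> U"
    "l < 3" "on_line l p" "on_line l q" "\<not> on_line l r"
  shows "3 * c \<le> FM.sdim U + b"
proof -
  let ?S = "FM.subspace_sum (sp p) (sp q)"
  note m = FM.sdim_modular[OF sp_dim(1)[OF assms(1)] sp_dim(1)[OF assms(2)]]
  note m' = FM.sdim_modular[OF m(1) sp_dim(1)[OF assms(3)]]
  have "?S \<subseteq> supp (lblocks l)"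
    by (intro FM.sum_least supp_subspace sp_on assms)
  then have "FM.sdim (?S \<inter> sp r) = 0"
    using sp_off[OF assms(3,12,9)] by (intro sdim_trivial sp_sub assms FM.fsub_subspace[OF m(1)]) blast
  moreover have "FM.subspace_sum ?S (sp r) \<subseteq> U"
    using assms(6-8) by (intro FM.sum_least FM.fsub_subspace[OF assms(5)])
  then have "FM.sdim (FM.subspace_sum ?S (sp r)) \<le> FM.sdim U"
    using FM.fsub_subset(2)[OF assms(5) FM.fsub_subspace[OF m'(1)]] by blast
  moreover have "2 * c \<le> FM.sdim ?S + b"
    using FM.sum_upper[OF sp_sub[OF assms(1)] sp_sub[OF assms(2)]] by (intro pair_lower[OF assms(1,2,4) m(1)])
  ultimately show ?thesis using m'(2) sp_dim(2)[OF assms(3)] by linarith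
qed

lemma neg_eq_iff: "u \<in> carrier K \<Longrightarrow> v \<in> carrier K \<Longrightarrow> u \<oplus> v = \<zero> \<Longrightarrow> u = \<ominus> v"
  using minus_equality by (metis a_comm minus_minus)

text \<open>A vector of \<open>L\<close> that is a sum of vectors from \<open>R\<close> and
  \<open>S\<close> has no part in block 2. Eliminating this block shows that it is constant along
  the orbits that compare \<open>\<pi> L \<circ> \<pi> R\<close> with
  \<open>\<pi> S\<close>.\<close>

lemma triple_lower_mixed:
  assumes "w \<in> W" "e \<in> Q" "e' \<in> Q" "\<not> col (Lpt w) (Rpt \<beta> e) (Spt \<gamma> e')"
    "FM.fsub U" "sp (Lpt w) \<subseteq> U" "sp (Rpt \<beta> e) \<subseteq> U" "sp (Spt \<gamma> e') \<subseteq> U"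
  shows "3 * c \<le> FM.sdim U + b"
proof -
  let ?L = "Lpt w" and ?R = "Rpt \<beta> e" and ?S = "Spt \<gamma> e'"
  have pts: "?L \<in> points W Q" "?R \<in> points W Q" "?S \<in> points W Q" using assms by simp_all
  let ?T = "FM.subspace_sum (sp ?R) (sp ?S)"
  note m = FM.sdim_modular[OF sp_dim(1)[OF pts(2)] sp_dim(1)[OF pts(3)]]
  note m' = FM.sdim_modular[OF m(1) sp_dim(1)[OF pts(1)]]
  have "FM.sdim (sp ?R \<inter> sp ?S) = 0"
    using sp_on[OF pts(2), of 1] sp_off[OF pts(3), of 1] by (intro sdim_trivial sp_sub pts) auto
  then have T: "FM.sdim ?T = 2 * c" using m(2) sp_dim(2)[OF pts(2)] sp_dim(2)[OF pts(3)] by simp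
  obtain B where B: "hits c (\<lambda>x. \<pi> ?L (\<pi> ?R x)) (\<pi> ?S) B" "card B \<le> b" using triples[OF assms(1-4)] by blast
  then have fB: "finite B" unfolding hits_def using finite_subset by blast
  have "FM.sdim (?T \<inter> sp ?L) \<le> card ((\<lambda>x. 3 * x + 0) ` B)"
  proof (rule sdim_le_card(2)[of "block c 0 \<union> block c 1"])
    show "finite (block c 0 \<union> block c 1)" by (simp add: block)
    show "subspace K (?T \<inter> sp ?L) (fun_module K)" by (intro FM.subspace_inter sp_sub pts FM.fsub_subspace[OF m(1)])
    show "?T \<inter> sp ?L \<subseteq> supp (block c 0 \<union> block c 1)" using graph_sp_supp unfolding sp_simps by blast
    show "finite ((\<lambda>x. 3 * x + 0) ` B)" using fB by simp
    fix v assume v: "v \<in> ?T \<inter> sp ?L" and zero: "\<And>n. n \<in> (\<lambda>x. 3 * x + 0) ` B \<Longrightarrow> v n = \<zero>"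
    obtain r s where rs: "r \<in> sp ?R" "s \<in> sp ?S" "v = r \<oplus>\<^bsub>fun_module K\<^esub> s" using v[THEN IntD1] unfolding FM.in_sum_iff by blast
    have vL: "v \<in> sp ?L" using v by blast
    have sup: "v \<in> supp (block c 0 \<union> block c 1)" "r \<in> supp (block c 1 \<union> block c 2)" "s \<in> supp (block c 0 \<union> block c 2)"
      using graph_sp_supp vL rs(1,2) unfolding sp_simps by blast+
    note car = supp_carrier[OF sup(1)] supp_carrier[OF sup(2)] supp_carrier[OF sup(3)]
    have b: "3 * x \<in> block c 0" "Suc (3 * x) \<in> block c 1" "Suc (Suc (3 * x)) \<in> block c 2" if "x < c" for x
      using that by (auto simp: block_def)
    have nb: "r (3 * x) = \<zero>" "s (Suc (3 * x)) = \<zero>" "v (Suc (Suc (3 * x))) = \<zero>" if "x < c" for x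
      using b[OF that] block(3)[of 0 1 c] block(3)[of 0 2 c] block(3)[of 1 2 c]
      by (intro supp_outside[OF sup(2)] supp_outside[OF sup(3)] supp_outside[OF sup(1)]; auto)+
    have vrs: "v n = r n \<oplus> s n" for n using rs(3) by simp
    have "v n = \<zero>" if n: "n \<in> block c 0" for n
    proof (rule hits_zero[OF B(1) _ _ n])
      fix x assume x: "x < c"
      have lx: "\<pi> ?R x < c" "\<pi> ?S x < c" "\<pi> ?L (\<pi> ?R x) < c" using perm_less pts x by blast+
      have 1: "v (3 * \<pi> ?L (\<pi> ?R x)) = \<ominus> v (Suc (3 * \<pi> ?R x))" using vL lx by (simp add: sp_simps graph_sp_def)
      have 2: "r (Suc (3 * \<pi> ?R x)) = \<ominus> r (Suc (Suc (3 * x)))" using rs(1) x by (simp add: sp_simps graph_sp_def)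
      have 3: "s (3 * \<pi> ?S x) = \<ominus> s (Suc (Suc (3 * x)))" using rs(2) x by (simp add: sp_simps graph_sp_def)
      have 4: "r (Suc (Suc (3 * x))) = \<ominus> s (Suc (Suc (3 * x)))"
        using neg_eq_iff[OF car(2,3)] vrs nb(3)[OF x] by metis
      have "v (Suc (3 * \<pi> ?R x)) = r (Suc (3 * \<pi> ?R x))" using vrs[of "Suc (3 * \<pi> ?R x)"] nb(2)[OF lx(1)] car by simp
      moreover have "v (3 * \<pi> ?S x) = s (3 * \<pi> ?S x)" using vrs[of "3 * \<pi> ?S x"] nb(1)[OF lx(2)] car by simp
      ultimately show "v (3 * \<pi> ?L (\<pi> ?R x) + 0) = v (3 * \<pi> ?S x + 0)" using 1 2 3 4 car by simp
    next
      show "v (3 * x + 0) = \<zero>" if "x \<in> B" for x using zero that by blast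
    qed (use perm_less pts in auto)
    then show "v = (\<lambda>_. \<zero>)" using vL graph_sp_zero[OF perm[OF pts(1)], of v 0 1 0] by (simp add: sp_simps)
  qed
  also have "\<dots> \<le> b" using card_image_le[OF fB, of "\<lambda>x. 3 * x + 0"] B(2) by linarith
  finally have "FM.sdim (?T \<inter> sp ?L) \<le> b" .
  moreover have "FM.subspace_sum ?T (sp ?L) \<subseteq> U"
    using assms(6-8) by (intro FM.sum_least FM.fsub_subspace[OF assms(5)])
  then have "FM.sdim (FM.subspace_sum ?T (sp ?L)) \<le> FM.sdim U"
    using FM.fsub_subset(2)[OF assms(5) FM.fsub_subspace[OF m'(1)]] by blast
  ultimately show ?thesis using m'(2) T sp_dim(2)[OF pts(1)] by linarith
qed

text \<open>Either two of the points share a long line that misses the third, or the points are one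
  \<open>Lpt\<close>, one \<open>Rpt\<close> and one \<open>Spt\<close>.\<close>

lemma triple_lower:
  assumes "p \<in> points W Q" "q \<in> points W Q" "r \<in> points W Q" "\<not> col p q r" "FM.fsub U" "sp p \<subseteq> U" "sp q \<subseteq> U" "sp r \<subseteq> U"
  shows "3 * c \<le> FM.sdim U + b"
proof -
  have line: ?thesis if "l < 3" "on_line l x" "on_line l y" "{x, y, z} = {p, q, r}" "x \<noteq> y" "\<not> col x y z" for l x y z
  proof -
    have "\<not> on_line l z" using on_line_col[OF that(1-3)] that(6) by blast
    moreover have "x \<in> {p, q, r}" "y \<in> {p, q, r}" "z \<in> {p, q, r}" using that(4) by blast+
    then have "x \<in> points W Q" "y \<in> points W Q" "z \<in> points W Q" "sp x \<subseteq> U" "sp y \<subseteq> U" "sp z \<subseteq> U"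
      using assms by blast+
    ultimately show ?thesis using triple_lower_line[of x y z U l] assms(5) that(1-3,5) by blast
  qed
  have d: "p \<noteq> q" "q \<noteq> r" "p \<noteq> r" using ncol_distinct[OF assms(4)] by blast+
  have s: "\<not> col p r q" "\<not> col q r p" using assms(4) col_swap by metis+
  have e: "{p, q, r} = {p, q, r}" "{p, r, q} = {p, q, r}" "{q, r, p} = {p, q, r}" by blast+
  have mixed: ?thesis if mm: "w \<in> W" "e \<in> Q" "e' \<in> Q" "{Lpt w, Rpt \<beta> e, Spt \<gamma> e'} = {p, q, r}" for w \<beta> e \<gamma> e'
  proof (rule triple_lower_mixed[OF mm(1-3) _ assms(5)])
    have in3: "Lpt w \<in> {p, q, r}" "Rpt \<beta> e \<in> {p, q, r}" "Spt \<gamma> e' \<in> {p, q, r}" using mm(4) by blast+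
    then show "sp (Lpt w) \<subseteq> U" "sp (Rpt \<beta> e) \<subseteq> U" "sp (Spt \<gamma> e') \<subseteq> U" using assms by blast+
    show "\<not> col (Lpt w) (Rpt \<beta> e) (Spt \<gamma> e')"
    proof
      assume c: "col (Lpt w) (Rpt \<beta> e) (Spt \<gamma> e')"
      then have "\<exists>l\<in>quad_lines Q. {Lpt w, Rpt \<beta> e, Spt \<gamma> e'} \<subseteq> l" unfolding col_def by simp
      then have "\<exists>l\<in>quad_lines Q. {p, q, r} \<subseteq> l" unfolding mm(4) .
      then show False using assms(4) unfolding col_def by blast
    qed
  qed
  let ?share = "\<lambda>x y. on_line 0 x \<and> on_line 0 y \<or> on_line 1 x \<and> on_line 1 y \<or> on_line 2 x \<and> on_line 2 y"
  have "?share p q \<or> ?share p r \<or> ?share q r \<or>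
    (\<exists>w\<in>W. \<exists>e\<in>Q. \<exists>e'\<in>Q. \<exists>\<beta> \<gamma>. {Lpt w, Rpt \<beta> e, Spt \<gamma> e'} = {p, q, r})"
  proof -
    have "i = 0 \<or> i = 1 \<or> i = 2" if "Joint i \<in> points W Q" for i using joint_less[OF that] by linarith
    note j = this
    \<comment> \<open>A joint lies on two of the three long lines; if neither other point is on one
      of these, both are on the remaining line.\<close>
    have sh: "?share (Joint i) x \<or> ?share (Joint i) y \<or> ?share x y"
      if pts: "Joint i \<in> points W Q" "x \<in> points W Q" "y \<in> points W Q" for i x y
    proof -
      have "on_line 0 (Joint i) \<and> on_line 1 (Joint i) \<or> on_line 0 (Joint i) \<and> on_line 2 (Joint i) \<or> on_line 1 (Joint i) \<and> on_line 2 (Joint i)"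
        using j[OF pts(1)] by auto
      then show ?thesis using on_some_line[OF pts(2)] on_some_line[OF pts(3)] by argo
    qed
    consider i where "p = Joint i" | i where "q = Joint i" | i where "r = Joint i" | "\<forall>i. p \<noteq> Joint i \<and> q \<noteq> Joint i \<and> r \<noteq> Joint i" by blast
    then show ?thesis
    proof cases
      case (1 i)
      have "Joint i \<in> points W Q" using 1 assms(1) by simp
      from sh[OF this assms(2,3)] show ?thesis unfolding 1 by blast
    next
      case (2 i)
      have "Joint i \<in> points W Q" using 2 assms(2) by simp
      from sh[OF this assms(1,3)] show ?thesis unfolding 2 by blast
    next
      case (3 i)
      have "Joint i \<in> points W Q" using 3 assms(3) by simp
      from sh[OF this assms(1,2)] show ?thesis unfolding 3 by blast
    next
      case 4
      then show ?thesis using assms(1-3) by (cases p; cases q; cases r; simp; blast)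
    qed
  qed
  moreover have "l < 3 \<Longrightarrow> on_line l p \<and> on_line l q \<or> on_line l p \<and> on_line l r \<or> on_line l q \<and> on_line l r \<Longrightarrow> ?thesis" for l
    using line[OF _ _ _ e(1) d(1) assms(4)] line[OF _ _ _ e(2) d(3) s(1)] line[OF _ _ _ e(3) d(2) s(2)] by blast
  from this[of 0] this[of 1] this[of 2]
  have "on_line l p \<and> on_line l q \<or> on_line l p \<and> on_line l r \<or> on_line l q \<and> on_line l r \<Longrightarrow> ?thesis" if "l \<in> {0, 1, 2}" for l
    using that by auto
  ultimately show ?thesis using mixed by (metis insertI1 insertI2)
qed

text \<open>If blocks 1 and 2 of a vector of the sum vanish, composition forces block 0 to vanish as
  well, except at the at most \<open>b\<close> arguments where the triangle fails.\<close>

lemma triangle_upper: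
  assumes e: "e \<in> Q"
  shows "FM.sdim (FM.subspace_sum (sp (Lpt (slot e \<beta> \<gamma>))) (FM.subspace_sum (sp (Rpt \<beta> e)) (sp (Spt \<gamma> e)))) \<le> 2 * c + b"
proof -
  let ?L = "Lpt (slot e \<beta> \<gamma>)" and ?R = "Rpt \<beta> e" and ?S = "Spt \<gamma> e"
  have pts: "?L \<in> points W Q" "?R \<in> points W Q" "?S \<in> points W Q" using e slots by simp_all
  define N where "N = {x\<in>{..<c}. \<pi> ?L (\<pi> ?R x) \<noteq> \<pi> ?S x}"
  have fN: "finite N" by (simp add: N_def)
  let ?T = "FM.subspace_sum (sp ?L) (FM.subspace_sum (sp ?R) (sp ?S))"
  let ?B = "block c 1 \<union> block c 2 \<union> (\<lambda>x. 3 * \<pi> ?S x) ` N"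
  let ?A = "block c 0 \<union> block c 1 \<union> block c 2"
  note sub = FM.subspace_sum[OF sp_sub[OF pts(2)] sp_sub[OF pts(3)]]
  have A: "supp (block c i \<union> block c j) \<subseteq> supp ?A" if "i < 3" "j < 3" for i j
  proof -
    have "block c i \<subseteq> ?A" if "i < 3" for i
    proof -
      from that consider "i = 0" | "i = 1" | "i = 2" by linarith
      then show ?thesis by cases auto
    qed
    then show ?thesis using that by (intro supp_mono) blast
  qed
  have "FM.sdim ?T \<le> card ?B"
  proof (rule sdim_le_card(2)[of ?A])
    show "finite ?A" by (simp add: block)
    show "subspace K ?T (fun_module K)" by (rule FM.subspace_sum[OF sp_sub[OF pts(1)] sub])
    have "sp ?L \<subseteq> supp ?A" "sp ?R \<subseteq> supp ?A" "sp ?S \<subseteq> supp ?A"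
      using subset_trans[OF graph_sp_supp A[of 0 1]] subset_trans[OF graph_sp_supp A[of 1 2]] subset_trans[OF graph_sp_supp A[of 0 2]]
      by (simp_all add: sp_simps)
    then show TA: "?T \<subseteq> supp ?A" by (intro FM.sum_least supp_subspace)
    show "finite ?B" using fN by (simp add: block)
    fix v assume vT: "v \<in> ?T" and zero: "\<And>n. n \<in> ?B \<Longrightarrow> v n = \<zero>"
    from vT obtain l u where lu: "l \<in> sp ?L" "u \<in> FM.subspace_sum (sp ?R) (sp ?S)" "v = l \<oplus>\<^bsub>fun_module K\<^esub> u"
      unfolding FM.in_sum_iff[of v] by blast
    from lu(2) obtain r s where "r \<in> sp ?R" "s \<in> sp ?S" "u = r \<oplus>\<^bsub>fun_module K\<^esub> s"
      unfolding FM.in_sum_iff by blast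
    then have rs: "l \<in> sp ?L" "r \<in> sp ?R" "s \<in> sp ?S" "v = l \<oplus>\<^bsub>fun_module K\<^esub> (r \<oplus>\<^bsub>fun_module K\<^esub> s)"
      using lu by simp_all
    have sup: "l \<in> supp (block c 0 \<union> block c 1)" "r \<in> supp (block c 1 \<union> block c 2)" "s \<in> supp (block c 0 \<union> block c 2)"
      using graph_sp_supp rs(1,2,3) unfolding sp_simps by blast+
    note car = supp_carrier[OF sup(1)] supp_carrier[OF sup(2)] supp_carrier[OF sup(3)]
    have b: "3 * x \<in> block c 0" "Suc (3 * x) \<in> block c 1" "Suc (Suc (3 * x)) \<in> block c 2" if "x < c" for x
      using that by (auto simp: block_def)
    have nb: "r (3 * x) = \<zero>" "s (Suc (3 * x)) = \<zero>" "l (Suc (Suc (3 * x))) = \<zero>" if "x < c" for x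
      using b[OF that] block(3)[of 0 1 c] block(3)[of 0 2 c] block(3)[of 1 2 c]
      by (intro supp_outside[OF sup(2)] supp_outside[OF sup(3)] supp_outside[OF sup(1)]; auto)+
    have vn: "v n = l n \<oplus> (r n \<oplus> s n)" for n using rs(4) by simp
    have main: "v (3 * \<pi> ?S x) = \<zero>" if x: "x < c" for x
    proof (cases "x \<in> N")
      case True
      then show ?thesis using zero by blast
    next
      case False
      then have eq: "\<pi> ?L (\<pi> ?R x) = \<pi> ?S x" using x by (simp add: N_def)
      have lx: "\<pi> ?R x < c" "\<pi> ?S x < c" using perm_less pts x by blast+
      have 1: "l (3 * \<pi> ?S x) = \<ominus> l (Suc (3 * \<pi> ?R x))" using rs(1) lx unfolding eq [symmetric] by (simp add: sp_simps graph_sp_def)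
      have 2: "r (Suc (3 * \<pi> ?R x)) = \<ominus> r (Suc (Suc (3 * x)))" using rs(2) x by (simp add: sp_simps graph_sp_def)
      have 3: "s (3 * \<pi> ?S x) = \<ominus> s (Suc (Suc (3 * x)))" using rs(3) x by (simp add: sp_simps graph_sp_def)
      have "v (Suc (3 * \<pi> ?R x)) = \<zero>" "v (Suc (Suc (3 * x))) = \<zero>" using zero b lx x by blast+
      then have "l (Suc (3 * \<pi> ?R x)) \<oplus> r (Suc (3 * \<pi> ?R x)) = \<zero>" "r (Suc (Suc (3 * x))) \<oplus> s (Suc (Suc (3 * x))) = \<zero>"
        using vn nb(2)[OF lx(1)] nb(3)[OF x] car by simp_all
      then have "l (Suc (3 * \<pi> ?R x)) = \<ominus> r (Suc (3 * \<pi> ?R x))" "r (Suc (Suc (3 * x))) = \<ominus> s (Suc (Suc (3 * x)))"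
        using neg_eq_iff car by blast+
      then have "l (3 * \<pi> ?S x) = \<ominus> s (3 * \<pi> ?S x)" using 1 2 3 car by simp
      then show ?thesis using vn[of "3 * \<pi> ?S x"] nb(1)[OF lx(2)] car by (simp add: l_neg)
    qed
    have "v n = \<zero>" if "n \<in> ?A" for n
    proof (cases "n \<in> block c 0")
      case True
      then obtain y where "y < c" "n = 3 * y" by (auto simp: block_def)
      moreover obtain x where "x < c" "\<pi> ?S x = y"
        using bij_betw_imp_surj_on[OF perm[OF pts(3)]] \<open>y < c\<close> by (metis imageE lessThan_iff)
      ultimately show ?thesis using main by blast
    next
      case False
      then show ?thesis using zero that by blast
    qed
    then show "v = (\<lambda>_. \<zero>)" by (rule supp_zeroI[OF subsetD[OF TA vT]])
  qed
  also have "\<dots> \<le> card (block c 1) + card (block c 2) + card ((\<lambda>x. 3 * \<pi> ?S x) ` N)"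
    using card_Un_le[of "block c 1 \<union> block c 2"] card_Un_le[of "block c 1" "block c 2"] by (meson add_mono le_refl order_trans)
  also have "\<dots> \<le> c + c + b"
    using card_image_le[OF fN, of "\<lambda>x. 3 * \<pi> ?S x"] triangles[OF e, of \<beta> \<gamma>] by (simp add: block N_def)
  finally show ?thesis by simp
qed

text \<open>Since \<open>U\<close> is known only as the least subspace over the points, each upper
  bound amounts to exhibiting some subspace that contains them. The lower bounds come from at most
  three points that witness the rank.\<close>

lemma rank_bound:
  assumes S: "S \<subseteq> points W Q" and U: "FM.fsub U" "\<And>p. p \<in> S \<Longrightarrow> sp p \<subseteq> U"
    and least: "\<And>U'. subspace K U' (fun_module K) \<Longrightarrow> (\<And>p. p \<in> S \<Longrightarrow> sp p \<subseteq> U') \<Longrightarrow> U \<subseteq> U'"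
  shows "rk S * c \<le> FM.sdim U + b" "FM.sdim U \<le> rk S * c + b"
proof -
  have upper: "FM.sdim U \<le> FM.sdim U'" if "FM.fsub U'" "\<And>p. p \<in> S \<Longrightarrow> sp p \<subseteq> U'" for U'
    using FM.fsub_subset(2)[OF that(1) FM.fsub_subspace[OF U(1)] least[OF FM.fsub_subspace[OF that(1)] that(2)]] .
  have "rk S \<le> 3" by (rule rk_le_3)
  then consider "rk S = 0" | "rk S = 1" | "rk S = 2" | "rk S = 3" by linarith
  then have "rk S * c \<le> FM.sdim U + b \<and> FM.sdim U \<le> rk S * c + b"
  proof cases
    case 1
    then have "S = {}" by (simp add: rk_eq_0)
    then show ?thesis using upper[OF FM.sdim_zero(2)] FM.sdim_zero(1) 1 by simp
  next
    case 2
    then obtain p where p: "S = {p}" using rk_le_1_cases[of S] rk_eq_0[of S] by auto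
    then have pU: "p \<in> points W Q" "sp p \<subseteq> U" using S U(2) by auto
    have "FM.sdim U \<le> FM.sdim (sp p)" by (rule upper[OF sp_dim(1)[OF pU(1)]]) (use p in auto)
    then show ?thesis
      using FM.fsub_subset(2)[OF U(1) sp_sub pU(2)] pU sp_dim(2)[of p] 2 by simp
  next
    case 3
    then have "2 \<le> rk S" by simp
    then obtain p q where pq: "p \<in> S" "q \<in> S" "p \<noteq> q" unfolding two_le_rk_iff by blast
    have "2 * c \<le> FM.sdim U + b" using pair_lower[OF _ _ pq(3) U(1)] pq U(2) S by blast
    moreover have "FM.sdim U \<le> 2 * c + b"
      using rk_le_2_flat[OF S 3]
    proof
      assume "\<exists>x y. S = {x, y}"
      then obtain x y where xy: "S = {x, y}" by blast
      then have pts: "x \<in> points W Q" "y \<in> points W Q" using S by auto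
      note m = FM.sdim_modular[OF sp_dim(1)[OF pts(1)] sp_dim(1)[OF pts(2)]]
      have "FM.sdim U \<le> FM.sdim (FM.subspace_sum (sp x) (sp y))"
        using FM.sum_upper[OF sp_sub[OF pts(1)] sp_sub[OF pts(2)]] xy by (intro upper m(1)) auto
      then show ?thesis using m(2) sp_dim(2)[OF pts(1)] sp_dim(2)[OF pts(2)] by linarith
    next
      assume "\<exists>l\<in>quad_lines Q. S \<subseteq> l"
      then obtain l where l: "l \<in> quad_lines Q" "S \<subseteq> l" by blast
      then have "(\<exists>k<3. l = Collect (on_line k)) \<or> (\<exists>\<beta> \<gamma> e. l = triangle \<beta> \<gamma> e \<and> e \<in> Q)"
        unfolding quad_lines_def by blast
      then show ?thesis
      proof (elim disjE exE conjE)
        fix k assume k: "k < (3 :: nat)" "l = Collect (on_line k)"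
        have "FM.sdim U \<le> FM.sdim (supp (lblocks k))"
          using sp_on[OF _ _ k(1)] S l(2) k(2) by (intro upper sdim_supp(1) finite_lblocks) blast
        then show ?thesis using sdim_supp(2)[OF finite_lblocks] card_lblocks[OF k(1)] by simp
      next
        fix \<beta> \<gamma> e assume e: "l = triangle \<beta> \<gamma> e" "e \<in> Q"
        let ?L = "Lpt (slot e \<beta> \<gamma>)" and ?R = "Rpt \<beta> e" and ?S = "Spt \<gamma> e"
        have pts: "?L \<in> points W Q" "?R \<in> points W Q" "?S \<in> points W Q" using e slots by simp_all
        note m = FM.sdim_modular(1)[OF sp_dim(1)[OF pts(2)] sp_dim(1)[OF pts(3)]]
        note m' = FM.sdim_modular(1)[OF sp_dim(1)[OF pts(1)] m]
        have "sp p \<subseteq> FM.subspace_sum (sp ?L) (FM.subspace_sum (sp ?R) (sp ?S))" if "p \<in> S" for p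
        proof -
          have "p = ?L \<or> p = ?R \<or> p = ?S" using that l(2) e(1) by (auto simp: triangle_def)
          then show ?thesis
            using FM.sum_upper[OF sp_sub[OF pts(2)] sp_sub[OF pts(3)]] FM.sum_upper[OF sp_sub[OF pts(1)] FM.fsub_subspace[OF m]] by blast
        qed
        then show ?thesis using upper[OF m'] triangle_upper[OF e(2), of \<beta> \<gamma>] by fastforce
      qed
    qed
    ultimately show ?thesis using 3 by simp
  next
    case 4
    then obtain p q r where pqr: "p \<in> S" "q \<in> S" "r \<in> S" "\<not> col p q r" unfolding rk_eq_3_iff by blast
    have "3 * c \<le> FM.sdim U + b" using triple_lower[OF _ _ _ pqr(4) U(1)] pqr U(2) S by blast
    moreover have "FM.sdim U \<le> 3 * c"
    proof -
      let ?A = "\<Union>i\<in>{..<3}. block c i"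
      have "sp p \<subseteq> supp ?A" if "p \<in> S" for p
      proof -
        have "p \<in> points W Q" using that S by blast
        then have "on_line 0 p \<or> on_line 1 p \<or> on_line 2 p" using on_some_line by blast
        then have "\<exists>l<3. on_line l p"
        proof (elim disjE)
          show "\<exists>l<3. on_line l p" if "on_line 0 p" using that by (intro exI[of _ 0]) simp
          show "\<exists>l<3. on_line l p" if "on_line 1 p" using that by (intro exI[of _ 1]) simp
          show "\<exists>l<3. on_line l p" if "on_line 2 p" using that by (intro exI[of _ 2]) simp
        qed
        then obtain l where "l < 3" "on_line l p" by blast
        moreover have "lblocks l \<subseteq> ?A" unfolding lblocks_def by blast
        ultimately show ?thesis using sp_on[OF \<open>p \<in> points W Q\<close>] supp_mono by blast
      qed
      then have "FM.sdim U \<le> FM.sdim (supp ?A)" by (intro upper sdim_supp(1)) (auto simp: block)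
      also have "\<dots> = card ?A" by (rule sdim_supp(2)) (auto simp: block)
      also have "\<dots> \<le> (\<Sum>i<3. card (block c i))" by (rule card_UN_le) simp
      finally show ?thesis by (simp add: block)
    qed
    ultimately show ?thesis using 4 by simp
  qed
  then show "rk S * c \<le> FM.sdim U + b" "FM.sdim U \<le> rk S * c + b" by simp_all
qed

end

lemma (in quad_matroid) almost_multilinear_perms:
  fixes K :: "'k ring"
  assumes "field K" and model: "\<And>\<delta>::real. \<delta> > 0 \<Longrightarrow> \<exists>c b \<pi>. c > 0 \<and> real b \<le> \<delta> * real c \<and> perm_model W Q c b \<pi>"
  shows "almost_multilinear K ground rank"
  unfolding almost_multilinear_def
proof (intro allI impI)
  fix \<epsilon> :: real assume \<epsilon>: "\<epsilon> > 0"
  \<comment> \<open>Half of \<open>\<epsilon>\<close> leaves room for the strict inequality.\<close>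
  then obtain c b \<pi> where cb: "c > 0" "real b \<le> \<epsilon> / 2 * real c" "perm_model W Q c b \<pi>" using model[of "\<epsilon> / 2"] by auto
  interpret perm_space W Q c b \<pi> K using cb(3) assms(1) by (rule perm_space.intro)
  define U where "U n = sp (inv_into UNIV pt_code n)" for n
  have U: "U (pt_code p) = sp p" for p using inj_pt_code by (simp add: U_def)
  have fin: "finite ground" using finite_P by (simp add: ground_def)
  have fU: "FM.fsub (U n)" if "n \<in> ground" for n using that sp_dim(1) U by (auto simp: ground_def)
  let ?d = "\<lambda>S. \<bar>real (rank S) - 1 / real c * real (FM.sdim (subspaces_sum (fun_module K) U S))\<bar>"
  have d: "?d S < \<epsilon>" if "S \<subseteq> ground" for S
  proof -
    define T where "T = {p \<in> points W Q. pt_code p \<in> S}"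
    have S: "S = pt_code ` T" using that by (auto simp: T_def ground_def)
    have T: "T \<subseteq> points W Q" by (auto simp: T_def)
    have rank: "rank S = rk T" using rank_image[OF T] S by simp
    have fS: "finite S" using fin that finite_subset by blast
    let ?V = "subspaces_sum (fun_module K) U S"
    have fV: "FM.fsub ?V"
    proof (cases "S = {}")
      case True
      then show ?thesis using FM.sdim_zero(2) by (simp add: FM.subspaces_sum_empty)
    next
      case False
      then show ?thesis using FM.fsub_subspaces_sum[OF fS] fU that by blast
    qed
    have up: "sp p \<subseteq> ?V" if "p \<in> T" for p
      using FM.subspaces_sum_upper[OF fS, of U "pt_code p"] fU \<open>S \<subseteq> ground\<close> S that U by auto
    have least: "?V \<subseteq> U'" if "subspace K U' (fun_module K)" "\<And>p. p \<in> T \<Longrightarrow> sp p \<subseteq> U'" for U'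
    proof (rule FM.subspaces_sum_least[OF fS _ that(1)])
      fix y assume y: "y \<in> S"
      then show "subspace K (U y) (fun_module K)" using FM.fsub_subspace[OF fU] \<open>S \<subseteq> ground\<close> by blast
      obtain p where "p \<in> T" "y = pt_code p" using y S by blast
      then show "U y \<subseteq> U'" using that(2) U by simp
    qed
    note rb = rank_bound[OF T fV up least]
    have "real (rk T) * real c \<le> real (FM.sdim ?V) + real b" "real (FM.sdim ?V) \<le> real (rk T) * real c + real b"
      using rb by (metis of_nat_add of_nat_le_iff of_nat_mult)+
    then have "\<bar>real (rk T) * real c - real (FM.sdim ?V)\<bar> \<le> \<epsilon> / 2 * real c" using cb(2) by linarith
    also have "\<dots> < \<epsilon> * real c" using \<epsilon> cb(1) by simp
    finally have "\<bar>(real (rk T) - 1 / real c * real (FM.sdim ?V)) * real c\<bar> < \<epsilon> * real c"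
      using cb(1) by (simp add: left_diff_distrib)
    then show ?thesis using cb(1) rank by (simp add: abs_mult)
  qed
  have "Max (?d ` Pow ground) < \<epsilon>"
    using fin d by (subst Max_less_iff) auto
  then show "\<exists>(V :: ('k, nat \<Rightarrow> 'k) module) W c. vectorspace K V \<and>
    (\<forall>e\<in>ground. subspace K (W e) V \<and> vectorspace.fin_dim K (V\<lparr>carrier := W e\<rparr>)) \<and> c > 0 \<and>
    (MAX S\<in>Pow ground. \<bar>real (rank S) - 1 / real c * real (vectorspace.dim K (V\<lparr>carrier := subspaces_sum V W S\<rparr>))\<bar>) < \<epsilon>"
    using FM.vectorspace_axioms fU cb(1)
    by (intro exI[of _ "fun_module K"] exI[of _ U] exI[of _ c]) (simp add: FM.fsub_def FM.sdim_def)
qed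

section \<open>Foelner sets turn an amenable action into permutations\<close>

section \<open>From group actions to permutations\<close>

text \<open>The Foelner condition, stated for a set of maps instead of a group.\<close>

definition amenable :: "('x \<Rightarrow> 'x) set \<Rightarrow> bool" where
  "amenable G \<longleftrightarrow> (\<forall>\<delta>::real. \<delta> > 0 \<longrightarrow>
     (\<exists>F. finite F \<and> F \<noteq> {} \<and> (\<forall>g\<in>G. real (card {x\<in>F. g x \<notin> F}) \<le> \<delta> * real (card F))))"

lemma amenable_mono: "amenable G \<Longrightarrow> H \<subseteq> G \<Longrightarrow> amenable H"
  unfolding amenable_def by (meson subset_iff)

lemma amenableD:
  assumes "amenable G" "\<delta> > 0"
  shows "\<exists>F. finite F \<and> F \<noteq> {} \<and> (\<forall>g\<in>G. real (card {x\<in>F. g x \<notin> F}) \<le> \<delta> * real (card F))"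
  using assms unfolding amenable_def by (elim allE impE)

text \<open>For bijections this says that all orbits of \<open>g\<close> after the inverse of
  \<open>f\<close> are infinite. After restriction to a finite set, every orbit must then contain an
  argument where the restriction was altered.\<close>

definition separated :: "('x \<Rightarrow> 'y) \<Rightarrow> ('x \<Rightarrow> 'y) \<Rightarrow> bool" where
  "separated f g \<longleftrightarrow> (\<forall>Z. finite Z \<and> (\<forall>x. f x \<in> Z \<longrightarrow> g x \<in> Z) \<longrightarrow> Z = {})"

text \<open>The part of \<open>F\<close> that \<open>g\<close> keeps inside \<open>F\<close> has the
  size of its image, which is the part kept by the inverse.\<close>

lemma escape_inv:
  assumes "bij g" "finite F"
  shows "card {x\<in>F. inv_into UNIV g x \<notin> F} = card {x\<in>F. g x \<notin> F}"
proof -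
  let ?h = "inv_into UNIV g"
  have gh: "g (?h x) = x" "?h (g x) = x" for x using assms(1) by (simp_all add: bij_def surj_f_inv_f)
  have "g ` {x\<in>F. g x \<in> F} = {x\<in>F. ?h x \<in> F}"
  proof
    show "g ` {x\<in>F. g x \<in> F} \<subseteq> {x\<in>F. ?h x \<in> F}" using gh by auto
    show "{x\<in>F. ?h x \<in> F} \<subseteq> g ` {x\<in>F. g x \<in> F}"
    proof
      fix x assume "x \<in> {x\<in>F. ?h x \<in> F}"
      then show "x \<in> g ` {x\<in>F. g x \<in> F}" using gh(1)[of x] by (intro image_eqI[of _ _ "?h x"]) auto
    qed
  qed
  moreover have "inj_on g {x\<in>F. g x \<in> F}" using assms(1) by (auto simp: bij_def inj_on_def)
  ultimately have "card {x\<in>F. g x \<in> F} = card {x\<in>F. ?h x \<in> F}" using card_image[of g "{x\<in>F. g x \<in> F}"] by simp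
  moreover have c: "card {x\<in>F. k x \<notin> F} + card {x\<in>F. k x \<in> F} = card F" for k
  proof -
    have "{x\<in>F. k x \<notin> F} \<union> {x\<in>F. k x \<in> F} = F" by blast
    moreover have "{x\<in>F. k x \<notin> F} \<inter> {x\<in>F. k x \<in> F} = {}" by blast
    ultimately show ?thesis using card_Un_disjoint[of "{x\<in>F. k x \<notin> F}" "{x\<in>F. k x \<in> F}"] assms(2) by simp
  qed
  ultimately show ?thesis using c[of g] c[of ?h] by linarith
qed

lemma escape_comp:
  assumes "inj h" "finite F"
  shows "card {x\<in>F. g (h x) \<notin> F} \<le> card {x\<in>F. g x \<notin> F} + card {x\<in>F. h x \<notin> F}"
proof -
  have "{x\<in>F. g (h x) \<notin> F} \<subseteq> h -` {x\<in>F. g x \<notin> F} \<union> {x\<in>F. h x \<notin> F}" by auto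
  moreover have f: "finite (h -` {x\<in>F. g x \<notin> F})" using assms by (intro finite_vimageI) auto
  moreover have "card (h -` {x\<in>F. g x \<notin> F}) \<le> card {x\<in>F. g x \<notin> F}"
    using assms by (intro card_inj_on_le[of h]) (auto intro: inj_on_subset)
  moreover have "card {x\<in>F. g (h x) \<notin> F} \<le> card (h -` {x\<in>F. g x \<notin> F} \<union> {x\<in>F. h x \<notin> F})"
    using calculation(1) f assms(2) by (intro card_mono) auto
  moreover have "card (h -` {x\<in>F. g x \<notin> F} \<union> {x\<in>F. h x \<notin> F}) \<le> card (h -` {x\<in>F. g x \<notin> F}) + card {x\<in>F. h x \<notin> F}"
    by (rule card_Un_le)
  ultimately show ?thesis by linarith
qed

lemma amenable_comp_inv:
  assumes "amenable G" "\<And>g. g \<in> G \<Longrightarrow> bij g"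
  shows "amenable {g \<circ> inv_into UNIV h | g h. g \<in> G \<and> h \<in> G}"
  unfolding amenable_def
proof (intro allI impI)
  fix \<delta> :: real assume "\<delta> > 0"
  then obtain F where "finite F \<and> F \<noteq> {} \<and> (\<forall>g\<in>G. real (card {x\<in>F. g x \<notin> F}) \<le> \<delta> / 2 * real (card F))"
    using amenableD[OF assms(1) half_gt_zero] by blast
  then have F: "finite F" "F \<noteq> {}" "\<And>g. g \<in> G \<Longrightarrow> real (card {x\<in>F. g x \<notin> F}) \<le> \<delta> / 2 * real (card F)"
    by blast+
  have "real (card {x\<in>F. (g \<circ> inv_into UNIV h) x \<notin> F}) \<le> \<delta> * real (card F)" if gh: "g \<in> G" "h \<in> G" for g h
  proof -
    have "inj (inv_into UNIV h)" using assms(2)[OF gh(2)] by (simp add: bij_imp_bij_inv bij_is_inj)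
    then have "card {x\<in>F. (g \<circ> inv_into UNIV h) x \<notin> F} \<le> card {x\<in>F. g x \<notin> F} + card {x\<in>F. h x \<notin> F}"
      using escape_comp[of "inv_into UNIV h" F g] escape_inv[OF assms(2)[OF gh(2)] F(1)] F(1) by simp
    then show ?thesis using F(3)[OF gh(1)] F(3)[OF gh(2)] by simp
  qed
  then show "\<exists>F. finite F \<and> F \<noteq> {} \<and> (\<forall>g\<in>{g \<circ> inv_into UNIV h | g h. g \<in> G \<and> h \<in> G}. real (card {x\<in>F. g x \<notin> F}) \<le> \<delta> * real (card F))"
    using F(1,2) by blast
qed

text \<open>The Foelner set is multiplied by an integer interval that is long against all
  translations involved.\<close>

lemma amenable_shift:
  fixes n :: "'i \<Rightarrow> int"
  assumes "amenable (g ` I)" "finite I"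
  shows "amenable ((\<lambda>i (x, t). (g i x, t + n i)) ` I)"
  unfolding amenable_def
proof (intro allI impI)
  fix \<delta> :: real assume d: "\<delta> > 0"
  then obtain F where "finite F \<and> F \<noteq> {} \<and> (\<forall>k\<in>g ` I. real (card {x\<in>F. k x \<notin> F}) \<le> \<delta> / 2 * real (card F))"
    using amenableD[OF assms(1) half_gt_zero] by blast
  then have F: "finite F" "F \<noteq> {}" "\<And>i. i \<in> I \<Longrightarrow> real (card {x\<in>F. g i x \<notin> F}) \<le> \<delta> / 2 * real (card F)"
    by blast+
  define m where "m = (\<Sum>i\<in>I. nat \<bar>n i\<bar>)"
  obtain T :: nat where T: "real m \<le> \<delta> / 2 * real T" "T > 0"
  proof -
    obtain T :: nat where "real T > max 1 (real m / (\<delta> / 2))" using reals_Archimedean2 by blast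
    then have "real m \<le> \<delta> / 2 * real T" "T > 0" using d by (auto simp: field_simps)
    then show ?thesis by (rule that)
  qed
  let ?B = "{0..<int T}"
  have "real (card {x\<in>F \<times> ?B. (\<lambda>(x, t). (g i x, t + n i)) x \<notin> F \<times> ?B}) \<le> \<delta> * real (card (F \<times> ?B))" if i: "i \<in> I" for i
  proof -
    have "{x\<in>F \<times> ?B. (\<lambda>(x, t). (g i x, t + n i)) x \<notin> F \<times> ?B} \<subseteq> {x\<in>F. g i x \<notin> F} \<times> ?B \<union> F \<times> {t\<in>?B. t + n i \<notin> ?B}"
      by auto
    then have "card {x\<in>F \<times> ?B. (\<lambda>(x, t). (g i x, t + n i)) x \<notin> F \<times> ?B} \<le> card ({x\<in>F. g i x \<notin> F} \<times> ?B \<union> F \<times> {t\<in>?B. t + n i \<notin> ?B})"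
      using F(1) by (intro card_mono finite_UnI finite_cartesian_product finite_Collect_conjI) auto
    also have "\<dots> \<le> card {x\<in>F. g i x \<notin> F} * T + card F * card {t\<in>?B. t + n i \<notin> ?B}"
      using card_Un_le[of "{x\<in>F. g i x \<notin> F} \<times> ?B" "F \<times> {t\<in>?B. t + n i \<notin> ?B}"] by (simp add: card_cartesian_product)
    also have "card {t\<in>?B. t + n i \<notin> ?B} \<le> m"
    proof -
      have "{t\<in>?B. t + n i \<notin> ?B} \<subseteq> {0..<- n i} \<union> {int T - n i..<int T}" by auto
      then have "card {t\<in>?B. t + n i \<notin> ?B} \<le> card ({0..<- n i} \<union> {int T - n i..<int T})" by (intro card_mono) auto
      also have "\<dots> \<le> nat (- n i) + nat (n i)" using card_Un_le[of "{0..<- n i}" "{int T - n i..<int T}"] by simp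
      also have "\<dots> = nat \<bar>n i\<bar>" by simp
      also have "\<dots> \<le> m" unfolding m_def using assms(2) i by (intro member_le_sum) auto
      finally show ?thesis .
    qed
    finally have "real (card {x\<in>F \<times> ?B. (\<lambda>(x, t). (g i x, t + n i)) x \<notin> F \<times> ?B}) \<le> real (card {x\<in>F. g i x \<notin> F} * T + card F * m)"
      by (rule of_nat_mono) (simp add: mult_le_mono2)
    also have "\<dots> = real (card {x\<in>F. g i x \<notin> F}) * real T + real (card F) * real m" by simp
    also have "\<dots> \<le> (\<delta> / 2 * real (card F)) * real T + real (card F) * (\<delta> / 2 * real T)"
      using F(3)[OF i] T(1) by (intro add_mono mult_mono) auto
    also have "\<dots> = \<delta> * real (card (F \<times> ?B))" by (simp add: card_cartesian_product)
    finally show ?thesis .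
  qed
  moreover have "finite (F \<times> ?B)" "F \<times> ?B \<noteq> {}" using F(1,2) T(2) by auto
  ultimately show "\<exists>F. finite F \<and> F \<noteq> {} \<and> (\<forall>g\<in>(\<lambda>i (x, t). (g i x, t + n i)) ` I. real (card {x\<in>F. g x \<notin> F}) \<le> \<delta> * real (card F))"
    by blast
qed

text \<open>Different translations would push the highest or the lowest level out of a finite
  invariant set. Equal translations reduce the claim to a single level.\<close>

lemma separated_shift:
  fixes m n :: int and f g :: "'x \<Rightarrow> 'y"
  assumes "surj f" "m = n \<Longrightarrow> separated f g"
  shows "separated (\<lambda>(x, t). (f x, t + m)) (\<lambda>(x, t). (g x, t + n))"
  unfolding separated_def
proof (intro allI impI, elim conjE)
  fix Z :: "('y \<times> int) set" assume Z: "finite Z" "\<forall>x. (case x of (x, t) \<Rightarrow> (f x, t + m)) \<in> Z \<longrightarrow> (case x of (x, t) \<Rightarrow> (g x, t + n)) \<in> Z"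
  have step: "\<exists>y. (y, t - m + n) \<in> Z" if z: "(z, t) \<in> Z" for z t
  proof -
    obtain x where "z = f x" using assms(1) by blast
    then show ?thesis using Z(2)[rule_format, of "(x, t - m)"] z by auto
  qed
  show "Z = {}"
  proof (cases "m = n")
    case True
    have "{x. (x, t) \<in> Z} = {}" for t
    proof -
      have "finite {x. (x, t) \<in> Z}" using finite_vimageI[OF Z(1), of "\<lambda>x. (x, t)"] by (auto simp: inj_on_def vimage_def)
      moreover have "g x \<in> {x. (x, t) \<in> Z}" if "f x \<in> {x. (x, t) \<in> Z}" for x
        using Z(2)[rule_format, of "(x, t - m)"] that True by simp
      ultimately show ?thesis using assms(2)[OF True] unfolding separated_def by blast
    qed
    then show ?thesis by auto
  next
    case False
    show ?thesis
    proof (rule ccontr)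
      assume "Z \<noteq> {}"
      then have ne: "snd ` Z \<noteq> {}" "finite (snd ` Z)" using Z(1) by auto
      have "t - m + n \<in> snd ` Z" if "t \<in> snd ` Z" for t using step that by force
      then have "Max (snd ` Z) - m + n \<in> snd ` Z" "Min (snd ` Z) - m + n \<in> snd ` Z" using ne by simp_all
      then have "Max (snd ` Z) - m + n \<le> Max (snd ` Z)" "Min (snd ` Z) \<le> Min (snd ` Z) - m + n" using ne(2) by simp_all
      then show False using False by linarith
    qed
  qed
qed

text \<open>Equally many points are missing from the part that stays inside and from its image, and
  they can be matched arbitrarily.\<close>

lemma extend_to_permutation:
  assumes "finite F" "inj g"
  shows "\<exists>h. bij_betw h F F \<and> (\<forall>x\<in>F. g x \<in> F \<longrightarrow> h x = g x)"
proof -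
  let ?A = "{x\<in>F. g x \<in> F}"
  have i: "inj_on g ?A" using assms(2) by (auto simp: inj_on_def)
  then have A: "bij_betw g ?A (g ` ?A)" by (rule inj_on_imp_bij_betw)
  have sub: "g ` ?A \<subseteq> F" by blast
  have "card (F - ?A) = card (F - g ` ?A)"
    using card_image[OF i] assms(1) sub by (simp add: card_Diff_subset)
  then obtain k where k: "bij_betw k (F - ?A) (F - g ` ?A)"
    using finite_same_card_bij[of "F - ?A" "F - g ` ?A"] assms(1) by auto
  let ?h = "\<lambda>x. if x \<in> ?A then g x else k x"
  have "bij_betw ?h (?A \<union> (F - ?A)) (g ` ?A \<union> (F - g ` ?A))"
    using A k by (rule bij_betw_disjoint_Un) auto
  moreover have "?A \<union> (F - ?A) = F" "g ` ?A \<union> (F - g ` ?A) = F" using sub by blast+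
  ultimately have "bij_betw ?h F F" by simp
  then show ?thesis by (intro exI[of _ ?h]) auto
qed

text \<open>An invariant set that avoids the exceptional arguments \<open>N\<close> would be a
  finite invariant set for the original maps.\<close>

lemma hits_of_separated:
  fixes f g :: "'x \<Rightarrow> 'x" and f' g' :: "nat \<Rightarrow> nat"
  assumes h: "bij_betw h {..<c} F" and sep: "separated f g"
    and f': "bij_betw f' {..<c} {..<c}"
    and N: "N \<subseteq> {..<c}" and fN: "\<And>x. x < c \<Longrightarrow> x \<notin> N \<Longrightarrow> h (f' x) = f (h x)" "\<And>x. x < c \<Longrightarrow> x \<notin> N \<Longrightarrow> h (g' x) = g (h x)"
    and inj: "inj f"
  shows "hits c f' g' (f' ` N)"
  unfolding hits_def
proof (intro conjI allI impI)
  show "f' ` N \<subseteq> {..<c}" using f' N by (auto simp: bij_betw_def)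
  fix Z assume "Z \<subseteq> {..<c}" "(\<forall>x<c. f' x \<in> Z \<longleftrightarrow> g' x \<in> Z) \<and> Z \<inter> f' ` N = {}"
  then have Z: "Z \<subseteq> {..<c}" "\<forall>x<c. f' x \<in> Z \<longleftrightarrow> g' x \<in> Z" "Z \<inter> f' ` N = {}" by blast+
  have "finite (h ` Z)" using Z(1) finite_subset by blast
  moreover have "g x \<in> h ` Z" if x: "f x \<in> h ` Z" for x
  proof -
    obtain y where y: "y \<in> Z" "f x = h y" using x by blast
    obtain x' where x': "x' < c" "y = f' x'" using bij_betw_imp_surj_on[OF f'] y(1) Z(1) by (metis imageE lessThan_iff subsetD)
    have "x' \<notin> N" using Z(3) y(1) x'(2) by blast
    then have "f x = f (h x')" using fN(1)[OF x'(1)] y(2) x'(2) by simp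
    then have "x = h x'" using inj by (simp add: inj_eq)
    moreover have "g' x' \<in> Z" using Z(2) x' y(1) by blast
    ultimately show ?thesis using fN(2)[OF x'(1) \<open>x' \<notin> N\<close>] by (metis imageI)
  qed
  ultimately have "h ` Z = {}" using sep unfolding separated_def by blast
  then show "Z = {}" by blast
qed

lemma (in quad_matroid) perm_model_exists:
  fixes a :: "pt \<Rightarrow> 'x \<Rightarrow> 'x"
  assumes bij: "\<And>p. p \<in> points W Q \<Longrightarrow> bij (a p)" and am: "amenable (a ` points W Q)"
    and tri: "\<And>e \<beta> \<gamma> x. e \<in> Q \<Longrightarrow> a (Lpt (slot e \<beta> \<gamma>)) (a (Rpt \<beta> e) x) = a (Spt \<gamma> e) x"
    and sep: "\<And>p q. p \<in> points W Q \<Longrightarrow> q \<in> points W Q \<Longrightarrow> p \<noteq> q \<Longrightarrow> (\<And>l. on_line l p \<longleftrightarrow> on_line l q) \<Longrightarrow> separated (a p) (a q)"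
    and sep3: "\<And>w e \<beta> e' \<gamma>. w \<in> W \<Longrightarrow> e \<in> Q \<Longrightarrow> e' \<in> Q \<Longrightarrow> \<not> col (Lpt w) (Rpt \<beta> e) (Spt \<gamma> e') \<Longrightarrow>
      separated (\<lambda>x. a (Lpt w) (a (Rpt \<beta> e) x)) (a (Spt \<gamma> e'))"
    and \<epsilon>: "\<epsilon> > (0::real)"
  shows "\<exists>c b \<pi>. c > 0 \<and> real b \<le> \<epsilon> * real c \<and> perm_model W Q c b \<pi>"
proof -
  \<comment> \<open>Three maps enter each condition, and each contributes its own exceptional
    arguments.\<close>
  have "\<epsilon> / 3 > 0" using \<epsilon> by simp
  then obtain F where "finite F \<and> F \<noteq> {} \<and> (\<forall>k\<in>a ` points W Q. real (card {x\<in>F. k x \<notin> F}) \<le> \<epsilon> / 3 * real (card F))"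
    using amenableD[OF am] by blast
  then have F: "finite F" "F \<noteq> {}" "\<And>p. p \<in> points W Q \<Longrightarrow> real (card {x\<in>F. a p x \<notin> F}) \<le> \<epsilon> / 3 * real (card F)"
    by blast+
  define c where "c = card F"
  have c: "c > 0" using F by (simp add: c_def card_gt_0_iff)
  obtain h where h: "bij_betw h {..<c} F" using ex_bij_betw_nat_finite[OF F(1)] unfolding c_def atLeast0LessThan by blast
  have "\<exists>k. bij_betw k F F \<and> (\<forall>x\<in>F. a p x \<in> F \<longrightarrow> k x = a p x)" if "p \<in> points W Q" for p
    using extend_to_permutation[OF F(1) bij_is_inj[OF bij[OF that]]] .
  then obtain k where k: "\<And>p. p \<in> points W Q \<Longrightarrow> bij_betw (k p) F F" "\<And>p x. p \<in> points W Q \<Longrightarrow> x \<in> F \<Longrightarrow> a p x \<in> F \<Longrightarrow> k p x = a p x"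
    by metis
  define i where "i = inv_into {..<c} h"
  have i: "bij_betw i F {..<c}" using bij_betw_inv_into[OF h] by (simp add: i_def)
  have hi: "h (i x) = x" if "x \<in> F" for x using bij_betw_inv_into_right[OF h that] by (simp add: i_def)
  have hF: "h x \<in> F" if "x < c" for x using h that by (auto simp: bij_betw_def)
  define \<pi> where "\<pi> p = i \<circ> k p \<circ> h" for p
  have perm: "bij_betw (\<pi> p) {..<c} {..<c}" if "p \<in> points W Q" for p
    unfolding \<pi>_def using bij_betw_trans[OF h bij_betw_trans[OF k(1)[OF that] i]] by (simp add: comp_assoc)
  have lt: "\<pi> p x < c" if "p \<in> points W Q" "x < c" for p x using perm[OF that(1)] that(2) by (auto simp: bij_betw_def)
  define N where "N p = {x\<in>{..<c}. a p (h x) \<notin> F}" for p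
  have fN: "finite (N p)" "N p \<subseteq> {..<c}" for p by (auto simp: N_def)
  have h\<pi>: "h (\<pi> p x) = a p (h x)" if "p \<in> points W Q" "x < c" "x \<notin> N p" for p x
  proof -
    have "a p (h x) \<in> F" using that by (simp add: N_def)
    then show ?thesis using k(2)[OF that(1) hF[OF that(2)]] hi by (simp add: \<pi>_def)
  qed
  define b where "b = nat \<lfloor>\<epsilon> * real c\<rfloor>"
  have b: "real b \<le> \<epsilon> * real c" using \<epsilon> by (simp add: b_def)
  have bI: "n \<le> b" if "real n \<le> \<epsilon> * real c" for n using that unfolding b_def by (simp add: le_nat_floor)
  have cN: "real (card (N p)) \<le> \<epsilon> / 3 * real c" if "p \<in> points W Q" for p
  proof -
    have "h ` N p \<subseteq> {x\<in>F. a p x \<notin> F}" using hF by (auto simp: N_def)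
    then have "card (h ` N p) \<le> card {x\<in>F. a p x \<notin> F}" using F(1) by (intro card_mono) auto
    moreover have "card (h ` N p) = card (N p)" using h fN(2)[of p] by (intro card_image) (auto simp: bij_betw_def intro: inj_on_subset)
    ultimately show ?thesis using F(3)[OF that] by (simp add: c_def)
  qed
  \<comment> \<open>Arguments where \<open>p\<close> followed by \<open>q\<close>, or else
    \<open>r\<close>, is not the original action transported along \<open>h\<close>.\<close>
  define M where "M p q r = N p \<union> \<pi> p -` N q \<inter> {..<c} \<union> N r" for p q r
  have M: "finite (M p q r)" "M p q r \<subseteq> {..<c}" for p q r unfolding M_def using fN by auto
  have cM: "card (M p q r) \<le> b" if pts: "p \<in> points W Q" "q \<in> points W Q" "r \<in> points W Q" for p q r
  proof -
    have "card (\<pi> p -` N q \<inter> {..<c}) \<le> card (N q)"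
      using perm[OF pts(1)] fN(1) by (intro card_inj_on_le[of "\<pi> p"]) (auto simp: bij_betw_def inj_on_def)
    then have "card (M p q r) \<le> card (N p) + card (N q) + card (N r)"
      unfolding M_def using card_Un_le[of "N p \<union> \<pi> p -` N q \<inter> {..<c}" "N r"] card_Un_le[of "N p" "\<pi> p -` N q \<inter> {..<c}"] by linarith
    then show ?thesis using cN[OF pts(1)] cN[OF pts(2)] cN[OF pts(3)] by (intro bI) linarith
  qed
  have comp: "h (\<pi> q (\<pi> p x)) = a q (a p (h x))" "h (\<pi> r x) = a r (h x)"
    if "p \<in> points W Q" "q \<in> points W Q" "r \<in> points W Q" "x < c" "x \<notin> M p q r" for p q r x
    using h\<pi>[OF that(1,4)] h\<pi>[OF that(2) lt[OF that(1,4)]] h\<pi>[OF that(3,4)] that(4,5) by (auto simp: M_def)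
  have hinj: "x = y" if "h x = h y" "x < c" "y < c" for x y using h that by (auto simp: bij_betw_def inj_on_def)
  have "perm_model W Q c b \<pi>"
  proof
    show "bij_betw (\<pi> p) {..<c} {..<c}" if "p \<in> points W Q" for p by (rule perm[OF that])
  next
    fix e \<beta> \<gamma> assume e: "e \<in> Q"
    let ?L = "Lpt (slot e \<beta> \<gamma>)" and ?R = "Rpt \<beta> e" and ?S = "Spt \<gamma> e"
    have pts: "?R \<in> points W Q" "?L \<in> points W Q" "?S \<in> points W Q" using e slots by simp_all
    have "x \<in> M ?R ?L ?S" if x: "x < c" "\<pi> ?L (\<pi> ?R x) \<noteq> \<pi> ?S x" for x
    proof (rule ccontr)
      assume "x \<notin> M ?R ?L ?S"
      then have "h (\<pi> ?L (\<pi> ?R x)) = h (\<pi> ?S x)" using comp[OF pts x(1)] tri[OF e] by simp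
      then show False using hinj lt pts x by blast
    qed
    then have "{x\<in>{..<c}. \<pi> ?L (\<pi> ?R x) \<noteq> \<pi> ?S x} \<subseteq> M ?R ?L ?S" by blast
    then show "card {x\<in>{..<c}. \<pi> ?L (\<pi> ?R x) \<noteq> \<pi> ?S x} \<le> b"
      using card_mono[OF M(1)] cM[OF pts] by (meson order_trans)
  next
    fix p q assume pq: "p \<in> points W Q" "q \<in> points W Q" "p \<noteq> q" "\<And>l. on_line l p \<longleftrightarrow> on_line l q"
    have "N p \<subseteq> M p p q" "N q \<subseteq> M p p q" by (auto simp: M_def)
    then have "hits c (\<pi> p) (\<pi> q) (\<pi> p ` M p p q)"
      using h\<pi>[OF pq(1)] h\<pi>[OF pq(2)] bij_is_inj[OF bij[OF pq(1)]]
      by (intro hits_of_separated[OF h sep[OF pq] perm[OF pq(1)] M(2)]) blast+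
    then show "\<exists>B. hits c (\<pi> p) (\<pi> q) B \<and> card B \<le> b"
      using card_image_le[OF M(1), of "\<pi> p" p p q] cM[OF pq(1,1,2)] by (meson order_trans)
  next
    fix w e \<beta> e' \<gamma> assume w: "w \<in> W" "e \<in> Q" "e' \<in> Q" "\<not> col (Lpt w) (Rpt \<beta> e) (Spt \<gamma> e')"
    let ?L = "Lpt w" and ?R = "Rpt \<beta> e" and ?S = "Spt \<gamma> e'" and ?f = "\<lambda>x. \<pi> (Lpt w) (\<pi> (Rpt \<beta> e) x)"
    have pts: "?R \<in> points W Q" "?L \<in> points W Q" "?S \<in> points W Q" using w by simp_all
    have "bij_betw (\<pi> ?L \<circ> \<pi> ?R) {..<c} {..<c}" using bij_betw_trans[OF perm[OF pts(1)] perm[OF pts(2)]] .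
    then have p: "bij_betw ?f {..<c} {..<c}" by (simp add: comp_def)
    have "inj (a ?L \<circ> a ?R)" using bij_is_inj[OF bij_comp[OF bij[OF pts(1)] bij[OF pts(2)]]] .
    then have "inj (\<lambda>x. a ?L (a ?R x))" by (simp add: comp_def)
    then have "hits c ?f (\<pi> ?S) (?f ` M ?R ?L ?S)"
      using comp[OF pts] by (intro hits_of_separated[OF h sep3[OF w] p M(2)]) blast+
    then show "\<exists>B. hits c ?f (\<pi> ?S) B \<and> card B \<le> b"
      using card_image_le[OF M(1), of ?f ?R ?L ?S] cM[OF pts] by (meson order_trans)
  qed
  then show ?thesis using c b by blast
qed

text \<open>Only words act. Taking the identity for \<open>Spt False e\<close> determines the
  auxiliary points of a quadruple through its triangles. An additional translation, by the weight
  and by a multiple of the code of the quadruple, separates points of different weights or different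
  quadruples.\<close>

lemma (in quad_matroid) perm_model_of_action:
  fixes lam :: "word \<Rightarrow> 'x \<Rightarrow> 'x" and \<theta> :: "word \<Rightarrow> int"
  assumes bij: "\<And>w. w \<in> W \<Longrightarrow> bij (lam w)" and am: "amenable (lam ` W)"
    and quad: "\<And>a b c d. (a, b, c, d) \<in> Q \<Longrightarrow> \<exists>v. lam b = lam a \<circ> v \<and> lam d = lam c \<circ> v"
    and \<theta>: "\<And>a b c d. (a, b, c, d) \<in> Q \<Longrightarrow> \<theta> b - \<theta> a = \<theta> d - \<theta> c"
    and sep: "\<And>w w'. w \<in> W \<Longrightarrow> w' \<in> W \<Longrightarrow> w \<noteq> w' \<Longrightarrow> \<theta> w = \<theta> w' \<Longrightarrow> separated (lam w) (lam w')"
    and id: "lam [] = id" and \<epsilon>: "\<epsilon> > (0::real)"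
  shows "\<exists>c b \<pi>. c > 0 \<and> real b \<le> \<epsilon> * real c \<and> perm_model W Q c b \<pi>"
proof -
  have fW: "finite W" by (rule finite_W)
  define B where "B = (\<Sum>w\<in>W. \<bar>\<theta> w\<bar>)"
  have B: "\<bar>\<theta> w\<bar> \<le> B" if "w \<in> W" for w unfolding B_def using fW that by (intro member_le_sum) auto
  \<comment> \<open>Combinations of up to three weights are at most \<open>3 * B\<close> in absolute
    value, so steps of \<open>6 * B + 1\<close> keep different quadruples apart.\<close>
  define n where "n e = (6 * B + 1) * int (quad_code e)" for e
  have key: "e = e'" if "n e + u = n e' + u'" "\<bar>u\<bar> \<le> 3 * B" "\<bar>u'\<bar> \<le> 3 * B" for e e' u u'
  proof (rule ccontr)
    assume "e \<noteq> e'"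
    then have "1 \<le> \<bar>int (quad_code e) - int (quad_code e')\<bar>" using quad_code_eq_iff[of e e'] by linarith
    moreover have "0 \<le> B" by (simp add: B_def sum_nonneg)
    ultimately have "(6 * B + 1) * 1 \<le> (6 * B + 1) * \<bar>int (quad_code e) - int (quad_code e')\<bar>" by (intro mult_left_mono) auto
    also have "\<dots> = \<bar>n e - n e'\<bar>" using \<open>0 \<le> B\<close> by (simp add: n_def abs_mult flip: right_diff_distrib)
    also have "\<dots> \<le> 6 * B" using that by linarith
    finally show False by simp
  qed
  define g where "g p = (case p of Joint i \<Rightarrow> id | Lpt w \<Rightarrow> lam w | Rpt \<beta> e \<Rightarrow> inv_into UNIV (lam (slot e \<beta> False))
    | Spt \<gamma> e \<Rightarrow> lam (slot e False \<gamma>) \<circ> inv_into UNIV (lam (slot e False False)))" for p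
  define m where "m p = (case p of Joint i \<Rightarrow> 0 | Lpt w \<Rightarrow> \<theta> w | Rpt \<beta> e \<Rightarrow> n e - \<theta> (slot e \<beta> False)
    | Spt \<gamma> e \<Rightarrow> n e + \<theta> (slot e False \<gamma>) - \<theta> (slot e False False))" for p
  define a where "a p = (\<lambda>(x, t). (g p x, t + m p))" for p
  have inv: "lam w (inv_into UNIV (lam w) x) = x" "inv_into UNIV (lam w) (lam w x) = x" if "w \<in> W" for w x
    using bij[OF that] by (simp_all add: bij_def surj_f_inv_f)
  have bg: "bij (g p)" if "p \<in> points W Q" for p
  proof -
    have "bij (lam (slot e \<beta> \<gamma>))" if "e \<in> Q" for e \<beta> \<gamma> using bij slots that by blast
    then show ?thesis using that bij by (cases p; simp add: g_def bij_comp bij_imp_bij_inv)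
  qed
  have ba: "bij (a p)" if "p \<in> points W Q" for p
  proof -
    have "bij_betw (map_prod (g p) (\<lambda>t. t + m p)) (UNIV \<times> UNIV) (UNIV \<times> UNIV)"
      using bg[OF that] by (intro bij_betw_map_prod) (auto intro: bij_plus_right)
    moreover have "map_prod (g p) (\<lambda>t. t + m p) = a p" by (auto simp: a_def)
    ultimately show ?thesis by simp
  qed
  have "g p \<in> {h \<circ> inv_into UNIV k | h k. h \<in> lam ` W \<and> k \<in> lam ` W}" if p: "p \<in> points W Q" for p
  proof -
    have I: "h \<circ> inv_into UNIV k \<in> {h \<circ> inv_into UNIV k | h k. h \<in> lam ` W \<and> k \<in> lam ` W}" if "h \<in> lam ` W" "k \<in> lam ` W" for h k
      using that by blast
    have e: "id \<in> lam ` W" using id Nil_W by (metis imageI)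
    have l: "lam (slot e \<beta> \<gamma>) \<in> lam ` W" if "e \<in> Q" for e \<beta> \<gamma> using slots[OF that] by (rule imageI)
    show ?thesis
    proof (cases p)
      case (Joint i) then show ?thesis using I[OF e e] by (simp add: g_def)
    next
      case (Lpt w) then show ?thesis using I[OF _ e, of "lam w"] p by (simp add: g_def)
    next
      case (Rpt \<beta> q) then show ?thesis using I[OF e l[of q \<beta> False]] p by (simp add: g_def)
    next
      case (Spt \<gamma> q) then show ?thesis using I[OF l[of q False \<gamma>] l[of q False False]] p by (simp add: g_def)
    qed
  qed
  then have "g ` points W Q \<subseteq> {h \<circ> inv_into UNIV k | h k. h \<in> lam ` W \<and> k \<in> lam ` W}" by (rule image_subsetI)
  then have "amenable (g ` points W Q)"
    using amenable_mono[OF amenable_comp_inv[OF am]] bij by blast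
  then have am': "amenable (a ` points W Q)"
    using amenable_shift[of g "points W Q" m] finite_P by (simp add: a_def[abs_def])
  have sep': "separated (lam w) (lam w')" if "w \<in> W" "w' \<in> W" "w \<noteq> w'" "\<theta> w = \<theta> w'" for w w'
    using sep that by blast
  have slot_eq: "lam (slot e \<beta> \<gamma>) (inv_into UNIV (lam (slot e \<beta> False)) x) = lam (slot e False \<gamma>) (inv_into UNIV (lam (slot e False False)) x)"
    and \<theta>_eq: "\<theta> (slot e \<beta> \<gamma>) - \<theta> (slot e \<beta> False) = \<theta> (slot e False \<gamma>) - \<theta> (slot e False False)" if e: "e \<in> Q" for e \<beta> \<gamma> x
  proof -
    obtain A B C D where e': "e = (A, B, C, D)" by (cases e)
    obtain v where v: "lam B = lam A \<circ> v" "lam D = lam C \<circ> v" using quad e e' by blast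
    have w: "A \<in> W" "B \<in> W" using slots[OF e, of False False] slots[OF e, of True False] by (simp_all add: e')
    have "lam D (inv_into UNIV (lam B) x) = lam C (inv_into UNIV (lam A) x)"
    proof -
      have "lam A (v (inv_into UNIV (lam B) x)) = x" using inv(1)[OF w(2), of x] v(1) by simp
      then have "v (inv_into UNIV (lam B) x) = inv_into UNIV (lam A) x" using inv(2)[OF w(1)] by metis
      then show ?thesis using v(2) by simp
    qed
    then show "lam (slot e \<beta> \<gamma>) (inv_into UNIV (lam (slot e \<beta> False)) x) = lam (slot e False \<gamma>) (inv_into UNIV (lam (slot e False False)) x)"
      using inv(1)[OF w(1)] inv(1)[OF w(2)] by (simp add: e')
    show "\<theta> (slot e \<beta> \<gamma>) - \<theta> (slot e \<beta> False) = \<theta> (slot e False \<gamma>) - \<theta> (slot e False False)"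
      using \<theta>[of A B C D] e by (simp add: e')
  qed
  have quot: "separated (\<lambda>x. f (k x)) (\<lambda>x. f' (k x))" if "separated f f'" "surj k" for f f' :: "'x \<Rightarrow> 'x" and k
    using that unfolding separated_def by (metis surjD)
  have inv_sep: "separated (inv_into UNIV (lam w)) (inv_into UNIV (lam w'))" if w: "w \<in> W" "w' \<in> W" "separated (lam w') (lam w)" for w w'
    unfolding separated_def
  proof (intro allI impI, elim conjE)
    fix Z assume Z: "finite Z" "\<forall>x. inv_into UNIV (lam w) x \<in> Z \<longrightarrow> inv_into UNIV (lam w') x \<in> Z"
    have "lam w x \<in> lam w' ` Z" if "x \<in> Z" for x
      using Z(2)[rule_format, of "lam w x"] inv[OF w(1)] inv[OF w(2)] that by (metis imageI)
    then have "lam w x \<in> lam w' ` Z" if "lam w' x \<in> lam w' ` Z" for x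
      using that inv(2)[OF w(2)] by (metis imageE)
    then have "lam w' ` Z = {}" using w(3) Z(1) unfolding separated_def by blast
    then show "Z = {}" by blast
  qed
  show ?thesis
  proof (rule perm_model_exists[OF ba am' _ _ _ \<epsilon>])
    fix e \<beta> \<gamma> x assume e: "e \<in> Q"
    show "a (Lpt (slot e \<beta> \<gamma>)) (a (Rpt \<beta> e) x) = a (Spt \<gamma> e) x"
      using slot_eq[OF e, of \<beta> \<gamma>] \<theta>_eq[OF e, of \<beta> \<gamma>] by (cases x) (simp add: a_def g_def m_def)
  next
    fix p q assume pq: "p \<in> points W Q" "q \<in> points W Q" "p \<noteq> q" "\<And>l. on_line l p \<longleftrightarrow> on_line l q"
    show "separated (a p) (a q)"
      unfolding a_def
    proof (rule separated_shift)
      show "surj (g p)" using bg[OF pq(1)] by (rule bij_is_surj)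
      assume mm: "m p = m q"
      show "separated (g p) (g q)"
        using pq
      proof (rule same_lines_cases)
        fix w w' assume "p = Lpt w" "q = Lpt w'"
        then show ?thesis using pq mm sep'[of w w'] by (simp add: g_def m_def)
      next
        fix \<beta> e \<beta>' e' assume Rpt: "p = Rpt \<beta> e" and q: "q = Rpt \<beta>' e'"
        have e: "e \<in> Q" "e' \<in> Q" using pq(1,2) Rpt q by simp_all
        have "n e + (- \<theta> (slot e \<beta> False)) = n e' + (- \<theta> (slot e' \<beta>' False))" using mm Rpt q by (simp add: m_def)
        then have ee: "e = e'" by (rule key) (use B[OF slots[OF e(1), of \<beta> False]] B[OF slots[OF e(2), of \<beta>' False]] in linarith)+
        have "slot e \<beta> False \<noteq> slot e \<beta>' False" using good_quad_slot(1)[OF good[OF e(1)]] ee pq(3) q Rpt by simp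
        moreover have "\<theta> (slot e \<beta>' False) = \<theta> (slot e \<beta> False)" using mm ee q Rpt by (simp add: m_def)
        ultimately have "separated (lam (slot e \<beta>' False)) (lam (slot e \<beta> False))" using sep' slots[OF e(1)] by metis
        then show ?thesis using inv_sep slots[OF e(1)] ee q Rpt by (simp add: g_def)
      next
        fix \<gamma> e \<gamma>' e' assume Spt: "p = Spt \<gamma> e" and q: "q = Spt \<gamma>' e'"
        have e: "e \<in> Q" "e' \<in> Q" using pq(1,2) Spt q by simp_all
        have "n e + (\<theta> (slot e False \<gamma>) - \<theta> (slot e False False)) = n e' + (\<theta> (slot e' False \<gamma>') - \<theta> (slot e' False False))"
          using mm Spt q by (simp add: m_def)
        then have ee: "e = e'"
          by (rule key) (use B[OF slots[OF e(1), of False \<gamma>]] B[OF slots[OF e(2), of False \<gamma>']]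
            B[OF slots[OF e(1), of False False]] B[OF slots[OF e(2), of False False]] in linarith)+
        have "slot e False \<gamma> \<noteq> slot e False \<gamma>'" using good_quad_slot(2)[OF good[OF e(1)]] ee pq(3) q Spt by simp
        moreover have "\<theta> (slot e False \<gamma>) = \<theta> (slot e False \<gamma>')" using mm ee q Spt by (simp add: m_def)
        ultimately have "separated (lam (slot e False \<gamma>)) (lam (slot e False \<gamma>'))" using sep' slots[OF e(1)] by metis
        moreover have "surj (inv_into UNIV (lam (slot e False False)))"
          using bij[OF slots[OF e(1)]] by (intro bij_is_surj bij_imp_bij_inv)
        ultimately show ?thesis using quot ee q Spt by (simp add: g_def comp_def)
      qed
    qed
  next
    fix w e \<beta> e' \<gamma> assume w: "w \<in> W" "e \<in> Q" "e' \<in> Q" "\<not> col (Lpt w) (Rpt \<beta> e) (Spt \<gamma> e')"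
    let ?L = "Lpt w" and ?R = "Rpt \<beta> e" and ?S = "Spt \<gamma> e'"
    have pts: "?R \<in> points W Q" "?L \<in> points W Q" "?S \<in> points W Q" using w by simp_all
    have eq: "(\<lambda>x. a ?L (a ?R x)) = (\<lambda>(x, t). (g ?L (g ?R x), t + (m ?R + m ?L)))" by (auto simp: a_def)
    have "separated (\<lambda>(x, t). (g ?L (g ?R x), t + (m ?R + m ?L))) (\<lambda>(x, t). (g ?S x, t + m ?S))"
    proof (rule separated_shift)
      show "surj (\<lambda>x. g ?L (g ?R x))"
        using bij_is_surj[OF bij_comp[OF bg[OF pts(1)] bg[OF pts(2)]]] by (simp add: comp_def)
      assume mm: "m ?R + m ?L = m ?S"
      have "n e + (\<theta> w - \<theta> (slot e \<beta> False)) = n e' + (\<theta> (slot e' False \<gamma>) - \<theta> (slot e' False False))"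
        using mm by (simp add: m_def)
      then have ee: "e = e'"
        by (rule key) (use B[OF w(1)] B[OF slots[OF w(2), of \<beta> False]] B[OF slots[OF w(3), of False \<gamma>]]
            B[OF slots[OF w(3), of False False]] in linarith)+
      have "w \<noteq> slot e \<beta> \<gamma>" using w(4) triangle_col[OF w(2), of \<beta> \<gamma>] ee by auto
      moreover have "\<theta> w = \<theta> (slot e \<beta> \<gamma>)" using mm \<theta>_eq[OF w(2), of \<beta> \<gamma>] ee by (simp add: m_def)
      ultimately have "separated (lam w) (lam (slot e \<beta> \<gamma>))" using sep' w(1) slots[OF w(2)] by metis
      moreover have "surj (inv_into UNIV (lam (slot e \<beta> False)))"
        using bij[OF slots[OF w(2)]] by (intro bij_is_surj bij_imp_bij_inv)
      ultimately have "separated (\<lambda>x. lam w (inv_into UNIV (lam (slot e \<beta> False)) x)) (\<lambda>x. lam (slot e \<beta> \<gamma>) (inv_into UNIV (lam (slot e \<beta> False)) x))"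
        by (rule quot)
      then show "separated (\<lambda>x. g ?L (g ?R x)) (g ?S)"
        using slot_eq[OF w(2), of \<beta> \<gamma>] ee by (simp add: g_def comp_def)
    qed
    then show "separated (\<lambda>x. a ?L (a ?R x)) (a ?S)" unfolding eq by (simp add: a_def)
  qed
qed

section \<open>The model: stacks of integers with a central extension\<close>

section \<open>Stacks\<close>

text \<open>A linear functional on finitely supported integer sequences. Polynomials serve as these
  sequences, the coefficient of degree \<open>i\<close> being entry \<open>i\<close>.\<close>

definition moment :: "(nat \<Rightarrow> int) \<Rightarrow> int poly \<Rightarrow> int" where
  "moment h A = (\<Sum>i\<le>degree A. h i * coeff A i)"

lemma moment_eq:
  assumes "degree A < n"
  shows "moment h A = (\<Sum>i<n. h i * coeff A i)"
  unfolding moment_def using assms by (intro sum.mono_neutral_left) (auto simp: coeff_eq_0)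

lemma moment_pCons: "moment h (pCons b A) = h 0 * b + moment (\<lambda>i. h (Suc i)) A"
proof -
  have "degree (pCons b A) < Suc (Suc (degree A))" using degree_pCons_le[of b A] by linarith
  then show ?thesis
    using moment_eq[of A "Suc (degree A)" "\<lambda>i. h (Suc i)"] by (simp add: moment_eq sum.lessThan_Suc_shift del: sum.lessThan_Suc)
qed

lemma moment_add: "moment h (A + B) = moment h A + moment h B"
proof -
  let ?n = "Suc (max (degree A) (degree B))"
  have "degree (A + B) < ?n" "degree A < ?n" "degree B < ?n"
    using degree_add_le_max[of A B] by auto
  then show ?thesis by (simp add: moment_eq[of _ ?n] distrib_left sum.distrib del: sum.lessThan_Suc)
qed

lemma moment_const: "moment h [:b:] = h 0 * b"
  by (simp add: moment_def)

lemma moment_combine: "moment (\<lambda>i. f i + c * g i) A = moment f A + c * moment g A"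
  by (simp add: moment_def distrib_right sum.distrib sum_distrib_left mult.assoc)

text \<open>A main stack with its top at degree 0, and a family of side stacks. A stack is infinite
  with almost all entries 0, so it is never exhausted, and \<open>push\<close> and
  \<open>pop\<close> are inverse bijections.\<close>

type_synonym stacks = "int poly \<times> (nat \<Rightarrow> int poly)"

definition push :: "nat \<Rightarrow> stacks \<Rightarrow> stacks" where
  "push k X = (pCons (coeff (snd X k) 0) (fst X), (snd X)(k := poly_shift 1 (snd X k)))"

definition pop :: "nat \<Rightarrow> stacks \<Rightarrow> stacks" where
  "pop k X = (poly_shift 1 (fst X), (snd X)(k := pCons (coeff (fst X) 0) (snd X k)))"

definition incr :: "stacks \<Rightarrow> stacks" where
  "incr X = (fst X + [:1:], snd X)"

definition decr :: "stacks \<Rightarrow> stacks" where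
  "decr X = (fst X + [:-1:], snd X)"

lemma pCons_poly_shift [simp]: "pCons (coeff A 0) (poly_shift (Suc 0) A) = A"
  by (rule poly_eqI) (simp add: coeff_pCons coeff_poly_shift split: nat.split)

lemma poly_shift_pCons [simp]: "poly_shift (Suc 0) (pCons a A) = A"
  by (rule poly_eqI) (simp add: coeff_poly_shift)

lemma poly_shift_add: "poly_shift n (A + B) = poly_shift n A + poly_shift n (B :: int poly)"
  by (rule poly_eqI) (simp add: coeff_poly_shift)

lemma push_pop [simp]: "push k (pop k X) = X" "pop k (push k X) = X"
  by (simp_all add: push_def pop_def)

lemma incr_decr [simp]: "incr (decr X) = X" "decr (incr X) = X"
  by (simp_all add: incr_def decr_def add.assoc)

lemma bij_push: "bij (push k)" and bij_pop: "bij (pop k)" and bij_incr: "bij incr"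
  by (rule o_bij[of "pop k"] o_bij[of "push k"] o_bij[of decr]; simp add: fun_eq_iff)+

text \<open>Pushing from \<open>j\<close> and popping to \<open>i\<close> transfers an entry between
  two side stacks and leaves the main stack alone, so it commutes with \<open>incr\<close> and with
  pushes from a third stack. In the last two rules both conjugates act on the second entry of the
  main stack.\<close>

lemma stack_rules:
  "i \<noteq> k \<Longrightarrow> j \<noteq> k \<Longrightarrow> push i (push k (pop i (push j X))) = push j (push k X)"
  "push i (incr (pop i (push j X))) = push j (incr X)"
  "i \<noteq> k \<Longrightarrow> j \<noteq> k \<Longrightarrow> pop j (push i (pop k (pop i X))) = pop k (pop j X)"
  "pop j (push i (incr (pop i X))) = incr (pop j X)"
  by (auto simp: push_def pop_def incr_def fun_eq_iff coeff_pCons poly_shift_add)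

section \<open>The model of a relation system\<close>

type_synonym state = "stacks \<times> stacks \<times> int"

text \<open>\<open>J\<close> stands for a set of configurations that is closed under steps in both
  directions and separates the start from the halting configuration.\<close>

locale stack_model =
  fixes R :: rels and N :: nat and J :: "nat \<Rightarrow> nat \<Rightarrow> nat \<Rightarrow> bool"
  assumes supp: "supported R N"
    and start: "J 0 0 0" and halt: "\<not> J 1 0 0"
    and J0: "R 0 i j \<Longrightarrow> J j (Suc a) b \<longleftrightarrow> J i a b"
    and J1: "R 1 i j \<Longrightarrow> J j a (Suc b) \<longleftrightarrow> J i a b"
    and J2: "R 2 i j \<Longrightarrow> J i 0 b \<longleftrightarrow> J j 0 b"
    and J3: "R 3 i j \<Longrightarrow> J i a 0 \<longleftrightarrow> J j a 0"
begin

text \<open>The bilinear form with matrix \<open>J i\<close>. Raising entry \<open>a\<close> of one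
  stack and entry \<open>b\<close> of the other gives the mixed difference \<open>J i a b\<close>,
  which is the value of the commutator behind \<open>zero_at\<close>.\<close>

definition \<Phi> :: "nat \<Rightarrow> stacks \<Rightarrow> stacks \<Rightarrow> int" where
  "\<Phi> i X Y = moment (\<lambda>a. moment (\<lambda>b. of_bool (J i a b)) (fst Y)) (fst X)"

definition row :: "nat \<Rightarrow> stacks \<Rightarrow> int" where
  "row i Y = moment (\<lambda>b. of_bool (J i 0 b)) (fst Y)"

definition column :: "nat \<Rightarrow> stacks \<Rightarrow> int" where
  "column i X = moment (\<lambda>a. of_bool (J i a 0)) (fst X)"

lemma \<Phi>_incr1: "\<Phi> i (incr X) Y = \<Phi> i X Y + row i Y"
  by (simp add: \<Phi>_def row_def incr_def moment_add moment_const)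

lemma \<Phi>_incr2: "\<Phi> i X (incr Y) = \<Phi> i X Y + column i X"
  using moment_combine[of "\<lambda>a. moment (\<lambda>b. of_bool (J i a b)) (fst Y)" 1 "\<lambda>a. of_bool (J i a 0)" "fst X"]
  by (simp add: \<Phi>_def column_def incr_def moment_add moment_const)

lemma row_incr: "row i (incr Y) = row i Y + of_bool (J i 0 0)" and column_incr: "column i (incr X) = column i X + of_bool (J i 0 0)"
  by (simp_all add: row_def column_def incr_def moment_add moment_const)

text \<open>All entries move from \<open>a\<close> to \<open>a + 1\<close>, as in the passage from
  state \<open>i\<close> to state \<open>j\<close>; the new top entry contributes the
  \<open>row\<close> term.\<close>

lemma \<Phi>_push: "R 0 i j \<Longrightarrow> \<Phi> j (push k X) Y = \<Phi> i X Y + coeff (snd X k) 0 * row j Y"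
  by (simp add: \<Phi>_def row_def push_def moment_pCons J0)

lemma \<Phi>_pop:
  assumes "R 1 i j"
  shows "\<Phi> j X Y = \<Phi> i X (pop k Y) + coeff (fst Y) 0 * column j X"
proof -
  have "moment (\<lambda>b. of_bool (J j a b)) (fst Y) = moment (\<lambda>b. of_bool (J i a b)) (poly_shift 1 (fst Y)) + coeff (fst Y) 0 * of_bool (J j a 0)" for a
    using moment_pCons[of "\<lambda>b. of_bool (J j a b)" "coeff (fst Y) 0" "poly_shift 1 (fst Y)"] by (simp add: J1[OF assms])
  then show ?thesis
    by (simp add: \<Phi>_def column_def pop_def moment_combine)
qed

lemma row_zero: "R 2 i j \<Longrightarrow> row i Y = row j Y"
  by (simp add: row_def J2)

lemma column_zero: "R 3 i j \<Longrightarrow> column i X = column j X"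
  by (simp add: column_def J3)

text \<open>As in a Heisenberg group, \<open>z\<close> is a central coordinate. Letter 10 acts as
  \<open>q u_0\<close> with one unit less: its relator contains the commutator at the start
  configuration, which is 1 by \<open>J 0 0 0\<close>.\<close>

fun act :: "nat \<Rightarrow> state \<Rightarrow> state" where
  "act x (X, Y, z) = (if x < 4 then (push x X, Y, z) else if x = 4 then (incr X, Y, z)
     else if x < 9 then (X, pop (x - 5) Y, z) else if x = 9 then (X, incr Y, z)
     else if x = 10 then (X, incr Y, z + \<Phi> 0 X Y - 1) else (X, Y, z + \<Phi> (x - 11) X Y))"

primrec lam :: "word \<Rightarrow> state \<Rightarrow> state" where
  "lam [] = id"
| "lam (x # w) = act x \<circ> lam w"

lemma lam_append: "lam (w @ w') = lam w \<circ> lam w'"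
  by (induction w) (simp_all add: comp_assoc)

text \<open>For a word family the witness is the action of \<open>b\<close>, as \<open>a\<close> is
  empty. For a relator it is the quotient computed from one side, and the transformation laws of
  \<open>\<Phi>\<close>, \<open>row\<close> and \<open>column\<close> show that the other side has
  the same quotient.\<close>

lemma lam_quads:
  assumes "(a, b, c, d) \<in> quads R N"
  shows "\<exists>v. lam b = lam a \<circ> v \<and> lam d = lam c \<circ> v"
proof -
  obtain k Q i j where Q: "(k, Q) \<in> set families" "admits R k i j" "(a, b, c, d) = subst_quad i j Q"
    using assms unfolding quads_def by blast
  then consider "(k, Q) \<in> set word_families" | "(k, Q) \<in> set relator_families" by (auto simp: families_def)
  then show ?thesis
  proof cases
    case 1
    have "\<forall>(k, a, b, c, d) \<in> set word_families. a = [] \<and> d = c @ b" by (simp add: word_families_def)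
    then have "a = []" "d = c @ b" using 1 Q(3) by (cases Q; auto)+
    then show ?thesis by (auto simp: lam_append)
  next
    case 2
    show ?thesis
      using 2 Q(2,3) unfolding relator_families_def
      apply (simp add: fun_eq_iff)
      apply (elim disjE; clarsimp simp: subst_letter_def admits_def)
      \<comment> \<open>The subgoals come in the order of \<open>relator_families\<close>.\<close>
      subgoal by (rule exI[of _ "\<lambda>(X, Y, z). (pop 0 (push 1 X), Y, z)"]) (simp add: stack_rules)
      subgoal by (rule exI[of _ "\<lambda>(X, Y, z). (pop 0 (push 1 X), Y, z)"]) (simp add: stack_rules)
      subgoal by (rule exI[of _ "\<lambda>(X, Y, z). (X, push 0 (pop 2 (pop 0 Y)), z)"]) (simp add: stack_rules)
      subgoal by (rule exI[of _ "\<lambda>(X, Y, z). (X, push 0 (incr (pop 0 Y)), z)"]) (simp add: stack_rules)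
      subgoal by (rule exI[of _ "\<lambda>(X, Y, z). (pop 1 (push 2 X), Y, z)"]) (simp add: stack_rules)
      subgoal by (rule exI[of _ "\<lambda>(X, Y, z). (pop 1 (push 2 X), Y, z)"]) (simp add: stack_rules)
      subgoal by (rule exI[of _ "\<lambda>(X, Y, z). (X, push 1 (pop 3 (pop 1 Y)), z)"]) (simp add: stack_rules)
      subgoal by (rule exI[of _ "\<lambda>(X, Y, z). (X, push 1 (incr (pop 1 Y)), z)"]) (simp add: stack_rules)
      subgoal by (rule exI[of _ "\<lambda>(X, Y, z). (pop 1 (push 3 X), Y, z)"]) (simp add: stack_rules)
      subgoal by (rule exI[of _ "\<lambda>(X, Y, z). (pop 1 (push 3 X), Y, z)"]) (simp add: stack_rules)
      subgoal by (rule exI[of _ "\<lambda>(X, Y, z). (X, push 1 (pop 0 (pop 1 Y)), z)"]) (simp add: stack_rules)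
      subgoal by (rule exI[of _ "\<lambda>(X, Y, z). (X, push 1 (incr (pop 1 Y)), z)"]) (simp add: stack_rules)
      subgoal by (rule exI[of _ "act 0"]) simp
      subgoal by (rule exI[of _ "act 0"]) simp
      subgoal by (rule exI[of _ "act 5"]) simp
      subgoal using halt by (intro exI[of _ "\<lambda>(X, Y, z). (X, incr Y, z + \<Phi> 1 X Y - \<Phi> 1 X (incr Y))"]) (simp add: \<Phi>_incr1 \<Phi>_incr2 row_incr column_incr)
      subgoal using start by (intro exI[of _ "\<lambda>(X, Y, z). (X, incr Y, z + \<Phi> 0 X Y - 1 - \<Phi> 0 X (incr Y))"]) (simp add: \<Phi>_incr1 \<Phi>_incr2 row_incr column_incr)
      subgoal by (rule exI[of _ "\<lambda>(X, Y, z). (pop 1 (push 0 X), Y, z + \<Phi> i X Y - \<Phi> j (push 0 X) Y)"]) (simp add: stack_rules \<Phi>_push, simp add: incr_def)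
      subgoal by (rule exI[of _ "\<lambda>(X, Y, z). (pop 1 (push 0 X), Y, z + \<Phi> i X Y - \<Phi> j (push 0 X) Y)"]) (simp add: stack_rules \<Phi>_push, simp add: push_def)
      subgoal by (rule exI[of _ "\<lambda>(X, Y, z). (X, push 1 (incr (pop 1 Y)), z + \<Phi> j X Y - \<Phi> j X (push 1 (incr (pop 1 Y))))"])
        (simp add: stack_rules \<Phi>_pop[of i j _ _ 0], simp add: push_def pop_def incr_def)
      subgoal by (rule exI[of _ "\<lambda>(X, Y, z). (X, push 1 (pop 2 (pop 1 Y)), z + \<Phi> j X Y - \<Phi> j X (push 1 (pop 2 (pop 1 Y))))"])
        (simp add: stack_rules \<Phi>_pop[of i j _ _ 0], simp add: push_def pop_def incr_def)
      subgoal by (rule exI[of _ "\<lambda>(X, Y, z). (X, Y, z + \<Phi> i X Y - \<Phi> j X Y)"]) (simp add: \<Phi>_incr1 row_zero[of i j])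
      subgoal by (rule exI[of _ "\<lambda>(X, Y, z). (X, incr Y, z + \<Phi> i X Y - \<Phi> i X (incr Y))"]) (simp add: \<Phi>_incr2 column_zero[of i j])
      done
  qed
qed

lemma bij_shear: "bij f \<Longrightarrow> bij g \<Longrightarrow> bij (\<lambda>(X, Y, z). (f X, g Y, z + h X Y))" for f :: "'x \<Rightarrow> 'x" and g :: "'y \<Rightarrow> 'y" and h :: "'x \<Rightarrow> 'y \<Rightarrow> int"
  by (rule o_bij[of "\<lambda>(X, Y, z). (inv_into UNIV f X, inv_into UNIV g Y, z - h (inv_into UNIV f X) (inv_into UNIV g Y))"])
    (auto simp: fun_eq_iff bij_def surj_f_inv_f)

definition shear1 :: "nat \<Rightarrow> stacks \<Rightarrow> stacks" where
  "shear1 x = (if x < 4 then push x else if x = 4 then incr else id)"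

definition shear2 :: "nat \<Rightarrow> stacks \<Rightarrow> stacks" where
  "shear2 x = (if x \<in> {5..8} then pop (x - 5) else if x = 9 \<or> x = 10 then incr else id)"

definition shear3 :: "nat \<Rightarrow> stacks \<Rightarrow> stacks \<Rightarrow> int" where
  "shear3 x X Y = (if x < 10 then 0 else if x = 10 then \<Phi> 0 X Y - 1 else \<Phi> (x - 11) X Y)"

lemma act_shear: "act x = (\<lambda>(X, Y, z). (shear1 x X, shear2 x Y, z + shear3 x X Y))"
  by (auto simp: fun_eq_iff shear1_def shear2_def shear3_def)

lemma bij_act: "bij (act x)"
  unfolding act_shear by (rule bij_shear) (auto simp: shear1_def shear2_def bij_push bij_pop bij_incr)

lemma bij_lam: "bij (lam w)"
proof (induction w)
  case (Cons x w)
  show ?case unfolding lam.simps by (rule bij_comp[OF Cons bij_act])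
qed (simp only: lam.simps bij_id)

end

section \<open>Amenability of the model\<close>

text \<open>The images of \<open>B\<close> under the powers of \<open>g\<close> below
  \<open>n\<close> lie on different levels, so they are disjoint, and all of them are inside
  \<open>F\<close>.\<close>

lemma level_bound:
  assumes "finite F" "B \<subseteq> F" "inj g" "\<And>x j. x \<in> B \<Longrightarrow> j < n \<Longrightarrow> (g ^^ j) x \<in> F \<and> lev ((g ^^ j) x) = (j :: nat)"
  shows "n * card B \<le> card F"
proof -
  have "inj_on (\<lambda>(j, x). (g ^^ j) x) ({..<n} \<times> B)"
  proof (rule inj_onI, clarify)
    fix j x j' x' assume *: "j < n" "x \<in> B" "j' < n" "x' \<in> B" "(g ^^ j) x = (g ^^ j') x'"
    then have "j = j'" using assms(4) by metis
    moreover have "inj (g ^^ j)" using assms(3) by (rule inj_fn)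
    ultimately show "j = j' \<and> x = x'" using *(5) by (simp add: inj_eq)
  qed
  moreover have "(\<lambda>(j, x). (g ^^ j) x) ` ({..<n} \<times> B) \<subseteq> F" using assms(4) by auto
  ultimately have "card ({..<n} \<times> B) \<le> card F" using assms(1) by (rule card_inj_on_le)
  then show ?thesis by (simp add: card_cartesian_product)
qed

text \<open>Entries below the height are positive, so the height can be read off the stack.\<close>

definition tower :: "nat \<Rightarrow> nat \<Rightarrow> int poly \<Rightarrow> bool" where
  "tower M n A \<longleftrightarrow> (\<forall>i<n. 1 \<le> coeff A i \<and> coeff A i \<le> int M) \<and> (\<forall>i\<ge>n. coeff A i = 0)"

lemma tower_unique: "tower M n A \<Longrightarrow> tower M n' A \<Longrightarrow> n = n'"
proof -
  have "\<not> m < m'" if tt: "tower M m' A" "tower M m A" for m m'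
  proof
    assume "m < m'"
    have "\<forall>i<m'. 1 \<le> coeff A i \<and> coeff A i \<le> int M" "\<forall>i\<ge>m. coeff A i = 0"
      using tt unfolding tower_def by simp_all
    then have "1 \<le> coeff A m" "coeff A m = 0" using \<open>m < m'\<close> by (blast, simp)
    then
show False by simp
  qed
  then show "tower M n A \<Longrightarrow> tower M n' A \<Longrightarrow> n = n'" using linorder_less_linear[of n n'] by blast
qed

lemma tower_pCons: "tower M (Suc n) (pCons b A) \<longleftrightarrow> 1 \<le> b \<and> b \<le> int M \<and> tower M n A"
proof
  assume *: "tower M (Suc n) (pCons b A)"
  then have "1 \<le> coeff (pCons b A) i \<and> coeff (pCons b A) i \<le> int M" if "i < Suc n" for i using that unfolding tower_def by blast
  from this[of 0] this[of "Suc _"] have "1 \<le> b \<and> b \<le> int M" "\<And>i. i < n \<Longrightarrow> 1 \<le> coeff A i \<and> coeff A i \<le> int M" by auto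
  moreover have "coeff A i = 0" if "i \<ge> n" for i
    using * that unfolding tower_def by (metis Suc_le_mono coeff_pCons_Suc)
  ultimately show "1 \<le> b \<and> b \<le> int M \<and> tower M n A" unfolding tower_def by blast
next
  assume *: "1 \<le> b \<and> b \<le> int M \<and> tower M n A"
  then show "tower M (Suc n) (pCons b A)"
    unfolding tower_def by (auto simp: coeff_pCons split: nat.splits)
qed

lemma tower_shift: "tower M (Suc n) A \<Longrightarrow> tower M n (poly_shift 1 A) \<and> 1 \<le> coeff A 0 \<and> coeff A 0 \<le> int M"
  using tower_pCons[of M n "coeff A 0" "poly_shift 1 A"] by simp

lemma finite_tower: "finite {A. tower M n A}"
proof (induction n)
  case 0
  have "{A. tower M 0 A} \<subseteq> {0}" by (auto simp: tower_def intro: poly_eqI)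
  then show ?case using finite_subset by blast
next
  case (Suc n)
  have "A \<in> (\<lambda>(b, A). pCons b A) ` ({1..int M} \<times> {A. tower M n A})" if "tower M (Suc n) A" for A
    using tower_shift[OF that] by (intro image_eqI[of _ _ "(coeff A 0, poly_shift 1 A)"]) auto
  then have "{A. tower M (Suc n) A} \<subseteq> (\<lambda>(b, A). pCons b A) ` ({1..int M} \<times> {A. tower M n A})" by blast
  moreover have "finite ({1..int M} \<times> {A. tower M n A})" using Suc by simp
  ultimately show ?case by (rule finite_subset[OF _ finite_imageI])
qed

text \<open>The total height is \<open>4 * n\<close> while each of the four side stacks stays below
  \<open>n\<close>. So the main stack is never empty, and \<open>pop\<close> and \<open>incr\<close>
  always find a positive top entry.\<close>

definition heights :: "nat \<Rightarrow> nat \<Rightarrow> (nat \<Rightarrow> nat) \<Rightarrow> stacks \<Rightarrow> bool" where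
  "heights n M h X \<longleftrightarrow> (\<forall>k<4. h k < n \<and> tower M (h k) (snd X k)) \<and> (\<forall>k\<ge>4. snd X k = 0)
     \<and> (\<Sum>k<4. h k) \<le> 4 * n \<and> tower M (4 * n - (\<Sum>k<4. h k)) (fst X)"

definition tower_set :: "nat \<Rightarrow> nat \<Rightarrow> stacks set" where
  "tower_set n M = {X. \<exists>h. heights n M h X}"

lemma finite_tower_set: "finite (tower_set n M)"
proof -
  let ?T = "\<Union>m\<le>4 * n. {A. tower M m A}"
  have T: "finite ?T" using finite_tower by blast
  have "tower_set n M \<subseteq> (\<lambda>(A, Bs). (A, \<lambda>k. if k < 4 then Bs ! k else 0)) ` (?T \<times> {Bs. set Bs \<subseteq> ?T \<and> length Bs = 4})"
  proof
    fix X assume "X \<in> tower_set n M"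
    then obtain h where h: "heights n M h X" by (auto simp: tower_set_def)
    have 1: "fst X \<in> ?T" using h unfolding heights_def by (meson UN_I atMost_iff diff_le_self mem_Collect_eq)
    have 2: "snd X k \<in> ?T" if "k < 4" for k
    proof -
      have "h k < n" using h that unfolding heights_def by blast
      then have "h k \<le> 4 * n" by linarith
      then show ?thesis using h that unfolding heights_def by blast
    qed
    have "X = (fst X, \<lambda>k. if k < 4 then map (snd X) [0..<4] ! k else 0)"
      using h unfolding heights_def by (auto simp: prod_eq_iff fun_eq_iff)
    then show "X \<in> (\<lambda>(A, Bs). (A, \<lambda>k. if k < 4 then Bs ! k else 0)) ` (?T \<times> {Bs. set Bs \<subseteq> ?T \<and> length Bs = 4})"
      using 1 2 by (intro image_eqI[of _ _ "(fst X, map (snd X) [0..<4])"]) auto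
  qed
  moreover have "finite (?T \<times> {Bs. set Bs \<subseteq> ?T \<and> length Bs = 4})"
    by (intro finite_cartesian_product T finite_lists_length_eq)
  ultimately show ?thesis by (rule finite_subset[OF _ finite_imageI])
qed

lemma tower_set_nonempty: "n > 0 \<Longrightarrow> M > 0 \<Longrightarrow> tower_set n M \<noteq> {}"
proof -
  assume "n > 0" "M > 0"
  have "\<exists>A. tower M m A" for m
  proof (induction m)
    case 0 then show ?case by (intro exI[of _ 0]) (simp add: tower_def)
  next
    case (Suc m)
    then obtain A where "tower M m A" by blast
    then show ?case using tower_pCons[of M m 1 A] \<open>M > 0\<close> by (intro exI[of _ "pCons 1 A"]) simp
  qed
  then obtain A where "tower M (4 * n) A" by blast
  then have "heights n M (\<lambda>_. 0) (A, \<lambda>_. 0)" using \<open>n > 0\<close> by (simp add: heights_def tower_def)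
  then show ?thesis by (auto simp: tower_set_def)
qed

lemma heights_total: "heights n M h X \<Longrightarrow> (\<Sum>k<4. h k) < 4 * n"
proof -
  assume *: "heights n M h X"
  have "h k < n" if "k < 4" for k using * that unfolding heights_def by blast
  from this[of 0] this[of 1] this[of 2] this[of 3] show ?thesis by (simp add: numeral_eq_Suc)
qed

lemma sum_update4: "k < (4::nat) \<Longrightarrow> (\<Sum>i<4. (h(k := v)) i) + h k = (\<Sum>i<4. h i) + (v :: nat)"
  by (subst (1 2) sum.remove[of _ k]) auto

lemma heights_pop:
  assumes "heights n M h X" "k < 4" "Suc (h k) < n"
  shows "heights n M (h(k := Suc (h k))) (pop k X)"
proof -
  have h: "\<And>k. k < 4 \<Longrightarrow> h k < n \<and> tower M (h k) (snd X k)" "\<And>k. k \<ge> 4 \<Longrightarrow> snd X k = 0" "(\<Sum>k<4. h k) \<le> 4 * n"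
    "tower M (4 * n - (\<Sum>k<4. h k)) (fst X)" using assms(1) by (auto simp: heights_def)
  have lt: "(\<Sum>i<4. h i) < 4 * n" using heights_total[OF assms(1)] .
  then obtain m where m: "4 * n - (\<Sum>k<4. h k) = Suc m" by (metis Suc_diff_Suc)
  then have t: "tower M m (poly_shift 1 (fst X))" "1 \<le> coeff (fst X) 0" "coeff (fst X) 0 \<le> int M"
    using tower_shift h(4) by auto
  have s: "(\<Sum>i<4. (h(k := Suc (h k))) i) = Suc (\<Sum>i<4. h i)" using sum_update4[OF assms(2), of h "Suc (h k)"] by simp
  have "4 * n - (\<Sum>i<4. (h(k := Suc (h k))) i) = m" using m s by simp
  then show ?thesis
    unfolding heights_def using h t assms(2,3) s lt tower_pCons[of M "h k"] by (auto simp: pop_def)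
qed

lemma heights_push:
  assumes "heights n M h X" "k < 4" "h k = Suc m"
  shows "heights n M (h(k := m)) (push k X)"
proof -
  have h: "\<And>k. k < 4 \<Longrightarrow> h k < n \<and> tower M (h k) (snd X k)" "\<And>k. k \<ge> 4 \<Longrightarrow> snd X k = 0" "(\<Sum>k<4. h k) \<le> 4 * n"
    "tower M (4 * n - (\<Sum>k<4. h k)) (fst X)" using assms(1) by (auto simp: heights_def)
  have t: "tower M m (poly_shift 1 (snd X k))" "1 \<le> coeff (snd X k) 0" "coeff (snd X k) 0 \<le> int M"
    using tower_shift[of M m "snd X k"] h(1)[OF assms(2)] assms(3) by auto
  have s: "(\<Sum>i<4. (h(k := m)) i) + 1 = (\<Sum>i<4. h i)" using sum_update4[OF assms(2), of h m] assms(3) by simp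
  then have e: "4 * n - (\<Sum>i<4. (h(k := m)) i) = Suc (4 * n - (\<Sum>i<4. h i))" using h(3) by linarith
  have "m < n" using h(1)[OF assms(2)] assms(3) by simp
  then show ?thesis
    unfolding heights_def using h t assms(2,3) s e tower_pCons[of M "4 * n - (\<Sum>i<4. h i)"] by (auto simp: push_def)
qed

lemma heights_unique: "heights n M h X \<Longrightarrow> heights n M h' X \<Longrightarrow> k < 4 \<Longrightarrow> h k = h' k"
  unfolding heights_def using tower_unique by blast

text \<open>A push leads out only from an empty side stack, and popping onto it reaches every height
  below \<open>n\<close> within the set.\<close>

lemma push_escape:
  assumes "k < 4"
  shows "n * card {X \<in> tower_set n M. push k X \<notin> tower_set n M} \<le> card (tower_set n M)"
proof (rule level_bound[where g = "pop k" and lev = "\<lambda>X. (SOME h. heights n M h X) k"])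
  fix X j assume X: "X \<in> {X \<in> tower_set n M. push k X \<notin> tower_set n M}" and j: "j < n"
  then obtain h where h: "heights n M h X" by (auto simp: tower_set_def)
  have "h k = 0"
  proof (rule ccontr)
    assume "h k \<noteq> 0"
    then obtain m where "h k = Suc m" using not0_implies_Suc by blast
    then show False using heights_push[OF h assms] X by (auto simp: tower_set_def)
  qed
  have *: "heights n M (h(k := j)) ((pop k ^^ j) X)"
    using j
  proof (induction j)
    case 0
    then show ?case using h \<open>h k = 0\<close> fun_upd_triv[of h k] by simp
  next
    case (Suc j)
    have IH: "heights n M (h(k := j)) ((pop k ^^ j) X)" by (rule Suc.IH) (use Suc.prems in simp)
    have "Suc ((h(k := j)) k) < n" using Suc.prems by simp
    from heights_pop[OF IH assms this] show ?case by (simp only: fun_upd_same fun_upd_upd funpow.simps o_apply)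
  qed
  moreover from * have "heights n M (SOME h. heights n M h ((pop k ^^ j) X)) ((pop k ^^ j) X)"
    by (rule someI[of "\<lambda>h. heights n M h ((pop k ^^ j) X)"])
  ultimately have "(SOME h. heights n M h ((pop k ^^ j) X)) k = (h(k := j)) k"
    by (intro heights_unique[OF _ _ assms])
  moreover have "(pop k ^^ j) X \<in> tower_set n M" using * by (auto simp: tower_set_def)
  ultimately show "(pop k ^^ j) X \<in> tower_set n M \<and> (SOME h. heights n M h ((pop k ^^ j) X)) k = j"
    by simp
qed (auto simp: finite_tower_set bij_is_inj bij_pop)

lemma tower_change:
  assumes "tower M n A" "n > 0" "1 \<le> coeff A 0 + b" "coeff A 0 + b \<le> int M"
  shows "tower M n (A + [:b:])"
  using assms unfolding tower_def by (auto simp: coeff_pCons split: nat.splits)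

lemma heights_change:
  assumes "heights n M h X" "1 \<le> coeff (fst X) 0 + b" "coeff (fst X) 0 + b \<le> int M"
  shows "heights n M h (fst X + [:b:], snd X)"
proof -
  from heights_total[OF assms(1)] have "4 * n - (\<Sum>i<4. h i) > 0" by simp
  then show ?thesis using assms tower_change unfolding heights_def by simp
qed

text \<open>\<open>incr\<close> leads out only if the top entry is \<open>M\<close>, and
  \<open>decr\<close> then runs through \<open>M\<close> different values within the set.\<close>

lemma incr_escape: "M * card {X \<in> tower_set n M. incr X \<notin> tower_set n M} \<le> card (tower_set n M)"
proof (rule level_bound[where g = decr and lev = "\<lambda>X. nat (int M - coeff (fst X) 0)"])
  fix X j assume X: "X \<in> {X \<in> tower_set n M. incr X \<notin> tower_set n M}" and j: "j < M"
  then obtain h where h: "heights n M h X" by (auto simp: tower_set_def)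
  from heights_total[OF h] have "4 * n - (\<Sum>i<4. h i) > 0" by simp
  then have r: "1 \<le> coeff (fst X) 0" "coeff (fst X) 0 \<le> int M" using h unfolding heights_def tower_def by blast+
  have m: "coeff (fst X) 0 = int M"
  proof (rule ccontr)
    assume "coeff (fst X) 0 \<noteq> int M"
    then have "heights n M h (incr X)" unfolding incr_def using r by (intro heights_change[OF h]) auto
    then show False using X by (auto simp: tower_set_def)
  qed
  have "heights n M h ((decr ^^ j) X) \<and> coeff (fst ((decr ^^ j) X)) 0 = int M - int j"
    using j
  proof (induction j)
    case (Suc j)
    then show ?case using heights_change[of n M h "(decr ^^ j) X" "-1"] by (simp add: decr_def[of "(decr ^^ j) X"])
  qed (use h m in simp)
  then show "(decr ^^ j) X \<in> tower_set n M \<and> nat (int M - coeff (fst ((decr ^^ j) X)) 0) = j"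
    by (auto simp: tower_set_def)
next
  show "inj decr" by (rule inj_on_inverseI[of _ incr]) simp
qed (auto simp: finite_tower_set)

lemma stacks_foelner:
  assumes "\<delta> > (0::real)"
  obtains F :: "stacks set" where "finite F" "F \<noteq> {}" "\<And>k. k < 4 \<Longrightarrow> real (card {X\<in>F. push k X \<notin> F}) \<le> \<delta> * real (card F)"
    "\<And>k. k < 4 \<Longrightarrow> real (card {X\<in>F. pop k X \<notin> F}) \<le> \<delta> * real (card F)" "real (card {X\<in>F. incr X \<notin> F}) \<le> \<delta> * real (card F)"
proof -
  obtain n :: nat where "real n > max 1 (1 / \<delta>)" using reals_Archimedean2 by blast
  then have n: "n > 0" "1 \<le> \<delta> * real n" using assms by (auto simp: field_simps)
  let ?F = "tower_set n n"
  have *: "real m \<le> \<delta> * real (card ?F)" if "n * m \<le> card ?F" for m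
  proof -
    have "real m \<le> (\<delta> * real n) * real m" using n(2) mult_right_mono[of 1 "\<delta> * real n" "real m"] by simp
    also have "\<dots> = \<delta> * real (n * m)" by simp
    also have "\<dots> \<le> \<delta> * real (card ?F)" using that assms by (intro mult_left_mono) (auto simp del: of_nat_mult)
    finally show ?thesis .
  qed
  have "inv_into UNIV (push k) = pop k" for k by (rule inv_equality) simp_all
  then have "card {X\<in>?F. pop k X \<notin> ?F} = card {X\<in>?F. push k X \<notin> ?F}" for k
    using escape_inv[OF bij_push[of k] finite_tower_set[of n n]] by simp
  then have "n * card {X\<in>?F. pop k X \<notin> ?F} \<le> card ?F" if "k < 4" for k using push_escape[OF that, of n n] by simp
  then show ?thesis
    by (intro that[of ?F] finite_tower_set tower_set_nonempty n * push_escape incr_escape)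
qed

context stack_model
begin

text \<open>The interval for \<open>z\<close> is chosen last: the forms are unbounded, but bounded
  on the finite product of the two Foelner sets of stacks.\<close>

lemma amenable_act: "finite L \<Longrightarrow> amenable (act ` L)"
  unfolding amenable_def
proof (intro allI impI)
  fix \<delta> :: real assume L: "finite L" and "\<delta> > 0"
  then have d3: "\<delta> / 3 > 0" by simp
  obtain F :: "stacks set" where F: "finite F" "F \<noteq> {}" "\<And>k. k < 4 \<Longrightarrow> real (card {X\<in>F. push k X \<notin> F}) \<le> \<delta> / 3 * real (card F)"
    "\<And>k. k < 4 \<Longrightarrow> real (card {X\<in>F. pop k X \<notin> F}) \<le> \<delta> / 3 * real (card F)" "real (card {X\<in>F. incr X \<notin> F}) \<le> \<delta> / 3 * real (card F)"
    by (rule stacks_foelner[OF d3]) (rule that; assumption)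
  have s1: "real (card {X\<in>F. shear1 x X \<notin> F}) \<le> \<delta> / 3 * real (card F)" for x using F d3 by (auto simp: shear1_def)
  have s2: "real (card {X\<in>F. shear2 x X \<notin> F}) \<le> \<delta> / 3 * real (card F)" for x using F d3 by (auto simp: shear2_def)
  define C where "C = (\<Sum>x\<in>L. \<Sum>X\<in>F. \<Sum>Y\<in>F. nat \<bar>shear3 x X Y\<bar>)"
  have C: "nat \<bar>shear3 x X Y\<bar> \<le> C" if "x \<in> L" "X \<in> F" "Y \<in> F" for x X Y
  proof -
    have "nat \<bar>shear3 x X Y\<bar> \<le> (\<Sum>Y\<in>F. nat \<bar>shear3 x X Y\<bar>)" using F(1) that by (intro member_le_sum) auto
    also have "\<dots> \<le> (\<Sum>X\<in>F. \<Sum>Y\<in>F. nat \<bar>shear3 x X Y\<bar>)" using F(1) that by (intro member_le_sum) auto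
    also have "\<dots> \<le> C" unfolding C_def using L that by (intro member_le_sum) auto
    finally show ?thesis .
  qed
  obtain T :: nat where T: "real C \<le> \<delta> / 3 * real T" "T > 0"
  proof -
    obtain T :: nat where "real T > max 1 (real C / (\<delta> / 3))" using reals_Archimedean2 by blast
    then have "real C \<le> \<delta> / 3 * real T" "T > 0" using d3 by (auto simp: field_simps)
    then show ?thesis by (rule that)
  qed
  let ?B = "{0..<int T}" and ?G = "F \<times> F \<times> {0..<int T}"
  have "real (card {s\<in>?G. act x s \<notin> ?G}) \<le> \<delta> * real (card ?G)" if x: "x \<in> L" for x
  proof -
    let ?A = "{X\<in>F. shear1 x X \<notin> F} \<times> F \<times> ?B" and ?A' = "F \<times> {Y\<in>F. shear2 x Y \<notin> F} \<times> ?B"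
    let ?E = "{z\<in>?B. z < int C \<or> int T - int C \<le> z}"
    let ?A'' = "F \<times> F \<times> ?E"
    define S where "S X Y = {z\<in>?B. z + shear3 x X Y \<notin> ?B}" for X Y
    let ?H = "SIGMA X:F. SIGMA Y:F. S X Y"
    have fS: "finite (S X Y)" for X Y unfolding S_def by (rule finite_Collect_conjI) simp
    have cS: "card (S X Y) \<le> C" if "X \<in> F" "Y \<in> F" for X Y
    proof -
      let ?n = "shear3 x X Y"
      have "S X Y \<subseteq> {0..<- ?n} \<union> {int T - ?n..<int T}" by (auto simp: S_def)
      then have "card (S X Y) \<le> card ({0..<- ?n} \<union> {int T - ?n..<int T})" by (intro card_mono) auto
      also have "\<dots> \<le> nat (- ?n) + nat ?n" using card_Un_le[of "{0..<- ?n}" "{int T - ?n..<int T}"] by simp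
      also have "\<dots> \<le> C" using C[OF x that] by linarith
      finally show ?thesis .
    qed
    have "{s\<in>?G. act x s \<notin> ?G} \<subseteq> ?A \<union> ?A' \<union> ?H" by (auto simp: act_shear S_def simp del: act.simps)
    moreover have "finite (?A \<union> ?A' \<union> ?H)"
      using F(1) fS by (intro finite_UnI finite_SigmaI) auto
    ultimately have "card {s\<in>?G. act x s \<notin> ?G} \<le> card (?A \<union> ?A' \<union> ?H)" by (intro card_mono)
    also have "\<dots> \<le> card ?A + card ?A' + card ?H"
      using card_Un_le[of "?A \<union> ?A'" ?H] card_Un_le[of ?A ?A'] by linarith
    also have "card ?H = (\<Sum>X\<in>F. \<Sum>Y\<in>F. card (S X Y))"
      using F(1) fS by simp
    also have "\<dots> \<le> (\<Sum>X\<in>F. \<Sum>Y\<in>F. C)" using cS by (intro sum_mono)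
    finally have "card {s\<in>?G. act x s \<notin> ?G} \<le> card {X\<in>F. shear1 x X \<notin> F} * card F * T + card F * card {Y\<in>F. shear2 x Y \<notin> F} * T + card F * card F * C"
      by (simp add: card_cartesian_product mult.assoc)
    then have "real (card {s\<in>?G. act x s \<notin> ?G}) \<le> real (card {X\<in>F. shear1 x X \<notin> F} * card F * T + card F * card {Y\<in>F. shear2 x Y \<notin> F} * T + card F * card F * C)"
      by (rule of_nat_mono)
    also have "\<dots> = real (card {X\<in>F. shear1 x X \<notin> F}) * (real (card F) * real T) + real (card {Y\<in>F. shear2 x Y \<notin> F}) * (real (card F) * real T)
      + real C * (real (card F) * real (card F))" by simp
    also have "\<dots> \<le> (\<delta> / 3 * real (card F)) * (real (card F) * real T) + (\<delta> / 3 * real (card F)) * (real (card F) * real T)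
      + (\<delta> / 3 * real T) * (real (card F) * real (card F))"
      using s1[of x] s2[of x] T(1) by (intro add_mono mult_right_mono) auto
    also have "\<dots> = \<delta> * real (card ?G)" by (simp add: card_cartesian_product)
    finally show ?thesis .
  qed
  moreover have "finite ?G" "?G \<noteq> {}" using F(1,2) T(2) by auto
  ultimately show "\<exists>F. finite F \<and> F \<noteq> {} \<and> (\<forall>g\<in>act ` L. real (card {x\<in>F. g x \<notin> F}) \<le> \<delta> * real (card F))"
    by blast
qed

text \<open>Escapes add up along the letters of a word, so the tolerance is divided by a bound for
  the lengths.\<close>

lemma amenable_lam:
  assumes "finite W"
  shows "amenable (lam ` W)"
  unfolding amenable_def
proof (intro allI impI)
  fix \<delta> :: real assume d: "\<delta> > 0"
  let ?L = "\<Union>w\<in>W. set w"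
  have L: "finite ?L" using assms by simp
  define n where "n = (\<Sum>w\<in>W. length w)"
  have n: "length w \<le> n" if "w \<in> W" for w unfolding n_def using assms that by (intro member_le_sum) auto
  have "\<delta> / real (Suc n) > 0" using d by simp
  then obtain F where "finite F \<and> F \<noteq> {} \<and> (\<forall>g\<in>act ` ?L. real (card {x\<in>F. g x \<notin> F}) \<le> \<delta> / real (Suc n) * real (card F))"
    using amenableD[OF amenable_act[OF L]] by blast
  then have F: "finite F" "F \<noteq> {}" "\<And>x. x \<in> ?L \<Longrightarrow> real (card {s\<in>F. act x s \<notin> F}) \<le> \<delta> / real (Suc n) * real (card F)"
    by blast+
  have len: "real (card {s\<in>F. lam w s \<notin> F}) \<le> real (length w) * (\<delta> / real (Suc n) * real (card F))" if "set w \<subseteq> ?L" for w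
    using that
  proof (induction w)
    case (Cons x w)
    have "card {s\<in>F. act x (lam w s) \<notin> F} \<le> card {s\<in>F. act x s \<notin> F} + card {s\<in>F. lam w s \<notin> F}"
      by (rule escape_comp[OF bij_is_inj[OF bij_lam] F(1)])
    then have "real (card {s\<in>F. lam (x # w) s \<notin> F}) \<le> real (card {s\<in>F. act x s \<notin> F}) + real (card {s\<in>F. lam w s \<notin> F})"
      by (simp del: act.simps)
    moreover have "x \<in> ?L" "set w \<subseteq> ?L" using Cons.prems by simp_all
    then have "real (card {s\<in>F. act x s \<notin> F}) \<le> \<delta> / real (Suc n) * real (card F)"
      "real (card {s\<in>F. lam w s \<notin> F}) \<le> real (length w) * (\<delta> / real (Suc n) * real (card F))"
      using F(3) Cons.IH by blast+
    moreover have "real (length (x # w)) * (\<delta> / real (Suc n) * real (card F)) = \<delta> / real (Suc n) * real (card F) + real (length w) * (\<delta> / real (Suc n) * real (card F))"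
      by (simp add: distrib_right add_divide_distrib)
    ultimately show ?case by linarith
  qed simp
  have "real (card {s\<in>F. lam w s \<notin> F}) \<le> \<delta> * real (card F)" if w: "w \<in> W" for w
  proof -
    have "real (length w) * (\<delta> / real (Suc n) * real (card F)) \<le> real (Suc n) * (\<delta> / real (Suc n) * real (card F))"
      using n[OF w] d by (intro mult_right_mono) auto
    also have "\<dots> = \<delta> * real (card F)" by simp
    finally show ?thesis using len[of w] w by fastforce
  qed
  then show "\<exists>F. finite F \<and> F \<noteq> {} \<and> (\<forall>g\<in>lam ` W. real (card {x\<in>F. g x \<notin> F}) \<le> \<delta> * real (card F))"
    using F(1,2) by blast
qed

end

section \<open>Weights separate the words, and the model yields representations\<close>

section \<open>Almost multilinear matroids of relation systems\<close>

text \<open>No two templates are permutations of each other. As their letters are distinct, a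
  template is determined by its set of letters.\<close>

lemma templates_sorted: "distinct (map sort templates)"
  by code_simp

lemma templates_distinct: "\<forall>t\<in>set templates. distinct t"
  and templates_letters: "\<forall>t\<in>set templates. \<forall>x\<in>set t. x < 11 \<or> x = 13"
  and templates_10: "\<forall>t\<in>set templates. 10 \<in> set t \<longrightarrow> t = [10]"
  by (simp_all add: templates_def)

lemma templates_mem:
  "[] \<in> set templates" "[0] \<in> set templates" "[1] \<in> set templates" "[2] \<in> set templates" 
  "[3] \<in> set templates" "[4] \<in> set templates" "[5] \<in> set templates" "[6] \<in> set templates" 
  "[7] \<in> set templates" "[8] \<in> set templates" "[9] \<in> set templates" "[10] \<in> set templates" 
  "[0,2] \<in> set templates" "[1,2] \<in> set templates" "[0,4] \<in> set templates" "[1,4] \<in> set templates" 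
  "[7,5] \<in> set templates" "[7,6] \<in> set templates" "[9,5] \<in> set templates" "[9,6] \<in> set templates" 
  "[1,3] \<in> set templates" "[2,3] \<in> set templates" "[2,4] \<in> set templates" "[8,6] \<in> set templates" 
  "[8,7] \<in> set templates" "[9,7] \<in> set templates" "[1,0] \<in> set templates" "[3,0] \<in> set templates" 
  "[3,4] \<in> set templates" "[5,6] \<in> set templates" "[5,8] \<in> set templates" "[9,8] \<in> set templates" 
  "[0,9] \<in> set templates" "[0,5] \<in> set templates" "[5,4] \<in> set templates" "[13] \<in> set templates" 
  "[13,4] \<in> set templates" "[9,13] \<in> set templates" "[13,1] \<in> set templates" "[0,13] \<in> set templates" 
  "[6,13] \<in> set templates" "[13,5] \<in> set templates" "[7,13] \<in> set templates" "[9,13,4] \<in> set templates" 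
  "[13,1,4] \<in> set templates" "[0,13,4] \<in> set templates" "[13,1,2] \<in> set templates" "[0,13,2] \<in> set templates" 
  "[9,6,13] \<in> set templates" "[9,13,5] \<in> set templates" "[7,6,13] \<in> set templates" "[7,13,5] \<in> set templates"
  by (simp_all add: templates_def)

lemma templates_eq:
  assumes "t \<in> set templates" "t' \<in> set templates" "set t = set t'"
  shows "t = t'"
proof -
  have "sort t = sort t'"
    using assms templates_distinct by (metis sorted_list_of_set_sort_remdups distinct_remdups_id)
  then show ?thesis using templates_sorted assms(1,2) by (auto simp: distinct_map inj_on_def)
qed

lemma words_eq:
  assumes "w \<in> words N" "w' \<in> words N" "set w = set w'"
  shows "w = w'"
proof -
  obtain t i where t: "w = subst_word i 0 t" "t \<in> set templates" using assms(1) by (auto simp: words_def)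
  obtain t' i' where t': "w' = subst_word i' 0 t'" "t' \<in> set templates" using assms(2) by (auto simp: words_def)
  have s: "x \<in> set (subst_word i 0 t) \<longleftrightarrow> (if x < 11 then x \<in> set t else 13 \<in> set t \<and> x = 11 + i)" if "t \<in> set templates" for x t i
    using templates_letters that by (force simp: subst_letter_def)
  have small: "x \<in> set t \<longleftrightarrow> x \<in> set t'" if "x < 11" for x
    using s[OF t(2), of x i] s[OF t'(2), of x i'] assms(3) that unfolding t(1) t'(1) by simp
  have big: "13 \<in> set t \<and> x = 11 + i \<longleftrightarrow> 13 \<in> set t' \<and> x = 11 + i'" if "\<not> x < 11" for x
    using s[OF t(2), of x i] s[OF t'(2), of x i'] assms(3) that unfolding t(1) t'(1) by simp
  have i: "13 \<in> set t \<longleftrightarrow> 13 \<in> set t'" "13 \<in> set t \<Longrightarrow> i = i'" using big[of "11 + i"] big[of "11 + i'"] by auto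
  have "x \<in> set t \<longleftrightarrow> x \<in> set t'" for x
    using small[of x] i(1) templates_letters t(2) t'(2) by blast
  then have "t = t'" using templates_eq[OF t(2) t'(2)] by blast
  moreover have "subst_word i 0 t = subst_word i' 0 t" if "13 \<notin> set t"
    using that templates_letters t(2) by (force simp: subst_letter_def)
  ultimately show ?thesis using t(1) t'(1) i(2) by blast
qed

text \<open>Powers of 2 let the weight encode a set of letters. The weight of letter 10 is forced by
  its relator, which requires the sum of those of 9 and 11.\<close>

definition weight :: "word \<Rightarrow> int" where
  "weight w = (\<Sum>x\<leftarrow>w. if x = 10 then 2 ^ 9 + 2 ^ 11 else 2 ^ x)"

lemma weight_words:
  assumes "w \<in> words N"
  shows "weight w = int (set_encode (if w = [10] then {9, 11} else set w))"
proof (cases "10 \<in> set w")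
  case True
  obtain t i where t: "w = subst_word i 0 t" "t \<in> set templates" using assms by (auto simp: words_def)
  have "10 \<in> set t" using True t by (auto simp: subst_letter_def split: if_splits)
  then have "w = [10]" using templates_10 t by (auto simp: subst_letter_def)
  then show ?thesis by (simp add: weight_def set_encode_def)
next
  case False
  obtain t i where t: "w = subst_word i 0 t" "t \<in> set templates" using assms by (auto simp: words_def)
  have l: "x < 11 \<or> x = 13" if "x \<in> set t" for x using templates_letters t(2) that by blast
  have "inj_on (subst_letter i 0) (set t)"
  proof (rule inj_onI)
    fix x y assume "x \<in> set t" "y \<in> set t" "subst_letter i 0 x = subst_letter i 0 y"
    then show "x = y" using l[of x] l[of y] by (auto simp: subst_letter_def split: if_splits)
  qed
  then have d: "distinct w" using templates_distinct t by (simp add: distinct_map)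
  have "weight w = (\<Sum>x\<leftarrow>w. 2 ^ x)" unfolding weight_def using False by (intro arg_cong[of _ _ sum_list] map_cong) auto
  also have "\<dots> = (\<Sum>x\<in>set w. 2 ^ x)" using d by (simp add: sum_list_distinct_conv_sum_set)
  finally show ?thesis using False by (auto simp: set_encode_def)
qed

text \<open>The integer translation therefore separates all other pairs of words without any
  knowledge of the action.\<close>

lemma weight_eq_cases:
  assumes "w \<in> words N" "w' \<in> words N" "weight w = weight w'" "w \<noteq> w'"
  shows "(w, w') = ([10], [9, 11]) \<or> (w, w') = ([9, 11], [10])"
proof -
  have "N > 0" using assms(1) by (auto simp: words_def)
  then have m: "[9, 11] \<in> words N"
    unfolding words_def using templates_mem by (intro CollectI exI[of _ "[9, 13]"] exI[of _ 0]) (simp add: subst_letter_def)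
  have "set_encode (if w = [10] then {9, 11} else set w) = set_encode (if w' = [10] then {9, 11} else set w')"
    using assms(3) weight_words[OF assms(1)] weight_words[OF assms(2)] by simp
  then have "(if w = [10] then {9, 11} else set w) = (if w' = [10] then {9, 11} else set w')"
    by (intro inj_onD[OF inj_on_set_encode]) auto
  then have s: "set (if w = [10] then [9, 11] else w) = set (if w' = [10] then [9, 11] else w')" by (simp split: if_splits)
  have "(if w = [10] then [9, 11] else w) = (if w' = [10] then [9, 11] else w')"
    by (rule words_eq[OF _ _ s]) (use assms m in auto)
  then show ?thesis using assms(4) by (auto split: if_splits)
qed

definition generic_letter :: "nat \<Rightarrow> nat" where
  "generic_letter x = (if 10 < x then 13 else x)"

lemma families_templates:
  assumes "(k, a, b, c, d) \<in> set families" "t \<in> {a, b, c, d}"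
  shows "map generic_letter t \<in> set templates" "length (filter (\<lambda>x. 10 < x) t) \<le> 1" "\<forall>x\<in>set t. x \<le> 14"
proof -
  have *: "\<forall>(k, a, b, c, d) \<in> set word_families. \<forall>t\<in>{a, b, c, d}. map generic_letter t \<in> set templates"
    "\<forall>(k, a, b, c, d) \<in> set relator_families. \<forall>t\<in>{a, b, c, d}. map generic_letter t \<in> set templates"
    by (simp_all add: word_families_def relator_families_def templates_mem generic_letter_def del: One_nat_def)
  have **: "\<forall>(k, a, b, c, d) \<in> set word_families. \<forall>t\<in>{a, b, c, d}. length (filter (\<lambda>x. 10 < x) t) \<le> 1"
    "\<forall>(k, a, b, c, d) \<in> set relator_families. \<forall>t\<in>{a, b, c, d}. length (filter (\<lambda>x. 10 < x) t) \<le> 1"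
    by (simp_all add: word_families_def relator_families_def)
  have ***: "\<forall>(k, a, b, c, d) \<in> set word_families. \<forall>t\<in>{a, b, c, d}. \<forall>x\<in>set t. x \<le> 14"
    "\<forall>(k, a, b, c, d) \<in> set relator_families. \<forall>t\<in>{a, b, c, d}. \<forall>x\<in>set t. x \<le> 14"
    by (simp_all add: word_families_def relator_families_def)
  have main: "P t" if P: "\<forall>(k, a, b, c, d) \<in> set word_families. \<forall>t\<in>{a, b, c, d}. P t"
    "\<forall>(k, a, b, c, d) \<in> set relator_families. \<forall>t\<in>{a, b, c, d}. P t" for P
  proof -
    from assms(1) consider "(k, a, b, c, d) \<in> set word_families" | "(k, a, b, c, d) \<in> set relator_families"
      unfolding families_def set_append by (rule UnE)
    then have "\<forall>t\<in>{a, b, c, d}. P t"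
    proof cases
      case 1 from bspec[OF P(1) 1] show ?thesis by (simp only: prod.case)
    next
      case 2 from bspec[OF P(2) 2] show ?thesis by (simp only: prod.case)
    qed
    then show ?thesis using assms(2) by (rule bspec)
  qed
  show "map generic_letter t \<in> set templates" by (rule main[OF *])
  show "length (filter (\<lambda>x. 10 < x) t) \<le> 1" by (rule main[OF **])
  show "\<forall>x\<in>set t. x \<le> 14" by (rule main[OF ***])
qed

text \<open>A word of a family has at most one kind of state letter, so it is an instance of a
  template with a single parameter even when its quadruple involves two states.\<close>

lemma subst_words:
  assumes "(k, a, b, c, d) \<in> set families" "t \<in> {a, b, c, d}" "i < N" "j < N" "2 \<le> N"
  shows "subst_word i j t \<in> words N"
proof -
  have t: "map generic_letter t \<in> set templates" "\<And>x y. x \<in> set t \<Longrightarrow> y \<in> set t \<Longrightarrow> 10 < x \<Longrightarrow> 10 < y \<Longrightarrow> x = y"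
    "\<And>x. x \<in> set t \<Longrightarrow> x \<le> 14"
  proof -
    note f = families_templates[OF assms(1,2)]
    show "map generic_letter t \<in> set templates" "\<And>x. x \<in> set t \<Longrightarrow> x \<le> 14" using f by blast+
    fix x y assume "x \<in> set t" "y \<in> set t" "10 < x" "10 < y"
    then have "x \<in> set (filter (\<lambda>x. 10 < x) t)" "y \<in> set (filter (\<lambda>x. 10 < x) t)" by simp_all
    then show "x = y" using f(2) by (cases "filter (\<lambda>x. 10 < x) t") auto
  qed
  have "\<exists>i'<N. \<forall>x\<in>set t. subst_letter i j x = subst_letter i' 0 (generic_letter x)"
  proof (cases "\<exists>y\<in>set t. 10 < y")
    case True
    then obtain y where y: "y \<in> set t" "10 < y" by blast
    then have "y = 11 \<or> y = 12 \<or> y = 13 \<or> y = 14" using t(3)[OF y(1)] by linarith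
    then obtain i' where i': "i' < N" "subst_letter i j y = 11 + i'" using assms(3-5) by (auto simp: subst_letter_def intro: that[of 0] that[of 1])
    have "subst_letter i j x = subst_letter i' 0 (generic_letter x)" if "x \<in> set t" for x
      using t(2)[OF that y(1) _ y(2)] i'(2) by (cases "10 < x") (auto simp: subst_letter_def generic_letter_def)
    then show ?thesis using i'(1) by blast
  next
    case False
    then have "subst_letter i j x = subst_letter i 0 (generic_letter x)" if "x \<in> set t" for x
      using that by (auto simp: subst_letter_def generic_letter_def)
    then show ?thesis using assms(3) by blast
  qed
  then obtain i' where "i' < N" "subst_word i j t = subst_word i' 0 (map generic_letter t)" by auto
  then show ?thesis unfolding words_def using t(1) by blast
qed

lemma finite_words: "finite (words N)"
proof -
  have "words N \<subseteq> (\<lambda>(i, w). subst_word i 0 w) ` ({..<N} \<times> set templates)" by (force simp: words_def)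
  then show ?thesis by (rule finite_subset) simp
qed

lemma finite_quads: "finite (quads R N)"
proof -
  have "quads R N \<subseteq> (\<lambda>(i, j, k, e). subst_quad i j e) ` ({..<N} \<times> {..<N} \<times> set families)"
    by (force simp: quads_def)
  then show ?thesis by (rule finite_subset) simp
qed

lemma good_quads:
  assumes "supported R N" "e \<in> quads R N"
  shows "good_quad e"
proof -
  obtain k Q i j where Q: "(k, Q) \<in> set families" "admits R k i j" "e = subst_quad i j Q"
    using assms(2) unfolding quads_def by blast
  have ne: "R 2 i j \<or> R 3 i j \<Longrightarrow> i \<noteq> j" using assms(1) unfolding supported_def by fastforce
  show ?thesis
    using Q ne unfolding families_def word_families_def relator_families_def
    by (auto simp: subst_letter_def admits_def)
qed

lemma quad_matroid_quads:
  assumes "supported R N"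
  shows "quad_matroid (words N) (quads R N)"
proof
  show "finite (words N)" "finite (quads R N)" by (rule finite_words finite_quads)+
  show "good_quad e" if "e \<in> quads R N" for e using good_quads[OF assms that] .
  show "slot e \<beta> \<gamma> \<in> words N" if e: "e \<in> quads R N" for e \<beta> \<gamma>
  proof -
    obtain k a b c d i j where Q: "(k, a, b, c, d) \<in> set families" "i < N" "j < N" "e = subst_quad i j (a, b, c, d)"
      using e unfolding quads_def by auto
    have "2 \<le> N" using assms by (simp add: supported_def)
    then show ?thesis using subst_words[OF Q(1) _ Q(2,3)] Q(4) by simp
  qed
  have "N > 0" using assms by (simp add: supported_def)
  then show "[] \<in> words N" unfolding words_def using templates_mem by force
qed

context stack_model
begin

lemma weight_quads:
  assumes "(a, b, c, d) \<in> quads R N"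
  shows "weight b - weight a = weight d - weight c"
proof -
  obtain k Q i j where Q: "(k, Q) \<in> set families" "(a, b, c, d) = subst_quad i j Q"
    using assms unfolding quads_def by blast
  have w: "weight [] = 0" "weight (x # w) = (if x = 10 then 2 ^ 9 + 2 ^ 11 else 2 ^ x) + weight w" for x w
    by (simp_all add: weight_def)
  show ?thesis
    using Q unfolding families_def word_families_def relator_families_def
    by (auto simp: subst_letter_def w)
qed

text \<open>Only the pair \<open>[10]\<close>, \<open>[9, 11]\<close> is left. Its two actions
  differ by a unit translation of \<open>z\<close>, which leaves no nonempty finite set
  invariant.\<close>

lemma separated_lam:
  assumes "w \<in> words N" "w' \<in> words N" "w \<noteq> w'" "weight w = weight w'"
  shows "separated (lam w) (lam w')"
proof -
  have sep: "separated f g" if fg: "surj f" "\<And>s. g s = (case f s of (X, Y, z) \<Rightarrow> (X, Y, z + e))" "e \<noteq> (0::int)" for f g :: "state \<Rightarrow> state" and e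
    unfolding separated_def
  proof (intro allI impI)
    fix Z assume "finite Z \<and> (\<forall>x. f x \<in> Z \<longrightarrow> g x \<in> Z)"
    then have Z: "finite Z" "\<And>x. f x \<in> Z \<Longrightarrow> g x \<in> Z" by blast+
    let ?H = "(\<lambda>(X, Y, z). z) ` Z"
    have "h + e \<in> ?H" if h: "h \<in> ?H" for h
    proof -
      obtain X Y where "(X, Y, h) \<in> Z" using h by auto
      moreover obtain s where "f s = (X, Y, h)" using fg(1) by (metis surjD)
      ultimately have "(X, Y, h + e) \<in> Z" using Z(2)[of s] fg(2)[of s] by simp
      then show ?thesis by force
    qed
    note step = this
    show "Z = {}"
    proof (rule ccontr)
      assume "Z \<noteq> {}"
      then have ne: "?H \<noteq> {}" "finite ?H" using Z(1) by auto
      have "Max ?H + e \<le> Max ?H" by (rule Max_ge[OF ne(2) step[OF Max_in[OF ne(2,1)]]])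
      moreover have "Min ?H \<le> Min ?H + e" by (rule Min_le[OF ne(2) step[OF Min_in[OF ne(2,1)]]])
      ultimately show False using fg(3) by linarith
    qed
  qed
  have "(w, w') = ([10], [9, 11]) \<or> (w, w') = ([9, 11], [10])"
    by (rule weight_eq_cases[OF assms(1,2,4,3)])
  then show ?thesis
  proof
    assume ww: "(w, w') = ([10], [9, 11])"
    have "lam [9, 11] q = (case lam [10] q of (X, Y, z) \<Rightarrow> (X, Y, z + 1))" for q by (cases q) simp
    then have "separated (lam [10]) (lam [9, 11])" by (rule sep[OF bij_is_surj[OF bij_lam]]) simp
    then show ?thesis using ww by simp
  next
    assume ww: "(w, w') = ([9, 11], [10])"
    have "lam [10] q = (case lam [9, 11] q of (X, Y, z) \<Rightarrow> (X, Y, z + -1))" for q by (cases q) simp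
    then have "separated (lam [9, 11]) (lam [10])" by (rule sep[OF bij_is_surj[OF bij_lam]]) simp
    then show ?thesis using ww by simp
  qed
qed

theorem almost_multilinear_model:
  fixes K :: "'k ring"
  assumes "field K"
  shows "almost_multilinear K (quad_matroid.ground (words N) (quads R N)) (quad_matroid.rank (words N) (quads R N))"
proof -
  interpret M: quad_matroid "words N" "quads R N" by (rule quad_matroid_quads[OF supp])
  show ?thesis
  proof (rule M.almost_multilinear_perms[OF assms])
    fix \<delta> :: real assume "\<delta> > 0"
    then show "\<exists>c b \<pi>. c > 0 \<and> real b \<le> \<delta> * real c \<and> perm_model (words N) (quads R N) c b \<pi>"
    proof (rule M.perm_model_of_action[where lam = lam and \<theta> = weight, rotated -1])
      show "amenable (lam ` words N)" by (rule amenable_lam[OF finite_words])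
      show "\<exists>v. lam b = lam a \<circ> v \<and> lam d = lam c \<circ> v" if "(a, b, c, d) \<in> quads R N" for a b c d by (rule lam_quads[OF that])
      show "weight b - weight a = weight d - weight c" if "(a, b, c, d) \<in> quads R N" for a b c d by (rule weight_quads[OF that])
      show "separated (lam w) (lam w')" if "w \<in> words N" "w' \<in> words N" "w \<noteq> w'" "weight w = weight w'" for w w' by (rule separated_lam[OF that])
    qed (rule bij_lam lam.simps(1))+
  qed
qed

end

text \<open>The equivalence class of the start configuration serves as \<open>J\<close>; without
  collapse it omits the halting configuration.\<close>

lemma almost_multilinear_of_not_collapses:
  fixes K :: "'k ring"
  assumes "field K" "supported R N" "\<not> collapses R"
  shows "almost_multilinear K (quad_matroid.ground (words N) (quads R N)) (quad_matroid.rank (words N) (quads R N))"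
proof -
  define J where "J i a b = equivclp (rstep R) (0, 0, 0) (i, a, b)" for i a b
  have J: "J i a b \<longleftrightarrow> J j a' b'" if "rstep R (i, a, b) (j, a', b')" for i a b j a' b'
  proof -
    have e: "equivclp (rstep R) (i, a, b) (j, a', b')" using that by (rule r_into_equivclp)
    show ?thesis unfolding J_def using equivclp_trans[OF _ e] equivclp_trans[OF _ equivclp_sym[OF e]] by blast
  qed
  have "stack_model R N J"
  proof
    show "supported R N" by fact
    show "J 0 0 0" by (simp add: J_def)
    show "\<not> J 1 0 0" using assms(3) by (simp add: J_def collapses_def)
    show "J j (Suc a) b \<longleftrightarrow> J i a b" if "R 0 i j" for i j a b using J[OF rstep.shift_a[where R = R, OF that]] by blast
    show "J j a (Suc b) \<longleftrightarrow> J i a b" if "R 1 i j" for i j a b using J[OF rstep.shift_b[where R = R, OF that]] by blast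
    show "J i 0 b \<longleftrightarrow> J j 0 b" if "R 2 i j" for i j b using J[OF rstep.zero_a[where R = R, OF that]] by blast
    show "J i a 0 \<longleftrightarrow> J j a 0" if "R 3 i j" for i j a using J[OF rstep.zero_b[where R = R, OF that]] by blast
  qed
  then show ?thesis by (rule stack_model.almost_multilinear_model[OF _ assms(1)])
qed

section \<open>Closure properties of total recursive functions\<close>

section \<open>Total recursive functions\<close>

text \<open>Arguments form a list of fixed length. Variables are read by \<open>hd\<close> and
  \<open>tl\<close>, and a bound variable is put in front.\<close>

definition recursive :: "nat \<Rightarrow> (nat list \<Rightarrow> nat) \<Rightarrow> bool" where
  "recursive k F \<longleftrightarrow> (\<exists>t. \<forall>xs. length xs = k \<longrightarrow> computes t xs (F xs))"

lemma recursiveI: "(\<And>xs. length xs = k \<Longrightarrow> computes t xs (F xs)) \<Longrightarrow> recursive k F"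
  unfolding recursive_def by blast

lemma recursive_cong: "recursive k F \<Longrightarrow> (\<And>xs. length xs = k \<Longrightarrow> F xs = G xs) \<Longrightarrow> recursive k G"
  unfolding recursive_def by simp

lemma recursive_nth: "i < k \<Longrightarrow> recursive k (\<lambda>xs. xs ! i)"
  by (rule recursiveI[of _ "Proj i"]) (simp add: computes.proj)

lemma recursive_compose:
  assumes "recursive (length Gs) F" "\<And>G. G \<in> set Gs \<Longrightarrow> recursive k G"
  shows "recursive k (\<lambda>xs. F (map (\<lambda>G. G xs) Gs))"
proof -
  obtain f where f: "\<And>xs. length xs = length Gs \<Longrightarrow> computes f xs (F xs)" using assms(1) unfolding recursive_def by blast
  obtain g where g: "\<And>G xs. G \<in> set Gs \<Longrightarrow> length xs = k \<Longrightarrow> computes (g G) xs (G xs)"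
    using assms(2) unfolding recursive_def by metis
  show ?thesis
  proof (rule recursiveI[of _ "Comp f (map g Gs)"])
    fix xs :: "nat list" assume "length xs = k"
    then have l: "list_all2 (\<lambda>g y. computes g xs y) (map g Gs) (map (\<lambda>G. G xs) Gs)"
      using g by (simp add: list_all2_conv_all_nth)
    have "computes f (map (\<lambda>G. G xs) Gs) (F (map (\<lambda>G. G xs) Gs))" by (rule f) simp
    then show "computes (Comp f (map g Gs)) xs (F (map (\<lambda>G. G xs) Gs))" by (rule computes.comp[OF l])
  qed
qed

lemma recursive_comp1:
  assumes "recursive 1 (\<lambda>xs. f (hd xs))" "recursive k G"
  shows "recursive k (\<lambda>xs. f (G xs))"
  using recursive_compose[of "[G]" "\<lambda>xs. f (hd xs)" k] assms by simp

lemma recursive_Suc [intro]: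
  assumes "recursive k F"
  shows "recursive k (\<lambda>xs. Suc (F xs))"
proof -
  have "recursive 1 (\<lambda>xs. Suc (hd xs))"
  proof (rule recursiveI[of _ Succ])
    fix xs :: "nat list" assume "length xs = 1"
    then obtain x where "xs = [x]" by (auto simp: length_Suc_conv)
    then show "computes Succ xs (Suc (hd xs))" by (simp add: computes.succ)
  qed
  then show ?thesis using recursive_comp1[of Suc k F] assms by blast
qed

lemma recursive_const [intro]: "recursive k (\<lambda>xs. c)"
proof (induction c)
  case 0 then show ?case by (rule recursiveI[of _ Zero]) (rule computes.zero)
next
  case (Suc c) then show ?case by (rule recursive_Suc)
qed

lemma recursive_tl:
  assumes "recursive k F"
  shows "recursive (Suc k) (\<lambda>xs. F (tl xs))"
proof -
  have "recursive (Suc k) (\<lambda>xs. F (map (\<lambda>G. G xs) (map (\<lambda>i xs. xs ! Suc i) [0..<k])))"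
    using assms by (intro recursive_compose) (auto intro: recursive_nth)
  then show ?thesis
  proof (rule recursive_cong)
    fix xs :: "nat list" assume "length xs = Suc k"
    then have "map (\<lambda>i. xs ! Suc i) [0..<k] = tl xs" by (intro nth_equalityI) (auto simp: nth_tl)
    then show "F (map (\<lambda>G. G xs) (map (\<lambda>i xs. xs ! Suc i) [0..<k])) = F (tl xs)" by (simp add: comp_def)
  qed
qed

lemma recursive_hd [intro]: "recursive (Suc k) hd"
  by (rule recursive_cong[OF recursive_nth[of 0]]) (auto simp: hd_conv_nth simp flip: length_greater_0_conv)

lemma recursive_var [intro]:
  "recursive (Suc (Suc k)) (\<lambda>xs. hd (tl xs))" "recursive (Suc (Suc (Suc k))) (\<lambda>xs. hd (tl (tl xs)))"
  "recursive (Suc (Suc (Suc (Suc k)))) (\<lambda>xs. hd (tl (tl (tl xs))))"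
  "recursive (Suc (Suc (Suc (Suc (Suc k))))) (\<lambda>xs. hd (tl (tl (tl (tl xs)))))"
  "recursive (Suc (Suc (Suc (Suc (Suc (Suc k)))))) (\<lambda>xs. hd (tl (tl (tl (tl (tl xs))))))"
  by (intro recursive_tl[of _ "\<lambda>xs. hd _"] recursive_tl[of _ "\<lambda>xs. hd (_ xs)"] recursive_hd recursive_tl[of _ hd]
    recursive_tl[of _ "\<lambda>xs. hd (tl xs)"] recursive_tl[of _ "\<lambda>xs. hd (tl (tl xs))"] recursive_tl[of _ "\<lambda>xs. hd (tl (tl (tl xs)))"]
    recursive_tl[of _ "\<lambda>xs. hd (tl (tl (tl (tl xs))))"])+

lemma recursive_rec_nat:
  assumes "recursive k A" "recursive (Suc (Suc k)) (\<lambda>xs. S (hd xs) (hd (tl xs)) (tl (tl xs)))" "recursive k N"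
  shows "recursive k (\<lambda>xs. rec_nat (A xs) (\<lambda>n y. S n y xs) (N xs))"
proof -
  obtain a where a: "\<And>xs. length xs = k \<Longrightarrow> computes a xs (A xs)" using assms(1) unfolding recursive_def by blast
  obtain s where s: "\<And>xs. length xs = Suc (Suc k) \<Longrightarrow> computes s xs (S (hd xs) (hd (tl xs)) (tl (tl xs)))"
    using assms(2) unfolding recursive_def by blast
  have rec: "computes (PrimRec a s) (n # xs) (rec_nat (A xs) (\<lambda>n y. S n y xs) n)" if "length xs = k" for n xs
  proof (induction n)
    case 0 then show ?case using a[OF that] by (simp add: computes.prim_0)
  next
    case (Suc n)
    then show ?case using s[of "n # _ # xs"] that by (auto intro: computes.prim_Suc)
  qed
  have "recursive (Suc k) (\<lambda>ys. rec_nat (A (tl ys)) (\<lambda>n y. S n y (tl ys)) (hd ys))"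
  proof (rule recursiveI[of _ "PrimRec a s"])
    fix ys :: "nat list" assume "length ys = Suc k"
    then show "computes (PrimRec a s) ys (rec_nat (A (tl ys)) (\<lambda>n y. S n y (tl ys)) (hd ys))" using rec by (cases ys) auto
  qed
  then have "recursive (length (N # map (\<lambda>i xs. xs ! i) [0..<k])) (\<lambda>ys. rec_nat (A (tl ys)) (\<lambda>n y. S n y (tl ys)) (hd ys))" by simp
  then have "recursive k (\<lambda>xs. (\<lambda>ys. rec_nat (A (tl ys)) (\<lambda>n y. S n y (tl ys)) (hd ys)) (map (\<lambda>G. G xs) (N # map (\<lambda>i xs. xs ! i) [0..<k])))"
    by (rule recursive_compose) (use assms(3) recursive_nth in auto)
  then have "recursive k (\<lambda>xs. rec_nat (A (map (\<lambda>i. xs ! i) [0..<k])) (\<lambda>n y. S n y (map (\<lambda>i. xs ! i) [0..<k])) (N xs))"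
    by (simp add: comp_def)
  then show ?thesis
  proof (rule recursive_cong)
    fix xs :: "nat list" assume "length xs = k"
    then have "map (\<lambda>i. xs ! i) [0..<k] = xs" using map_nth by blast
    then show "rec_nat (A (map (\<lambda>i. xs ! i) [0..<k])) (\<lambda>n y. S n y (map (\<lambda>i. xs ! i) [0..<k])) (N xs) = rec_nat (A xs) (\<lambda>n y. S n y xs) (N xs)" by simp
  qed
qed

lemma recursive_add [intro]: "recursive k F \<Longrightarrow> recursive k G \<Longrightarrow> recursive k (\<lambda>xs. F xs + G xs)"
proof -
  assume F: "recursive k F" "recursive k G"
  have "recursive k (\<lambda>xs. rec_nat (F xs) (\<lambda>n y. Suc y) (G xs))" by (rule recursive_rec_nat[OF F(1) _ F(2)]) auto
  moreover have "rec_nat a (\<lambda>n y. Suc y) b = a + b" for a b by (induction b) auto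
  ultimately show ?thesis by simp
qed

text \<open>Bounded sums yield the rest: bounded search, division, and finally the code of the
  matroid.\<close>

lemma recursive_sum [intro]:
  assumes "recursive (Suc k) (\<lambda>ys. G (hd ys) (tl ys))" "recursive k B"
  shows "recursive k (\<lambda>xs. \<Sum>y<B xs. G y xs)"
proof -
  have swap: "recursive (Suc (Suc k)) (\<lambda>ys. G (hd ys) (tl (tl ys)))"
  proof -
    have "recursive (Suc (Suc k)) (\<lambda>xs. (\<lambda>ys. G (hd ys) (tl ys)) (map (\<lambda>G. G xs) (hd # map (\<lambda>i xs. xs ! Suc (Suc i)) [0..<k])))"
      using assms(1) by (intro recursive_compose) (auto intro: recursive_nth)
    then show ?thesis
    proof (rule recursive_cong)
      fix xs :: "nat list" assume "length xs = Suc (Suc k)"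
      then have "map (\<lambda>i. xs ! Suc (Suc i)) [0..<k] = tl (tl xs)" by (intro nth_equalityI) (auto simp: nth_tl)
      then show "G (hd (map (\<lambda>G. G xs) (hd # map (\<lambda>i xs. xs ! Suc (Suc i)) [0..<k]))) (tl (map (\<lambda>G. G xs) (hd # map (\<lambda>i xs. xs ! Suc (Suc i)) [0..<k]))) = G (hd xs) (tl (tl xs))"
        by (simp add: comp_def)
    qed
  qed
  have "recursive k (\<lambda>xs. rec_nat 0 (\<lambda>n y. y + G n xs) (B xs))"
    by (rule recursive_rec_nat[OF recursive_const _ assms(2)]) (intro recursive_add swap recursive_var)
  moreover have "rec_nat 0 (\<lambda>n y. y + g n) b = (\<Sum>y<b. g y)" for g :: "nat \<Rightarrow> nat" and b by (induction b) auto
  ultimately show ?thesis by simp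
qed

lemma recursive_mult [intro]: "recursive k F \<Longrightarrow> recursive k G \<Longrightarrow> recursive k (\<lambda>xs. F xs * G xs)"
  using recursive_sum[of k "\<lambda>y xs. F xs" G] recursive_tl[of k F] by (simp add: mult.commute)

lemma recursive_power [intro]: "recursive k F \<Longrightarrow> recursive k G \<Longrightarrow> recursive k (\<lambda>xs. F xs ^ G xs)"
proof -
  assume F: "recursive k F" "recursive k G"
  have "recursive k (\<lambda>xs. rec_nat 1 (\<lambda>n y. y * F xs) (G xs))"
    using recursive_tl[OF recursive_tl[OF F(1)]] by (intro recursive_rec_nat[OF _ _ F(2)]) auto
  moreover have "rec_nat 1 (\<lambda>n y. y * a) b = a ^ b" for a b :: nat by (induction b) auto
  ultimately show ?thesis by simp
qed

lemma recursive_diff [intro]: "recursive k F \<Longrightarrow> recursive k G \<Longrightarrow> recursive k (\<lambda>xs. F xs - G xs)"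
proof -
  assume F: "recursive k F" "recursive k G"
  have "recursive (Suc (Suc k)) (\<lambda>xs. rec_nat 0 (\<lambda>n y. n) (hd (tl xs)))" for k
    by (intro recursive_rec_nat) auto
  moreover have "rec_nat 0 (\<lambda>n y. n) b = b - 1" for b by (cases b) auto
  ultimately have p: "recursive (Suc (Suc k)) (\<lambda>xs. hd (tl xs) - 1)" for k by simp
  have "recursive k (\<lambda>xs. rec_nat (F xs) (\<lambda>n y. y - 1) (G xs))"
    by (rule recursive_rec_nat[OF F(1) p F(2)])
  moreover have "rec_nat a (\<lambda>n y. y - 1) b = a - b" for a b :: nat by (induction b) auto
  ultimately show ?thesis by simp
qed

definition decidable :: "nat \<Rightarrow> (nat list \<Rightarrow> bool) \<Rightarrow> bool" where
  "decidable k P \<longleftrightarrow> recursive k (\<lambda>xs. of_bool (P xs))"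

lemma recursive_of_bool [intro]: "decidable k P \<Longrightarrow> recursive k (\<lambda>xs. of_bool (P xs))"
  by (simp add: decidable_def)

lemma decidable_not [intro]: "decidable k P \<Longrightarrow> decidable k (\<lambda>xs. \<not> P xs)" (is "_ \<Longrightarrow> ?thesis")
proof -
  have "(of_bool (\<not> p) :: nat) = 1 - of_bool p" for p by (cases p) auto
  then show "decidable k P \<Longrightarrow> ?thesis"
    unfolding decidable_def using recursive_diff[OF recursive_const[of k 1], of "\<lambda>xs. of_bool (P xs)"] by simp
qed

lemma decidable_conj [intro]: "decidable k P \<Longrightarrow> decidable k Q \<Longrightarrow> decidable k (\<lambda>xs. P xs \<and> Q xs)"
  unfolding decidable_def of_bool_conj by (rule recursive_mult)

lemma decidable_disj [intro]: "decidable k P \<Longrightarrow> decidable k Q \<Longrightarrow> decidable k (\<lambda>xs. P xs \<or> Q xs)"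
  using decidable_not[OF decidable_conj[OF decidable_not[of k P] decidable_not[of k Q]]] by (simp only: de_Morgan_conj not_not)

lemma decidable_imp [intro]: "decidable k P \<Longrightarrow> decidable k Q \<Longrightarrow> decidable k (\<lambda>xs. P xs \<longrightarrow> Q xs)"
  using decidable_disj[OF decidable_not[of k P], of Q] by (simp only: imp_conv_disj)

lemma decidable_le [intro]: "recursive k F \<Longrightarrow> recursive k G \<Longrightarrow> decidable k (\<lambda>xs. F xs \<le> G xs)"
proof -
  assume "recursive k F" "recursive k G"
  then have "recursive k (\<lambda>xs. 1 - (F xs - G xs))" by auto
  moreover have "1 - (a - b) = of_bool (a \<le> b)" for a b :: nat by auto
  ultimately show ?thesis by (simp add: decidable_def)
qed

lemma decidable_less [intro]: "recursive k F \<Longrightarrow> recursive k G \<Longrightarrow> decidable k (\<lambda>xs. F xs < G xs)"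
  using decidable_le[OF recursive_Suc, of k F G] by (simp add: Suc_le_eq)

lemma decidable_eq [intro]: "recursive k F \<Longrightarrow> recursive k G \<Longrightarrow> decidable k (\<lambda>xs. F xs = G xs)"
  using decidable_conj[OF decidable_le[of k F G] decidable_le[of k G F]] by (simp add: eq_iff)

lemma decidable_const [intro]: "decidable k (\<lambda>xs. p)"
  unfolding decidable_def by (rule recursive_const)

lemma decidable_ex [intro]:
  assumes "decidable (Suc k) (\<lambda>ys. P (hd ys) (tl ys))" "recursive k B"
  shows "decidable k (\<lambda>xs. \<exists>y<B xs. P y xs)"
proof -
  have "recursive k (\<lambda>xs. \<Sum>y<B xs. of_bool (P y xs))"
    using assms by (intro recursive_sum) (auto simp: decidable_def)
  then have "decidable k (\<lambda>xs. 0 < (\<Sum>y<B xs. of_bool (P y xs) :: nat))" by (rule decidable_less[OF recursive_const[of k 0]])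
  moreover have "0 < (\<Sum>y<b. of_bool (p y) :: nat) \<longleftrightarrow> (\<exists>y<b. p y)" for b :: nat and p
  proof (induction b)
    case (Suc b)
    then show ?case by (auto simp: less_Suc_eq)
  qed simp
  ultimately show ?thesis by (simp only:)
qed

lemma decidable_all [intro]:
  assumes "decidable (Suc k) (\<lambda>ys. P (hd ys) (tl ys))" "recursive k B"
  shows "decidable k (\<lambda>xs. \<forall>y<B xs. P y xs)"
  using decidable_not[OF decidable_ex[OF decidable_not[OF assms(1)] assms(2)]] by (simp only: not_ex de_Morgan_conj not_not imp_conv_disj)

text \<open>The quotient counts the \<open>q\<close> with \<open>Suc q * b \<le> a\<close>, and the
  guard \<open>0 < b\<close> reproduces division by 0.\<close>

lemma recursive_div [intro]: "recursive k F \<Longrightarrow> recursive k G \<Longrightarrow> recursive k (\<lambda>xs. F xs div G xs)"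
proof -
  assume F: "recursive k F" "recursive k G"
  have "recursive k (\<lambda>xs. \<Sum>q<F xs. of_bool (0 < G xs \<and> Suc q * G xs \<le> F xs))"
    using recursive_tl[OF F(1)] recursive_tl[OF F(2)] F by (intro recursive_sum recursive_of_bool decidable_conj decidable_less decidable_le recursive_mult recursive_Suc recursive_hd recursive_const)
  moreover have "(\<Sum>q<a. of_bool (0 < b \<and> Suc q * b \<le> a)) = a div b" for a b :: nat
  proof (cases "b = 0")
    case False
    have "{q. q < a \<and> 0 < b \<and> Suc q * b \<le> a} = {..<a div b}"
    proof -
      have "Suc q * b \<le> a \<longleftrightarrow> q < a div b" for q using False by (simp add: less_eq_div_iff_mult_less_eq flip: Suc_le_eq)
      moreover have "q < a" if "q < a div b" for q using div_le_dividend[of a b] that by linarith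
      ultimately show ?thesis using False by (auto simp del: mult_Suc)
    qed
    then show ?thesis by (simp add: of_bool_def sum.If_cases Int_def conj_commute del: mult_Suc)
  qed simp
  ultimately show ?thesis by simp
qed

lemma recursive_mod [intro]: "recursive k F \<Longrightarrow> recursive k G \<Longrightarrow> recursive k (\<lambda>xs. F xs mod G xs)"
proof -
  assume "recursive k F" "recursive k G"
  then have "recursive k (\<lambda>xs. F xs - F xs div G xs * G xs)" by (intro recursive_diff recursive_mult recursive_div)
  then show ?thesis by (simp add: minus_div_mult_eq_mod)
qed

lemma recursive_prod_encode [intro]: "recursive k F \<Longrightarrow> recursive k G \<Longrightarrow> recursive k (\<lambda>xs. prod_encode (F xs, G xs))"
  unfolding prod_encode_def Nat_Bijection.triangle_def prod.case
  by (intro recursive_add recursive_div recursive_mult recursive_Suc recursive_const)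

lemma decidable_set_decode [intro]: "recursive k F \<Longrightarrow> recursive k G \<Longrightarrow> decidable k (\<lambda>xs. F xs \<in> set_decode (G xs))"
proof -
  assume "recursive k F" "recursive k G"
  then have "decidable k (\<lambda>xs. (G xs div 2 ^ F xs) mod 2 = 1)"
    by (intro decidable_eq recursive_mod recursive_div recursive_power recursive_const)
  then show ?thesis by (simp add: set_decode_def odd_iff_mod_2_eq_one)
qed

lemma decidable_list_ex: "(\<And>a. a \<in> set as \<Longrightarrow> decidable k (P a)) \<Longrightarrow> decidable k (\<lambda>xs. \<exists>a\<in>set as. P a xs)"
proof (induction as)
  case (Cons a as)
  then have "decidable k (\<lambda>xs. P a xs \<or> (\<exists>a\<in>set as. P a xs))" by auto
  then show ?case by simp
qed auto

lemma recursive_sum_list: "(\<And>a. a \<in> set as \<Longrightarrow> recursive k (F a)) \<Longrightarrow> recursive k (\<lambda>xs. \<Sum>a\<leftarrow>as. F a xs)"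
  by (induction as) auto

section \<open>Recursive functions as programs on registers, then on two counters\<close>

section \<open>Register programs\<close>

text \<open>The loop decrements the tested register before its body runs. On Goedel numbers, test
  and decrement are then a single division.\<close>

datatype cmd = Skip | Inc nat | Seq cmd cmd | Loop nat cmd

inductive exec :: "cmd \<Rightarrow> (nat \<Rightarrow> nat) \<Rightarrow> (nat \<Rightarrow> nat) \<Rightarrow> bool" where
  exec_Skip: "exec Skip \<sigma> \<sigma>"
| exec_Inc: "exec (Inc r) \<sigma> (\<sigma>(r := Suc (\<sigma> r)))"
| exec_Seq: "exec c \<sigma> \<sigma>' \<Longrightarrow> exec c' \<sigma>' \<sigma>'' \<Longrightarrow> exec (Seq c c') \<sigma> \<sigma>''"
| exec_done: "\<sigma> r = 0 \<Longrightarrow> exec (Loop r c) \<sigma> \<sigma>"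
| exec_Loop: "\<sigma> r = Suc n \<Longrightarrow> exec c (\<sigma>(r := n)) \<sigma>' \<Longrightarrow> exec (Loop r c) \<sigma>' \<sigma>'' \<Longrightarrow> exec (Loop r c) \<sigma> \<sigma>''"

lemma exec_cong: "exec c \<sigma> \<sigma>' \<Longrightarrow> \<sigma> = \<tau> \<Longrightarrow> \<sigma>' = \<tau>' \<Longrightarrow> exec c \<tau> \<tau>'"
  by simp

fun seqs :: "cmd list \<Rightarrow> cmd" where
  "seqs [] = Skip"
| "seqs (c # cs) = Seq c (seqs cs)"

definition clear :: "nat \<Rightarrow> cmd" where
  "clear r = Loop r Skip"

lemma exec_clear: "exec (clear r) \<sigma> (\<sigma>(r := 0))"
proof (induction "\<sigma> r" arbitrary: \<sigma>)
  case 0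
  then have "\<sigma>(r := 0) = \<sigma>" by (metis fun_upd_triv)
  then show ?case using 0 exec_done[of \<sigma> r Skip] by (simp add: clear_def)
next
  case (Suc n)
  have "exec (clear r) (\<sigma>(r := n)) ((\<sigma>(r := n))(r := 0))" by (rule Suc(1)) simp
  then show ?case using exec_Loop[of \<sigma> r n Skip, OF Suc(2)[symmetric] exec_Skip] by (simp add: clear_def)
qed

definition move :: "nat \<Rightarrow> nat \<Rightarrow> cmd" where
  "move r r' = Loop r (Inc r')"

lemma exec_move: "r \<noteq> r' \<Longrightarrow> exec (move r r') \<sigma> (\<sigma>(r := 0, r' := \<sigma> r' + \<sigma> r))"
proof (induction "\<sigma> r" arbitrary: \<sigma>)
  case 0
  then have "\<sigma>(r := 0, r' := \<sigma> r' + \<sigma> r) = \<sigma>" by auto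
  then show ?case using exec_done[of \<sigma> r "Inc r'", OF 0(1)[symmetric]] by (simp only: move_def)
next
  case (Suc n)
  let ?\<tau> = "\<sigma>(r := n, r' := Suc (\<sigma> r'))"
  have "exec (move r r') ?\<tau> (?\<tau>(r := 0, r' := ?\<tau> r' + ?\<tau> r))" by (rule Suc(1)) (use Suc.prems in auto)
  moreover have "exec (Inc r') (\<sigma>(r := n)) ?\<tau>" using exec_Inc[of r' "\<sigma>(r := n)"] Suc.prems by simp
  ultimately have "exec (move r r') \<sigma> (?\<tau>(r := 0, r' := ?\<tau> r' + ?\<tau> r))"
    unfolding move_def by (rule exec_Loop[of \<sigma> r n, OF Suc(2)[symmetric], rotated])
  moreover have "?\<tau>(r := 0, r' := ?\<tau> r' + ?\<tau> r) = \<sigma>(r := 0, r' := \<sigma> r' + \<sigma> r)"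
    using Suc(2) Suc.prems by (auto simp: fun_eq_iff)
  ultimately show ?case by simp
qed

definition double :: "nat \<Rightarrow> nat \<Rightarrow> nat \<Rightarrow> cmd" where
  "double r r' s = Loop r (Seq (Inc r') (Inc s))"

lemma exec_double: "distinct [r, r', s] \<Longrightarrow> exec (double r r' s) \<sigma> (\<sigma>(r := 0, r' := \<sigma> r' + \<sigma> r, s := \<sigma> s + \<sigma> r))"
proof (induction "\<sigma> r" arbitrary: \<sigma>)
  case 0
  then have "\<sigma>(r := 0, r' := \<sigma> r' + \<sigma> r, s := \<sigma> s + \<sigma> r) = \<sigma>" by auto
  then show ?case using exec_done[of \<sigma> r "Seq (Inc r') (Inc s)", OF 0(1)[symmetric]] by (simp only: double_def)
next
  case (Suc n)
  let ?\<tau> = "\<sigma>(r := n, r' := Suc (\<sigma> r'), s := Suc (\<sigma> s))"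
  let ?\<rho> = "?\<tau>(r := 0, r' := ?\<tau> r' + ?\<tau> r, s := ?\<tau> s + ?\<tau> r)"
  have "exec (double r r' s) ?\<tau> ?\<rho>" by (rule Suc(1)) (use Suc.prems in auto)
  moreover have "exec (Seq (Inc r') (Inc s)) (\<sigma>(r := n)) ?\<tau>"
    using exec_Seq[OF exec_Inc[of r' "\<sigma>(r := n)"] exec_Inc[of s]] Suc.prems by simp
  ultimately have "exec (double r r' s) \<sigma> ?\<rho>"
    unfolding double_def by (rule exec_Loop[of \<sigma> r n, OF Suc(2)[symmetric], rotated])
  moreover have "?\<rho> = \<sigma>(r := 0, r' := \<sigma> r' + \<sigma> r, s := \<sigma> s + \<sigma> r)"
    using Suc(2) Suc.prems by (auto simp: fun_eq_iff)
  ultimately show ?case by simp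
qed

definition copy :: "nat \<Rightarrow> nat \<Rightarrow> nat \<Rightarrow> cmd" where
  "copy r r' s = Seq (double r r' s) (move s r)"

lemma exec_copy:
  assumes "distinct [r, r', s]" "\<sigma> s = 0"
  shows "exec (copy r r' s) \<sigma> (\<sigma>(r' := \<sigma> r' + \<sigma> r))"
proof -
  have "s \<noteq> r" using assms(1) by auto
  from exec_Seq[OF exec_double[OF assms(1), of \<sigma>] exec_move[OF this]]
  show ?thesis unfolding copy_def
    by (rule exec_cong) (use assms in \<open>auto simp: fun_eq_iff\<close>)
qed

text \<open>\<open>prog t ins out s\<close> reads its arguments from the registers \<open>ins\<close>, adds the result to the empty
  register \<open>out\<close>, and uses registers from \<open>s\<close> on as scratch space, which it leaves empty.\<close>

function prog :: "recf \<Rightarrow> nat list \<Rightarrow> nat \<Rightarrow> nat \<Rightarrow> cmd" where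
  "prog Zero ins out s = Skip"
| "prog Succ ins out s = Seq (copy (hd ins) out s) (Inc out)"
| "prog (Proj i) ins out s = copy (ins ! i) out s"
| "prog (Comp f gs) ins out s = (let n = length gs in
     seqs (map (\<lambda>i. prog (gs ! i) ins (s + i) (s + n)) [0..<n] @ [prog f [s..<s + n] out (s + n)] @ map clear [s..<s + n]))"
| "prog (PrimRec f g) ins out s = seqs [prog f (tl ins) (s + 1) (s + 4), copy (hd ins) (s + 3) (s + 4),
     Loop (s + 3) (seqs [prog g (s # (s + 1) # tl ins) (s + 2) (s + 4), clear (s + 1), move (s + 2) (s + 1), Inc s]),
     move (s + 1) out, clear s]"
| "prog (Minim f) ins out s = seqs [Inc (s + 2),
     Loop (s + 2) (seqs [prog f (s # ins) (s + 1) (s + 3), Loop (s + 1) (seqs [clear (s + 1), Inc s, Inc (s + 2)])]),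
     move s out]"
  by pat_completeness auto
termination
  by (relation "measure (\<lambda>(t, _). size t)") (auto simp: less_Suc_eq_le intro: trans_le_add1 size_list_estimation'[OF nth_mem order_refl])

lemma exec_seqs_append: "exec (seqs cs) \<sigma> \<sigma>' \<Longrightarrow> exec (seqs ds) \<sigma>' \<sigma>'' \<Longrightarrow> exec (seqs (cs @ ds)) \<sigma> \<sigma>''"
proof (induction cs arbitrary: \<sigma>)
  case Nil
  then show ?case by (auto elim: exec.cases)
next
  case (Cons c cs)
  from Cons.prems(1) obtain \<tau> where "exec c \<sigma> \<tau>" "exec (seqs cs) \<tau> \<sigma>'"
    by (auto elim: exec.cases)
  then show ?case using Cons exec_Seq by auto
qed

lemma exec_seqs_single: "exec c \<sigma> \<sigma>' \<Longrightarrow> exec (seqs [c]) \<sigma> \<sigma>'"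
  using exec_Seq exec_Skip by auto

lemma exec_clears: "exec (seqs (map clear rs)) \<sigma> (\<lambda>r. if r \<in> set rs then 0 else \<sigma> r)"
proof (induction rs arbitrary: \<sigma>)
  case Nil
  then show ?case using exec_Skip by simp
next
  case (Cons r rs)
  show ?case
    using exec_Seq[OF exec_clear[of r \<sigma>] Cons[of "\<sigma>(r := 0)"]]
    by (auto elim!: exec_cong simp: fun_eq_iff)
qed

definition ready :: "nat list \<Rightarrow> nat \<Rightarrow> nat \<Rightarrow> (nat \<Rightarrow> nat) \<Rightarrow> bool" where
  "ready ins out s \<sigma> \<longleftrightarrow> (\<forall>r\<in>set ins. r < s) \<and> out < s \<and> out \<notin> set ins \<and> \<sigma> out = 0 \<and> (\<forall>r\<ge>s. \<sigma> r = 0)"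

text \<open>The intermediate values \<open>Y\<close> state the invariant of the loop that implements
  primitive recursion.\<close>

lemma computes_PrimRec_values:
  "computes (PrimRec f g) (n # xs) y \<Longrightarrow> \<exists>Y. computes f xs (Y 0) \<and> (\<forall>i<n. computes g (i # Y i # xs) (Y (Suc i))) \<and> Y n = y"
proof (induction n arbitrary: y)
  case 0
  then have "computes f xs y" by (auto elim: computes.cases)
  then show ?case by auto
next
  case (Suc n)
  from Suc.prems obtain y' where y': "computes (PrimRec f g) (n # xs) y'" "computes g (n # y' # xs) y"
    by (auto elim: computes.cases)
  obtain Y where Y: "computes f xs (Y 0)" "\<forall>i<n. computes g (i # Y i # xs) (Y (Suc i))" "Y n = y'"
    using Suc.IH[OF y'(1)] by blast
  then show ?case using y'(2) by (intro exI[of _ "Y(Suc n := y)"]) (auto simp: less_Suc_eq)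
qed

lemma exec_prog:
  "computes t xs y \<Longrightarrow> ready ins out s \<sigma> \<Longrightarrow> map \<sigma> ins = xs \<Longrightarrow> exec (prog t ins out s) \<sigma> (\<sigma>(out := y))"
proof (induction t arbitrary: ins out s \<sigma> xs y)
  case Zero
  then have "y = 0" "\<sigma> out = 0" by (auto simp: ready_def elim: computes.cases)
  then have "\<sigma>(out := y) = \<sigma>" by auto
  then show ?case using exec_Skip by simp
next
  case Succ
  then obtain x where x: "xs = [x]" "y = Suc x" by (auto elim: computes.cases)
  then obtain r where r: "ins = [r]" "\<sigma> r = x" using Succ.prems(3) by auto
  have "exec (copy r out s) \<sigma> (\<sigma>(out := \<sigma> out + \<sigma> r))" using Succ.prems r by (intro exec_copy) (auto simp: ready_def)
  from exec_Seq[OF this exec_Inc[of out]] have "exec (prog Succ ins out s) \<sigma> (\<sigma>(out := \<sigma> out + \<sigma> r, out := Suc (\<sigma> out + \<sigma> r)))"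
    using r by simp
  moreover have "\<sigma>(out := \<sigma> out + \<sigma> r, out := Suc (\<sigma> out + \<sigma> r)) = \<sigma>(out := y)"
    using r x Succ.prems(2) by (simp add: ready_def)
  ultimately show ?case by (rule exec_cong[OF _ refl])
next
  case (Proj i)
  then have i: "i < length xs" "y = xs ! i" by (auto elim: computes.cases)
  have l: "i < length ins" using i(1) Proj.prems(3) by (metis length_map)
  then have m: "ins ! i \<in> set ins" "\<sigma> (ins ! i) = xs ! i" using Proj.prems(3) nth_map by (simp, metis)
  have "exec (copy (ins ! i) out s) \<sigma> (\<sigma>(out := \<sigma> out + \<sigma> (ins ! i)))"
    using Proj.prems m by (intro exec_copy) (auto simp: ready_def)
  moreover have "\<sigma>(out := \<sigma> out + \<sigma> (ins ! i)) = \<sigma>(out := y)" using m i Proj.prems by (simp add: ready_def)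
  ultimately have "exec (copy (ins ! i) out s) \<sigma> (\<sigma>(out := y))" by (rule exec_cong[OF _ refl])
  then show ?case by (simp only: prog.simps)
next
  case (Comp f gs)
  from Comp.prems(1) obtain ys where ys: "list_all2 (\<lambda>g y. computes g xs y) gs ys" "computes f ys y"
    by (auto elim: computes.cases)
  let ?n = "length gs"
  have len: "length ys = ?n" using ys(1) by (simp add: list_all2_conv_all_nth)
  have s: "\<And>r. r \<in> set ins \<Longrightarrow> r < s" "out < s" "\<sigma> out = 0" "\<And>r. s \<le> r \<Longrightarrow> \<sigma> r = 0" "out \<notin> set ins"
    using Comp.prems(2) by (auto simp: ready_def)
  let ?\<sigma> = "\<lambda>m r. if s \<le> r \<and> r < s + m then ys ! (r - s) else \<sigma> r"
  have args: "exec (seqs (map (\<lambda>i. prog (gs ! i) ins (s + i) (s + ?n)) [0..<m])) \<sigma> (?\<sigma> m)" if "m \<le> ?n" for m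
    using that
  proof (induction m)
    case 0
    have "?\<sigma> 0 = \<sigma>" by auto
    then show ?case using exec_Skip by simp
  next
    case (Suc m)
    then have m: "m < ?n" by simp
    have "map (?\<sigma> m) ins = map \<sigma> ins" using s(1) by (intro map_cong) (auto dest: leD)
    then have "map (?\<sigma> m) ins = xs" using Comp.prems(3) by simp
    moreover have "ready ins (s + m) (s + ?n) (?\<sigma> m)" using s m by (fastforce simp: ready_def)
    moreover have "computes (gs ! m) xs (ys ! m)" using ys(1) m by (simp add: list_all2_conv_all_nth)
    ultimately have "exec (prog (gs ! m) ins (s + m) (s + ?n)) (?\<sigma> m) ((?\<sigma> m)(s + m := ys ! m))"
      using Comp.IH(2)[OF nth_mem[OF m]] by blast
    moreover have "(?\<sigma> m)(s + m := ys ! m) = ?\<sigma> (Suc m)" by (auto simp: fun_eq_iff)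
    ultimately have "exec (prog (gs ! m) ins (s + m) (s + ?n)) (?\<sigma> m) (?\<sigma> (Suc m))" by simp
    from exec_seqs_append[OF Suc.IH exec_seqs_single[OF this]] show ?case using m by simp
  qed
  have "ready [s..<s + ?n] out (s + ?n) (?\<sigma> ?n)" using s by (auto simp: ready_def)
  moreover have "map (?\<sigma> ?n) [s..<s + ?n] = ys" using len by (intro nth_equalityI) auto
  ultimately have "exec (prog f [s..<s + ?n] out (s + ?n)) (?\<sigma> ?n) ((?\<sigma> ?n)(out := y))" by (rule Comp.IH(1)[OF ys(2)])
  from exec_seqs_append[OF exec_seqs_append[OF args[OF le_refl] exec_seqs_single[OF this]] exec_clears[of "[s..<s + ?n]"]]
  have "exec (prog (Comp f gs) ins out s) \<sigma> (\<lambda>r. if r \<in> set [s..<s + ?n] then 0 else ((?\<sigma> ?n)(out := y)) r)"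
    by (simp add: Let_def)
  moreover have "(\<lambda>r. if r \<in> set [s..<s + ?n] then 0 else ((?\<sigma> ?n)(out := y)) r) = \<sigma>(out := y)"
    using s by (auto simp: fun_eq_iff)
  ultimately show ?case by (rule exec_cong[OF _ refl])
next
  case (PrimRec f g)
  have "xs \<noteq> []" using PrimRec.prems(1) by (auto elim: computes.cases)
  then obtain n xs' where xs: "xs = n # xs'" by (cases xs) auto
  then obtain r ins' where ins: "ins = r # ins'" "\<sigma> r = n" "map \<sigma> ins' = xs'" using PrimRec.prems(3) by auto
  obtain Y where Y: "computes f xs' (Y 0)" "\<And>i. i < n \<Longrightarrow> computes g (i # Y i # xs') (Y (Suc i))" "Y n = y"
    using computes_PrimRec_values PrimRec.prems(1) xs by blast
  have s: "\<And>r. r \<in> set ins \<Longrightarrow> r < s" "out < s" "\<sigma> out = 0" "\<And>r. s \<le> r \<Longrightarrow> \<sigma> r = 0" "out \<notin> set ins"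
    using PrimRec.prems(2) by (auto simp: ready_def)
  \<comment> \<open>The loop invariant: register \<open>s\<close> counts rounds,
    \<open>s + 1\<close> holds the current value and \<open>s + 3\<close> the number of rounds left.
    The next value is computed in \<open>s + 2\<close>.\<close>
  define \<tau> where "\<tau> i = \<sigma>(s := i, s + 1 := Y i, s + 3 := n - i)" for i
  have args: "map (\<sigma>(s := a, s + 1 := b, s + 3 := d)) ins' = xs'" for a b d
  proof -
    have "map (\<sigma>(s := a, s + 1 := b, s + 3 := d)) ins' = map \<sigma> ins'"
    proof (intro map_cong refl)
      fix x assume "x \<in> set ins'"
      then have "x < s" using s(1) ins(1) by simp
      then show "(\<sigma>(s := a, s + 1 := b, s + 3 := d)) x = \<sigma> x" by simp
    qed
    then show ?thesis using ins(3) by simp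
  qed
  have 1: "exec (prog f ins' (s + 1) (s + 4)) \<sigma> (\<sigma>(s + 1 := Y 0))"
    by (rule PrimRec.IH(1)[OF Y(1) _ ins(3)]) (use s ins in \<open>fastforce simp: ready_def\<close>)
  have "exec (copy r (s + 3) (s + 4)) (\<sigma>(s + 1 := Y 0)) ((\<sigma>(s + 1 := Y 0))(s + 3 := (\<sigma>(s + 1 := Y 0)) (s + 3) + (\<sigma>(s + 1 := Y 0)) r))"
    by (rule exec_copy) (use s(1)[of r] s(4) ins in auto)
  moreover have "(\<sigma>(s + 1 := Y 0))(s + 3 := (\<sigma>(s + 1 := Y 0)) (s + 3) + (\<sigma>(s + 1 := Y 0)) r) = \<tau> 0"
    using s(1)[of r] s(4) ins by (auto simp: \<tau>_def fun_eq_iff)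
  ultimately have 2: "exec (copy r (s + 3) (s + 4)) (\<sigma>(s + 1 := Y 0)) (\<tau> 0)" by simp
  let ?body = "seqs [prog g (s # (s + 1) # ins') (s + 2) (s + 4), clear (s + 1), move (s + 2) (s + 1), Inc s]"
  have body: "exec ?body ((\<tau> i)(s + 3 := n - Suc i)) (\<tau> (Suc i))" if i: "i < n" for i
  proof -
    let ?\<upsilon> = "(\<tau> i)(s + 3 := n - Suc i)"
    have u: "?\<upsilon> = \<sigma>(s := i, s + 1 := Y i, s + 3 := n - Suc i)" by (simp add: \<tau>_def)
    have "exec (prog g (s # (s + 1) # ins') (s + 2) (s + 4)) ?\<upsilon> (?\<upsilon>(s + 2 := Y (Suc i)))"
    proof (rule PrimRec.IH(2)[OF Y(2)[OF i]])
      show "ready (s # (s + 1) # ins') (s + 2) (s + 4) ?\<upsilon>"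
        unfolding u using s ins by (fastforce simp: ready_def)
      show "map ?\<upsilon> (s # (s + 1) # ins') = i # Y i # xs'" unfolding u using args by simp
    qed
    from exec_Seq[OF this exec_Seq[OF exec_clear[of "s + 1"] exec_Seq[OF exec_move[of "s + 2" "s + 1"] exec_Seq[OF exec_Inc[of s] exec_Skip]]]]
    show ?thesis
      by (simp only: seqs.simps) (rule exec_cong, simp, use s(4) in \<open>auto simp: fun_eq_iff \<tau>_def\<close>)
  qed
  have 3: "exec (Loop (s + 3) ?body) (\<tau> (n - m)) (\<tau> n)" if "m \<le> n" for m
    using that
  proof (induction m)
    case 0
    have "\<tau> n (s + 3) = 0" by (simp add: \<tau>_def)
    from exec_done[of "\<tau> n" "s + 3" ?body, OF this] show ?case by (simp only: diff_zero)
  next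
    case (Suc m)
    have e: "\<tau> (n - Suc m) (s + 3) = Suc (n - Suc (n - Suc m))" using Suc.prems by (simp add: \<tau>_def)
    have "Suc (n - Suc m) = n - m" using Suc.prems by simp
    then show ?case
      using exec_Loop[where c = ?body and \<sigma> = "\<tau> (n - Suc m)" and r = "s + 3", OF e body[of "n - Suc m"]] Suc by simp
  qed
  have 4: "exec (move (s + 1) out) (\<tau> n) ((\<tau> n)(s + 1 := 0, out := \<tau> n out + \<tau> n (s + 1)))"
    using s(2) by (intro exec_move) simp
  from exec_Seq[OF 1 exec_Seq[OF 2 exec_Seq[OF 3[OF le_refl, simplified] exec_Seq[OF 4 exec_Seq[OF exec_clear[of s] exec_Skip]]]]]
  have "exec (prog (PrimRec f g) ins out s) \<sigma> ((\<tau> n)(s + 1 := 0, out := \<tau> n out + \<tau> n (s + 1), s := 0))"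
    using ins(1) by simp
  moreover have "(\<tau> n)(s + 1 := 0, out := \<tau> n out + \<tau> n (s + 1), s := 0) = \<sigma>(out := y)"
    using s(2-4) Y(3) by (auto simp: fun_eq_iff \<tau>_def)
  ultimately show ?case by (rule exec_cong[OF _ refl])
next
  case (Minim f)
  have f: "computes f (y # xs) 0" "\<And>m. m < y \<Longrightarrow> \<exists>v. computes f (m # xs) (Suc v)"
    using Minim.prems(1) by (auto elim: computes.cases)
  have s: "\<And>r. r \<in> set ins \<Longrightarrow> r < s" "out < s" "\<sigma> out = 0" "\<And>r. s \<le> r \<Longrightarrow> \<sigma> r = 0" "out \<notin> set ins"
    using Minim.prems(2) by (auto simp: ready_def)
  \<comment> \<open>Register \<open>s\<close> holds the candidate and \<open>s + 2\<close> a flag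
    that asks for another round. The inner loop runs at most once, since it clears the register
    \<open>s + 1\<close> that it tests.\<close>
  define \<tau> where "\<tau> m b = \<sigma>(s := m, s + 2 := b)" for m b
  let ?in = "seqs [clear (s + 1), Inc s, Inc (s + 2)]"
  let ?body = "seqs [prog f (s # ins) (s + 1) (s + 3), Loop (s + 1) ?in]"
  have args: "map (\<tau> m b) (s # ins) = m # xs" for m b
  proof -
    have "map (\<tau> m b) ins = map \<sigma> ins"
    proof (intro map_cong refl)
      fix x assume "x \<in> set ins"
      then have "x < s" using s(1) by simp
      then show "\<tau> m b x = \<sigma> x" by (simp add: \<tau>_def)
    qed
    then show ?thesis using Minim.prems(3) by (simp add: \<tau>_def)
  qed
  have rd: "ready (s # ins) (s + 1) (s + 3) (\<tau> m b)" for m b using s by (fastforce simp: ready_def \<tau>_def)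
  have step: "exec ?body (\<tau> m 0) (\<tau> (Suc m) 1)" if "m < y" for m
  proof -
    obtain v where v: "computes f (m # xs) (Suc v)" using f(2)[OF \<open>m < y\<close>] by blast
    let ?\<upsilon> = "(\<tau> m 0)(s + 1 := Suc v)"
    have 1: "exec (prog f (s # ins) (s + 1) (s + 3)) (\<tau> m 0) ?\<upsilon>" by (rule Minim.IH[OF v rd args])
    have "exec ?in (?\<upsilon>(s + 1 := v)) (\<tau> (Suc m) 1)"
      unfolding seqs.simps
      by (rule exec_cong[OF exec_Seq[OF exec_clear[of "s + 1"] exec_Seq[OF exec_Inc[of s] exec_Seq[OF exec_Inc[of "s + 2"] exec_Skip]]] refl])
        (use s(4) in \<open>auto simp: fun_eq_iff \<tau>_def\<close>)
    from exec_Loop[where r = "s + 1" and \<sigma> = ?\<upsilon>, OF _ this exec_done]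
    have "exec (Loop (s + 1) ?in) ?\<upsilon> (\<tau> (Suc m) 1)" using s(4) by (simp add: \<tau>_def)
    from exec_Seq[OF 1 exec_Seq[OF this exec_Skip]] show ?thesis by simp
  qed
  have last: "exec ?body (\<tau> y 0) (\<tau> y 0)"
  proof -
    have 1: "exec (prog f (s # ins) (s + 1) (s + 3)) (\<tau> y 0) ((\<tau> y 0)(s + 1 := 0))" by (rule Minim.IH[OF f(1) rd args])
    moreover have "(\<tau> y 0)(s + 1 := 0) = \<tau> y 0" using s(4) by (auto simp: fun_eq_iff \<tau>_def)
    ultimately have "exec (prog f (s # ins) (s + 1) (s + 3)) (\<tau> y 0) (\<tau> y 0)" by simp
    moreover have "exec (Loop (s + 1) ?in) (\<tau> y 0) (\<tau> y 0)" by (rule exec_done) (use s(4) in \<open>simp add: \<tau>_def\<close>)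
    ultimately show ?thesis unfolding seqs.simps by (blast intro: exec_Seq exec_Skip)
  qed
  have u: "\<tau> m 1 (s + 2) = Suc 0" "(\<tau> m 1)(s + 2 := 0) = \<tau> m 0" for m by (simp_all add: \<tau>_def)
  have loop: "exec (Loop (s + 2) ?body) (\<tau> (y - m) 1) (\<tau> y 0)" if "m \<le> y" for m
    using that
  proof (induction m)
    case 0
    have "exec (Loop (s + 2) ?body) (\<tau> y 0) (\<tau> y 0)" by (rule exec_done) (simp add: \<tau>_def)
    then show ?case using exec_Loop[where c = ?body and \<sigma> = "\<tau> y 1" and r = "s + 2", OF u(1)] last u(2) by simp
  next
    case (Suc m)
    have "Suc (y - Suc m) = y - m" using Suc.prems by simp
    then have "exec ?body ((\<tau> (y - Suc m) 1)(s + 2 := 0)) (\<tau> (y - m) 1)" using step[of "y - Suc m"] Suc.prems u(2) by simp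
    then show ?case using exec_Loop[where c = ?body and \<sigma> = "\<tau> (y - Suc m) 1" and r = "s + 2", OF u(1)] Suc by simp
  qed
  have "exec (Inc (s + 2)) \<sigma> (\<tau> 0 1)"
    using exec_Inc[of "s + 2" \<sigma>] by (rule exec_cong) (use s(4) in \<open>auto simp: fun_eq_iff \<tau>_def\<close>)
  moreover have "exec (move s out) (\<tau> y 0) ((\<tau> y 0)(s := 0, out := \<tau> y 0 out + \<tau> y 0 s))"
    using s(2) by (intro exec_move) simp
  moreover have eq: "(\<tau> y 0)(s := 0, out := \<tau> y 0 out + \<tau> y 0 s) = \<sigma>(out := y)"
    using s(2-4) by (auto simp: fun_eq_iff \<tau>_def)
  moreover have "exec (Loop (s + 2) ?body) (\<tau> 0 1) (\<tau> y 0)" using loop[OF le_refl] by simp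
  ultimately have "exec (prog (Minim f) ins out s) \<sigma> ((\<tau> y 0)(s := 0, out := \<tau> y 0 out + \<tau> y 0 s))"
    unfolding prog.simps seqs.simps by (blast intro: exec_Seq exec_Skip)
  from exec_cong[OF this refl eq] show ?case .
qed

section \<open>Counter machines\<close>

definition pr :: "nat \<Rightarrow> nat" where
  "pr = enumerate {p. prime p}"

lemma prime_pr: "prime (pr r)"
  using enumerate_in_set[OF primes_infinite] by (simp add: pr_def)

lemma pr_eq_iff: "pr r = pr s \<longleftrightarrow> r = s"
  using strict_mono_enumerate[OF primes_infinite] by (simp add: pr_def strict_mono_eq)

text \<open>All registers are stored in one counter as exponents of primes; \<open>K\<close> bounds
  the registers in use, as the product must be finite.\<close>

definition goedel :: "nat \<Rightarrow> (nat \<Rightarrow> nat) \<Rightarrow> nat" where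
  "goedel K \<sigma> = (\<Prod>r<K. pr r ^ \<sigma> r)"

lemma goedel_split: "r < K \<Longrightarrow> goedel K \<sigma> = pr r ^ \<sigma> r * (\<Prod>s\<in>{..<K} - {r}. pr s ^ \<sigma> s)"
  unfolding goedel_def by (rule prod.remove) auto

lemma goedel_Suc:
  assumes "r < K"
  shows "goedel K (\<sigma>(r := Suc n)) = pr r * goedel K (\<sigma>(r := n))"
proof -
  have "(\<Prod>s\<in>{..<K} - {r}. pr s ^ (\<sigma>(r := Suc n)) s) = (\<Prod>s\<in>{..<K} - {r}. pr s ^ (\<sigma>(r := n)) s)"
    by (intro prod.cong) auto
  then show ?thesis using goedel_split[OF assms, of "\<sigma>(r := Suc n)"] goedel_split[OF assms, of "\<sigma>(r := n)"] by simp
qed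

lemma goedel_not_dvd:
  assumes "r < K" "\<sigma> r = 0"
  shows "\<not> pr r dvd goedel K \<sigma>"
proof
  assume "pr r dvd goedel K \<sigma>"
  then have "pr r dvd (\<Prod>s\<in>{..<K} - {r}. pr s ^ \<sigma> s)" using goedel_split[OF assms(1), of \<sigma>] assms(2) by simp
  then obtain s where s: "s \<in> {..<K} - {r}" "pr r dvd pr s ^ \<sigma> s"
    using prime_dvd_prod_iff[OF _ prime_pr, of "{..<K} - {r}"] by auto
  then have "pr r dvd pr s" using prime_dvd_power prime_pr by blast
  then have "pr r = pr s" using primes_dvd_imp_eq prime_pr by blast
  then show False using s(1) pr_eq_iff by auto
qed

datatype instr = IncA nat | IncB nat | TestA nat nat | TestB nat nat | Stop

inductive mstep :: "(nat \<Rightarrow> instr) \<Rightarrow> config \<Rightarrow> config \<Rightarrow> bool" for P where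
  inc_a: "P i = IncA j \<Longrightarrow> mstep P (i, a, b) (j, Suc a, b)"
| inc_b: "P i = IncB j \<Longrightarrow> mstep P (i, a, b) (j, a, Suc b)"
| dec_a: "P i = TestA j k \<Longrightarrow> mstep P (i, Suc a, b) (j, a, b)"
| dec_b: "P i = TestB j k \<Longrightarrow> mstep P (i, a, Suc b) (j, a, b)"
| test_a: "P i = TestA j k \<Longrightarrow> mstep P (i, 0, b) (k, 0, b)"
| test_b: "P i = TestB j k \<Longrightarrow> mstep P (i, a, 0) (k, a, 0)"

abbreviation "msteps P \<equiv> (mstep P)\<^sup>*\<^sup>*"

lemma mstep_deterministic: "mstep P c d \<Longrightarrow> mstep P c d' \<Longrightarrow> d = d'"
  by (erule mstep.cases; erule mstep.cases; simp)

fun len :: "cmd \<Rightarrow> nat" where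
  "len Skip = 1"
| "len (Inc r) = pr r + 3"
| "len (Seq c d) = len c + len d"
| "len (Loop r c) = 2 * pr r + 4 + len c"

text \<open>\<open>gen c n x\<close> is code for \<open>c\<close> which occupies the states from \<open>n\<close> on, is entered at \<open>n\<close> and left to \<open>x\<close>.
  The registers are stored as \<open>goedel K \<sigma>\<close> in the first counter, the second one is empty at entry and
  exit. The code for a loop divides by \<open>pr r\<close>; with remainder \<open>k > 0\<close> the quotient is multiplied back,
  the \<open>k\<close> being added by entering the multiplication \<open>k\<close> increments before its test.\<close>

fun gen :: "cmd \<Rightarrow> nat \<Rightarrow> nat \<Rightarrow> instr list" where
  "gen Skip n x = [TestB x x]"
| "gen (Inc r) n x = (let p = pr r in
     TestA (n + 1) (n + p + 1) # map (\<lambda>i. IncB (if i = p then n else n + i + 1)) [1..<p + 1] @ [TestB (n + p + 2) x, IncA (n + p + 1)])"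
| "gen (Seq c d) n x = gen c n (n + len c) @ gen d (n + len c) x"
| "gen (Loop r c) n x = (let p = pr r in
     map (\<lambda>k. TestA (n + k + 1) (if k = 0 then n + p + 1 else n + p + 3 + (p - k + 1))) [0..<p]
     @ [IncB n, TestB (n + p + 2) (n + 2 * p + 4), IncA (n + p + 1), TestB (n + p + 4) x]
     @ map (\<lambda>i. IncA (if i = p then n + p + 3 else n + p + 3 + i + 1)) [1..<p + 1] @ gen c (n + 2 * p + 4) n)"

lemma length_gen [simp]: "length (gen c n x) = len c"
  by (induction c arbitrary: n x) (auto simp: Let_def)

definition located :: "(nat \<Rightarrow> instr) \<Rightarrow> nat \<Rightarrow> instr list \<Rightarrow> bool" where
  "located P n l \<longleftrightarrow> (\<forall>i<length l. P (n + i) = l ! i)"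

lemma located_append: "located P n (l @ l') \<longleftrightarrow> located P n l \<and> located P (n + length l) l'"
proof
  assume *: "located P n (l @ l')"
  have "P (n + i) = l ! i" if "i < length l" for i
    using *[unfolded located_def, rule_format, of i] that by (simp add: nth_append)
  moreover have "P (n + length l + i) = l' ! i" if "i < length l'" for i
    using *[unfolded located_def, rule_format, of "length l + i"] that by (simp add: add.assoc)
  ultimately show "located P n l \<and> located P (n + length l) l'" by (simp add: located_def)
next
  assume *: "located P n l \<and> located P (n + length l) l'"
  show "located P n (l @ l')"
    unfolding located_def
  proof (intro allI impI)
    fix i assume i: "i < length (l @ l')"
    show "P (n + i) = (l @ l') ! i"
    proof (cases "i < length l")
      case True then show ?thesis using * by (simp add: located_def nth_append)
    next
      case False
      then have "P (n + length l + (i - length l)) = l' ! (i - length l)" by (intro *[THEN conjunct2, unfolded located_def, rule_format]) (use i False in auto)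
      moreover have "n + length l + (i - length l) = n + i" using False by simp
      ultimately show ?thesis using False by (simp add: nth_append)
    qed
  qed
qed

lemma located_Cons: "located P n (x # l) \<longleftrightarrow> P n = x \<and> located P (Suc n) l"
  using located_append[of P n "[x]" l] by (simp add: located_def)

lemma located_appendD1: "located P n (l @ l') \<Longrightarrow> located P n l"
  and located_appendD2: "located P n (l @ l') \<Longrightarrow> n + length l = m \<Longrightarrow> located P m l'"
  unfolding located_append by auto

lemma located_map:
  assumes "located P n (map f [m..<m'])" "m \<le> i" "i < m'"
  shows "P (n + (i - m)) = f i"
proof -
  have "P (n + (i - m)) = map f [m..<m'] ! (i - m)"
    by (rule assms(1)[unfolded located_def, rule_format]) (use assms in simp)
  also have "\<dots> = f (m + (i - m))" by (rule nth_map_upt) (use assms in simp)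
  also have "m + (i - m) = i" using assms by simp
  finally show ?thesis .
qed

lemma inc_a_chain: "(\<And>i. i < m \<Longrightarrow> P (q i) = IncA (q (Suc i))) \<Longrightarrow> msteps P (q 0, a, b) (q m, a + m, b)"
proof (induction m)
  case (Suc m)
  then have "msteps P (q 0, a, b) (q m, a + m, b)" by simp
  moreover have "mstep P (q m, a + m, b) (q (Suc m), Suc (a + m), b)" using Suc.prems by (intro inc_a) simp
  ultimately show ?case by simp
qed simp

lemma inc_b_chain: "(\<And>i. i < m \<Longrightarrow> P (q i) = IncB (q (Suc i))) \<Longrightarrow> msteps P (q 0, a, b) (q m, a, b + m)"
proof (induction m)
  case (Suc m)
  then have "msteps P (q 0, a, b) (q m, a, b + m)" by simp
  moreover have "mstep P (q m, a, b + m) (q (Suc m), a, Suc (b + m))" using Suc.prems by (intro inc_b) simp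
  ultimately show ?case by simp
qed simp

lemma dec_a_chain: "(\<And>i. i < m \<Longrightarrow> \<exists>k. P (q i) = TestA (q (Suc i)) k) \<Longrightarrow> msteps P (q 0, a + m, b) (q m, a, b)"
proof (induction m arbitrary: a)
  case (Suc m)
  have "msteps P (q 0, Suc a + m, b) (q m, Suc a, b)" by (rule Suc.IH) (use Suc.prems in simp)
  moreover obtain k where "P (q m) = TestA (q (Suc m)) k" using Suc.prems by blast
  then have "mstep P (q m, Suc a, b) (q (Suc m), a, b)" by (rule dec_a)
  ultimately show ?case by simp
qed simp

lemma move_back:
  assumes "P m = TestB (Suc m) x" "P (Suc m) = IncA m"
  shows "msteps P (m, a, b) (x, a + b, 0)"
proof (induction b arbitrary: a)
  case 0
  then show ?case using test_b[where P = P, OF assms(1)] by auto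
next
  case (Suc b)
  have "mstep P (m, a, Suc b) (Suc m, a, b)" using dec_b[where P = P, OF assms(1)] .
  moreover have "mstep P (Suc m, a, b) (m, Suc a, b)" using inc_a[where P = P, OF assms(2)] .
  ultimately show ?case using Suc[of "Suc a"] by (metis add_Suc add_Suc_right converse_rtranclp_into_rtranclp)
qed

lemma gen_Inc:
  assumes "located P n (gen (Inc r) n x)"
  shows "msteps P (n, a, 0) (x, pr r * a, 0)"
proof -
  let ?p = "pr r"
  let ?l = "map (\<lambda>i. IncB (if i = ?p then n else n + i + 1)) [1..<?p + 1]"
  have g: "located P n ([TestA (n + 1) (n + ?p + 1)] @ ?l @ [TestB (n + ?p + 2) x, IncA (n + ?p + 1)])"
    using assms by (simp only: gen.simps Let_def append.simps)
  have r1: "located P (n + 1) (?l @ [TestB (n + ?p + 2) x, IncA (n + ?p + 1)])" by (rule located_appendD2[OF g]) simp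
  have r2: "located P (n + ?p + 1) [TestB (n + ?p + 2) x, IncA (n + ?p + 1)]" by (rule located_appendD2[OF r1]) simp
  have P: "P n = TestA (n + 1) (n + ?p + 1)" "P (n + ?p + 1) = TestB (Suc (n + ?p + 1)) x" "P (Suc (n + ?p + 1)) = IncA (n + ?p + 1)"
    using located_appendD1[OF g] r2 by (simp_all add: located_Cons)
  have P2: "P (n + i) = IncB (if i = ?p then n else n + i + 1)" if "1 \<le> i" "i \<le> ?p" for i
    using located_map[OF located_appendD1[OF r1] that(1)] that by simp
  have "?p > 0" using prime_gt_0_nat prime_pr by blast
  \<comment> \<open>One unit taken from the first counter is paid for by \<open>?p\<close> units in
    the second.\<close>
  have chunk: "msteps P (n + 1, a, b) (n, a, b + ?p)" for a b
  proof -
    define q where "q i = (if i = ?p then n else n + 1 + i)" for i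
    have "msteps P (q 0, a, b) (q ?p, a, b + ?p)"
      by (rule inc_b_chain) (use P2[of "Suc _"] in \<open>simp add: q_def\<close>)
    then show ?thesis using \<open>?p > 0\<close> by (simp add: q_def)
  qed
  have "msteps P (n, a, b) (n + ?p + 1, 0, b + ?p * a)" for b
  proof (induction a arbitrary: b)
    case 0
    then show ?case using test_a[where P = P, OF P(1)] by auto
  next
    case (Suc a)
    have "msteps P (n, Suc a, b) (n, a, b + ?p)" using converse_rtranclp_into_rtranclp[OF dec_a[where P = P, OF P(1)] chunk] .
    from rtranclp_trans[OF this Suc[of "b + ?p"]] show ?case by (simp add: add.assoc)
  qed
  from rtranclp_trans[OF this move_back[OF P(2,3)]] show ?thesis by (metis add_0)
qed

lemma gen_Loop:
  assumes "located P n (gen (Loop r c) n x)"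
  shows "msteps P (n, pr r * a, 0) (n + 2 * pr r + 4, a, 0)" "\<not> pr r dvd a \<Longrightarrow> msteps P (n, a, 0) (x, a, 0)"
    "located P (n + 2 * pr r + 4) (gen c (n + 2 * pr r + 4) n)"
proof -
  let ?p = "pr r"
  have p: "?p > 0" using prime_gt_0_nat prime_pr by blast
  let ?A = "map (\<lambda>k. TestA (n + k + 1) (if k = 0 then n + ?p + 1 else n + ?p + 3 + (?p - k + 1))) [0..<?p]"
  let ?B = "[IncB n, TestB (n + ?p + 2) (n + 2 * ?p + 4), IncA (n + ?p + 1), TestB (n + ?p + 4) x]"
  let ?C = "map (\<lambda>i. IncA (if i = ?p then n + ?p + 3 else n + ?p + 3 + i + 1)) [1..<?p + 1]"
  let ?D = "gen c (n + 2 * ?p + 4) n"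
  have g: "located P n (?A @ ?B @ ?C @ ?D)" using assms by (simp only: gen.simps Let_def)
  have r1: "located P (n + ?p) (?B @ ?C @ ?D)" by (rule located_appendD2[OF g]) simp
  have r2: "located P (n + ?p + 4) (?C @ ?D)" by (rule located_appendD2[OF r1]) simp
  show "located P (n + 2 * ?p + 4) (gen c (n + 2 * ?p + 4) n)" by (rule located_appendD2[OF r2]) simp
  note 2 = located_appendD1[OF r1] and 3 = located_appendD1[OF r2]
  have P1: "P (n + k) = TestA (n + k + 1) (if k = 0 then n + ?p + 1 else n + ?p + 3 + (?p - k + 1))" if "k < ?p" for k
    using located_map[OF located_appendD1[OF g], of k] that by simp
  have P2: "P (n + ?p) = IncB n" "P (n + ?p + 1) = TestB (Suc (n + ?p + 1)) (n + 2 * ?p + 4)" "P (Suc (n + ?p + 1)) = IncA (n + ?p + 1)"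
    "P (n + ?p + 3) = TestB (n + ?p + 4) x"
    using 2 by (auto simp: located_Cons numeral_eq_Suc)
  have P3: "P (n + ?p + 3 + i) = IncA (if i = ?p then n + ?p + 3 else n + ?p + 3 + i + 1)" if "1 \<le> i" "i \<le> ?p" for i
  proof -
    have "P (n + ?p + 4 + (i - 1)) = IncA (if i = ?p then n + ?p + 3 else n + ?p + 3 + i + 1)"
      using located_map[OF 3 that(1)] that(2) by simp
    moreover have "n + ?p + 4 + (i - 1) = n + ?p + 3 + i" using that by simp
    ultimately show ?thesis by (simp only:)
  qed
  have dec: "msteps P (n, a + k, b) (n + k, a, b)" if "k \<le> ?p" for a b k
    using dec_a_chain[of k P "\<lambda>i. n + i" a b] P1 that by simp
  have chunks: "msteps P (n, ?p * m + k, b) (n, k, b + m)" for m k b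
  proof (induction m arbitrary: b)
    case (Suc m)
    have "msteps P (n, ?p * Suc m + k, b) (n + ?p, ?p * m + k, b)" using dec[of ?p "?p * m + k" b] by (simp add: ac_simps)
    then have "msteps P (n, ?p * Suc m + k, b) (n, ?p * m + k, Suc b)" using inc_b[where P = P, OF P2(1)] by (rule rtranclp.rtrancl_into_rtrancl)
    from rtranclp_trans[OF this Suc[of "Suc b"]] show ?case by simp
  qed simp
  have "mstep P (n, 0, 0 + a) (n + ?p + 1, 0, 0 + a)" using test_a[of P n] P1[of 0] p by simp
  from rtranclp_trans[OF rtranclp.rtrancl_into_rtrancl[OF chunks[of a 0 0] this] move_back[OF P2(2,3)]]
  show "msteps P (n, ?p * a, 0) (n + 2 * ?p + 4, a, 0)" by simp
  assume nd: "\<not> ?p dvd a"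
  define m k where "m = a div ?p" and "k = a mod ?p"
  have a: "?p * m + k = a" by (simp add: m_def k_def)
  have k: "0 < k" "k < ?p" using nd p by (auto simp: k_def dvd_eq_mod_eq_0)
  \<comment> \<open>Entering the cycle \<open>j\<close> increments before its test adds exactly
    \<open>j\<close>: a full round \<open>j = ?p\<close> multiplies, and \<open>j = k\<close>
    restores the remainder.\<close>
  have chain: "msteps P (n + ?p + 3 + (?p - j + 1), a, b) (n + ?p + 3, a + j, b)" if "1 \<le> j" "j \<le> ?p" for j a b
  proof -
    define m where "m = ?p - j"
    have m: "?p = j + m" "?p - j = m" using that by (simp_all add: m_def)
    define q where "q i = (if i = j then n + ?p + 3 else n + ?p + 3 + (m + 1 + i))" for i
    have "P (q i) = IncA (q (Suc i))" if "i < j" for i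
    proof -
      have "(m + 1 + i = ?p) = (Suc i = j)" "m + 1 + i \<le> ?p" using m(1) that by linarith+
      then show ?thesis using P3[of "m + 1 + i"] that by (simp add: q_def)
    qed
    from inc_a_chain[of j P q a b, OF this] have "msteps P (q 0, a, b) (q j, a + j, b)" .
    then show ?thesis using that m(2) by (simp add: q_def)
  qed
  have mult: "msteps P (n + ?p + 3, a, b) (x, a + ?p * b, 0)" for a b
  proof (induction b arbitrary: a)
    case 0
    then show ?case using test_b[where P = P, OF P2(4)] by auto
  next
    case (Suc b)
    have "mstep P (n + ?p + 3, a, Suc b) (n + ?p + 3 + (?p - ?p + 1), a, b)" using dec_b[where P = P, OF P2(4), of a b] by (simp add: numeral_eq_Suc)
    moreover have "msteps P (n + ?p + 3 + (?p - ?p + 1), a, b) (n + ?p + 3, a + ?p, b)" using p by (intro chain) auto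
    ultimately have "msteps P (n + ?p + 3, a, Suc b) (n + ?p + 3, a + ?p, b)" by (rule converse_rtranclp_into_rtranclp)
    from rtranclp_trans[OF this Suc[of "a + ?p"]] show ?case by (simp add: add.assoc)
  qed
  have "msteps P (n, a, 0) (n, k, m)" using chunks[of m k 0] a by simp
  moreover have "msteps P (n, k, m) (n + k, 0, m)" using dec[of k 0 m] k by simp
  moreover have "mstep P (n + k, 0, m) (n + ?p + 3 + (?p - k + 1), 0, m)" using test_a[of P "n + k"] P1[OF k(2)] k(1) by simp
  moreover have "msteps P (n + ?p + 3 + (?p - k + 1), 0, m) (n + ?p + 3, k, m)" using chain[of k 0 m] k by simp
  moreover have "msteps P (n + ?p + 3, k, m) (x, a, 0)" using mult[of k m] a by (simp add: add.commute)
  ultimately show "msteps P (n, a, 0) (x, a, 0)" by (meson rtranclp_trans r_into_rtranclp)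
qed

fun regs :: "cmd \<Rightarrow> nat" where
  "regs Skip = 0"
| "regs (Inc r) = Suc r"
| "regs (Seq c d) = max (regs c) (regs d)"
| "regs (Loop r c) = max (Suc r) (regs c)"

lemma exec_gen:
  "exec c \<sigma> \<sigma>' \<Longrightarrow> located P n (gen c n x) \<Longrightarrow> regs c \<le> K \<Longrightarrow> msteps P (n, goedel K \<sigma>, 0) (x, goedel K \<sigma>', 0)"
proof (induction arbitrary: n x rule: exec.induct)
  case (exec_Skip \<sigma>)
  then have "P n = TestB x x" by (simp add: located_Cons)
  then show ?case using test_b by blast
next
  case (exec_Inc r \<sigma>)
  have "goedel K (\<sigma>(r := Suc (\<sigma> r))) = pr r * goedel K \<sigma>"
    using goedel_Suc[of r K \<sigma> "\<sigma> r"] exec_Inc(2) by (simp only: fun_upd_triv regs.simps Suc_le_eq)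
  then show ?case using gen_Inc[OF exec_Inc(1), of "goedel K \<sigma>"] by (simp only:)
next
  case (exec_Seq c \<sigma> \<sigma>' c' \<sigma>'')
  then have "located P n (gen c n (n + len c))" "located P (n + len c) (gen c' (n + len c) x)" "regs c \<le> K" "regs c' \<le> K"
    by (simp_all add: located_append)
  then show ?case using exec_Seq.IH by (meson rtranclp_trans)
next
  case (exec_done \<sigma> r c)
  then show ?case using gen_Loop(2)[OF exec_done(2) goedel_not_dvd] by simp
next
  case (exec_Loop \<sigma> r m c \<sigma>' \<sigma>'')
  have "goedel K \<sigma> = pr r * goedel K (\<sigma>(r := m))"
    using goedel_Suc[of r K \<sigma> m] exec_Loop.hyps(1) exec_Loop.prems(2) fun_upd_triv[of \<sigma> r] by simp
  then have "msteps P (n, goedel K \<sigma>, 0) (n + 2 * pr r + 4, goedel K (\<sigma>(r := m)), 0)"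
    using gen_Loop(1)[OF exec_Loop.prems(1)] by simp
  moreover have "msteps P (n + 2 * pr r + 4, goedel K (\<sigma>(r := m)), 0) (n, goedel K \<sigma>', 0)"
    by (rule exec_Loop.IH(1)[OF gen_Loop(3)[OF exec_Loop.prems(1)]]) (use exec_Loop.prems(2) in simp)
  moreover have "msteps P (n, goedel K \<sigma>', 0) (x, goedel K \<sigma>'', 0)" using exec_Loop.IH(2)[OF exec_Loop.prems] .
  ultimately show ?case by (meson rtranclp_trans)
qed

section \<open>Machines started on their own code\<close>

section \<open>The relation system of a number\<close>

text \<open>The target of link \<open>k\<close> in the chain of \<open>2 ^ d\<close> increments.
  Link 0 starts in state 0, link \<open>k\<close> in state \<open>d + k\<close>, and the last link
  enters the program at state 2.\<close>

definition follow :: "nat \<Rightarrow> nat \<Rightarrow> nat" where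
  "follow d k = (if k + 1 = 2 ^ d then 2 else d + k + 1)"

definition edge_code :: "nat \<times> nat \<times> nat \<Rightarrow> nat" where
  "edge_code = (\<lambda>(t, i, j). prod_encode (t, prod_encode (i, j)))"

text \<open>The relations of a program coded by \<open>d\<close>, and a chain which starts the program in state 2 with
  \<open>2 ^ d\<close>, that is, \<open>d\<close> in register 0, in the first counter. The states of the chain come after \<open>d\<close>,
  which exceeds all states of the program.\<close>

definition system :: "nat \<Rightarrow> rels" where
  "system d t i j \<longleftrightarrow> edge_code (t, i, j) \<in> set_decode d \<and> (2 \<le> t \<longrightarrow> i \<noteq> j) \<or>
     t = 0 \<and> (i = 0 \<and> j = follow d 0 \<or> (\<exists>k<2 ^ d. 1 \<le> k \<and> i = d + k \<and> j = follow d k))"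

definition extent :: "nat \<Rightarrow> nat" where
  "extent d = d + 2 ^ d + 3"

text \<open>Positions of bits in \<open>d\<close> are below \<open>d\<close>, and so are the states
  coded by them. This keeps the states of the program apart from those of the chain.\<close>

lemma edge_code_less: "edge_code (t, i, j) \<in> set_decode d \<Longrightarrow> i < d \<and> j < d"
proof -
  assume "edge_code (t, i, j) \<in> set_decode d"
  then have "odd (d div 2 ^ edge_code (t, i, j))" by (simp add: set_decode_def)
  then have "2 ^ edge_code (t, i, j) \<le> d" using div_less[of d "2 ^ edge_code (t, i, j)"] by (metis even_zero not_less)
  then have "edge_code (t, i, j) < d" using less_exp[of "edge_code (t, i, j)"] by linarith
  moreover have "i \<le> prod_encode (i, j)" "j \<le> prod_encode (i, j)" "prod_encode (i, j) \<le> edge_code (t, i, j)"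
    by (simp_all add: edge_code_def le_prod_encode_1 le_prod_encode_2)
  ultimately show ?thesis by linarith
qed

lemma supported_system: "supported (system d) (extent d)"
  unfolding supported_def
proof (intro conjI allI impI)
  show "2 \<le> extent d" by (simp add: extent_def)
  fix t i j assume "system d t i j"
  then consider "edge_code (t, i, j) \<in> set_decode d" "2 \<le> t \<longrightarrow> i \<noteq> j" | "t = 0" "i = 0" "j = follow d 0"
    | k where "t = 0" "k < 2 ^ d" "i = d + k" "j = follow d k" unfolding system_def by blast
  note cs = this
  then show "i < extent d"
    by cases (use edge_code_less[of t i j d] in \<open>auto simp: extent_def\<close>)
  show "j < extent d"
    using cs by cases (use edge_code_less[of t i j d] in \<open>auto simp: extent_def follow_def\<close>)
  show "i \<noteq> j" if "2 \<le> t" using cs that by cases auto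
qed

text \<open>A decrement contributes the shift in the opposite direction, since equivalence does not
  see directions.\<close>

fun edges :: "nat \<Rightarrow> instr \<Rightarrow> (nat \<times> nat \<times> nat) set" where
  "edges i (IncA j) = {(0, i, j)}"
| "edges i (IncB j) = {(1, i, j)}"
| "edges i (TestA j k) = {(0, j, i), (2, i, k)}"
| "edges i (TestB j k) = {(1, j, i), (3, i, k)}"
| "edges i Stop = {}"

definition index :: "instr list \<Rightarrow> nat" where
  "index l = set_encode (edge_code ` (\<Union>s<length l. edges (s + 2) (l ! s)))"

lemma edge_index: "edge_code e \<in> set_decode (index l) \<longleftrightarrow> (\<exists>s<length l. e \<in> edges (s + 2) (l ! s))"
proof -
  have "finite (edges i x)" for i x by (cases x) auto
  then have "set_decode (index l) = edge_code ` (\<Union>s<length l. edges (s + 2) (l ! s))"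
    unfolding index_def by (intro set_encode_inverse) auto
  moreover have "inj edge_code" by (auto simp: inj_def edge_code_def)
  ultimately show ?thesis by (auto simp: inj_image_mem_iff)
qed

text \<open>A deterministic machine that generates the same equivalence as \<open>system\<close> at
  its index; determinism makes the equivalence accessible.\<close>

definition machine :: "instr list \<Rightarrow> nat \<Rightarrow> instr" where
  "machine l i = (let d = index l in if i = 0 then IncA (follow d 0) else if 2 \<le> i \<and> i < length l + 2 then l ! (i - 2)
     else if d < i \<and> i < d + 2 ^ d then IncA (follow d (i - d)) else Stop)"

context
  fixes l d assumes d: "d = index l" and large: "length l + 1 \<le> d"
begin

lemma machine_program: "s < length l \<Longrightarrow> machine l (s + 2) = l ! s"
  by (simp add: machine_def)

lemma machine_chain: "machine l 0 = IncA (follow d 0)" "k < 2 ^ d \<Longrightarrow> 1 \<le> k \<Longrightarrow> machine l (d + k) = IncA (follow d k)"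
  using large by (auto simp: machine_def Let_def d)

lemma rstep_mstep: "rstep (system d) c c' \<Longrightarrow> mstep (machine l) c c' \<or> mstep (machine l) c' c"
proof (induction rule: rstep.induct)
  case (shift_a i j a b)
  have "(\<exists>s<length l. (0, i, j) \<in> edges (s + 2) (l ! s)) \<or> machine l i = IncA j"
    using shift_a machine_chain edge_index[of "(0, i, j)" l] unfolding system_def d by auto
  then show ?case
  proof
    assume "\<exists>s<length l. (0, i, j) \<in> edges (s + 2) (l ! s)"
    then obtain s where s: "s < length l" "(0, i, j) \<in> edges (s + 2) (l ! s)" by blast
    then show ?thesis using machine_program[OF s(1)] by (cases "l ! s") (auto intro: mstep.intros)
  qed (auto intro: mstep.intros)
next
  case (shift_b i j a b)
  then obtain s where s: "s < length l" "(1, i, j) \<in> edges (s + 2) (l ! s)"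
    using edge_index[of "(1, i, j)" l] unfolding system_def d by auto
  then show ?case using machine_program[OF s(1)] by (cases "l ! s") (auto intro: mstep.intros)
next
  case (zero_a i j b)
  then obtain s where s: "s < length l" "(2, i, j) \<in> edges (s + 2) (l ! s)"
    using edge_index[of "(2, i, j)" l] unfolding system_def d by auto
  then show ?case using machine_program[OF s(1)] by (cases "l ! s") (auto intro: mstep.intros)
next
  case (zero_b i j a)
  then obtain s where s: "s < length l" "(3, i, j) \<in> edges (s + 2) (l ! s)"
    using edge_index[of "(3, i, j)" l] unfolding system_def d by auto
  then show ?case using machine_program[OF s(1)] by (cases "l ! s") (auto intro: mstep.intros)
qed

lemma system_machine:
  "machine l i = IncA j \<Longrightarrow> system d 0 i j" "machine l i = IncB j \<Longrightarrow> system d 1 i j"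
  "machine l i = TestA j k \<Longrightarrow> system d 0 j i \<and> (i \<noteq> k \<longrightarrow> system d 2 i k)"
  "machine l i = TestB j k \<Longrightarrow> system d 1 j i \<and> (i \<noteq> k \<longrightarrow> system d 3 i k)"
proof -
  have *: "(\<forall>e\<in>edges i I. edge_code e \<in> set_decode d) \<or> (\<exists>j. I = IncA j \<and> system d 0 i j)" if "machine l i = I" "I \<noteq> Stop" for I
  proof (cases "i = 0")
    case True
    then show ?thesis using that by (auto simp: machine_def system_def d Let_def)
  next
    case False
    show ?thesis
    proof (cases "2 \<le> i \<and> i < length l + 2")
      case True
      then have s: "i - 2 < length l" "i - 2 + 2 = i" "l ! (i - 2) = I" using that(1) by (auto simp: machine_def)
      have "edge_code e \<in> set_decode d" if "e \<in> edges i I" for e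
        unfolding d edge_index using s that by (intro exI[of _ "i - 2"]) simp
      then show ?thesis by blast
    next
      case F: False
      then have "d < i" "i < d + 2 ^ d" "I = IncA (follow d (i - d))"
        using that False by (auto simp: machine_def Let_def d split: if_splits)
      then have "i - d < 2 ^ d" "1 \<le> i - d" "i = d + (i - d)" by linarith+
      then show ?thesis using \<open>I = IncA (follow d (i - d))\<close> unfolding system_def by blast
    qed
  qed
  show "system d 0 i j" if "machine l i = IncA j" using *[OF that] by (auto simp: system_def)
  show "system d 1 i j" if "machine l i = IncB j" using *[OF that] by (auto simp: system_def)
  show "system d 0 j i \<and> (i \<noteq> k \<longrightarrow> system d 2 i k)" if "machine l i = TestA j k"
    using *[OF that] by (auto simp: system_def)
  show "system d 1 j i \<and> (i \<noteq> k \<longrightarrow> system d 3 i k)" if "machine l i = TestB j k"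
    using *[OF that] by (auto simp: system_def)
qed

text \<open>The case \<open>c = c'\<close> is a zero test that stays in its state, which
  \<open>system\<close> omits.\<close>

lemma mstep_rstep: "mstep (machine l) c c' \<Longrightarrow> c = c' \<or> rstep (system d) c c' \<or> rstep (system d) c' c"
proof (induction rule: mstep.induct)
  case (inc_a i j a b) then show ?case using system_machine(1) rstep.shift_a[of "system d"] by blast
next
  case (inc_b i j a b) then show ?case using system_machine(2) rstep.shift_b[of "system d"] by blast
next
  case (dec_a i j k a b) then show ?case using system_machine(3) rstep.shift_a[of "system d"] by blast
next
  case (dec_b i j k a b) then show ?case using system_machine(4) rstep.shift_b[of "system d"] by blast
next
  case (test_a i j k b) then show ?case using system_machine(3) rstep.zero_a[of "system d"] by blast
next
  case (test_b i j k a) then show ?case using system_machine(4) rstep.zero_b[of "system d"] by blast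
qed

lemma equivclp_machine: "equivclp (mstep (machine l)) = equivclp (rstep (system d))"
proof (intro ext iffI)
  fix x y assume "equivclp (mstep (machine l)) x y"
  then show "equivclp (rstep (system d)) x y"
  proof (induction rule: equivclp_induct)
    case (step y z)
    then have "equivclp (rstep (system d)) y z"
      using mstep_rstep[of y z] mstep_rstep[of z y] by (auto intro: r_into_equivclp equivclp_sym)
    then show ?case using step by (meson equivclp_trans)
  qed simp
next
  fix x y assume "equivclp (rstep (system d)) x y"
  then show "equivclp (mstep (machine l)) x y"
  proof (induction rule: equivclp_induct)
    case (step y z)
    then have "equivclp (mstep (machine l)) y z"
      using rstep_mstep[of y z] rstep_mstep[of z y] by (auto intro: r_into_equivclp equivclp_sym)
    then show ?case using step by (meson equivclp_trans)
  qed simp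
qed

lemma msteps_start: "msteps (machine l) (0, 0, 0) (2, 2 ^ d, 0)"
proof -
  define q where "q i = (if i = 0 then 0 else follow d (i - 1))" for i
  have "msteps (machine l) (q 0, 0, 0) (q (2 ^ d), 0 + 2 ^ d, 0)"
  proof (rule inc_a_chain)
    fix i :: nat assume i: "i < 2 ^ d"
    have "q i = d + i" if "1 \<le> i" using i that by (auto simp: q_def follow_def)
    then show "machine l (q i) = IncA (q (Suc i))"
      using machine_chain i by (cases "i = 0") (auto simp: q_def)
  qed
  then show ?thesis by (simp add: q_def follow_def)
qed

end

lemma deterministic_confluent:
  assumes det: "\<And>x y z. r x y \<Longrightarrow> r x z \<Longrightarrow> y = z" and "r\<^sup>*\<^sup>* x y" "r\<^sup>*\<^sup>* x z"
  shows "r\<^sup>*\<^sup>* y z \<or> r\<^sup>*\<^sup>* z y"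
  using assms(2,3)
proof (induction rule: rtranclp_induct)
  case (step y y')
  then consider "r\<^sup>*\<^sup>* y z" | "r\<^sup>*\<^sup>* z y" by blast
  then show ?case
  proof cases
    case 1
    then show ?thesis
    proof (cases rule: converse_rtranclpE)
      case base
      then show ?thesis using step.hyps(2) by blast
    next
      case (step w)
      then show ?thesis using det \<open>r y y'\<close> by blast
    qed
  next
    case 2
    then show ?thesis using step.hyps(2) by (meson rtranclp.rtrancl_into_rtrancl)
  qed
qed simp

text \<open>A zigzag of steps can be straightened: a backward step keeps the meeting point, and a
  forward step is absorbed by confluence. So two equivalent configurations without successor are
  equal.\<close>

lemma deterministic_joinable:
  assumes det: "\<And>x y z. r x y \<Longrightarrow> r x z \<Longrightarrow> y = z" and "equivclp r x y"
  shows "\<exists>z. r\<^sup>*\<^sup>* x z \<and> r\<^sup>*\<^sup>* y z"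
  using assms(2)
proof (induction rule: equivclp_induct)
  case (step y y')
  then obtain z where z: "r\<^sup>*\<^sup>* x z" "r\<^sup>*\<^sup>* y z" by blast
  from step.hyps(2) show ?case
  proof
    assume "r y y'"
    have "r\<^sup>*\<^sup>* y' z \<or> r\<^sup>*\<^sup>* z y'"
      by (rule deterministic_confluent[of r y], erule (1) det) (use \<open>r y y'\<close> z(2) in auto)
    then show ?thesis using z(1) by (meson rtranclp_trans rtranclp.rtrancl_refl)
  next
    assume "r y' y"
    then show ?thesis using z by (meson converse_rtranclp_into_rtranclp)
  qed
qed auto

lemma rtranclp_imp_equivclp: "r\<^sup>*\<^sup>* x y \<Longrightarrow> equivclp r x y"
proof (induction rule: rtranclp_induct)
  case (step y z)
  then show ?case using equivclp_trans[of r x y z] r_into_equivclp[of r y z] by blast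
qed simp

text \<open>The first counter arrives with \<open>pr 1 ^ y\<close>: this is 1 for
  \<open>y = 0\<close>, caught by the second test, and at least 2 for \<open>y = 1\<close>, after
  which it is emptied and state 1 is reached.\<close>

definition final :: "nat \<Rightarrow> instr list" where
  "final e = [TestA (e + 1) (e + 3), TestA (e + 2) (e + 3), TestA (e + 2) 1, Stop]"

text \<open>The program \<open>l\<close> is complete before its code \<open>d\<close> is formed,
  because its input comes from the chain in \<open>system d\<close>. Hence \<open>d\<close> may be
  its own input.\<close>

lemma machine_outcome:
  assumes "computes t [d] y" "y \<le> 1"
    and c: "c = Seq (prog t [0] 1 2) (clear 0)" and l: "l = gen c 2 (2 + len c) @ final (2 + len c)" and d: "d = index l"
  shows "collapses (system d) \<longleftrightarrow> y = 1"
proof -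
  let ?e = "2 + len c" and ?P = "machine l"
  have len: "length l = len c + 4" by (simp add: l final_def)
  have nth: "l ! (len c + i) = final ?e ! i" for i by (simp add: l nth_append)
  \<comment> \<open>The zero test of the second instruction of \<open>final\<close> names the last
    state of the program, so \<open>d\<close> exceeds all program states.\<close>
  have "(2, len c + 3, ?e + 3) \<in> edges (Suc (len c) + 2) (l ! Suc (len c))" using nth[of 1] by (simp add: final_def)
  then have "edge_code (2, len c + 3, ?e + 3) \<in> set_decode d" unfolding d edge_index by (intro exI[of _ "Suc (len c)"] conjI) (simp_all add: len)
  then have large: "length l + 1 \<le> d" using edge_code_less len by fastforce
  note pm = machine_program[OF d large] and start = msteps_start[OF d large] and eq = equivclp_machine[OF d large]
  have loc: "located ?P 2 (gen c 2 ?e)"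
    unfolding located_def
  proof (intro allI impI)
    fix i assume "i < length (gen c 2 ?e)"
    then show "?P (2 + i) = gen c 2 ?e ! i" using pm[of i] len by (simp add: l nth_append)
  qed
  have fin: "?P (?e + i) = final ?e ! i" if "i < 4" for i
    using pm[of "len c + i"] nth[of i] len that by (simp add: ac_simps)
  have F: "?P ?e = TestA (?e + 1) (?e + 3)" "?P (?e + 1) = TestA (?e + 2) (?e + 3)" "?P (?e + 2) = TestA (?e + 2) 1" "?P (?e + 3) = Stop"
    using fin[of 0] fin[of 1] fin[of 2] fin[of 3] by (simp_all add: final_def)
  define K where "K = max (regs c) 2"
  let ?\<sigma> = "(\<lambda>_. 0)(0 := d)"
  have "exec (prog t [0] 1 2) ?\<sigma> (?\<sigma>(1 := y))"
    by (rule exec_prog[OF assms(1)]) (auto simp: ready_def)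
  from exec_Seq[OF this exec_clear[of 0]] have ex: "exec c ?\<sigma> (?\<sigma>(1 := y, 0 := 0))" unfolding c .
  \<comment> \<open>The chain leaves \<open>2 ^ d\<close>, which is the Goedel number of
    \<open>d\<close> in register 0 because the first prime is 2.\<close>
  have "pr 0 = 2" unfolding pr_def enumerate_0 by (rule Least_equality) (auto intro: prime_ge_2_nat)
  then have "goedel K ?\<sigma> = 2 ^ d"
    using goedel_split[of 0 K ?\<sigma>] by (simp add: K_def)
  moreover have "goedel K (?\<sigma>(1 := y, 0 := 0)) = pr 1 ^ y"
  proof -
    have "(\<Prod>s\<in>{..<K} - {1}. pr s ^ (?\<sigma>(1 := y, 0 := 0)) s) = 1" by (rule prod.neutral) auto
    then show ?thesis using goedel_split[of 1 K "?\<sigma>(1 := y, 0 := 0)"] by (simp add: K_def)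
  qed
  moreover have "msteps ?P (2, goedel K ?\<sigma>, 0) (?e, goedel K (?\<sigma>(1 := y, 0 := 0)), 0)"
    by (rule exec_gen[OF ex loc]) (simp add: K_def)
  ultimately have run: "msteps ?P (0, 0, 0) (?e, pr 1 ^ y, 0)"
    using start by (metis rtranclp_trans)
  have stuck: "\<not> mstep ?P (s, a, b) z" if "?P s = Stop" for s a b z
    using that by (auto elim: mstep.cases)
  have P1: "?P 1 = Stop" using large by (simp add: machine_def Let_def d)
  show ?thesis
  proof (cases "y = 1")
    case True
    obtain m where m: "pr 1 = Suc (Suc m)" using prime_ge_2_nat[OF prime_pr, of 1] by (metis add_2_eq_Suc le_Suc_ex)
    have "msteps ?P (?e + 2, m, 0) (1, 0, 0)" for m
    proof (induction m)
      case 0 show ?case using test_a[where P = ?P, OF F(3)] by blast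
    next
      case (Suc m)
      show ?case by (rule converse_rtranclp_into_rtranclp[OF dec_a[where P = ?P, OF F(3)] Suc])
    qed
    then have "msteps ?P (?e, pr 1 ^ y, 0) (1, 0, 0)"
      using dec_a[where P = ?P, OF F(1), of "Suc m" 0] dec_a[where P = ?P, OF F(2), of m 0] True m
      by (metis converse_rtranclp_into_rtranclp power_one_right)
    with run have "msteps ?P (0, 0, 0) (1, 0, 0)" by (rule rtranclp_trans)
    then have "equivclp (mstep ?P) (0, 0, 0) (1, 0, 0)" by (rule rtranclp_imp_equivclp)
    then show ?thesis using True eq by (simp add: collapses_def)
  next
    case False
    then have "y = 0" using assms(2) by simp
    have "mstep ?P (?e, Suc 0, 0) (?e + 1, 0, 0)" "mstep ?P (?e + 1, 0, 0) (?e + 3, 0, 0)"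
      using dec_a[where P = ?P, OF F(1)] test_a[where P = ?P, OF F(2)] by blast+
    then have r: "msteps ?P (0, 0, 0) (?e + 3, 0, 0)" using run \<open>y = 0\<close> by (simp add: rtranclp.rtrancl_into_rtrancl)
    have "\<not> equivclp (mstep ?P) (0, 0, 0) (1, 0, 0)"
    proof
      assume "equivclp (mstep ?P) (0, 0, 0) (1, 0, 0)"
      moreover have det: "v = w" if "mstep ?P u v" "mstep ?P u w" for u v w using that by (rule mstep_deterministic)
      ultimately obtain z where z: "msteps ?P (0, 0, 0) z" "msteps ?P (1, 0, 0) z"
        using deterministic_joinable[of "mstep ?P" "(0, 0, 0)" "(1, 0, 0)"] by blast
      have "z = (1, 0, 0)" using z(2) stuck[OF P1] by (auto elim: converse_rtranclpE)
      then have "msteps ?P (1, 0, 0) (?e + 3, 0, 0) \<or> msteps ?P (?e + 3, 0, 0) (1, 0, 0)"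
        using deterministic_confluent[of "mstep ?P" "(0, 0, 0)" z "(?e + 3, 0, 0)"] det z(1) r by blast
      then show False using stuck[OF P1] stuck[OF F(4)] by (auto elim: converse_rtranclpE)
    qed
    then show ?thesis using False eq by (simp add: collapses_def)
  qed
qed

theorem self_referential_system: "\<exists>d. \<forall>y\<le>1. computes t [d] y \<longrightarrow> (collapses (system d) \<longleftrightarrow> y = 1)"
  using machine_outcome by blast

section \<open>The code of the matroid as a recursive function of \<open>d\<close>\<close>

section \<open>The matroid of a relation system is computable\<close>

text \<open>\<open>set_encode\<close> is a sum of powers of 2, so the code becomes a bounded sum
  over codes \<open>s\<close> of subsets; a ground set below \<open>m\<close> gives
  \<open>s < 2 ^ m\<close>.\<close>

lemma matroid_code_sum:
  assumes "E \<subseteq> {..<m}"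
  shows "matroid_code E r = (\<Sum>s<2 ^ m. of_bool (set_decode s \<subseteq> E) * 2 ^ prod_encode (s, r (set_decode s)))"
proof -
  have fE: "finite E" using assms finite_subset by blast
  have fin: "finite S" if "S \<subseteq> E" for S using fE that finite_subset by blast
  have se: "set_encode A = (\<Sum>x\<in>A. 2 ^ x)" for A by (simp add: set_encode_def)
  have "matroid_code E r = (\<Sum>S\<in>Pow E. 2 ^ prod_encode (set_encode S, r S))"
    unfolding matroid_code_def
  proof (subst se, subst sum.reindex)
    show "inj_on (\<lambda>S. prod_encode (set_encode S, r S)) (Pow E)"
      using fin by (intro inj_onI) (auto dest: inj_onD[OF inj_on_set_encode])
  qed simp
  also have "\<dots> = (\<Sum>s\<in>{s. s < 2 ^ m \<and> set_decode s \<subseteq> E}. 2 ^ prod_encode (s, r (set_decode s)))"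
  proof (rule sum.reindex_bij_witness[of _ set_decode set_encode])
    fix S assume "S \<in> Pow E"
    then have S: "S \<subseteq> E" "finite S" using fin by auto
    then show "set_decode (set_encode S) = S" by simp
    have "set_encode S < 2 ^ m"
    proof -
      have "set_encode S \<le> (\<Sum>i<m. 2 ^ i)" unfolding set_encode_def using S assms by (intro sum_mono2) auto
      also have "\<dots> = 2 ^ m - 1" by (induction m) auto
      finally show ?thesis by (metis One_nat_def Suc_pred le_imp_less_Suc zero_less_numeral zero_less_power)
    qed
    then show "set_encode S \<in> {s. s < 2 ^ m \<and> set_decode s \<subseteq> E}" using S by simp
    show "2 ^ prod_encode (set_encode S, r (set_decode (set_encode S))) = 2 ^ prod_encode (set_encode S, r S)" using S by simp
  qed auto
  also have "\<dots> = (\<Sum>s<2 ^ m. of_bool (set_decode s \<subseteq> E) * 2 ^ prod_encode (s, r (set_decode s)))"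
    by (rule sum.mono_neutral_cong_left) auto
  finally show ?thesis .
qed

lemma set_decode_less: "x \<in> set_decode s \<Longrightarrow> x < s"
proof -
  assume "x \<in> set_decode s"
  then have "odd (s div 2 ^ x)" by (simp add: set_decode_def)
  then have "2 ^ x \<le> s" using div_less[of s "2 ^ x"] by (metis even_zero not_less)
  then show ?thesis using less_exp[of x] by linarith
qed

abbreviation "word_set d \<equiv> words (extent d)"
abbreviation "quad_set d \<equiv> quads (system d) (extent d)"

text \<open>This and the following definitions restate the matroid with bounded quantifiers over
  numbers, so that the closure rules for recursive functions apply.\<close>

definition is_word :: "nat \<Rightarrow> nat \<Rightarrow> bool" where
  "is_word d x \<longleftrightarrow> (\<exists>t\<in>set templates. \<exists>i<extent d. x = list_encode (subst_word i 0 t))"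

definition is_quad :: "nat \<Rightarrow> nat \<Rightarrow> bool" where
  "is_quad d x \<longleftrightarrow> (\<exists>f\<in>set families. \<exists>i<extent d. \<exists>j<extent d. admits (system d) (fst f) i j \<and> x = quad_code (subst_quad i j (snd f)))"

definition is_point :: "nat \<Rightarrow> nat \<Rightarrow> bool" where
  "is_point d n \<longleftrightarrow> n mod 8 = 0 \<and> n div 8 \<le> 2 \<or> n mod 8 = 1 \<and> is_word d (n div 8) \<or>
     2 \<le> n mod 8 \<and> n mod 8 \<le> 5 \<and> is_quad d (n div 8)"

definition code_on_line :: "nat \<Rightarrow> nat \<Rightarrow> bool" where
  "code_on_line l n \<longleftrightarrow> l = 0 \<and> (n = 0 \<or> n = 8 \<or> n mod 8 = 1) \<or> l = 1 \<and> (n = 8 \<or> n = 16 \<or> n mod 8 = 2 \<or> n mod 8 = 3)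
     \<or> l = 2 \<and> (n = 0 \<or> n = 16 \<or> n mod 8 = 4 \<or> n mod 8 = 5)"

definition in_triangle :: "bool \<Rightarrow> bool \<Rightarrow> quad \<Rightarrow> nat \<Rightarrow> bool" where
  "in_triangle \<beta> \<gamma> e n \<longleftrightarrow> n = 8 * list_encode (slot e \<beta> \<gamma>) + 1 \<or> n = 8 * quad_code e + (if \<beta> then 3 else 2) \<or> n = 8 * quad_code e + (if \<gamma> then 5 else 4)"

text \<open>Finite alternatives are written with \<open>set\<close> of a list to match
  \<open>decidable_list_ex\<close>.\<close>

definition code_col :: "nat \<Rightarrow> nat \<Rightarrow> nat \<Rightarrow> nat \<Rightarrow> bool" where
  "code_col d x y z \<longleftrightarrow> x = y \<or> y = z \<or> x = z \<or> (\<exists>l\<in>set [0, 1, 2]. code_on_line l x \<and> code_on_line l y \<and> code_on_line l z) \<or>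
     (\<exists>f\<in>set families. \<exists>i<extent d. \<exists>j<extent d. admits (system d) (fst f) i j \<and>
       (\<exists>\<beta>\<in>set [False, True]. \<exists>\<gamma>\<in>set [False, True]. in_triangle \<beta> \<gamma> (subst_quad i j (snd f)) x \<and> in_triangle \<beta> \<gamma> (subst_quad i j (snd f)) y
         \<and> in_triangle \<beta> \<gamma> (subst_quad i j (snd f)) z))"

definition code_rank :: "nat \<Rightarrow> nat \<Rightarrow> nat" where
  "code_rank d s = of_bool (\<exists>x<s. x \<in> set_decode s) + of_bool (\<exists>x<s. \<exists>y<s. x \<in> set_decode s \<and> y \<in> set_decode s \<and> x \<noteq> y)
     + of_bool (\<exists>x<s. \<exists>y<s. \<exists>z<s. x \<in> set_decode s \<and> y \<in> set_decode s \<and> z \<in> set_decode s \<and> \<not> code_col d x y z)"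

text \<open>Joints have codes up to 16, and any other code is eight times an index plus at most
  5.\<close>

definition code_bound :: "nat \<Rightarrow> nat" where
  "code_bound d = 25 + (\<Sum>t\<leftarrow>templates. \<Sum>i<extent d. 8 * list_encode (subst_word i 0 t) + 6)
     + (\<Sum>f\<leftarrow>families. \<Sum>i<extent d. \<Sum>j<extent d. 8 * quad_code (subst_quad i j (snd f)) + 6)"

definition code_matroid :: "nat \<Rightarrow> nat" where
  "code_matroid d = (\<Sum>s<2 ^ code_bound d. of_bool (\<forall>n<s. n \<in> set_decode s \<longrightarrow> is_point d n) * 2 ^ prod_encode (s, code_rank d s))"

lemma is_word: "is_word d (list_encode w) \<longleftrightarrow> w \<in> word_set d"
  unfolding is_word_def words_def by (auto simp: inj_eq[OF inj_list_encode])

lemma is_word': "is_word d x \<Longrightarrow> \<exists>w\<in>word_set d. x = list_encode w"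
  unfolding is_word_def words_def by blast

lemma quad_set_iff: "e \<in> quad_set d \<longleftrightarrow> (\<exists>f\<in>set families. \<exists>i<extent d. \<exists>j<extent d. admits (system d) (fst f) i j \<and> e = subst_quad i j (snd f))"
  unfolding quads_def by force

lemma quad_set_Bex:
  "(\<exists>f\<in>set families. \<exists>i<extent d. \<exists>j<extent d. admits (system d) (fst f) i j \<and> P (subst_quad i j (snd f))) \<longleftrightarrow> (\<exists>e\<in>quad_set d. P e)"
proof
  assume "\<exists>f\<in>set families. \<exists>i<extent d. \<exists>j<extent d. admits (system d) (fst f) i j \<and> P (subst_quad i j (snd f))"
  then obtain f i j where f: "f \<in> set families" "i < extent d" "j < extent d" "admits (system d) (fst f) i j" "P (subst_quad i j (snd f))"
    by (elim bexE exE conjE)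
  have "subst_quad i j (snd f) \<in> quad_set d" using quadsI[of "fst f" "snd f" i "extent d" j "system d"] f by simp
  then show "\<exists>e\<in>quad_set d. P e" using f(5) by (rule bexI[rotated])
next
  assume "\<exists>e\<in>quad_set d. P e"
  then obtain e where e: "e \<in> quad_set d" "P e" by (elim bexE)
  obtain f i j where f: "f \<in> set families" "i < extent d" "j < extent d" "admits (system d) (fst f) i j" "e = subst_quad i j (snd f)"
    using quad_set_iff[THEN iffD1, OF e(1)] by (elim bexE exE conjE)
  then show "\<exists>f\<in>set families. \<exists>i<extent d. \<exists>j<extent d. admits (system d) (fst f) i j \<and> P (subst_quad i j (snd f))"
    using e(2) by (intro bexI[of _ f] exI[of _ i] exI[of _ j] conjI) simp_all
qed

lemma is_quad: "is_quad d x \<longleftrightarrow> (\<exists>e\<in>quad_set d. x = quad_code e)"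
  unfolding is_quad_def by (rule quad_set_Bex)

lemma is_point: "is_point d n \<longleftrightarrow> n \<in> pt_code ` points (word_set d) (quad_set d)"
proof
  assume p: "is_point d n"
  have n: "n = 8 * (n div 8) + n mod 8" by simp
  from p consider "n mod 8 = 0 \<and> n div 8 \<le> 2" | "n mod 8 = 1 \<and> is_word d (n div 8)" | "2 \<le> n mod 8 \<and> n mod 8 \<le> 5 \<and> is_quad d (n div 8)"
    unfolding is_point_def by (elim disjE)
  then show "n \<in> pt_code ` points (word_set d) (quad_set d)"
  proof cases
    case 1
    then have "n = pt_code (Joint (n div 8))" "n div 8 \<in> {0, 1, 2}" using n by auto
    then show ?thesis unfolding points_def by blast
  next
    case 2
    then obtain w where "w \<in> word_set d" "n div 8 = list_encode w" using is_word' by blast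
    then have "n = pt_code (Lpt w)" "Lpt w \<in> points (word_set d) (quad_set d)" using n 2 by (auto simp: points_def)
    then show ?thesis by blast
  next
    case 3
    then obtain e where e: "e \<in> quad_set d" "n div 8 = quad_code e" using is_quad by blast
    have "n mod 8 = 2 \<or> n mod 8 = 3 \<or> n mod 8 = 4 \<or> n mod 8 = 5" using 3 by linarith
    then have "n = pt_code (Rpt False e) \<or> n = pt_code (Rpt True e) \<or> n = pt_code (Spt False e) \<or> n = pt_code (Spt True e)"
      using n e(2) by auto
    moreover have "Rpt \<beta> e \<in> points (word_set d) (quad_set d)" "Spt \<beta> e \<in> points (word_set d) (quad_set d)" for \<beta>
      using e(1) by (auto simp: points_def)
    ultimately show ?thesis by blast
  qed
next
  assume "n \<in> pt_code ` points (word_set d) (quad_set d)"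
  then obtain p where p: "p \<in> points (word_set d) (quad_set d)" "n = pt_code p" by blast
  have m: "n div 8 = pt_index p" "n mod 8 = pt_kind p" using p(2) pt_code_div_mod by auto
  show "is_point d n"
    using p(1) by (cases p) (auto simp: is_point_def m points_def is_word is_quad)
qed

lemma code_on_line: "p \<in> points W Q \<Longrightarrow> l < 3 \<Longrightarrow> code_on_line l (pt_code p) \<longleftrightarrow> on_line l p"
proof -
  assume p: "p \<in> points W Q" "l < 3"
  have m: "(8 * k + 1) mod 8 = 1" "(8 * k + 2) mod 8 = 2" "(8 * k + 3) mod 8 = 3" "(8 * k + 4) mod 8 = 4" "(8 * k + 5) mod 8 = 5" for k :: nat
    by presburger+
  have ne: "8 * k + 1 \<noteq> 8 * l" "8 * k + 2 \<noteq> 8 * l" "8 * k + 3 \<noteq> 8 * l" "8 * k + 4 \<noteq> 8 * l" "8 * k + 5 \<noteq> 8 * l" for k l :: nat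
    by presburger+
  show ?thesis
  proof (cases p)
    case (Joint i)
    then have "i = 0 \<or> i = 1 \<or> i = 2" using p(1) by (auto simp: points_def)
    then show ?thesis using Joint p(2) by (auto simp: code_on_line_def)
  next
    case (Lpt w)
    then show ?thesis using m(1)[of "list_encode w"] ne(1)[of "list_encode w" 1] ne(1)[of "list_encode w" 2] by (auto simp: code_on_line_def)
  next
    case (Rpt \<beta> e)
    then show ?thesis using m(2,3)[of "quad_code e"] ne(2,3)[of "quad_code e" 1] ne(2,3)[of "quad_code e" 2] by (auto simp: code_on_line_def)
  next
    case (Spt \<beta> e)
    then show ?thesis using m(4,5)[of "quad_code e"] ne(4,5)[of "quad_code e" 1] ne(4,5)[of "quad_code e" 2] by (auto simp: code_on_line_def)
  qed
qed

lemma in_triangle: "in_triangle \<beta> \<gamma> e (pt_code p) \<longleftrightarrow> p \<in> triangle \<beta> \<gamma> e"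
proof -
  have "in_triangle \<beta> \<gamma> e (pt_code p) \<longleftrightarrow> pt_code p \<in> pt_code ` triangle \<beta> \<gamma> e"
    by (auto simp: in_triangle_def triangle_def)
  then show ?thesis using inj_image_mem_iff[OF inj_pt_code] by simp
qed

lemma (in quad_matroid) code_col:
  assumes "W = word_set d" "Q = quad_set d" "p \<in> points W Q" "q \<in> points W Q" "r \<in> points W Q"
  shows "code_col d (pt_code p) (pt_code q) (pt_code r) \<longleftrightarrow> col p q r"
proof -
  have lines: "(\<exists>l\<in>quad_lines Q. {p, q, r} \<subseteq> l) \<longleftrightarrow> (\<exists>l<3. on_line l p \<and> on_line l q \<and> on_line l r) \<or>
    (\<exists>e\<in>Q. \<exists>\<beta> \<gamma>. p \<in> triangle \<beta> \<gamma> e \<and> q \<in> triangle \<beta> \<gamma> e \<and> r \<in> triangle \<beta> \<gamma> e)"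
    unfolding quad_lines_def by blast
  have l3: "(\<exists>l\<in>set [0, 1, 2]. P l) \<longleftrightarrow> (\<exists>l<3. P l)" for P :: "nat \<Rightarrow> bool" by (auto simp: numeral_3_eq_3 less_Suc_eq numeral_2_eq_2)
  have b2: "(\<exists>\<beta>\<in>set [False, True]. P \<beta>) \<longleftrightarrow> (\<exists>\<beta>. P \<beta>)" for P :: "bool \<Rightarrow> bool" by (metis (full_types) list.set_intros)
  have e: "pt_code x = pt_code y \<longleftrightarrow> x = y" for x y using inj_pt_code by (rule inj_eq)
  have ol: "(\<exists>l<3. code_on_line l (pt_code p) \<and> code_on_line l (pt_code q) \<and> code_on_line l (pt_code r)) \<longleftrightarrow> (\<exists>l<3. on_line l p \<and> on_line l q \<and> on_line l r)"
    using code_on_line assms(3-5) by blast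
  have "(\<exists>f\<in>set families. \<exists>i<extent d. \<exists>j<extent d. admits (system d) (fst f) i j \<and> P (subst_quad i j (snd f))) \<longleftrightarrow> (\<exists>e\<in>Q. P e)" for P
    unfolding assms(2) by (rule quad_set_Bex)
  note Bex = this[of "\<lambda>e. \<exists>\<beta> \<gamma>. p \<in> triangle \<beta> \<gamma> e \<and> q \<in> triangle \<beta> \<gamma> e \<and> r \<in> triangle \<beta> \<gamma> e"]
  show ?thesis unfolding code_col_def col_def lines l3 b2 e ol in_triangle Bex ..
qed

lemma point_less_bound: "is_point d n \<Longrightarrow> n < code_bound d"
proof -
  assume p: "is_point d n"
  have n: "n = 8 * (n div 8) + n mod 8" "n mod 8 < 8" by simp_all
  from p consider "n mod 8 = 0 \<and> n div 8 \<le> 2" | "n mod 8 = 1 \<and> is_word d (n div 8)" | "2 \<le> n mod 8 \<and> n mod 8 \<le> 5 \<and> is_quad d (n div 8)"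
    unfolding is_point_def by (elim disjE)
  then show ?thesis
  proof cases
    case 1 then have "n \<le> 16" using n by linarith
    then show ?thesis unfolding code_bound_def by linarith
  next
    case 2
    then obtain t i where t: "t \<in> set templates" "i < extent d" "n div 8 = list_encode (subst_word i 0 t)" unfolding is_word_def by blast
    have "8 * list_encode (subst_word i 0 t) + 6 \<le> (\<Sum>i<extent d. 8 * list_encode (subst_word i 0 t) + 6)"
      using t(2) by (intro member_le_sum[of i "{..<extent d}" "\<lambda>i. 8 * list_encode (subst_word i 0 t) + 6"]) auto
    also have "\<dots> \<le> (\<Sum>t\<leftarrow>templates. \<Sum>i<extent d. 8 * list_encode (subst_word i 0 t) + 6)"
      using t(1) by (intro member_le_sum_list) auto
    finally show ?thesis using n t(3) conjunct1[OF 2] unfolding code_bound_def by linarith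
  next
    case 3
    then obtain f i j where f: "f \<in> set families" "i < extent d" "j < extent d" "n div 8 = quad_code (subst_quad i j (snd f))" unfolding is_quad_def by blast
    let ?g = "\<lambda>f i j. 8 * quad_code (subst_quad i j (snd f)) + 6"
    have "?g f i j \<le> (\<Sum>j<extent d. ?g f i j)"
      using f(3) by (intro member_le_sum[of j "{..<extent d}" "?g f i"]) auto
    also have "\<dots> \<le> (\<Sum>i<extent d. \<Sum>j<extent d. ?g f i j)"
      using f(2) by (intro member_le_sum[of i "{..<extent d}" "\<lambda>i. \<Sum>j<extent d. ?g f i j"]) auto
    also have "\<dots> \<le> (\<Sum>f\<leftarrow>families. \<Sum>i<extent d. \<Sum>j<extent d. ?g f i j)"
      using f(1) by (intro member_le_sum_list) auto
    finally show ?thesis using n f(4) conjunct1[OF conjunct2[OF 3]] unfolding code_bound_def by linarith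
  qed
qed

lemma (in quad_matroid) code_matroid:
  assumes W: "W = word_set d" and Q: "Q = quad_set d"
  shows "matroid_code ground rank = code_matroid d"
proof -
  have g: "n \<in> ground \<longleftrightarrow> is_point d n" for n unfolding is_point W[symmetric] Q[symmetric] ground_def ..
  have r1: "ground \<subseteq> {..<code_bound d}" using g point_less_bound by blast
  have r2: "set_decode s \<subseteq> ground \<longleftrightarrow> (\<forall>n<s. n \<in> set_decode s \<longrightarrow> is_point d n)" for s
    using g set_decode_less by blast
  have r3: "rank (set_decode s) = code_rank d s" if "set_decode s \<subseteq> ground" for s
  proof -
    define T where "T = {p \<in> points W Q. pt_code p \<in> set_decode s}"
    have T: "set_decode s = pt_code ` T" using that by (auto simp: T_def ground_def)
    have TP: "p \<in> points W Q" if "p \<in> T" for p using that by (simp add: T_def)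
    have b: "(\<exists>x<s. x \<in> set_decode s \<and> P x) \<longleftrightarrow> (\<exists>p\<in>T. P (pt_code p))" for P
    proof
      assume "\<exists>x<s. x \<in> set_decode s \<and> P x"
      then obtain x where "x \<in> set_decode s" "P x" by blast
      then show "\<exists>p\<in>T. P (pt_code p)" unfolding T by (elim imageE) (intro bexI, simp_all)
    next
      assume "\<exists>p\<in>T. P (pt_code p)"
      then obtain p where p: "p \<in> T" "P (pt_code p)" by blast
      then have "pt_code p \<in> set_decode s" by (simp add: T_def)
      then show "\<exists>x<s. x \<in> set_decode s \<and> P x" using set_decode_less p(2) by (intro exI[of _ "pt_code p"] conjI)
    qed
    have e: "pt_code x \<noteq> pt_code y \<longleftrightarrow> x \<noteq> y" for x y using inj_eq[OF inj_pt_code] by blast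
    have 1: "(\<exists>x<s. x \<in> set_decode s) \<longleftrightarrow> (\<exists>x. x \<in> T)" using b[of "\<lambda>_. True"] by blast
    have "(\<exists>x<s. \<exists>y<s. x \<in> set_decode s \<and> y \<in> set_decode s \<and> x \<noteq> y) \<longleftrightarrow> (\<exists>x<s. x \<in> set_decode s \<and> (\<exists>y<s. y \<in> set_decode s \<and> x \<noteq> y))" by blast
    then have 2: "(\<exists>x<s. \<exists>y<s. x \<in> set_decode s \<and> y \<in> set_decode s \<and> x \<noteq> y) \<longleftrightarrow> (\<exists>x\<in>T. \<exists>y\<in>T. x \<noteq> y)" unfolding b e .
    have "(\<exists>x<s. \<exists>y<s. \<exists>z<s. x \<in> set_decode s \<and> y \<in> set_decode s \<and> z \<in> set_decode s \<and> \<not> code_col d x y z) \<longleftrightarrow>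
      (\<exists>x<s. x \<in> set_decode s \<and> (\<exists>y<s. y \<in> set_decode s \<and> (\<exists>z<s. z \<in> set_decode s \<and> \<not> code_col d x y z)))" by blast
    then have 3: "(\<exists>x<s. \<exists>y<s. \<exists>z<s. x \<in> set_decode s \<and> y \<in> set_decode s \<and> z \<in> set_decode s \<and> \<not> code_col d x y z) \<longleftrightarrow>
      (\<exists>x\<in>T. \<exists>y\<in>T. \<exists>z\<in>T. \<not> col x y z)" unfolding b using code_col[OF W Q TP TP TP] by blast
    have "rank (set_decode s) = rk T" by (simp add: rank_def T_def)
    then show ?thesis unfolding rk_def code_rank_def 1 2 3 by simp
  qed
  show ?thesis
    unfolding matroid_code_sum[OF r1] code_matroid_def r2[symmetric]
  proof (rule sum.cong[OF refl])
    fix s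
    show "of_bool (set_decode s \<subseteq> ground) * (2 :: nat) ^ prod_encode (s, rank (set_decode s)) = of_bool (set_decode s \<subseteq> ground) * 2 ^ prod_encode (s, code_rank d s)"
      using r3[of s] by (cases "set_decode s \<subseteq> ground") simp_all
  qed
qed

lemmas recursive_intros = recursive_sum recursive_mult recursive_power recursive_diff recursive_add recursive_div recursive_mod
  recursive_prod_encode recursive_of_bool decidable_not decidable_conj decidable_disj decidable_imp decidable_ex decidable_all
  decidable_le decidable_less decidable_eq decidable_set_decode recursive_var recursive_hd recursive_Suc

text \<open>Decidability is shown once for variables and then transferred to arbitrary recursive
  arguments.\<close>

lemma decidable_comp:
  "decidable (Suc (Suc 0)) (\<lambda>xs. P (hd xs) (hd (tl xs))) \<Longrightarrow> recursive k A \<Longrightarrow> recursive k B \<Longrightarrow> decidable k (\<lambda>xs. P (A xs) (B xs))"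
  unfolding decidable_def using recursive_compose[of "[A, B]" "\<lambda>xs. of_bool (P (hd xs) (hd (tl xs)))" k] by auto

lemma decidable_comp4:
  "decidable (Suc (Suc (Suc (Suc 0)))) (\<lambda>xs. S (hd xs) (hd (tl xs)) (hd (tl (tl xs))) (hd (tl (tl (tl xs))))) \<Longrightarrow>
   recursive k A \<Longrightarrow> recursive k B \<Longrightarrow> recursive k C \<Longrightarrow> recursive k D \<Longrightarrow> decidable k (\<lambda>xs. S (A xs) (B xs) (C xs) (D xs))"
  unfolding decidable_def
  using recursive_compose[of "[A, B, C, D]" "\<lambda>xs. of_bool (S (hd xs) (hd (tl xs)) (hd (tl (tl xs))) (hd (tl (tl (tl xs)))))" k] by auto

lemma recursive_extent: "recursive k D \<Longrightarrow> recursive k (\<lambda>xs. extent (D xs))"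
  unfolding extent_def by (intro recursive_intros recursive_const)

lemma decidable_system4:
  "decidable (Suc (Suc (Suc (Suc 0)))) (\<lambda>xs. system (hd xs) (hd (tl xs)) (hd (tl (tl xs))) (hd (tl (tl (tl xs)))))"
proof -
  \<comment> \<open>The conditional is replaced by a propositional form that the decidability rules
    can traverse.\<close>
  have *: "j = follow d k \<longleftrightarrow> k + 1 = 2 ^ d \<and> j = 2 \<or> \<not> k + 1 = 2 ^ d \<and> j = d + k + 1" for j d k by (auto simp: follow_def)
  show ?thesis
    unfolding system_def edge_code_def prod.case * not_less [symmetric]
    by (intro recursive_intros recursive_const | simp only: not_less)+
qed

lemma decidable_admits:
  "recursive k D \<Longrightarrow> recursive k I \<Longrightarrow> recursive k J \<Longrightarrow> decidable k (\<lambda>xs. admits (system (D xs)) t (I xs) (J xs))"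
  unfolding admits_def by (intro decidable_disj decidable_const decidable_comp4[OF decidable_system4] recursive_const)

lemma recursive_word: "recursive k I \<Longrightarrow> recursive k J \<Longrightarrow> recursive k (\<lambda>xs. list_encode (subst_word (I xs) (J xs) w))"
proof (induction w)
  case (Cons x w)
  then have "recursive k (\<lambda>xs. subst_letter (I xs) (J xs) x)"
    unfolding subst_letter_def by (cases "x = 13"; cases "x = 14") (auto intro: recursive_add recursive_const)
  then show ?case using Cons by (auto intro!: recursive_Suc recursive_prod_encode)
qed (simp add: recursive_const)

lemma recursive_quad: "recursive k I \<Longrightarrow> recursive k J \<Longrightarrow> recursive k (\<lambda>xs. quad_code (subst_quad (I xs) (J xs) e))"
  by (cases e) (simp add: quad_code_def, intro recursive_prod_encode recursive_word)

lemma recursive_slot: "recursive k I \<Longrightarrow> recursive k J \<Longrightarrow> recursive k (\<lambda>xs. list_encode (slot (subst_quad (I xs) (J xs) e) \<beta> \<gamma>))"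
  by (cases e; cases \<beta>; cases \<gamma>) (simp_all add: recursive_word)

lemma decidable_is_word: "decidable (Suc (Suc 0)) (\<lambda>xs. is_word (hd xs) (hd (tl xs)))"
  unfolding is_word_def
  by (intro decidable_list_ex decidable_ex decidable_eq recursive_word recursive_extent recursive_var recursive_hd recursive_const)

lemma decidable_is_quad: "decidable (Suc (Suc 0)) (\<lambda>xs. is_quad (hd xs) (hd (tl xs)))"
  unfolding is_quad_def
  by (intro decidable_list_ex decidable_ex decidable_conj decidable_eq decidable_admits recursive_quad recursive_extent recursive_var recursive_hd recursive_const)

lemma decidable_is_point: "decidable (Suc (Suc 0)) (\<lambda>xs. is_point (hd xs) (hd (tl xs)))"
  unfolding is_point_def
  by (intro decidable_disj decidable_conj decidable_eq decidable_le decidable_comp[OF decidable_is_word] decidable_comp[OF decidable_is_quad]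
    recursive_mod recursive_div recursive_var recursive_hd recursive_const)

lemma decidable_code_on_line: "recursive k N \<Longrightarrow> decidable k (\<lambda>xs. code_on_line l (N xs))"
  unfolding code_on_line_def by (intro decidable_disj decidable_conj decidable_eq decidable_const recursive_mod recursive_const)

lemma decidable_in_triangle:
  "recursive k I \<Longrightarrow> recursive k J \<Longrightarrow> recursive k N \<Longrightarrow> decidable k (\<lambda>xs. in_triangle \<beta> \<gamma> (subst_quad (I xs) (J xs) e) (N xs))"
  unfolding in_triangle_def by (intro decidable_disj decidable_eq recursive_add recursive_mult recursive_slot recursive_quad recursive_const)

lemma decidable_code_col:
  "decidable (Suc (Suc (Suc (Suc 0)))) (\<lambda>xs. code_col (hd xs) (hd (tl xs)) (hd (tl (tl xs))) (hd (tl (tl (tl xs)))))"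
  unfolding code_col_def
  by (intro decidable_disj decidable_list_ex decidable_ex decidable_conj decidable_eq decidable_admits decidable_code_on_line decidable_in_triangle
    recursive_extent recursive_var recursive_hd recursive_const)

lemma recursive_code_rank: "recursive (Suc (Suc 0)) (\<lambda>xs. code_rank (hd xs) (hd (tl xs)))"
  unfolding code_rank_def
  by (intro recursive_add recursive_of_bool decidable_ex decidable_conj decidable_not decidable_eq decidable_set_decode decidable_comp4[OF decidable_code_col]
    recursive_var recursive_hd)

lemma recursive_code_bound: "recursive k D \<Longrightarrow> recursive k (\<lambda>xs. code_bound (D xs))"
proof (rule recursive_comp1[of code_bound])
  show "recursive 1 (\<lambda>xs. code_bound (hd xs))"
    unfolding code_bound_def One_nat_def
    by (intro recursive_add recursive_sum_list recursive_sum recursive_mult recursive_word recursive_quad recursive_extent recursive_var recursive_hd recursive_const)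
qed

lemma recursive_code_matroid: "recursive (Suc 0) (\<lambda>xs. code_matroid (hd xs))"
proof -
  have "recursive (Suc (Suc 0)) (\<lambda>xs. code_rank (hd (tl xs)) (hd xs))"
    using recursive_compose[of "[\<lambda>xs. hd (tl xs), hd]" "\<lambda>xs. code_rank (hd xs) (hd (tl xs))" "Suc (Suc 0)"] recursive_code_rank
    by (auto intro: recursive_var recursive_hd)
  then show ?thesis
    unfolding code_matroid_def
    by (intro recursive_sum recursive_mult recursive_power recursive_of_bool decidable_all decidable_imp decidable_set_decode decidable_comp[OF decidable_is_point]
      recursive_prod_encode recursive_code_bound recursive_var recursive_hd recursive_const)
qed

section \<open>The reduction and the diagonal argument\<close>

section \<open>Undecidability\<close>

lemma word_families_mem:
  "(0, [], [2], [0], [0,2]) \<in> set word_families" "(0, [], [2], [1], [1,2]) \<in> set word_families" 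
  "(0, [], [4], [0], [0,4]) \<in> set word_families" "(0, [], [4], [1], [1,4]) \<in> set word_families" 
  "(0, [], [5], [7], [7,5]) \<in> set word_families" "(0, [], [6], [7], [7,6]) \<in> set word_families" 
  "(0, [], [5], [9], [9,5]) \<in> set word_families" "(0, [], [6], [9], [9,6]) \<in> set word_families" 
  "(0, [], [3], [1], [1,3]) \<in> set word_families" "(0, [], [3], [2], [2,3]) \<in> set word_families" 
  "(0, [], [4], [2], [2,4]) \<in> set word_families" "(0, [], [6], [8], [8,6]) \<in> set word_families" 
  "(0, [], [7], [8], [8,7]) \<in> set word_families" "(0, [], [7], [9], [9,7]) \<in> set word_families" 
  "(0, [], [0], [1], [1,0]) \<in> set word_families" "(0, [], [0], [3], [3,0]) \<in> set word_families" 
  "(0, [], [4], [3], [3,4]) \<in> set word_families" "(0, [], [6], [5], [5,6]) \<in> set word_families" 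
  "(0, [], [8], [5], [5,8]) \<in> set word_families" "(0, [], [8], [9], [9,8]) \<in> set word_families" 
  "(0, [], [9], [0], [0,9]) \<in> set word_families" "(0, [], [5], [0], [0,5]) \<in> set word_families" 
  "(0, [], [4], [5], [5,4]) \<in> set word_families" "(1, [], [4], [13], [13,4]) \<in> set word_families" 
  "(1, [], [13], [9], [9,13]) \<in> set word_families" "(1, [], [4], [9,13], [9,13,4]) \<in> set word_families" 
  "(1, [], [1], [13], [13,1]) \<in> set word_families" "(1, [], [4], [13,1], [13,1,4]) \<in> set word_families" 
  "(1, [], [13], [0], [0,13]) \<in> set word_families" "(1, [], [4], [0,13], [0,13,4]) \<in> set word_families" 
  "(1, [], [2], [13,1], [13,1,2]) \<in> set word_families" "(1, [], [2], [0,13], [0,13,2]) \<in> set word_families" 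
  "(1, [], [13], [6], [6,13]) \<in> set word_families" "(1, [], [13], [9,6], [9,6,13]) \<in> set word_families" 
  "(1, [], [5], [13], [13,5]) \<in> set word_families" "(1, [], [5], [9,13], [9,13,5]) \<in> set word_families" 
  "(1, [], [13], [7,6], [7,6,13]) \<in> set word_families" "(1, [], [13], [7], [7,13]) \<in> set word_families" 
  "(1, [], [5], [7,13], [7,13,5]) \<in> set word_families"
  by (simp_all add: word_families_def)

text \<open>Every longer template can be shortened by its last letter, and a word family restores
  this letter; this is what the evaluation of words by induction needs.\<close>

lemma templates_split:
  "\<forall>t\<in>set templates. length t < 2 \<or> butlast t \<in> set templates \<and>
     ((0, [], [last t], butlast t, t) \<in> set word_families \<or> (1, [], [last t], butlast t, t) \<in> set word_families)"
  unfolding templates_def[THEN arg_cong[of _ _ set]] by (simp add: word_families_mem templates_mem del: One_nat_def)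

lemma minus_add_cancel_common: "- (- p + q) + (- p + r) = - q + (r :: 'g :: group_add)"
  by (simp add: minus_add add.assoc)

text \<open>In the group of germs, values normalised at \<open>[]\<close> are products of letters.
  So \<open>collapse\<close> would identify the points of \<open>[10]\<close> and
  \<open>[9, 11]\<close>, contrary to injectivity on words.\<close>

lemma not_almost_multilinear_of_collapses:
  fixes K :: "'k ring"
  assumes R: "supported R N" "collapses R"
  shows "\<not> almost_multilinear K (quad_matroid.ground (words N) (quads R N)) (quad_matroid.rank (words N) (quads R N))"
proof
  assume am: "almost_multilinear K (quad_matroid.ground (words N) (quads R N)) (quad_matroid.rank (words N) (quads R N))"
  interpret M: quad_matroid "words N" "quads R N" by (rule quad_matroid_quads[OF R(1)])
  obtain g :: "word \<Rightarrow> (nat \<Rightarrow> ((nat \<Rightarrow> 'k) \<times> (nat \<Rightarrow> 'k)) set) set symm" where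
    g: "\<And>a b c d. (a, b, c, d) \<in> quads R N \<Longrightarrow> - g a + g b = - g c + g d"
      "\<And>w w'. w \<in> words N \<Longrightarrow> w' \<in> words N \<Longrightarrow> g w = g w' \<Longrightarrow> w = w'"
    using M.almost_multilinear_group[OF am] by blast
  define v where "v x = - g [] + g [x]" for x
  have N: "2 \<le> N" using R(1) by (simp add: supported_def)
  \<comment> \<open>The word family of \<open>t\<close> expresses its value by that of
    \<open>butlast t\<close> and its last letter.\<close>
  have val: "- g [] + g (subst_word i 0 t) = sum_list (map v (subst_word i 0 t))" if "t \<in> set templates" "i < N" for t i
    using that(1)
  proof (induction "length t" arbitrary: t)
    case 0
    then show ?case by simp
  next
    case (Suc n)
    show ?case
    proof (cases "length t < 2")
      case True
      then obtain x where "t = [x]" using Suc(2) by (cases t) auto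
      then show ?thesis by (simp add: v_def)
    next
      case False
      then have t: "butlast t \<in> set templates" "\<exists>k\<le>1. (k, [], [last t], butlast t, t) \<in> set word_families"
        using templates_split Suc(3) by (blast, fastforce)
      then obtain k where k: "k \<le> 1" "(k, [], [last t], butlast t, t) \<in> set families" by (auto simp: families_def)
      have "subst_quad i 0 ([], [last t], butlast t, t) \<in> quads R N"
        by (rule quadsI[OF k(2)]) (use that(2) k(1) N in \<open>auto simp: admits_def\<close>)
      then have "- g [] + g [subst_letter i 0 (last t)] = - g (subst_word i 0 (butlast t)) + g (subst_word i 0 t)"
        using g(1) by simp
      then have "g (subst_word i 0 t) = g (subst_word i 0 (butlast t)) + v (subst_letter i 0 (last t))"
        by (simp add: v_def add.assoc[symmetric])
      moreover have "- g [] + g (subst_word i 0 (butlast t)) = sum_list (map v (subst_word i 0 (butlast t)))"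
        using Suc(1)[of "butlast t"] Suc(2) t(1) by simp
      moreover have "subst_word i 0 t = subst_word i 0 (butlast t) @ [subst_letter i 0 (last t)]"
      proof -
        have "t = butlast t @ [last t]" using False by (intro append_butlast_last_id[symmetric]) auto
        then show ?thesis by (metis list.simps(8) list.simps(9) map_append)
      qed
      ultimately show ?thesis by (simp add: add.assoc[symmetric])
    qed
  qed
  then have val: "- g [] + g w = sum_list (map v w)" if "w \<in> words N" for w
    using that unfolding words_def by blast
  interpret G: relation_group R N v
  proof
    show "supported R N" by fact
    fix a b c d assume q: "(a, b, c, d) \<in> quads R N"
    have w: "a \<in> words N" "b \<in> words N" "c \<in> words N" "d \<in> words N"
      using M.slots[OF q, of False False] M.slots[OF q, of True False] M.slots[OF q, of False True] M.slots[OF q, of True True] by simp_all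
    have "- sum_list (map v x) + sum_list (map v y) = - g x + g y" if "x \<in> words N" "y \<in> words N" for x y
      unfolding val[OF that(1), symmetric] val[OF that(2), symmetric] by (rule minus_add_cancel_common)
    then show "- sum_list (map v a) + sum_list (map v b) = - sum_list (map v c) + sum_list (map v d)"
      using g(1)[OF q] w by simp
  qed
  have m: "[10] \<in> words N" "[9, 11] \<in> words N"
  proof -
    have "subst_word 0 0 t \<in> words N" if "t \<in> set templates" for t
      unfolding words_def using that N by (intro CollectI exI[of _ t] exI[of _ 0]) simp
    from this[of "[10]"] this[of "[9, 13]"] show "[10] \<in> words N" "[9, 11] \<in> words N"
      by (simp_all add: templates_mem subst_letter_def)
  qed
  have "- g [] + g [10] = - g [] + g [9, 11]" using val[OF m(1)] val[OF m(2)] G.collapse[OF R(2)] by simp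
  then have "[10 :: nat] = [9, 11]" using g(2)[OF m] by simp
  then show False by simp
qed

text \<open>One field of the class is fixed for the whole reduction, so its code is a constant of
  the computation.\<close>

theorem theorem1p4:
  fixes \<F> :: "'k ring set" and \<phi> :: "'k ring \<Rightarrow> nat"
  assumes "\<F> \<noteq> {}" and "\<And>K. K \<in> \<F> \<Longrightarrow> field K" and "inj_on \<phi> \<F>"
  shows "\<not> decidable_problem (almost_multilinear_instances \<F>) (almost_multilinear_code \<phi>)
           (\<lambda>(E, r, K). almost_multilinear K E r)"
proof
  assume "decidable_problem (almost_multilinear_instances \<F>) (almost_multilinear_code \<phi>) (\<lambda>(E, r, K). almost_multilinear K E r)"
  then obtain f where f: "\<forall>x\<in>almost_multilinear_instances \<F>. computes f [almost_multilinear_code \<phi> x] (if (\<lambda>(E, r, K). almost_multilinear K E r) x then 1 else 0)"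
    unfolding decidable_problem_def by blast
  obtain K where K: "K \<in> \<F>" "field K" using assms(1,2) by blast
  have "recursive (Suc 0) (\<lambda>xs. prod_encode (code_matroid (hd xs), \<phi> K))"
    by (intro recursive_prod_encode recursive_code_matroid recursive_const)
  then obtain h where "\<forall>xs. length xs = Suc 0 \<longrightarrow> computes h xs (prod_encode (code_matroid (hd xs), \<phi> K))"
    unfolding recursive_def by (elim exE)
  then have h: "computes h [d] (prod_encode (code_matroid d, \<phi> K))" for d
    by (auto dest: spec[of _ "[d]"])
  \<comment> \<open>The diagonal: \<open>d\<close> codes a machine that runs the decider on the
    matroid of \<open>system d\<close> and lets the system collapse exactly if the answer is
    yes.\<close>
  obtain d where d: "\<And>y. y \<le> 1 \<Longrightarrow> computes (Comp f [h]) [d] y \<Longrightarrow> collapses (system d) \<longleftrightarrow> y = 1"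
    using self_referential_system by blast
  interpret M: quad_matroid "word_set d" "quad_set d" by (rule quad_matroid_quads[OF supported_system])
  let ?Q = "almost_multilinear K M.ground M.rank"
  have "(M.ground, M.rank, K) \<in> almost_multilinear_instances \<F>"
    using M.matroid_rank K(1) by (simp add: almost_multilinear_instances_def)
  then have "computes f [prod_encode (code_matroid d, \<phi> K)] (if ?Q then 1 else 0)"
    using bspec[OF f] M.code_matroid[OF refl refl] by (fastforce simp: almost_multilinear_code_def)
  then have "computes (Comp f [h]) [d] (if ?Q then 1 else 0)"
    using h[of d] by (intro computes.comp[where ys = "[prod_encode (code_matroid d, \<phi> K)]"]) simp_all
  then have "collapses (system d) \<longleftrightarrow> ?Q" using d[of "if ?Q then 1 else 0"] by (simp split: if_splits)
  moreover have "collapses (system d) \<Longrightarrow> \<not> ?Q"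
    by (rule not_almost_multilinear_of_collapses[OF supported_system])
  moreover have "\<not> collapses (system d) \<Longrightarrow> ?Q"
    by (rule almost_multilinear_of_not_collapses[OF K(2) supported_system])
  ultimately show False by blast
qed

end
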